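(* Let $\mathbb{M}$ be a monster model for a quasiminimal class, and let $(f_{ij}:i,j<\omega_1)$ be an indiscernible array of elements of $\mathbb{M}$, of type $\alpha(m,n)=m+n-1$ over some finite parameter set $B$. Then there exists a Galois definable $1$-dimensional group in $(\mathbb{M}^{eq})^{eq}$.
   Context: QUASIMINIMAL CLASSES. Let $L$ be a countable language; $\mathrm{tp}$ denotes quantifier-free type. An $L$-structure $M$ with a pregeometry $\mathrm{cl}$ is a quasiminimal pregeometry structure if: (QM1) if $a,a'$ are singletons and $\mathrm{tp}(a,b)=\mathrm{tp}(a',b')$, then $a\in\mathrm{cl}(b)$ iff $a'\in\mathrm{cl}(b')$; (QM2) $M$ is infinite-dimensional; (QM3) $\mathrm{cl}(A)$ is countable for finite $A\subseteq M$; (QM4) if $H,H'\subseteq M$ are countable closed sets enumerated so that $\mathrm{tp}(H)=\mathrm{tp}(H')$ and $a\in M\setminus H$, $a'\in M\setminus H'$ are singletons, then $\mathrm{tp}(H,a)=\mathrm{tp}(H',a')$; (QM5) if $H,H'\subseteq M$ are countable closed sets or empty, enumerated so that $\mathrm{tp}(H)=\mathrm{tp}(H')$, $b,b'$ are finite tuples with $\mathrm{tp}(H,b)=\mathrm{tp}(H',b')$ and $a\in\mathrm{cl}(H,b)$ is a singleton, then there is a singleton $a'\in M$ with $\mathrm{tp}(H,b,a)=\mathrm{tp}(H',b',a')$. Weakly quasiminimal: all of these except possibly (QM2). A closed embedding $\theta:M_1\to M_2$ of weakly quasiminimal structures is an isomorphism onto a substructure that is $\mathrm{cl}_{M_2}$-closed,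 with $\mathrm{cl}_{M_1}$ the restriction of $\mathrm{cl}_{M_2}$. $\mathcal{K}^-(M)$ is the smallest class of $L$-structures containing $M$ and all its closed substructures and closed under isomorphism; $\mathcal{K}(M)$ is the smallest class containing $\mathcal{K}^-(M)$ and closed also under unions of chains of closed embeddings. A quasiminimal class is $\mathcal{K}=\mathcal{K}(M)$ with all finite-dimensional structures discarded, with $\mathcal{A}\preccurlyeq\mathcal{B}$ iff $\mathcal{A}$ is a closed submodel of $\mathcal{B}$; it is an abstract elementary class (AEC) with Löwenheim–Skolem number $\omega$. The monster model $\mathbb{M}$ is a $\delta$-model homogeneous, $\delta$-universal member of $\mathcal{K}$ for a large cardinal $\delta$. TYPES AND RANK (also applied with $\mathbb{M}^{eq}$, $(\mathbb{M}^{eq})^{eq}$ in place of $\mathbb{M}$). Models are $\mathcal{A}\preccurlyeq\mathbb{M}$; models and parameter sets have size $<\delta$; $a\in X$ may be a finite tuple. $a,b$ have the same Galois type $t^g$ over $A$ if some automorphism in $\mathrm{Aut}(\mathbb{M}/A)$ (fixing $A$ pointwise) maps $a$ to $b$; they have the same weak type, $t(a/A)=t(b/A)$, if they have the same Galois type over every finite subset of $A$. For $A\subseteq B$ with $A$ finite, $t(a/B)$ splits over $A$ if there are $b,c\in B$ with $t(b/A)=t(c/A)$ but $t(ab/A)\ne t(ac/A)$. $a\downarrow^{ns}_B C$ means that $t(a/B\cup C)$ does not split over some finite $A\subseteq B$. For a model $\mathcal{A}$: $U(a/\mathcal{A})\ge0$ always; $U(a/\mathcal{A})\ge n+1$ if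 there is a model $\mathcal{B}\supseteq\mathcal{A}$ with $a\not\downarrow^{ns}_{\mathcal{A}}\mathcal{B}$ and $U(a/\mathcal{B})\ge n$; $U(a/\mathcal A)$ is the largest $n$ with $U(a/\mathcal{A})\ge n$. For finite $A$, $U(a/A)=\max\{U(a/\mathcal{A}) : \mathcal{A}\supset A\text{ a model}\}$; for arbitrary $A$, $U(a/A)=\min\{U(a/B):B\subseteq A\text{ finite}\}$. In $\mathbb{M}$ itself, $U(a/A)$ is the dimension $\dim_{\mathrm{cl}}(a/A)$. ARRAYS. $A=(A_{ij}:i\in I,j\in J)$, $I,J$ ordered sets, is an indiscernible array over $B$ if whenever $i_1<\dots<i_m$ in $I$ and $j_1<\dots<j_n$ in $J$, the type $t((A_{i_\nu j_\mu}:1\le\nu\le m,1\le\mu\le n)/B)$ depends only on $m$ and $n$. It is of type $\alpha$ over $B$ if $U((A_{i_\nu j_\mu}:1\le\nu\le m,1\le\mu\le n)/B)=\alpha(m,n)$ for all such choices, $\alpha$ a polynomial. IMAGINARIES. Let $\mathcal{E}$ be a countable collection of $\emptyset$-invariant equivalence relations $E\subseteq\mathbb{M}^n\times\mathbb{M}^n$ (various $n$), containing equality, each given by a countable set $G_E$ of Galois types over $\emptyset$ via $(a,b)\in E$ iff $t^g(ab/\emptyset)\in G_E$. For $\mathcal{A}\in\mathcal{K}$, $\mathcal{A}^{eq}=\{a/E: a\in\mathcal{A},E\in\mathcal{E}\}$, with $a$ identified with $a/{=}$, the structure of $\mathcal{A}$ on the copy of $\mathcal{A}$, and additional predicates $P_E$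 for $\{a/E:a\in\mathcal{A}\}$ and functions $F_E(a)=a/E$. $\mathcal{K}^{eq}=\{\mathcal{A}^{eq}:\mathcal{A}\in\mathcal{K}\}$, with $\mathcal{A}^{eq}\preccurlyeq^{eq}\mathcal{B}^{eq}$ iff $\mathcal{A}^{eq}$ is a submodel of $\mathcal{B}^{eq}$ and $\mathcal{A}\preccurlyeq\mathcal{B}$; its monster model is $\mathbb{M}^{eq}$. $(\mathbb{M}^{eq})^{eq}$ is formed from $\mathbb{M}^{eq}$ in the same way. The countable collections $\mathcal{E}$ at both stages are assumed chosen to contain the relations needed (e.g. those providing canonical bases, and the relations "$\mathrm{cl}(x)=\mathrm{cl}(y)$" on tuples), so the assertion is for a suitable such choice. DEFINABILITY. A set $X$ is Galois definable over $A$ if every automorphism fixing $A$ pointwise fixes $X$ setwise. A group is Galois definable over $A$ if both its underlying set and its operation are; here "Galois definable" means over some finite set of parameters. An element is generic if its $U$-rank over these parameters is maximal in the group; the group is $1$-dimensional if its generic elements have $U$-rank $1$. *)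

theory Defs
  imports
    "HOL-Algebra.Group"
    "HOL-Library.Countable_Set"
    "HOL-Library.Extended_Nat"
begin

unbundle cardinal_syntax

section \<open>Languages, structures and quantifier-free types\<close>

record ('f, 'r) lang =
  funs :: "'f set"
  rels :: "'r set"
  farity :: "'f \<Rightarrow> nat"
  rarity :: "'r \<Rightarrow> nat"

definition countable_lang :: "('f, 'r) lang \<Rightarrow> bool" where
  "countable_lang L \<longleftrightarrow> countable (funs L) \<and> countable (rels L)"

text \<open>Function symbols are interpreted by partial functions. This is needed only for the
  expansions by imaginaries below, where the old functions and the quotient maps are defined on
  (tuples from) the home sort; ordinary structures are required to be total in \<open>wf_struct\<close>.\<close>

record ('a, 'f, 'r) struct =
  Dom :: "'a set"
  fn :: "'f \<Rightarrow> 'a list \<Rightarrow> 'a option"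
  rl :: "'r \<Rightarrow> 'a list \<Rightarrow> bool"

record ('a, 'f, 'r) pstruct = "('a, 'f, 'r) struct" +
  cl :: "'a set \<Rightarrow> 'a set"

definition tuples :: "'a set \<Rightarrow> nat \<Rightarrow> 'a list set" where
  "tuples A n = {xs. set xs \<subseteq> A \<and> length xs = n}"

definition wf_struct :: "('f, 'r) lang \<Rightarrow> ('a, 'f, 'r, 'm) struct_scheme \<Rightarrow> bool" where
  "wf_struct L M \<longleftrightarrow>
     (\<forall>f\<in>funs L. \<forall>xs\<in>tuples (Dom M) (farity L f). fn M f xs \<in> Some ` Dom M)"

definition substruct ::
  "('f, 'r) lang \<Rightarrow> ('a, 'f, 'r, 'm) struct_scheme \<Rightarrow> ('a, 'f, 'r, 'm) struct_scheme \<Rightarrow> bool"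
  where
  "substruct L S M \<longleftrightarrow> wf_struct L S \<and> Dom S \<subseteq> Dom M \<and>
     (\<forall>f\<in>funs L. \<forall>xs\<in>tuples (Dom S) (farity L f). fn S f xs = fn M f xs) \<and>
     (\<forall>r\<in>rels L. \<forall>xs\<in>tuples (Dom S) (rarity L r). rl S r xs = rl M r xs)"

definition struct_iso ::
  "('f, 'r) lang \<Rightarrow> ('a, 'f, 'r, 'm) struct_scheme \<Rightarrow> ('b, 'f, 'r, 'n) struct_scheme
     \<Rightarrow> ('a \<Rightarrow> 'b) \<Rightarrow> bool" where
  "struct_iso L M N h \<longleftrightarrow> bij_betw h (Dom M) (Dom N) \<and>
     (\<forall>f\<in>funs L. \<forall>xs\<in>tuples (Dom M) (farity L f).
        fn N f (map h xs) = map_option h (fn M f xs)) \<and>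
     (\<forall>r\<in>rels L. \<forall>xs\<in>tuples (Dom M) (rarity L r). rl N r (map h xs) = rl M r xs)"

datatype ('f, 'v) trm = Var 'v | App 'f "('f, 'v) trm list"

datatype ('f, 'r, 'v) qf =
    Eq "('f, 'v) trm" "('f, 'v) trm"
  | Rel 'r "('f, 'v) trm list"
  | Neg "('f, 'r, 'v) qf"
  | Conj "('f, 'r, 'v) qf" "('f, 'r, 'v) qf"

primrec trm_in :: "('f, 'r) lang \<Rightarrow> 'v set \<Rightarrow> ('f, 'v) trm \<Rightarrow> bool" where
  "trm_in L V (Var x) \<longleftrightarrow> x \<in> V"
| "trm_in L V (App f ts) \<longleftrightarrow>
     f \<in> funs L \<and> length ts = farity L f \<and> list_all id (map (trm_in L V) ts)"

primrec qf_in :: "('f, 'r) lang \<Rightarrow> 'v set \<Rightarrow> ('f, 'r, 'v) qf \<Rightarrow> bool" where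
  "qf_in L V (Eq s t) \<longleftrightarrow> trm_in L V s \<and> trm_in L V t"
| "qf_in L V (Rel r ts) \<longleftrightarrow>
     r \<in> rels L \<and> length ts = rarity L r \<and> (\<forall>t\<in>set ts. trm_in L V t)"
| "qf_in L V (Neg p) \<longleftrightarrow> qf_in L V p"
| "qf_in L V (Conj p q) \<longleftrightarrow> qf_in L V p \<and> qf_in L V q"

primrec trm_val :: "('a, 'f, 'r, 'm) struct_scheme \<Rightarrow> ('v \<Rightarrow> 'a) \<Rightarrow> ('f, 'v) trm \<Rightarrow> 'a" where
  "trm_val M v (Var x) = v x"
| "trm_val M v (App f ts) = the (fn M f (map (trm_val M v) ts))"

primrec sat :: "('a, 'f, 'r, 'm) struct_scheme \<Rightarrow> ('v \<Rightarrow> 'a) \<Rightarrow> ('f, 'r, 'v) qf \<Rightarrow> bool" where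
  "sat M v (Eq s t) \<longleftrightarrow> trm_val M v s = trm_val M v t"
| "sat M v (Rel r ts) \<longleftrightarrow> rl M r (map (trm_val M v) ts)"
| "sat M v (Neg p) \<longleftrightarrow> \<not> sat M v p"
| "sat M v (Conj p q) \<longleftrightarrow> sat M v p \<and> sat M v q"

text \<open>The quantifier-free type of the family \<open>(v x : x \<in> V)\<close>. Families with different index sets
  have different types, because of the formulas \<open>x = x\<close>.\<close>

definition tp ::
  "('f, 'r) lang \<Rightarrow> ('a, 'f, 'r, 'm) struct_scheme \<Rightarrow> 'v set \<Rightarrow> ('v \<Rightarrow> 'a) \<Rightarrow> ('f, 'r, 'v) qf set"
  where
  "tp L M V v = {p. qf_in L V p \<and> sat M v p}"

definition tp_list ::
  "('f, 'r) lang \<Rightarrow> ('a, 'f, 'r, 'm) struct_scheme \<Rightarrow> 'a list \<Rightarrow> ('f, 'r, nat) qf set" where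
  "tp_list L M xs = tp L M {..<length xs} (nth xs)"

text \<open>\<open>tp_ext L M V h xs\<close> is the type of \<open>(H, xs)\<close>, where the countable set \<open>H = h ` V\<close> is
  enumerated by \<open>h\<close> along the index set \<open>V\<close> of natural numbers (so finite and empty \<open>H\<close> are
  included).\<close>

definition tp_ext ::
  "('f, 'r) lang \<Rightarrow> ('a, 'f, 'r, 'm) struct_scheme \<Rightarrow> nat set \<Rightarrow> (nat \<Rightarrow> 'a) \<Rightarrow> 'a list
     \<Rightarrow> ('f, 'r, nat + nat) qf set" where
  "tp_ext L M V h xs = tp L M (V <+> {..<length xs}) (case_sum h (nth xs))"


section \<open>Quasiminimal pregeometry structures\<close>

definition pregeometry :: "'a set \<Rightarrow> ('a set \<Rightarrow> 'a set) \<Rightarrow> bool" where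
  "pregeometry D c \<longleftrightarrow>
     (\<forall>X. X \<subseteq> D \<longrightarrow> X \<subseteq> c X \<and> c X \<subseteq> D \<and> c (c X) = c X) \<and>
     (\<forall>X Y. X \<subseteq> Y \<and> Y \<subseteq> D \<longrightarrow> c X \<subseteq> c Y) \<and>
     (\<forall>X. X \<subseteq> D \<longrightarrow> c X = (\<Union>F\<in>{F. F \<subseteq> X \<and> finite F}. c F)) \<and>
     (\<forall>X a b. X \<subseteq> D \<and> a \<in> D \<and> b \<in> D \<and> a \<in> c (insert b X) - c X \<longrightarrow> b \<in> c (insert a X))"

definition closed_in :: "('a, 'f, 'r) pstruct \<Rightarrow> 'a set \<Rightarrow> bool" where
  "closed_in M H \<longleftrightarrow> H \<subseteq> Dom M \<and> cl M H = H"

definition infinite_dim :: "('a, 'f, 'r) pstruct \<Rightarrow> bool" where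
  "infinite_dim M \<longleftrightarrow> \<not> (\<exists>X. finite X \<and> X \<subseteq> Dom M \<and> cl M X = Dom M)"

definition QM1 :: "('f, 'r) lang \<Rightarrow> ('a, 'f, 'r) pstruct \<Rightarrow> bool" where
  "QM1 L M \<longleftrightarrow> (\<forall>a a' b b'.
     a \<in> Dom M \<and> a' \<in> Dom M \<and> set b \<subseteq> Dom M \<and> set b' \<subseteq> Dom M \<and>
     tp_list L M (a # b) = tp_list L M (a' # b')
     \<longrightarrow> (a \<in> cl M (set b) \<longleftrightarrow> a' \<in> cl M (set b')))"

definition QM3 :: "('a, 'f, 'r) pstruct \<Rightarrow> bool" where
  "QM3 M \<longleftrightarrow> (\<forall>A. finite A \<and> A \<subseteq> Dom M \<longrightarrow> countable (cl M A))"

definition QM4 :: "('f, 'r) lang \<Rightarrow> ('a, 'f, 'r) pstruct \<Rightarrow> bool" where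
  "QM4 L M \<longleftrightarrow> (\<forall>V h h' a a'.
     closed_in M (h ` V) \<and> closed_in M (h' ` V) \<and>
     tp L M V h = tp L M V h' \<and>
     a \<in> Dom M - h ` V \<and> a' \<in> Dom M - h' ` V
     \<longrightarrow> tp_ext L M V h [a] = tp_ext L M V h' [a'])"

definition QM5 :: "('f, 'r) lang \<Rightarrow> ('a, 'f, 'r) pstruct \<Rightarrow> bool" where
  "QM5 L M \<longleftrightarrow> (\<forall>V h h' b b' a.
     (closed_in M (h ` V) \<or> h ` V = {}) \<and> (closed_in M (h' ` V) \<or> h' ` V = {}) \<and>
     tp L M V h = tp L M V h' \<and>
     set b \<subseteq> Dom M \<and> set b' \<subseteq> Dom M \<and>
     tp_ext L M V h b = tp_ext L M V h' b' \<and>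
     a \<in> cl M (h ` V \<union> set b)
     \<longrightarrow> (\<exists>a'\<in>Dom M. tp_ext L M V h (b @ [a]) = tp_ext L M V h' (b' @ [a'])))"

definition weakly_quasiminimal :: "('f, 'r) lang \<Rightarrow> ('a, 'f, 'r) pstruct \<Rightarrow> bool" where
  "weakly_quasiminimal L M \<longleftrightarrow>
     wf_struct L M \<and> pregeometry (Dom M) (cl M) \<and> QM1 L M \<and> QM3 M \<and> QM4 L M \<and> QM5 L M"

definition quasiminimal :: "('f, 'r) lang \<Rightarrow> ('a, 'f, 'r) pstruct \<Rightarrow> bool" where
  "quasiminimal L M \<longleftrightarrow> weakly_quasiminimal L M \<and> infinite_dim M"


section \<open>Quasiminimal classes and monster models\<close>

definition closed_sub ::
  "('f, 'r) lang \<Rightarrow> ('a, 'f, 'r) pstruct \<Rightarrow> ('a, 'f, 'r) pstruct \<Rightarrow> bool" where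
  "closed_sub L S M \<longleftrightarrow> substruct L S M \<and> closed_in M (Dom S) \<and>
     (\<forall>X. X \<subseteq> Dom S \<longrightarrow> cl S X = cl M X \<inter> Dom S)"

definition pstruct_iso ::
  "('f, 'r) lang \<Rightarrow> ('a, 'f, 'r) pstruct \<Rightarrow> ('b, 'f, 'r) pstruct \<Rightarrow> ('a \<Rightarrow> 'b) \<Rightarrow> bool" where
  "pstruct_iso L M N h \<longleftrightarrow> struct_iso L M N h \<and>
     (\<forall>X. X \<subseteq> Dom M \<longrightarrow> cl N (h ` X) = h ` cl M X)"

definition closed_embedding ::
  "('f, 'r) lang \<Rightarrow> ('a, 'f, 'r) pstruct \<Rightarrow> ('b, 'f, 'r) pstruct \<Rightarrow> ('a \<Rightarrow> 'b) \<Rightarrow> bool" where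
  "closed_embedding L M N h \<longleftrightarrow> (\<exists>S. closed_sub L S N \<and> pstruct_iso L M S h)"

text \<open>Finite character of the closure of \<open>N\<close> (part of \<open>pregeometry\<close>) makes the closure of the
  union the one determined by the closures of the members of the chain.\<close>

definition chain_union ::
  "('f, 'r) lang \<Rightarrow> ('a, 'f, 'r) pstruct set \<Rightarrow> ('a, 'f, 'r) pstruct \<Rightarrow> bool" where
  "chain_union L C N \<longleftrightarrow> C \<noteq> {} \<and>
     (\<forall>S\<in>C. \<forall>T\<in>C. closed_sub L S T \<or> closed_sub L T S) \<and>
     Dom N = (\<Union>S\<in>C. Dom S) \<and> pregeometry (Dom N) (cl N) \<and> (\<forall>S\<in>C. closed_sub L S N)"

definition K_minus ::
  "('f, 'r) lang \<Rightarrow> ('b, 'f, 'r) pstruct \<Rightarrow> ('a, 'f, 'r) pstruct \<Rightarrow> bool" where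
  "K_minus L M0 N \<longleftrightarrow> (\<exists>S h. closed_sub L S M0 \<and> pstruct_iso L S N h)"

text \<open>The generating structure \<open>M0\<close> may live on another type than the members of the class. As the
  class is closed under isomorphism, chains of closed embeddings may be replaced by chains of closed
  substructures of their union, and the members on a given type \<open>'a\<close> are generated within
  that type.\<close>

inductive K_class ::
  "('f, 'r) lang \<Rightarrow> ('b, 'f, 'r) pstruct \<Rightarrow> ('a, 'f, 'r) pstruct \<Rightarrow> bool"
  for L :: "('f, 'r) lang" and M0 :: "('b, 'f, 'r) pstruct" where
  base: "K_minus L M0 N \<Longrightarrow> K_class L M0 N"
| iso: "K_class L M0 N \<Longrightarrow> pstruct_iso L N N' h \<Longrightarrow> K_class L M0 N'"
| union: "(\<And>S. S \<in> C \<Longrightarrow> K_class L M0 S) \<Longrightarrow> chain_union L C N \<Longrightarrow> K_class L M0 N"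

definition qm_class ::
  "('f, 'r) lang \<Rightarrow> ('b, 'f, 'r) pstruct \<Rightarrow> ('a, 'f, 'r) pstruct \<Rightarrow> bool" where
  "qm_class L M0 N \<longleftrightarrow> K_class L M0 N \<and> infinite_dim N"

text \<open>The underlying sets of the models \<open>\<A> \<preccurlyeq> M\<close> of size \<open>< \<delta>\<close>.\<close>

definition small_models ::
  "('f, 'r) lang \<Rightarrow> ('b, 'f, 'r) pstruct \<Rightarrow> 'd rel \<Rightarrow> ('a, 'f, 'r) pstruct \<Rightarrow> 'a set set" where
  "small_models L M0 \<delta> M =
     {A. qm_class L M0 (M\<lparr>Dom := A\<rparr>) \<and> closed_sub L (M\<lparr>Dom := A\<rparr>) M \<and> |A| <o \<delta>}"

definition model_homogeneous ::
  "('f, 'r) lang \<Rightarrow> ('b, 'f, 'r) pstruct \<Rightarrow> 'd rel \<Rightarrow> ('a, 'f, 'r) pstruct \<Rightarrow> bool" where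
  "model_homogeneous L M0 \<delta> M \<longleftrightarrow>
     (\<forall>A\<in>small_models L M0 \<delta> M. \<forall>B\<in>small_models L M0 \<delta> M. \<forall>h.
        struct_iso L (M\<lparr>Dom := A\<rparr>) (M\<lparr>Dom := B\<rparr>) h
        \<longrightarrow> (\<exists>\<sigma>. struct_iso L M M \<sigma> \<and> (\<forall>a\<in>A. \<sigma> a = h a)))"

text \<open>Every structure of size \<open>< \<delta>\<close> has an isomorphic copy on a subset of the type \<open>'d\<close>
  underlying \<open>\<delta>\<close>, so it is enough to quantify over structures on \<open>'d\<close>. (Quantifying over
  structures on \<open>'a\<close> would not be: the type \<open>'a\<close> of \<open>M\<close> might be too small.)\<close>

definition universal ::
  "('f, 'r) lang \<Rightarrow> ('b, 'f, 'r) pstruct \<Rightarrow> 'd rel \<Rightarrow> ('a, 'f, 'r) pstruct \<Rightarrow> bool" where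
  "universal L M0 \<delta> M \<longleftrightarrow>
     (\<forall>N :: ('d, 'f, 'r) pstruct. qm_class L M0 N \<and> |Dom N| <o \<delta>
        \<longrightarrow> (\<exists>h. closed_embedding L N M h))"

abbreviation omega1 :: "nat set rel" where
  "omega1 \<equiv> cardSuc natLeq"

text \<open>``Large'' is read as \<open>\<delta> > \<omega>\<^sub>1\<close>.\<close>

definition monster_model ::
  "('f, 'r) lang \<Rightarrow> ('b, 'f, 'r) pstruct \<Rightarrow> 'd rel \<Rightarrow> ('a, 'f, 'r) pstruct \<Rightarrow> bool" where
  "monster_model L M0 \<delta> M \<longleftrightarrow>
     Card_order \<delta> \<and> omega1 <o \<delta> \<and> qm_class L M0 M \<and>
     model_homogeneous L M0 \<delta> M \<and> universal L M0 \<delta> M"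


section \<open>Types, splitting and rank in an ambient monster\<close>

text \<open>The notions below are used for a monster \<open>M\<close>, for \<open>M\<^sup>e\<^sup>q\<close> and for \<open>(M\<^sup>e\<^sup>q)\<^sup>e\<^sup>q\<close>. They depend on
  the structure, which determines the automorphisms, and on the family of its small models.\<close>

record ('a, 'f, 'r) ambient =
  alang :: "('f, 'r) lang"
  astruct :: "('a, 'f, 'r) struct"
  models :: "'a set set"

abbreviation elems :: "('a, 'f, 'r) ambient \<Rightarrow> 'a set" where
  "elems N \<equiv> Dom (astruct N)"

definition monster_ambient ::
  "('f, 'r) lang \<Rightarrow> ('b, 'f, 'r) pstruct \<Rightarrow> 'd rel \<Rightarrow> ('a, 'f, 'r) pstruct
     \<Rightarrow> ('a, 'f, 'r) ambient" where
  "monster_ambient L M0 \<delta> M =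
     \<lparr>alang = L, astruct = struct.truncate M, models = small_models L M0 \<delta> M\<rparr>"

definition Aut :: "('a, 'f, 'r) ambient \<Rightarrow> 'a set \<Rightarrow> ('a \<Rightarrow> 'a) set" where
  "Aut N A = {\<sigma>. struct_iso (alang N) (astruct N) (astruct N) \<sigma> \<and> (\<forall>a\<in>A. \<sigma> a = a)}"

definition galois_tp :: "('a, 'f, 'r) ambient \<Rightarrow> 'a list \<Rightarrow> 'a set \<Rightarrow> 'a list set" where
  "galois_tp N a A = {map \<sigma> a | \<sigma>. \<sigma> \<in> Aut N A}"

definition same_tp :: "('a, 'f, 'r) ambient \<Rightarrow> 'a set \<Rightarrow> 'a list \<Rightarrow> 'a list \<Rightarrow> bool" where
  "same_tp N A a b \<longleftrightarrow>
     (\<forall>A0. finite A0 \<and> A0 \<subseteq> A \<longrightarrow> galois_tp N a A0 = galois_tp N b A0)"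

definition splits :: "('a, 'f, 'r) ambient \<Rightarrow> 'a list \<Rightarrow> 'a set \<Rightarrow> 'a set \<Rightarrow> bool" where
  "splits N a B A \<longleftrightarrow>
     (\<exists>b c. set b \<subseteq> B \<and> set c \<subseteq> B \<and> same_tp N A b c \<and> \<not> same_tp N A (a @ b) (a @ c))"

definition ns_indep :: "('a, 'f, 'r) ambient \<Rightarrow> 'a list \<Rightarrow> 'a set \<Rightarrow> 'a set \<Rightarrow> bool" where
  "ns_indep N a B C \<longleftrightarrow> (\<exists>A. finite A \<and> A \<subseteq> B \<and> \<not> splits N a (B \<union> C) A)"

primrec U_ge :: "('a, 'f, 'r) ambient \<Rightarrow> 'a list \<Rightarrow> nat \<Rightarrow> 'a set \<Rightarrow> bool" where
  "U_ge N a 0 \<A> \<longleftrightarrow> True"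
| "U_ge N a (Suc n) \<A> \<longleftrightarrow>
     (\<exists>\<B>\<in>models N. \<A> \<subseteq> \<B> \<and> \<not> ns_indep N a \<A> \<B> \<and> U_ge N a n \<B>)"

text \<open>Ranks are extended natural numbers; the value \<open>\<infinity>\<close> means that there is no largest \<open>n\<close>,
  respectively no maximum over models.\<close>

definition U_model :: "('a, 'f, 'r) ambient \<Rightarrow> 'a list \<Rightarrow> 'a set \<Rightarrow> enat" where
  "U_model N a \<A> = (SUP n\<in>{n. U_ge N a n \<A>}. enat n)"

text \<open>\<open>U_fin N a A\<close> is \<open>U(a/A)\<close> for finite \<open>A\<close>, the only case in which it is used.\<close>

definition U_fin :: "('a, 'f, 'r) ambient \<Rightarrow> 'a list \<Rightarrow> 'a set \<Rightarrow> enat" where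
  "U_fin N a A = (SUP \<A>\<in>{\<A> \<in> models N. A \<subseteq> \<A>}. U_model N a \<A>)"


section \<open>Arrays\<close>

definition increasing :: "'i rel \<Rightarrow> 'i list \<Rightarrow> bool" where
  "increasing r is \<longleftrightarrow> set is \<subseteq> Field r \<and> sorted_wrt (\<lambda>x y. (x, y) \<in> r \<and> x \<noteq> y) is"

definition subarray :: "('i \<Rightarrow> 'j \<Rightarrow> 'a) \<Rightarrow> 'i list \<Rightarrow> 'j list \<Rightarrow> 'a list" where
  "subarray A is js = concat (map (\<lambda>i. map (\<lambda>j. A i j) js) is)"

definition indiscernible_array ::
  "('a, 'f, 'r) ambient \<Rightarrow> 'i rel \<Rightarrow> 'j rel \<Rightarrow> ('i \<Rightarrow> 'j \<Rightarrow> 'a) \<Rightarrow> 'a set \<Rightarrow> bool" where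
  "indiscernible_array N I J A B \<longleftrightarrow>
     (\<forall>is is' js js'.
        increasing I is \<and> increasing I is' \<and> is \<noteq> [] \<and> length is = length is' \<and>
        increasing J js \<and> increasing J js' \<and> js \<noteq> [] \<and> length js = length js'
        \<longrightarrow> same_tp N B (subarray A is js) (subarray A is' js'))"

definition array_of_type ::
  "('a, 'f, 'r) ambient \<Rightarrow> 'i rel \<Rightarrow> 'j rel \<Rightarrow> ('i \<Rightarrow> 'j \<Rightarrow> 'a) \<Rightarrow> 'a set
     \<Rightarrow> (nat \<Rightarrow> nat \<Rightarrow> nat) \<Rightarrow> bool" where
  "array_of_type N I J A B \<alpha> \<longleftrightarrow>
     (\<forall>is js. increasing I is \<and> is \<noteq> [] \<and> increasing J js \<and> js \<noteq> []
        \<longrightarrow> U_fin N (subarray A is js) B = enat (\<alpha> (length is) (length js)))"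


section \<open>Imaginaries\<close>

text \<open>An imaginary \<open>a/E\<close> is tagged by \<open>E\<close>, so that the sorts of different equivalence relations
  are disjoint.\<close>

type_synonym 'a imag = "('a list \<times> 'a list) set \<times> 'a list set"

definition imag :: "('a list \<times> 'a list) set \<Rightarrow> 'a list \<Rightarrow> 'a imag" where
  "imag E a = (E, E `` {a})"

definition equality_rel :: "('a, 'f, 'r) ambient \<Rightarrow> ('a list \<times> 'a list) set" where
  "equality_rel N = {([a], [a]) | a. a \<in> elems N}"

definition imag_system :: "('a, 'f, 'r) ambient \<Rightarrow> ('a list \<times> 'a list) set set \<Rightarrow> bool" where
  "imag_system N \<E> \<longleftrightarrow> countable \<E> \<and> equality_rel N \<in> \<E> \<and>
     (\<forall>E\<in>\<E>. \<exists>n\<ge>1. equiv (tuples (elems N) n) E \<and>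
        (\<forall>\<sigma>\<in>Aut N {}. \<forall>(a, b)\<in>E. (map \<sigma> a, map \<sigma> b) \<in> E) \<and>
        (\<exists>G. countable G \<and> G \<subseteq> {galois_tp N c {} | c. c \<in> tuples (elems N) (2 * n)} \<and>
           (\<forall>a\<in>tuples (elems N) n. \<forall>b\<in>tuples (elems N) n.
              (a, b) \<in> E \<longleftrightarrow> galois_tp N (a @ b) {} \<in> G)))"

definition home :: "('a, 'f, 'r) ambient \<Rightarrow> 'a \<Rightarrow> 'a imag" where
  "home N a = imag (equality_rel N) [a]"

definition unhome :: "('a, 'f, 'r) ambient \<Rightarrow> 'a imag \<Rightarrow> 'a" where
  "unhome N = inv_into (elems N) (home N)"

definition imags_of :: "('a list \<times> 'a list) set set \<Rightarrow> 'a set \<Rightarrow> 'a imag set" where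
  "imags_of \<E> A = {imag E a | E a. E \<in> \<E> \<and> a \<in> Field E \<and> set a \<subseteq> A}"

text \<open>In the expanded language, \<open>Inr E\<close> is the function symbol \<open>F\<^sub>E\<close> and the relation symbol \<open>P\<^sub>E\<close>.\<close>

definition eq_lang ::
  "('f, 'r) lang \<Rightarrow> ('a list \<times> 'a list) set set
     \<Rightarrow> ('f + ('a list \<times> 'a list) set, 'r + ('a list \<times> 'a list) set) lang" where
  "eq_lang L \<E> =
     \<lparr>funs = funs L <+> \<E>,
      rels = rels L <+> \<E>,
      farity = case_sum (farity L) (\<lambda>E. THE n. \<forall>a\<in>Field E. length a = n),
      rarity = case_sum (rarity L) (\<lambda>E. 1)\<rparr>"

definition eq_struct ::
  "('a, 'f, 'r) ambient \<Rightarrow> ('a list \<times> 'a list) set set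
     \<Rightarrow> ('a imag, 'f + ('a list \<times> 'a list) set, 'r + ('a list \<times> 'a list) set) struct" where
  "eq_struct N \<E> =
     \<lparr>Dom = imags_of \<E> (elems N),
      fn = case_sum
        (\<lambda>f ys. if set ys \<subseteq> home N ` elems N
                then map_option (home N) (fn (astruct N) f (map (unhome N) ys)) else None)
        (\<lambda>E ys. if set ys \<subseteq> home N ` elems N \<and> map (unhome N) ys \<in> Field E
                then Some (imag E (map (unhome N) ys)) else None),
      rl = case_sum
        (\<lambda>r ys. set ys \<subseteq> home N ` elems N \<and> rl (astruct N) r (map (unhome N) ys))
        (\<lambda>E ys. \<exists>a\<in>Field E. ys = [imag E a])\<rparr>"

definition eq_ambient ::
  "('a, 'f, 'r) ambient \<Rightarrow> ('a list \<times> 'a list) set set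
     \<Rightarrow> ('a imag, 'f + ('a list \<times> 'a list) set, 'r + ('a list \<times> 'a list) set) ambient" where
  "eq_ambient N \<E> =
     \<lparr>alang = eq_lang (alang N) \<E>,
      astruct = eq_struct N \<E>,
      models = imags_of \<E> ` models N\<rparr>"


section \<open>Galois definable groups\<close>

definition galois_definable :: "('a, 'f, 'r) ambient \<Rightarrow> 'a set \<Rightarrow> 'a list set \<Rightarrow> bool" where
  "galois_definable N A X \<longleftrightarrow> (\<forall>\<sigma>\<in>Aut N A. map \<sigma> ` X = X)"

definition galois_definable_group ::
  "('a, 'f, 'r) ambient \<Rightarrow> 'a set \<Rightarrow> 'a monoid \<Rightarrow> bool" where
  "galois_definable_group N A G \<longleftrightarrow> group G \<and> carrier G \<subseteq> elems N \<and>
     galois_definable N A {[x] | x. x \<in> carrier G} \<and>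
     galois_definable N A {[x, y, x \<otimes>\<^bsub>G\<^esub> y] | x y. x \<in> carrier G \<and> y \<in> carrier G}"

definition generic_element :: "('a, 'f, 'r) ambient \<Rightarrow> 'a set \<Rightarrow> 'a monoid \<Rightarrow> 'a \<Rightarrow> bool" where
  "generic_element N A G g \<longleftrightarrow>
     g \<in> carrier G \<and> (\<forall>h\<in>carrier G. U_fin N [h] A \<le> U_fin N [g] A)"

definition one_dimensional_group :: "('a, 'f, 'r) ambient \<Rightarrow> 'a set \<Rightarrow> 'a monoid \<Rightarrow> bool" where
  "one_dimensional_group N A G \<longleftrightarrow>
     (\<exists>g. generic_element N A G g) \<and> (\<forall>g. generic_element N A G g \<longrightarrow> U_fin N [g] A = 1)"

end

theory Submission
  imports Defs "HOL-Library.Countable_Set_Type"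
begin

text \<open>
  The monster is a homogeneous pregeometry: isomorphisms between countable closed sets extend to
  automorphisms, since every countable closed subset of a member of the class embeds as a closed set
  into the generating structure. A Baire category argument shows that the type of a tuple over a
  model is based on a finite set; this makes one-dimensional types stationary and identifies the
  rank with dimension.

  The type of the array says that any three entries of a \<open>2 \<times> 2\<close> minor are independent and that
  their closure contains the fourth. Each of the entries \<open>f k 0\<close>, \<open>f 0 j\<close>, \<open>f k j\<close> lies in the
  closures of the other two formed with two different minors, and these intersect in the closure
  of the entry alone. So the three entries extend to tuples \<open>x\<close>, \<open>y\<close>, \<open>z\<close>, any two of which
  determine the third up to interalgebraicity, and modulo suitable equivalence relations each
  conjugate of \<open>y\<close> acts as a generic bijection from the conjugates of \<open>x\<close> to those of \<open>z\<close>.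
  Going along \<open>y\<close> and back along \<open>y'\<close> defines a germ \<open>(y, y')\<close>. The dependence of the minors
  implies that for each generic \<open>k\<close> this germ is equal to germs \<open>(k, f)\<close> and \<open>(e, k)\<close>, so that
  germs compose by \<open>(e, k) (k, f) = (e, f)\<close> and form a group. It has rank one, because \<open>k\<close> can be
  taken in any given model.
\<close>

section \<open>Quantifier-free types\<close>

text \<open>So closure takes the place of algebraicity and invariance under automorphisms the place
  of definability, and limits are taken by back-and-forth inside countable closed sets, with model
  homogeneity extending the result. That z lies in the closure of x and y does not prevent z from
  having conjugates over x and y that are independent of z. The additional entries of the tuples x,
  y, z are there to confine such conjugates to one closure. An invariant equivalence relation is
  given by countably many Galois types as soon as finite tuples have only countably many types, so
  the germ relation has to be invariant and nothing more. No group has to be extracted from a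
  partial operation: two germs always admit a common generic middle coordinate, so the set of germs
  is itself closed under composition. The index set \<omega>_1 serves twice: it forces the monster
  to be uncountable, and above an \<omega>-sequence whose entries generate a countable model it
  leaves uncountably many rows and columns, among which two have the same type over that
  model.\<close>

lemma trm_in_App [simp]:
  "trm_in L V (App f ts) \<longleftrightarrow> f \<in> funs L \<and> length ts = farity L f \<and> (\<forall>t\<in>set ts. trm_in L V t)"
  by (auto simp: list_all_iff)

declare trm_in.simps(2) [simp del]

lemma tp_eq_iff:
  "tp L M V v = tp L N V w \<longleftrightarrow> (\<forall>p. qf_in L V p \<longrightarrow> (sat M v p \<longleftrightarrow> sat N w p))"
  unfolding tp_def by auto

lemma trm_in_mono: "trm_in L V t \<Longrightarrow> V \<subseteq> W \<Longrightarrow> trm_in L W t"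
  by (induction t) auto

lemma qf_in_mono: "qf_in L V p \<Longrightarrow> V \<subseteq> W \<Longrightarrow> qf_in L W p"
proof (induction p)
  case (Eq s t)
  then show ?case using trm_in_mono[of L V s W] trm_in_mono[of L V t W] by simp
next
  case (Rel r ts)
  then show ?case using trm_in_mono[of L V _ W] by simp
qed auto

lemma finite_set2_trm: "finite (set2_trm t)"
  by (induction t) auto

lemma trm_in_vars: "trm_in L V t \<Longrightarrow> set2_trm t \<subseteq> V \<and> trm_in L (set2_trm t) t"
proof (induction t)
  case (App f ts)
  then have *: "\<forall>t\<in>set ts. set2_trm t \<subseteq> V \<and> trm_in L (set2_trm t) t"
    by auto
  have "trm_in L (set2_trm (App f ts)) t" if "t \<in> set ts" for t
    by (rule trm_in_mono[of L "set2_trm t"]) (use * that in auto)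
  with App.prems * show ?case by fastforce
qed auto

lemma qf_in_finite: "qf_in L V p \<Longrightarrow> \<exists>F. finite F \<and> F \<subseteq> V \<and> qf_in L F p"
proof (induction p)
  case (Eq s t)
  then have *: "set2_trm s \<subseteq> V \<and> trm_in L (set2_trm s) s" "set2_trm t \<subseteq> V \<and> trm_in L (set2_trm t) t"
    using trm_in_vars by auto
  show ?case
    using * trm_in_mono[of L "set2_trm s" s "set2_trm s \<union> set2_trm t"]
      trm_in_mono[of L "set2_trm t" t "set2_trm s \<union> set2_trm t"]
    by (intro exI[of _ "set2_trm s \<union> set2_trm t"]) (simp add: finite_set2_trm)
next
  case (Rel r ts)
  let ?F = "\<Union>t\<in>set ts. set2_trm t"
  have *: "set2_trm t \<subseteq> V \<and> trm_in L (set2_trm t) t" if "t \<in> set ts" for t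
    using Rel trm_in_vars that by auto
  have "trm_in L ?F t" if "t \<in> set ts" for t
    by (rule trm_in_mono[of L "set2_trm t"]) (use * that in auto)
  then show ?case
    using Rel * by (intro exI[of _ ?F]) (auto simp: finite_set2_trm)
next
  case (Neg p)
  then show ?case by simp
next
  case (Conj p q)
  then obtain F G where *: "finite F" "F \<subseteq> V" "qf_in L F p" "finite G" "G \<subseteq> V" "qf_in L G q"
    by auto
  then show ?case
    using qf_in_mono[of L F p "F \<union> G"] qf_in_mono[of L G q "F \<union> G"]
    by (intro exI[of _ "F \<union> G"]) simp
qed

section \<open>Substitution of variables and finite character\<close>

lemma trm_val_map: "trm_val M v (map_trm (\<lambda>x. x) r t) = trm_val M (\<lambda>x. v (r x)) t"
proof (induction t)
  case (App f ts)
  then have "map (\<lambda>t. trm_val M v (map_trm (\<lambda>x. x) r t)) ts = map (trm_val M (\<lambda>x. v (r x))) ts"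
    by (intro map_cong) auto
  then show ?case by (simp only: trm.map list.map_comp o_def trm_val.simps)
qed auto

lemma trm_in_map: "trm_in L V t \<Longrightarrow> r ` V \<subseteq> W \<Longrightarrow> trm_in L W (map_trm (\<lambda>x. x) r t)"
  by (induction t) auto

lemma sat_map: "sat M v (map_qf (\<lambda>x. x) (\<lambda>x. x) r p) = sat M (\<lambda>x. v (r x)) p"
  by (induction p) (simp_all add: trm_val_map o_def)

lemma qf_in_map: "qf_in L V p \<Longrightarrow> r ` V \<subseteq> W \<Longrightarrow> qf_in L W (map_qf (\<lambda>x. x) (\<lambda>x. x) r p)"
  by (induction p) (auto intro: trm_in_map)

text \<open>Substituting \<open>r\<close> into formulas turns the type of the reindexed family into
  a part of the original type; \<open>r\<close> may therefore identify indices.\<close>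

lemma tp_reindex:
  assumes "tp L M W v = tp L N W w" "r ` V \<subseteq> W"
  shows "tp L M V (\<lambda>x. v (r x)) = tp L N V (\<lambda>x. w (r x))"
  unfolding tp_eq_iff
proof (intro allI impI)
  fix p assume "qf_in L V p"
  then have "qf_in L W (map_qf (\<lambda>x. x) (\<lambda>x. x) r p)"
    using assms(2) by (rule qf_in_map)
  then show "sat M (\<lambda>x. v (r x)) p \<longleftrightarrow> sat N (\<lambda>x. w (r x)) p"
    using assms(1)[unfolded tp_eq_iff] by (simp only: sat_map[symmetric])
qed

lemma trm_val_cong: "trm_in L V t \<Longrightarrow> (\<And>x. x \<in> V \<Longrightarrow> v x = w x) \<Longrightarrow> trm_val M v t = trm_val M w t"
proof (induction t)
  case (App f ts)
  then have "map (trm_val M v) ts = map (trm_val M w) ts" by simp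
  then show ?case by (simp del: map_eq_conv)
qed auto

lemma sat_cong: "qf_in L V p \<Longrightarrow> (\<And>x. x \<in> V \<Longrightarrow> v x = w x) \<Longrightarrow> sat M v p = sat M w p"
proof (induction p)
  case (Rel r ts)
  then have "map (trm_val M v) ts = map (trm_val M w) ts"
    using trm_val_cong[of L V _ v w M] by simp
  then show ?case by (simp del: map_eq_conv)
next
  case (Eq s t)
  then show ?case using trm_val_cong[of L V _ v w M] by simp
qed auto

lemma tp_cong: "(\<And>x. x \<in> V \<Longrightarrow> v x = w x) \<Longrightarrow> tp L M V v = tp L M V w"
  unfolding tp_eq_iff using sat_cong by blast

text \<open>A formula mentions finitely many variables. This lets infinite correspondences and
  unions of chains be handled through their finite pieces.\<close>

lemma tp_compact:
  assumes "\<And>F. finite F \<Longrightarrow> F \<subseteq> V \<Longrightarrow> tp L M F v = tp L N F w"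
  shows "tp L M V v = tp L N V w"
  using assms qf_in_finite unfolding tp_eq_iff by metis

text \<open>Correspondences between two structures; the pairs themselves serve as the variables.\<close>

definition tpr ::
  "('f, 'r) lang \<Rightarrow> ('a, 'f, 'r, 'm) struct_scheme \<Rightarrow> ('b, 'f, 'r, 'n) struct_scheme
    \<Rightarrow> ('a \<times> 'b) set \<Rightarrow> bool" where
  "tpr L M N p \<longleftrightarrow> tp L M p fst = tp L N p snd"

text \<open>Indices with the same pair of values are interchangeable, so equality of the types of
  two families depends only on the set of value pairs. Enumerations can thus be forgotten and
  recovered at will.\<close>

lemma tpr_family: "tpr L M N ((\<lambda>x. (v x, w x)) ` V) \<longleftrightarrow> tp L M V v = tp L N V w"
proof
  assume "tpr L M N ((\<lambda>x. (v x, w x)) ` V)"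
  from tp_reindex[OF this[unfolded tpr_def], of "\<lambda>x. (v x, w x)" V]
  show "tp L M V v = tp L N V w" by simp
next
  assume *: "tp L M V v = tp L N V w"
  let ?p = "(\<lambda>x. (v x, w x)) ` V"
  let ?r = "inv_into V (\<lambda>x. (v x, w x))"
  have r: "?r q \<in> V" "v (?r q) = fst q" "w (?r q) = snd q" if "q \<in> ?p" for q
    using arg_cong[OF f_inv_into_f[OF that], of fst] arg_cong[OF f_inv_into_f[OF that], of snd]
      inv_into_into[OF that] by (simp_all only: fst_conv snd_conv)
  have "?r ` ?p \<subseteq> V"
    by (rule image_subsetI) (rule r(1))
  from tp_reindex[OF * this]
  have "tp L M ?p (\<lambda>q. v (?r q)) = tp L N ?p (\<lambda>q. w (?r q))" .
  moreover have "tp L M ?p (\<lambda>q. v (?r q)) = tp L M ?p fst"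
    by (rule tp_cong) (rule r(2))
  moreover have "tp L N ?p (\<lambda>q. w (?r q)) = tp L N ?p snd"
    by (rule tp_cong) (rule r(3))
  ultimately show "tpr L M N ?p" unfolding tpr_def by simp
qed

lemma tpr_subset: "tpr L M N p \<Longrightarrow> q \<subseteq> p \<Longrightarrow> tpr L M N q"
  using tp_reindex[of L M p fst N snd "\<lambda>x. x" q] unfolding tpr_def by auto

lemma tpr_compact: "(\<And>q. finite q \<Longrightarrow> q \<subseteq> p \<Longrightarrow> tpr L M N q) \<Longrightarrow> tpr L M N p"
  unfolding tpr_def by (rule tp_compact)

lemma tpr_converse: "tpr L M N p \<Longrightarrow> tpr L N M (p\<inverse>)"
proof -
  assume "tpr L M N p"
  moreover have "tpr L M N p \<longleftrightarrow> tp L M p fst = tp L N p snd" by (simp add: tpr_def)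
  moreover have "p\<inverse> = (\<lambda>x. (snd x, fst x)) ` p" by force
  ultimately show ?thesis using tpr_family[of L N M snd fst p] by simp
qed

text \<open>Each composite pair is routed through one chosen middle element. Indexing the pairs of
  \<open>p\<close> and of \<open>q\<close> by \<open>p O q\<close> reduces the claim to transitivity
  of equality of types.\<close>

lemma tpr_comp:
  assumes "tpr L M N p" "tpr L N K q"
  shows "tpr L M K (p O q)"
proof -
  define m where "m = (\<lambda>x. SOME b. (fst x, b) \<in> p \<and> (b, snd x) \<in> q)"
  have m: "(fst x, m x) \<in> p \<and> (m x, snd x) \<in> q" if "x \<in> p O q" for x
    unfolding m_def by (rule someI_ex) (use that in auto)
  have "tp L M (p O q) (\<lambda>x. fst (fst x, m x)) = tp L N (p O q) (\<lambda>x. snd (fst x, m x))"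
    by (rule tp_reindex[OF assms(1)[unfolded tpr_def]]) (use m in blast)
  moreover have "tp L N (p O q) (\<lambda>x. fst (m x, snd x)) = tp L K (p O q) (\<lambda>x. snd (m x, snd x))"
    by (rule tp_reindex[OF assms(2)[unfolded tpr_def]]) (use m in blast)
  ultimately show ?thesis unfolding tpr_def by simp
qed

text \<open>Equations between variables are quantifier-free formulas, so a correspondence is
  automatically the graph of a partial injection.\<close>

lemma tpr_eq_iff: "tpr L M N p \<Longrightarrow> (a, b) \<in> p \<Longrightarrow> (a', b') \<in> p \<Longrightarrow> a = a' \<longleftrightarrow> b = b'"
  unfolding tpr_def tp_eq_iff
  by (drule spec[of _ "Eq (Var (a, b)) (Var (a', b'))"]) auto

lemma tpr_rel:
  assumes "tpr L M N p" "r \<in> rels L" "set ps \<subseteq> p" "length ps = rarity L r"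
  shows "rl M r (map fst ps) \<longleftrightarrow> rl N r (map snd ps)"
  using assms(1)[unfolded tpr_def tp_eq_iff, rule_format, of "Rel r (map Var ps)"] assms(2-)
  by (auto simp: o_def)

lemma tpr_fn:
  assumes "tpr L M N p" "f \<in> funs L" "set ps \<subseteq> p" "length ps = farity L f" "(a, b) \<in> p"
  shows "the (fn M f (map fst ps)) = a \<longleftrightarrow> the (fn N f (map snd ps)) = b"
  using assms(1)[unfolded tpr_def tp_eq_iff, rule_format, of "Eq (App f (map Var ps)) (Var (a, b))"]
    assms(2-) by (auto simp: o_def)

lemma wf_structD: "wf_struct L M \<Longrightarrow> f \<in> funs L \<Longrightarrow> set xs \<subseteq> Dom M \<Longrightarrow> length xs = farity L f
    \<Longrightarrow> fn M f xs = Some (the (fn M f xs)) \<and> the (fn M f xs) \<in> Dom M"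
  unfolding wf_struct_def tuples_def by fastforce

text \<open>\<open>trm_val\<close> strips the option by \<open>the\<close>; well-formedness of
  \<open>M\<close> keeps the value of every subterm defined, so that no default value is ever
  compared.\<close>

lemma struct_iso_trm:
  assumes "struct_iso L M N h" "wf_struct L M" "trm_in L V t" "v ` V \<subseteq> Dom M"
  shows "trm_val M v t \<in> Dom M \<and> trm_val N (\<lambda>x. h (v x)) t = h (trm_val M v t)"
  using assms(3)
proof (induction t)
  case (App f ts)
  let ?xs = "map (trm_val M v) ts"
  have xs: "set ?xs \<subseteq> Dom M" "length ?xs = farity L f" "f \<in> funs L"
    using App by auto
  have "map (trm_val N (\<lambda>x. h (v x))) ts = map h ?xs"
    using App by auto
  moreover have "fn N f (map h ?xs) = map_option h (fn M f ?xs)"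
    using assms(1) xs unfolding struct_iso_def tuples_def by blast
  moreover have "fn M f ?xs = Some (the (fn M f ?xs)) \<and> the (fn M f ?xs) \<in> Dom M"
    using wf_structD[OF assms(2) xs(3,1,2)] .
  ultimately show ?case by (metis option.map(2) option.sel trm_val.simps(2))
qed (use assms in auto)

lemma struct_iso_sat:
  assumes "struct_iso L M N h" "wf_struct L M" "qf_in L V p" "v ` V \<subseteq> Dom M"
  shows "sat N (\<lambda>x. h (v x)) p = sat M v p"
  using assms(3)
proof (induction p)
  case (Eq s t)
  have "inj_on h (Dom M)" using assms(1) by (auto simp: struct_iso_def bij_betw_def)
  then show ?case
    using struct_iso_trm[OF assms(1,2) _ assms(4)] Eq by (auto dest: inj_onD)
next
  case (Rel r ts)
  let ?xs = "map (trm_val M v) ts"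
  have *: "map (trm_val N (\<lambda>x. h (v x))) ts = map h ?xs" "set ?xs \<subseteq> Dom M"
    "length ?xs = rarity L r" "r \<in> rels L"
    using Rel struct_iso_trm[OF assms(1,2) _ assms(4)] by auto
  have "rl N r (map h ?xs) = rl M r ?xs"
    using assms(1) * unfolding struct_iso_def tuples_def by blast
  then show ?case by (simp only: sat.simps *)
qed auto

lemma struct_iso_tpr:
  assumes "struct_iso L M N h" "wf_struct L M" "S \<subseteq> Dom M"
  shows "tpr L M N ((\<lambda>x. (x, h x)) ` S)"
  unfolding tpr_family tp_eq_iff
  using struct_iso_sat[OF assms(1,2), where v = "\<lambda>x. x"] assms(3) by blast

lemma substruct_iso: "substruct L S M \<Longrightarrow> struct_iso L S (M\<lparr>Dom := Dom S\<rparr>) (\<lambda>x. x)"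
  unfolding substruct_def struct_iso_def by (simp add: option.map_ident bij_betw_def)

lemma trm_val_Dom_update [simp]: "trm_val (M\<lparr>Dom := H\<rparr>) = trm_val M"
proof (intro ext)
  show "trm_val (M\<lparr>Dom := H\<rparr>) v t = trm_val M v t" for v t
  proof (induction t)
    case (App f ts)
    then have "map (trm_val (M\<lparr>Dom := H\<rparr>) v) ts = map (trm_val M v) ts" by simp
    then show ?case by (simp del: map_eq_conv)
  qed auto
qed

lemma sat_Dom_update [simp]: "sat (M\<lparr>Dom := H\<rparr>) v p = sat M v p"
  by (induction p) auto

lemma tpr_Dom_update [simp]:
  "tpr L (M\<lparr>Dom := H\<rparr>) N p = tpr L M N p" "tpr L M (N\<lparr>Dom := K\<rparr>) p = tpr L M N p"
  unfolding tpr_def tp_def by auto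

text \<open>Preservation of functions is read off from formulas equating a function value with a
  variable. Well-formedness on both sides excludes \<open>None\<close>, which such formulas could
  not detect.\<close>

lemma tpr_struct_iso:
  assumes "tpr L M N ((\<lambda>x. (x, h x)) ` Dom M)" "wf_struct L M" "wf_struct L N" "h ` Dom M = Dom N"
  shows "struct_iso L M N h"
  unfolding struct_iso_def
proof (intro conjI ballI)
  let ?p = "(\<lambda>x. (x, h x)) ` Dom M"
  have "inj_on h (Dom M)"
    by (rule inj_onI) (use tpr_eq_iff[OF assms(1)] in blast)
  then show "bij_betw h (Dom M) (Dom N)" using assms(4) by (simp add: bij_betw_def)
  fix xs
  let ?ps = "map (\<lambda>x. (x, h x)) xs"
  have ps: "map fst ?ps = xs" "map snd ?ps = map h xs" by (auto simp: o_def)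
  {
    fix f assume f: "f \<in> funs L" "xs \<in> tuples (Dom M) (farity L f)"
    then have xs: "set xs \<subseteq> Dom M" "length xs = farity L f" "set (map h xs) \<subseteq> Dom N"
      using assms(4) by (auto simp: tuples_def)
    note w = wf_structD[OF assms(2) f(1) xs(1,2)]
    note w' = wf_structD[OF assms(3) f(1) xs(3)]
    have "the (fn N f (map h xs)) = h (the (fn M f xs))"
      using tpr_fn[OF assms(1) f(1), of ?ps "the (fn M f xs)" "h (the (fn M f xs))"] w xs
      unfolding ps by auto
    then show "fn N f (map h xs) = map_option h (fn M f xs)"
      using w w' xs by (metis length_map option.map(2))
  }
  {
    fix r assume "r \<in> rels L" "xs \<in> tuples (Dom M) (rarity L r)"
    then show "rl N r (map h xs) = rl M r xs"
      using tpr_rel[OF assms(1), of r ?ps] unfolding ps by (auto simp: tuples_def)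
  }
qed

lemma substruct_tpr: "substruct L S M \<Longrightarrow> H \<subseteq> Dom S \<Longrightarrow> tpr L S M (Id_on H)"
proof -
  assume *: "substruct L S M" "H \<subseteq> Dom S"
  then have "wf_struct L S" by (auto simp: substruct_def)
  from struct_iso_tpr[OF substruct_iso[OF *(1)] this *(2)]
  have "tpr L S M ((\<lambda>x. (x, x)) ` H)" by simp
  moreover have "(\<lambda>x. (x, x)) ` H = Id_on H" by auto
  ultimately show ?thesis by simp
qed

section \<open>Pregeometries\<close>

locale pregeom =
  fixes D :: "'a set" and cl :: "'a set \<Rightarrow> 'a set"
  assumes pregeometry: "pregeometry D cl"
begin

lemma cl_basic: "\<forall>X. X \<subseteq> D \<longrightarrow> X \<subseteq> cl X \<and> cl X \<subseteq> D \<and> cl (cl X) = cl X"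
  and cl_mono_all: "\<forall>X Y. X \<subseteq> Y \<and> Y \<subseteq> D \<longrightarrow> cl X \<subseteq> cl Y"
  and cl_finite_all: "\<forall>X. X \<subseteq> D \<longrightarrow> cl X = (\<Union>F\<in>{F. F \<subseteq> X \<and> finite F}. cl F)"
  and exchange_all: "\<forall>X a b. X \<subseteq> D \<and> a \<in> D \<and> b \<in> D \<and> a \<in> cl (insert b X) - cl X \<longrightarrow> b \<in> cl (insert a X)"
  using pregeometry unfolding pregeometry_def by - (elim conjE, assumption)+

lemma cl_sub: "X \<subseteq> D \<Longrightarrow> X \<subseteq> cl X"
  and cl_D: "X \<subseteq> D \<Longrightarrow> cl X \<subseteq> D"
  and cl_idem: "X \<subseteq> D \<Longrightarrow> cl (cl X) = cl X"
  using cl_basic by simp_all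

lemma cl_mono: "X \<subseteq> Y \<Longrightarrow> Y \<subseteq> D \<Longrightarrow> cl X \<subseteq> cl Y"
  using cl_mono_all by simp

lemma cl_finite: "X \<subseteq> D \<Longrightarrow> a \<in> cl X \<Longrightarrow> \<exists>F. finite F \<and> F \<subseteq> X \<and> a \<in> cl F"
proof -
  assume X: "X \<subseteq> D" and a: "a \<in> cl X"
  from cl_finite_all[rule_format, OF X] a
  have "a \<in> (\<Union>F\<in>{F. F \<subseteq> X \<and> finite F}. cl F)" by (rule subst)
  then show ?thesis by blast
qed

lemma exchange:
  "X \<subseteq> D \<Longrightarrow> a \<in> D \<Longrightarrow> b \<in> D \<Longrightarrow> a \<in> cl (insert b X) \<Longrightarrow> a \<notin> cl X \<Longrightarrow> b \<in> cl (insert a X)"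
  using exchange_all[rule_format, of X a b] by (simp del: insert_subset)

lemma cl_minimal: "X \<subseteq> cl Y \<Longrightarrow> Y \<subseteq> D \<Longrightarrow> cl X \<subseteq> cl Y"
  using cl_mono[of X "cl Y"] cl_D cl_idem by simp

end

section \<open>Chains and back-and-forth\<close>

lemma finite_subset_chain:
  assumes "finite F" "F \<subseteq> (\<Union>n. A n)" "\<And>n. A n \<subseteq> A (Suc n)"
  shows "\<exists>n::nat. F \<subseteq> A n"
  using assms(1,2)
proof (induction F)
  case (insert x F)
  then obtain n m where "F \<subseteq> A n" "x \<in> A m" by auto
  moreover have "A n \<subseteq> A (max n m)" "A m \<subseteq> A (max n m)"
    by (intro lift_Suc_mono_le[of A, OF assms(3)]; simp)+
  ultimately show ?case by (intro exI[of _ "max n m"]) auto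
qed auto

text \<open>\<open>Good\<close> stays abstract because the scheme serves both correspondences
  extended by QM5 and finite maps induced by automorphisms. Each stage treats one element of each
  enumeration.\<close>

lemma back_and_forth:
  assumes "countable X" "countable Y" "Good p0"
    and forth: "\<And>p x. Good p \<Longrightarrow> x \<in> X \<Longrightarrow> \<exists>y. Good (insert (x, y) p)"
    and bwd: "\<And>p y. Good p \<Longrightarrow> y \<in> Y \<Longrightarrow> \<exists>x. Good (insert (x, y) p)"
  shows "\<exists>P :: nat \<Rightarrow> ('a \<times> 'b) set. P 0 = p0 \<and> (\<forall>n. Good (P n) \<and> P n \<subseteq> P (Suc n)) \<and>
    X \<subseteq> Domain (\<Union>n. P n) \<and> Y \<subseteq> Range (\<Union>n. P n)"
proof -
  have step: "\<exists>q. Good q \<and> p \<subseteq> q \<and> (X \<noteq> {} \<longrightarrow> from_nat_into X n \<in> Domain q) \<and>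
    (Y \<noteq> {} \<longrightarrow> from_nat_into Y n \<in> Range q)" if "Good p" for p n
  proof -
    obtain q where q: "Good q" "p \<subseteq> q" "X \<noteq> {} \<longrightarrow> from_nat_into X n \<in> Domain q"
    proof (cases "X = {}")
      case False
      with forth[OF \<open>Good p\<close> from_nat_into[OF this, of n]] show ?thesis
        using that by blast
    qed (use that \<open>Good p\<close> in auto)
    show ?thesis
    proof (cases "Y = {}")
      case False
      with bwd[OF q(1) from_nat_into[OF this, of n]] show ?thesis
        using q by blast
    qed (use q in auto)
  qed
  have "\<exists>P. \<forall>n. (Good (P n) \<and> (n = 0 \<longrightarrow> P n = p0)) \<and>
    (P n \<subseteq> P (Suc n) \<and> (X \<noteq> {} \<longrightarrow> from_nat_into X n \<in> Domain (P (Suc n))) \<and>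
    (Y \<noteq> {} \<longrightarrow> from_nat_into Y n \<in> Range (P (Suc n))))"
    by (rule dependent_nat_choice) (use assms(3) step in auto)
  then obtain P where P0: "\<forall>n. (Good (P n) \<and> (n = 0 \<longrightarrow> P n = p0)) \<and>
    (P n \<subseteq> P (Suc n) \<and> (X \<noteq> {} \<longrightarrow> from_nat_into X n \<in> Domain (P (Suc n))) \<and>
    (Y \<noteq> {} \<longrightarrow> from_nat_into Y n \<in> Range (P (Suc n))))"
    by (rule exE)
  have P: "\<And>n. Good (P n)" "P 0 = p0" "\<And>n. P n \<subseteq> P (Suc n)"
    "\<And>n. X \<noteq> {} \<Longrightarrow> from_nat_into X n \<in> Domain (P (Suc n))"
    "\<And>n. Y \<noteq> {} \<Longrightarrow> from_nat_into Y n \<in> Range (P (Suc n))"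
    by (use P0 in simp_all)
  have "x \<in> Domain (\<Union>n. P n)" if x: "x \<in> X" for x
    using P(4)[of "to_nat_on X x"] from_nat_into_to_nat_on[OF assms(1) x] x by fastforce
  moreover have "y \<in> Range (\<Union>n. P n)" if y: "y \<in> Y" for y
    using P(5)[of "to_nat_on Y y"] from_nat_into_to_nat_on[OF assms(2) y] y by fastforce
  ultimately show ?thesis using P by (intro exI[of _ P]) auto
qed

lemma tpr_Union:
  assumes "\<And>n. tpr L M N (P n)" "\<And>n::nat. P n \<subseteq> P (Suc n)"
  shows "tpr L M N (\<Union>n. P n)"
proof (rule tpr_compact)
  fix q assume "finite q" "q \<subseteq> (\<Union>n. P n)"
  then obtain n where "q \<subseteq> P n" using finite_subset_chain[of q P] assms(2) by blast
  then show "tpr L M N q" using tpr_subset assms(1) by blast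
qed

lemma tpr_list:
  "length xs = length ys \<Longrightarrow> tpr L M N (set (zip xs ys)) \<longleftrightarrow> tp_list L M xs = tp_list L N ys"
proof -
  assume *: "length xs = length ys"
  then have "set (zip xs ys) = (\<lambda>i. (xs ! i, ys ! i)) ` {..<length xs}"
    by (auto simp: set_zip image_def)
  with tpr_family[of L M N "nth xs" "nth ys" "{..<length xs}"] * show ?thesis
    by (simp add: tp_list_def)
qed

lemma tpr_ext:
  assumes "length xs = length ys"
  shows "tpr L M N ((\<lambda>v. (h v, k v)) ` V \<union> set (zip xs ys)) \<longleftrightarrow> tp_ext L M V h xs = tp_ext L N V k ys"
proof -
  have "(\<lambda>v. (h v, k v)) ` V \<union> set (zip xs ys) =
    (\<lambda>i. (case_sum h (nth xs) i, case_sum k (nth ys) i)) ` (V <+> {..<length xs})"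
    using assms by (auto simp: set_zip image_Un image_image Plus_def)
  with tpr_family[of L M N "case_sum h (nth xs)" "case_sum k (nth ys)" "V <+> {..<length xs}"] assms
  show ?thesis by (simp add: tp_ext_def)
qed

section \<open>Quasiminimal pregeometry structures\<close>

text \<open>QM4 and QM5 speak of sets enumerated along sets of natural numbers. Enumerating the
  pairs of a correspondence enumerates both of its sides in parallel.\<close>

lemma countable_enum: "countable p \<Longrightarrow> \<exists>V e. e ` (V :: nat set) = p"
  by (metis image_empty range_from_nat_into)

locale quasimin =
  fixes L :: "('f, 'r) lang" and M0 :: "('b, 'f, 'r) pstruct"
  assumes qm: "quasiminimal L M0"
begin

sublocale pregeom "Dom M0" "cl M0"
  using qm by unfold_locales (simp add: quasiminimal_def weakly_quasiminimal_def)

lemma wf0: "wf_struct L M0"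
  using qm by (simp add: quasiminimal_def weakly_quasiminimal_def)

lemma outside: "finite X \<Longrightarrow> X \<subseteq> Dom M0 \<Longrightarrow> \<exists>a\<in>Dom M0. a \<notin> cl M0 X"
  using qm cl_D[of X] unfolding quasiminimal_def infinite_dim_def by blast

lemma countable_cl: "countable X \<Longrightarrow> X \<subseteq> Dom M0 \<Longrightarrow> countable (cl M0 X)"
proof -
  assume X: "countable X" "X \<subseteq> Dom M0"
  have "cl M0 X \<subseteq> (\<Union>F\<in>{F. finite F \<and> F \<subseteq> X}. cl M0 F)"
    using cl_finite[OF X(2)] by blast
  moreover have "countable (\<Union>F\<in>{F. finite F \<and> F \<subseteq> X}. cl M0 F)"
    using X qm countable_Collect_finite_subset[OF X(1)]
    by (intro countable_UN) (auto simp: quasiminimal_def weakly_quasiminimal_def QM3_def)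
  ultimately show ?thesis using countable_subset by blast
qed

text \<open>QM1 is about finite tuples. Finite character replaces \<open>Domain s\<close> by a
  finite part, and the matching pairs of \<open>s\<close> form the two tuples to compare.\<close>

lemma cl_tpr_imp:
  assumes "tpr L M0 M0 r" "r \<subseteq> Dom M0 \<times> Dom M0" "s \<subseteq> r" "(a, b) \<in> r" "a \<in> cl M0 (Domain s)"
  shows "b \<in> cl M0 (Range s)"
proof -
  have s: "Domain s \<subseteq> Dom M0" "Range s \<subseteq> Dom M0" using assms by auto
  obtain F where F: "finite F" "F \<subseteq> Domain s" "a \<in> cl M0 F"
    using cl_finite[OF s(1) assms(5)] by blast
  obtain q where q: "finite q" "q \<subseteq> s" "F = fst ` q"
    using F finite_subset_image[of F fst s] by (auto simp: fst_eq_Domain)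
  then obtain ps where ps: "set ps = q" using finite_list by blast
  have "set (zip (a # map fst ps) (b # map snd ps)) = insert (a, b) q"
    using ps by (auto simp: zip_map_fst_snd)
  then have "tpr L M0 M0 (set (zip (a # map fst ps) (b # map snd ps)))"
    using tpr_subset[OF assms(1), of "insert (a, b) q"] assms q by auto
  then have "tp_list L M0 (a # map fst ps) = tp_list L M0 (b # map snd ps)"
    by (subst (asm) tpr_list) auto
  moreover have "QM1 L M0" using qm by (simp add: quasiminimal_def weakly_quasiminimal_def)
  moreover have "a \<in> cl M0 (set (map fst ps))" using F q ps by simp
  moreover have "set ps \<subseteq> Dom M0 \<times> Dom M0" "(a, b) \<in> Dom M0 \<times> Dom M0"
    using assms(2-4) q(2) unfolding ps by blast+
  then have "a \<in> Dom M0" "b \<in> Dom M0" "set (map fst ps) \<subseteq> Dom M0" "set (map snd ps) \<subseteq> Dom M0"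
    by auto
  ultimately have "b \<in> cl M0 (set (map snd ps))"
    unfolding QM1_def by blast
  moreover have "set (map snd ps) \<subseteq> Range s" using ps q by force
  ultimately show ?thesis using cl_mono s by blast
qed

lemma cl_tpr:
  assumes "tpr L M0 M0 r" "r \<subseteq> Dom M0 \<times> Dom M0" "s \<subseteq> r" "(a, b) \<in> r"
  shows "a \<in> cl M0 (Domain s) \<longleftrightarrow> b \<in> cl M0 (Range s)"
  using cl_tpr_imp[OF assms] cl_tpr_imp[OF tpr_converse[OF assms(1)], of "s\<inverse>" b a] assms by auto

lemma cl_Image:
  assumes "tpr L M0 M0 r" "r \<subseteq> Dom M0 \<times> Dom M0" "closed_in M0 (Domain r)" "closed_in M0 (Range r)"
    and "Y \<subseteq> Domain r"
  shows "cl M0 (r `` Y) = r `` cl M0 Y"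
proof -
  let ?s = "r \<inter> Y \<times> UNIV"
  have s: "Domain ?s = Y" "Range ?s = r `` Y" using assms(5) by auto
  have *: "a \<in> cl M0 Y \<longleftrightarrow> b \<in> cl M0 (r `` Y)" if "(a, b) \<in> r" for a b
    using cl_tpr[OF assms(1,2) _ that, of ?s] s by simp
  have "cl M0 Y \<subseteq> Domain r" "cl M0 (r `` Y) \<subseteq> Range r"
    using assms(3-5) cl_mono[of Y "Domain r"] cl_mono[of "r `` Y" "Range r"]
    unfolding closed_in_def by auto
  with * show ?thesis by blast
qed

lemma QM4':
  assumes "tpr L M0 M0 p" "countable p" "closed_in M0 (Domain p)" "closed_in M0 (Range p)"
    and "a \<in> Dom M0 - Domain p" "b \<in> Dom M0 - Range p"
  shows "tpr L M0 M0 (insert (a, b) p)"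
proof -
  obtain V :: "nat set" and e where e: "e ` V = p" using countable_enum[OF assms(2)] by blast
  let ?h = "\<lambda>v. fst (e v)" and ?k = "\<lambda>v. snd (e v)"
  have p: "(\<lambda>v. (?h v, ?k v)) ` V = p" "?h ` V = Domain p" "?k ` V = Range p"
    using e by (auto simp: fst_eq_Domain[symmetric] snd_eq_Range[symmetric] image_image[symmetric])
  have "QM4 L M0" using qm by (simp add: quasiminimal_def weakly_quasiminimal_def)
  moreover have "tp L M0 V ?h = tp L M0 V ?k"
    using assms(1) tpr_family[of L M0 M0 ?h ?k V] unfolding p(1) by simp
  ultimately have "tp_ext L M0 V ?h [a] = tp_ext L M0 V ?k [b]"
    using assms(3-6) unfolding QM4_def p(2,3)[symmetric] by blast
  then have "tpr L M0 M0 ((\<lambda>v. (?h v, ?k v)) ` V \<union> set (zip [a] [b]))"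
    by (subst tpr_ext) auto
  then show ?thesis using p(1) by simp
qed

text \<open>QM5 provides \<open>b\<close> somewhere in the structure; that it lies in the closure of
  the range follows from QM1 for the enlarged correspondence.\<close>

lemma QM5':
  assumes "countable p" "p = {} \<or> closed_in M0 (Domain p) \<and> closed_in M0 (Range p)"
    and "finite q" "tpr L M0 M0 (p \<union> q)" "p \<union> q \<subseteq> Dom M0 \<times> Dom M0"
    and "a \<in> cl M0 (Domain (p \<union> q))"
  shows "\<exists>b. b \<in> cl M0 (Range (p \<union> q)) \<and> tpr L M0 M0 (insert (a, b) (p \<union> q))"
proof -
  obtain V :: "nat set" and e where e: "e ` V = p" using countable_enum[OF assms(1)] by blast
  obtain ps where ps: "set ps = q" using finite_list assms(3) by blast
  let ?h = "\<lambda>v. fst (e v)" and ?k = "\<lambda>v. snd (e v)"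
  have p: "(\<lambda>v. (?h v, ?k v)) ` V = p" "?h ` V = Domain p" "?k ` V = Range p"
    using e by (auto simp: fst_eq_Domain[symmetric] snd_eq_Range[symmetric] image_image[symmetric])
  have q: "set (zip (map fst ps) (map snd ps)) = q" by (simp add: zip_map_fst_snd ps)
  have DR: "Domain (p \<union> q) = ?h ` V \<union> set (map fst ps)" 
    unfolding p Domain_Un_eq using ps by (auto simp: fst_eq_Domain[symmetric])
  have "QM5 L M0" using qm by (simp add: quasiminimal_def weakly_quasiminimal_def)
  moreover have "tp L M0 V ?h = tp L M0 V ?k"
    using tpr_subset[OF assms(4), of p] tpr_family[of L M0 M0 ?h ?k V] unfolding p(1) by simp
  moreover have "tp_ext L M0 V ?h (map fst ps) = tp_ext L M0 V ?k (map snd ps)"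
    using assms(4) tpr_ext[of "map fst ps" "map snd ps" L M0 M0 ?h ?k V] p(1) q by simp
  moreover have "closed_in M0 (?h ` V) \<or> ?h ` V = {}" "closed_in M0 (?k ` V) \<or> ?k ` V = {}"
    using assms(2) p by auto
  moreover have "set (map fst ps) \<subseteq> Dom M0" "set (map snd ps) \<subseteq> Dom M0"
    using assms(5) ps by auto
  moreover have "a \<in> cl M0 (?h ` V \<union> set (map fst ps))" using assms(6) unfolding DR .
  ultimately have "\<exists>b\<in>Dom M0. tp_ext L M0 V ?h (map fst ps @ [a]) = tp_ext L M0 V ?k (map snd ps @ [b])"
    unfolding QM5_def by (elim allE[where x = V] allE[where x = ?h] allE[where x = ?k]
      allE[where x = "map fst ps"] allE[where x = "map snd ps"] allE[where x = a]) simp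
  then obtain b where b: "b \<in> Dom M0"
    "tp_ext L M0 V ?h (map fst ps @ [a]) = tp_ext L M0 V ?k (map snd ps @ [b])"
    by blast
  then have "tpr L M0 M0 ((\<lambda>v. (?h v, ?k v)) ` V \<union> set (zip (map fst ps @ [a]) (map snd ps @ [b])))"
    by (subst tpr_ext) auto
  then have t: "tpr L M0 M0 (insert (a, b) (p \<union> q))" using p(1) q by simp
  have "a \<in> Dom M0" using assms(6) cl_D[of "Domain (p \<union> q)"] assms(5) by blast
  then show ?thesis
    using cl_tpr[OF t _ _ insertI1, of "p \<union> q"] t assms(5,6) b(1) by (intro exI[of _ b]) auto
qed

text \<open>Back-and-forth with QM5. At every stage only finitely many pairs have been added to the
  closed part \<open>p\<close>, which is the situation QM5 covers; hence the shape
  \<open>p \<union> q'\<close> with finite \<open>q'\<close> in the invariant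
  \<open>Good\<close>.\<close>

lemma extend_cl:
  assumes "countable p" "p = {} \<or> closed_in M0 (Domain p) \<and> closed_in M0 (Range p)"
    and "finite q" "tpr L M0 M0 (p \<union> q)" "p \<union> q \<subseteq> Dom M0 \<times> Dom M0"
  shows "\<exists>r. p \<union> q \<subseteq> r \<and> tpr L M0 M0 r \<and>
    Domain r = cl M0 (Domain (p \<union> q)) \<and> Range r = cl M0 (Range (p \<union> q))"
proof -
  let ?X = "cl M0 (Domain (p \<union> q))" and ?Y = "cl M0 (Range (p \<union> q))"
  have D: "Domain (p \<union> q) \<subseteq> Dom M0" "Range (p \<union> q) \<subseteq> Dom M0" using assms(5) by auto
  have c: "countable (Domain (p \<union> q))" "countable (Range (p \<union> q))"
    using assms(1,3) by (auto simp: fst_eq_Domain[symmetric] snd_eq_Range[symmetric] countable_finite)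
  define Good where "Good = (\<lambda>r. tpr L M0 M0 r \<and> r \<subseteq> ?X \<times> ?Y \<and> (\<exists>q'. finite q' \<and> r = p \<union> q') \<and> p \<union> q \<subseteq> r)"
  have XY: "?X \<subseteq> Dom M0" "?Y \<subseteq> Dom M0" using cl_D D by auto
  have forth: "\<exists>y. Good (insert (x, y) r)" if r: "Good r" and x: "x \<in> ?X" for r x
  proof -
    from r obtain q' where q': "finite q'" "r = p \<union> q'" "tpr L M0 M0 r" "r \<subseteq> ?X \<times> ?Y" "p \<union> q \<subseteq> r"
      unfolding Good_def by blast
    have rD: "r \<subseteq> Dom M0 \<times> Dom M0" using q'(4) XY by blast
    have "?X \<subseteq> cl M0 (Domain r)" using q'(5) rD by (intro cl_mono) auto
    then obtain y where y: "y \<in> cl M0 (Range r)" "tpr L M0 M0 (insert (x, y) r)"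
      using QM5'[OF assms(1,2) q'(1), of x] q' rD x by auto
    have "cl M0 (Range r) \<subseteq> ?Y" using q'(4) D by (intro cl_minimal) auto
    then have "insert (x, y) r \<subseteq> ?X \<times> ?Y" "p \<union> q \<subseteq> insert (x, y) r" using x y q'(4,5) by blast+
    moreover have "finite (insert (x, y) q')" "insert (x, y) r = p \<union> insert (x, y) q'" using q' by auto
    moreover have "tpr L M0 M0 (insert (x, y) r)" using y(2) q'(2) by simp
    ultimately have "Good (insert (x, y) r)" unfolding Good_def by blast
    then show ?thesis ..
  qed
  \<comment> \<open>The backward step is QM5 for the converse correspondence.\<close>
  have bwd: "\<exists>x. Good (insert (x, y) r)" if r: "Good r" and y: "y \<in> ?Y" for r y
  proof -
    from r obtain q' where q': "finite q'" "r = p \<union> q'" "tpr L M0 M0 r" "r \<subseteq> ?X \<times> ?Y" "p \<union> q \<subseteq> r"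
      unfolding Good_def by blast
    have rD: "r \<subseteq> Dom M0 \<times> Dom M0" using q'(4) XY by blast
    have "?Y \<subseteq> cl M0 (Range r)" using q'(5) rD by (intro cl_mono) auto
    moreover have "tpr L M0 M0 (p\<inverse> \<union> q'\<inverse>)" using tpr_converse[OF q'(3)] q'(2) by (simp add: converse_Un)
    moreover have "Domain (p\<inverse> \<union> q'\<inverse>) = Range r" "Range (p\<inverse> \<union> q'\<inverse>) = Domain r"
      using q'(2) by auto
    moreover have "p\<inverse> = prod.swap ` p" by force
    then have "countable (p\<inverse>)" using assms(1) by simp
    moreover have "p\<inverse> \<union> q'\<inverse> \<subseteq> Dom M0 \<times> Dom M0" using rD q'(2) by blast
    ultimately obtain x where x: "x \<in> cl M0 (Domain r)" "tpr L M0 M0 (insert (y, x) (p\<inverse> \<union> q'\<inverse>))"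
      using QM5'[of "p\<inverse>" "q'\<inverse>" y] q'(1) y assms(2) by auto
    have "(insert (y, x) (p\<inverse> \<union> q'\<inverse>))\<inverse> = insert (x, y) r" using q' by auto
    then have t: "tpr L M0 M0 (insert (x, y) r)" using tpr_converse[OF x(2)] by simp
    have "cl M0 (Domain r) \<subseteq> ?X" using q'(4) D by (intro cl_minimal) auto
    then have "insert (x, y) r \<subseteq> ?X \<times> ?Y" "p \<union> q \<subseteq> insert (x, y) r" using x y q'(4,5) by blast+
    moreover have "finite (insert (x, y) q')" "insert (x, y) r = p \<union> insert (x, y) q'" using q' by auto
    ultimately have "Good (insert (x, y) r)" unfolding Good_def using t by blast
    then show ?thesis ..
  qed
  have "p \<union> q \<subseteq> Domain (p \<union> q) \<times> Range (p \<union> q)" by (rule subrelI) (blast intro: DomainI RangeI)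
  also have "\<dots> \<subseteq> ?X \<times> ?Y" using cl_sub[OF D(1)] cl_sub[OF D(2)] by (rule Sigma_mono)
  finally have "p \<union> q \<subseteq> ?X \<times> ?Y" .
  then have "Good (p \<union> q)" unfolding Good_def using assms(3,4) by blast
  from back_and_forth[of ?X ?Y Good, OF countable_cl[OF c(1) D(1)] countable_cl[OF c(2) D(2)] this forth bwd]
  obtain P where P: "P 0 = p \<union> q" "\<And>n. Good (P n)" "\<And>n. P n \<subseteq> P (Suc n)"
    "?X \<subseteq> Domain (\<Union>n. P n)" "?Y \<subseteq> Range (\<Union>n. P n)"
    by blast
  have "(\<Union>n. P n) \<subseteq> ?X \<times> ?Y" using P(2) unfolding Good_def by blast
  moreover have "tpr L M0 M0 (\<Union>n. P n)"
    by (rule tpr_Union) (use P Good_def in auto)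
  moreover have "p \<union> q \<subseteq> (\<Union>n. P n)" using P(1) by blast
  ultimately show ?thesis using P(4,5) by (intro exI[of _ "\<Union>n. P n"]) blast
qed

text \<open>If a function value fell outside the closure of its arguments, then by QM4 it would equal
  every other element outside the closure.\<close>

lemma closed_fn:
  assumes "closed_in M0 H" "f \<in> funs L" "set xs \<subseteq> H" "length xs = farity L f"
  shows "the (fn M0 f xs) \<in> H"
proof -
  let ?a = "the (fn M0 f xs)"
  have xs: "set xs \<subseteq> Dom M0" using assms unfolding closed_in_def by auto
  note w = wf_structD[OF wf0 assms(2) xs assms(4)]
  let ?C = "cl M0 (set xs)"
  have C: "closed_in M0 ?C" "set xs \<subseteq> ?C" "countable ?C"
    using xs cl_idem cl_D cl_sub countable_cl[of "set xs"] unfolding closed_in_def by (auto simp: countable_finite)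
  have "?a \<in> ?C"
  proof (rule ccontr)
    assume a: "?a \<notin> ?C"
    obtain b where b: "b \<in> Dom M0" "b \<notin> cl M0 (insert ?a (set xs))"
      using outside[of "insert ?a (set xs)"] xs w by auto
    have bC: "b \<notin> ?C" "b \<noteq> ?a"
      using b cl_mono[of "set xs" "insert ?a (set xs)"] cl_sub[of "insert ?a (set xs)"] xs w by auto
    have Id: "Id_on ?C = (\<lambda>x. (x, x)) ` ?C" by auto
    have "tpr L M0 M0 (Id_on ?C)"
      unfolding Id tpr_family ..
    moreover have "countable (Id_on ?C)" using C(3) unfolding Id by simp
    ultimately have "tpr L M0 M0 (insert (?a, b) (Id_on ?C))"
      using C a b bC w by (intro QM4') auto
    from tpr_fn[OF this assms(2), of "map (\<lambda>x. (x, x)) xs" ?a b] C(2) assms(4) bC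
    show False by (auto simp: o_def)
  qed
  moreover have "?C \<subseteq> H"
    using assms(1,3) cl_mono[of "set xs" H] unfolding closed_in_def by auto
  ultimately show ?thesis by blast
qed

lemma closed_sub_restrict:
  assumes "closed_in M0 H"
  shows "closed_sub L (M0\<lparr>Dom := H\<rparr>) M0"
proof -
  have H: "H \<subseteq> Dom M0" "cl M0 H = H" using assms by (auto simp: closed_in_def)
  have "wf_struct L (M0\<lparr>Dom := H\<rparr>)"
    unfolding wf_struct_def tuples_def
  proof (intro ballI)
    fix f xs assume f: "f \<in> funs L" and "xs \<in> {xs. set xs \<subseteq> Dom (M0\<lparr>Dom := H\<rparr>) \<and> length xs = farity L f}"
    then have xs: "set xs \<subseteq> H" "set xs \<subseteq> Dom M0" "length xs = farity L f" using H(1) by auto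
    have "Some (the (fn M0 f xs)) \<in> Some ` H"
      using closed_fn[OF assms f xs(1,3)] by (rule imageI)
    moreover have "Some (the (fn M0 f xs)) = fn M0 f xs"
      using wf_structD[OF wf0 f xs(2,3)] by (rule conjunct1[THEN sym])
    ultimately show "fn (M0\<lparr>Dom := H\<rparr>) f xs \<in> Some ` Dom (M0\<lparr>Dom := H\<rparr>)"
      by simp
  qed
  then have "substruct L (M0\<lparr>Dom := H\<rparr>) M0"
    using H(1) unfolding substruct_def by simp
  moreover have "cl M0 X \<inter> H = cl M0 X" if "X \<subseteq> H" for X
    using cl_mono[OF that H(1)] unfolding H(2) by blast
  ultimately show ?thesis
    using assms unfolding closed_sub_def by simp
qed

end

section \<open>Members of a quasiminimal class\<close>

lemma rel_subset_Times: "Domain r \<subseteq> A \<Longrightarrow> Range r \<subseteq> B \<Longrightarrow> r \<subseteq> A \<times> B"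
  by (rule subrelI) auto

lemma tpr_inj_fst: "tpr L M N e \<Longrightarrow> inj_on fst e"
  by (rule inj_onI) (metis prod.collapse tpr_eq_iff)

lemma tpr_inj_snd: "tpr L M N e \<Longrightarrow> inj_on snd e"
  by (rule inj_onI) (metis prod.collapse tpr_eq_iff)

lemma tpr_countable: "tpr L M N e \<Longrightarrow> countable (Domain e) \<Longrightarrow> countable e"
  using countable_image_inj_on[of fst e] tpr_inj_fst[of L M N e] by (simp add: fst_eq_Domain)

lemma tpr_finite_Image: "tpr L M N e \<Longrightarrow> finite F \<Longrightarrow> finite (e `` F)"
proof -
  assume e: "tpr L M N e" and F: "finite F"
  have "finite (e \<inter> F \<times> UNIV)"
    by (rule finite_imageD[of fst])
      (use F tpr_inj_fst[OF e] in \<open>auto intro: finite_subset[of _ F] inj_on_subset\<close>)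
  moreover have "e `` F = snd ` (e \<inter> F \<times> UNIV)" by force
  ultimately show ?thesis by simp
qed

section \<open>Closed embeddings of countable pieces into the generating structure\<close>

context quasimin begin

definition cemb :: "('a, 'f, 'r) pstruct \<Rightarrow> ('a \<times> 'b) set \<Rightarrow> bool" where
  "cemb N e \<longleftrightarrow> tpr L N M0 e \<and> e \<subseteq> Dom N \<times> Dom M0 \<and> closed_in M0 (Range e) \<and>
     (\<forall>X. X \<subseteq> Domain e \<longrightarrow> cl M0 (e `` X) = e `` cl N X)"

text \<open>The invariant of the induction over the class. A member may be larger than
  \<open>M0\<close>, so only its countable closed subsets are compared with \<open>M0\<close>;
  consequences of QM1, QM4 and QM5 are pulled back along these embeddings.\<close>

definition good :: "('a, 'f, 'r) pstruct \<Rightarrow> bool" where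
  "good N \<longleftrightarrow> wf_struct L N \<and> pregeometry (Dom N) (cl N) \<and> QM3 N \<and>
     (\<forall>H. countable H \<and> closed_in N H \<longrightarrow> (\<exists>e. Domain e = H \<and> cemb N e))"

text \<open>The given embedding \<open>e'\<close> of the larger set need not extend
  \<open>e\<close>. It is corrected by a partial automorphism of \<open>M0\<close> that carries the
  image of \<open>cl N F\<close> under \<open>e'\<close> to its image under \<open>e\<close>; QM4
  and \<open>extend_cl\<close> enlarge this partial automorphism to all of
  \<open>Range e'\<close>.\<close>

lemma cemb_extend:
  assumes "cemb N e" "cemb N e'" "pregeometry (Dom N) (cl N)" "finite F" "F \<subseteq> Dom N" "b \<in> Dom N"
    and "Domain e = cl N F" "Domain e' = cl N (insert b F)" "countable (cl N F)"
  shows "\<exists>e''. e \<subseteq> e'' \<and> cemb N e'' \<and> Domain e'' = cl N (insert b F)"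
proof -
  interpret N: pregeom "Dom N" "cl N" by unfold_locales fact
  have e: "tpr L N M0 e" "e \<subseteq> Dom N \<times> Dom M0" "closed_in M0 (Range e)"
    "\<And>X. X \<subseteq> Domain e \<Longrightarrow> cl M0 (e `` X) = e `` cl N X"
    using assms(1) unfolding cemb_def by auto
  have e': "tpr L N M0 e'" "e' \<subseteq> Dom N \<times> Dom M0" "closed_in M0 (Range e')"
    "\<And>X. X \<subseteq> Domain e' \<Longrightarrow> cl M0 (e' `` X) = e' `` cl N X"
    using assms(2) unfolding cemb_def by auto
  let ?H = "cl N F" and ?H' = "cl N (insert b F)"
  have F: "F \<subseteq> ?H" "insert b F \<subseteq> ?H'" "?H \<subseteq> ?H'" "?H \<subseteq> Dom N"
    using N.cl_sub[of F] N.cl_sub[of "insert b F"] N.cl_mono[of F "insert b F"] N.cl_D[of F] assms(5,6)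
    by auto
  show ?thesis
  proof (cases "b \<in> ?H")
    case True
    then have "?H' \<subseteq> ?H" using F assms(5) by (intro N.cl_minimal) auto
    then have "?H' = ?H" using F by auto
    then show ?thesis using assms(1,7) by auto
  next
    case False
    have "b \<in> Domain e'" using F(2) assms(8) by blast
    then obtain u where u: "(b, u) \<in> e'" by blast
    \<comment> \<open>As \<open>Range e\<close> is the closure of a finite set, the
      infinite-dimensional \<open>M0\<close> has an element \<open>c\<close> outside it.\<close>
    have "Range e = cl M0 (e `` F)"
      using e(4)[of F] assms(7) F(1) by auto
    moreover have "finite (e `` F)" "e `` F \<subseteq> Dom M0"
      using tpr_finite_Image[OF e(1) assms(4)] e(2) by auto
    ultimately obtain c where c: "c \<in> Dom M0" "c \<notin> Range e"
      using outside by metis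
    \<comment> \<open>The two images of \<open>cl N F\<close> are matched by \<open>p\<close>. Both
      are closed, and \<open>u\<close> and \<open>c\<close> lie outside them, so QM4 allows
      \<open>u\<close> to be sent to \<open>c\<close>.\<close>
    define p where "p = e'\<inverse> O e"
    have p: "tpr L M0 M0 p" unfolding p_def by (rule tpr_comp[OF tpr_converse[OF e'(1)] e(1)])
    have Dp: "Domain p = e' `` ?H" and Rp: "Range p = Range e"
      using assms(7,8) F(3) unfolding p_def by blast+
    have "cl M0 (e' `` ?H) = e' `` ?H"
      using e'(4)[of ?H] F(3) assms(8) N.cl_idem[OF assms(5)] by simp
    moreover have e'D: "e' `` ?H \<subseteq> Dom M0" using e'(2) by blast
    ultimately have cDp: "closed_in M0 (Domain p)" unfolding closed_in_def Dp by simp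
    have cp: "countable p"
      using tpr_countable[OF e(1)] assms(7,9) countable_image[of e snd] Rp
        countable_image_inj_on[of snd p] tpr_inj_snd[OF p] by (simp add: snd_eq_Range)
    have pD: "p \<subseteq> Dom M0 \<times> Dom M0" using e(2) e'(2) unfolding p_def by blast
    have uD: "u \<in> Dom M0" using u e'(2) by blast
    have "u \<notin> e' `` ?H" using False u tpr_eq_iff[OF e'(1) u] by blast
    then have t: "tpr L M0 M0 (p \<union> {(u, c)})"
      using QM4'[OF p cp cDp] e(3) Rp Dp c uD by simp
    obtain r where r: "p \<union> {(u, c)} \<subseteq> r" "tpr L M0 M0 r"
      "Domain r = cl M0 (Domain (p \<union> {(u, c)}))" "Range r = cl M0 (Range (p \<union> {(u, c)}))"
      using extend_cl[OF cp _ _ t] cDp e(3) Rp pD uD c by auto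
    have I: "e' `` (insert b ?H) = insert u (e' `` ?H)"
      using u tpr_eq_iff[OF e'(1) u] by blast
    have ib: "insert b ?H \<subseteq> ?H'" using F by auto
    have "cl N (insert b ?H) = ?H'"
    proof
      show "cl N (insert b ?H) \<subseteq> ?H'" using ib assms(5,6) by (intro N.cl_minimal) auto
      show "?H' \<subseteq> cl N (insert b ?H)" using F assms(6) by (intro N.cl_mono) auto
    qed
    then have "cl M0 (insert u (e' `` ?H)) = e' `` ?H'"
      using e'(4)[of "insert b ?H"] ib assms(8) I by simp
    then have Dr: "Domain r = Range e'"
      using r(3) Dp assms(8) by auto
    have cDr: "closed_in M0 (Domain r)" using Dr e'(3) by simp
    have RD: "Range (p \<union> {(u, c)}) \<subseteq> Dom M0" using pD c by auto
    have cRr: "closed_in M0 (Range r)"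
      unfolding r(4) closed_in_def using cl_D[OF RD] cl_idem[OF RD] by simp
    have rD: "r \<subseteq> Dom M0 \<times> Dom M0"
      using cDr cRr unfolding closed_in_def by (intro rel_subset_Times) simp_all
    \<comment> \<open>The corrected embedding: followed by \<open>r\<close>, the embedding
      \<open>e'\<close> agrees with \<open>e\<close> on \<open>cl N F\<close>.\<close>
    let ?e = "e' O r"
    have "e \<subseteq> ?e"
    proof
      fix z assume z: "z \<in> e"
      then obtain h v where hv: "z = (h, v)" "h \<in> ?H" using assms(7) by (cases z) blast
      then obtain w where "(h, w) \<in> e'" using F(3) assms(8) by blast
      then show "z \<in> ?e" using z hv r(1) unfolding p_def by blast
    qed
    moreover have Ran: "Range ?e = Range r" and Domn: "Domain ?e = ?H'"
      using Dr assms(8) by blast+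
    moreover have "cl M0 (?e `` X) = ?e `` cl N X" if X: "X \<subseteq> Domain ?e" for X
    proof -
      have "e' `` X \<subseteq> Domain r" using Dr by blast
      from cl_Image[OF r(2) rD cDr cRr this] e'(4)[of X] X Domn assms(8)
      show ?thesis by (simp add: relcomp_Image)
    qed
    moreover have "tpr L N M0 ?e" by (rule tpr_comp[OF e'(1) r(2)])
    moreover have "?e \<subseteq> Dom N \<times> Dom M0" using e'(2) rD by blast
    ultimately show ?thesis unfolding cemb_def using cRr by (intro exI[of _ ?e]) simp
  qed
qed

lemma good_closed_sub:
  assumes "closed_sub L S M0"
  shows "good S"
proof -
  have S: "substruct L S M0" "Dom S \<subseteq> Dom M0" "cl M0 (Dom S) = Dom S"
    using assms unfolding closed_sub_def closed_in_def by auto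
  have eq: "cl S X = cl M0 X" if "X \<subseteq> Dom S" for X
  proof -
    have "cl S X = cl M0 X \<inter> Dom S" using assms that unfolding closed_sub_def by blast
    moreover have "cl M0 X \<subseteq> Dom S" using cl_mono[OF that S(2)] S(3) by simp
    ultimately show ?thesis by blast
  qed
  have sub: "cl M0 X \<subseteq> Dom S" if "X \<subseteq> Dom S" for X
    using cl_mono[OF that S(2)] S(3) by simp
  have "pregeometry (Dom S) (cl S)"
    unfolding pregeometry_def
  proof (intro conjI allI impI)
    fix X assume X: "X \<subseteq> Dom S"
    then have XM: "X \<subseteq> Dom M0" using S by auto
    show "X \<subseteq> cl S X" "cl S X \<subseteq> Dom S" "cl S (cl S X) = cl S X"
      using eq X sub cl_sub[OF XM] cl_idem[OF XM] by auto
    show "cl S X = (\<Union>F\<in>{F. F \<subseteq> X \<and> finite F}. cl S F)"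
    proof
      show "cl S X \<subseteq> (\<Union>F\<in>{F. F \<subseteq> X \<and> finite F}. cl S F)"
      proof
        fix a assume "a \<in> cl S X"
        then obtain F where "finite F" "F \<subseteq> X" "a \<in> cl M0 F"
          using cl_finite[OF XM] unfolding eq[OF X] by blast
        then show "a \<in> (\<Union>F\<in>{F. F \<subseteq> X \<and> finite F}. cl S F)" using eq[of F] X by blast
      qed
      show "(\<Union>F\<in>{F. F \<subseteq> X \<and> finite F}. cl S F) \<subseteq> cl S X"
      proof (rule UN_least, clarify)
        fix F a assume "F \<subseteq> X" "a \<in> cl S F"
        then show "a \<in> cl S X" using eq[of F] eq[of X] X cl_mono[of F X] XM by auto
      qed
    qed
  next
    fix X Y assume "X \<subseteq> Y \<and> Y \<subseteq> Dom S"
    then have "X \<subseteq> Dom S" "Y \<subseteq> Dom S" "X \<subseteq> Y" "Y \<subseteq> Dom M0" using S(2) by auto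
    then show "cl S X \<subseteq> cl S Y" using eq cl_mono by simp
  next
    fix X a b assume *: "X \<subseteq> Dom S \<and> a \<in> Dom S \<and> b \<in> Dom S \<and> a \<in> cl S (insert b X) - cl S X"
    then have "X \<subseteq> Dom M0" "a \<in> Dom M0" "b \<in> Dom M0" using S(2) by auto
    with * show "b \<in> cl S (insert a X)"
      using exchange[of X a b] eq[of X] eq[of "insert a X"] eq[of "insert b X"] S(2) by auto
  qed
  moreover have "QM3 S"
    unfolding QM3_def
  proof (intro allI impI)
    fix A assume A: "finite A \<and> A \<subseteq> Dom S"
    then have "A \<subseteq> Dom M0" using S(2) by (meson order_trans)
    with A show "countable (cl S A)"
      using eq[of A] countable_cl[of A] by (simp add: countable_finite)
  qed
  moreover have "\<exists>e. Domain e = H \<and> cemb S e" if H: "closed_in S H" for H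
  proof -
    have HS: "H \<subseteq> Dom S" "cl M0 H = H" using H eq[of H] unfolding closed_in_def by auto
    have HM: "H \<subseteq> Dom M0" using HS(1) S(2) by (rule order_trans)
    have "cl M0 (Id_on H `` X) = Id_on H `` cl S X" if X: "X \<subseteq> H" for X
    proof -
      have "cl M0 X \<subseteq> H" using cl_mono[OF X HM] HS(2) by simp
      moreover have "Id_on H `` X = X" using X by blast
      ultimately show ?thesis using eq[of X] X HS(1) by auto
    qed
    then show ?thesis
      unfolding cemb_def closed_in_def
      using substruct_tpr[OF S(1) HS(1)] HS HM by (intro exI[of _ "Id_on H"]) auto
  qed
  ultimately show ?thesis
    using S(1) unfolding good_def substruct_def by blast
qed

lemma good_iso:
  assumes "good N" "pstruct_iso L N N' h"
  shows "good N'"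
proof -
  have wfN: "wf_struct L N" and pgN: "pregeometry (Dom N) (cl N)" and qN: "QM3 N"
    and eN: "\<And>H. countable H \<Longrightarrow> closed_in N H \<Longrightarrow> \<exists>e. Domain e = H \<and> cemb N e"
    using assms(1) unfolding good_def by auto
  interpret N: pregeom "Dom N" "cl N" by unfold_locales fact
  have iso: "struct_iso L N N' h" and clh: "\<And>X. X \<subseteq> Dom N \<Longrightarrow> cl N' (h ` X) = h ` cl N X"
    using assms(2) unfolding pstruct_iso_def by auto
  have bij: "inj_on h (Dom N)" "h ` Dom N = Dom N'"
    using iso unfolding struct_iso_def bij_betw_def by auto
  have pull: "\<exists>X. X \<subseteq> Dom N \<and> Y = h ` X" if "Y \<subseteq> Dom N'" for Y
    using that bij(2) subset_imageE by metis
  have hmem: "h a \<in> h ` cl N X \<longleftrightarrow> a \<in> cl N X" if "X \<subseteq> Dom N" "a \<in> Dom N" for a X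
    using inj_on_image_mem_iff[OF bij(1) that(2) N.cl_D[OF that(1)]] .
  have "wf_struct L N'"
    unfolding wf_struct_def tuples_def
  proof (intro ballI)
    fix f xs assume f: "f \<in> funs L" "xs \<in> {xs. set xs \<subseteq> Dom N' \<and> length xs = farity L f}"
    then have "\<forall>x\<in>set xs. x \<in> h ` Dom N" using bij(2) by auto
    then have "\<exists>ys. xs = map h ys \<and> set ys \<subseteq> Dom N"
      by (induction xs) (auto, metis insert_subset list.set(2) list.simps(9))
    then obtain ys where ys: "xs = map h ys" "set ys \<subseteq> Dom N" by blast
    then have "fn N' f xs = map_option h (fn N f ys)"
      using iso f unfolding struct_iso_def tuples_def by auto
    moreover have "fn N f ys = Some (the (fn N f ys)) \<and> the (fn N f ys) \<in> Dom N"
      using wf_structD[OF wfN f(1) ys(2)] ys(1) f(2) by simp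
    ultimately have "fn N' f xs = Some (h (the (fn N f ys)))" "h (the (fn N f ys)) \<in> Dom N'"
      using bij(2) by (metis option.map(2), blast)
    then show "fn N' f xs \<in> Some ` Dom N'" by simp
  qed
  moreover have "pregeometry (Dom N') (cl N')"
    unfolding pregeometry_def
  proof (intro conjI allI impI)
    fix Y assume "Y \<subseteq> Dom N'"
    then obtain X where X: "X \<subseteq> Dom N" "Y = h ` X" using pull[of Y] by auto
    show "Y \<subseteq> cl N' Y" unfolding X(2) clh[OF X(1)] using N.cl_sub[OF X(1)] by blast
    show "cl N' Y \<subseteq> Dom N'" unfolding X(2) clh[OF X(1)] bij(2)[symmetric] using N.cl_D[OF X(1)] by blast
    show "cl N' (cl N' Y) = cl N' Y"
      unfolding X(2) clh[OF X(1)] clh[OF N.cl_D[OF X(1)]] N.cl_idem[OF X(1)] ..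
    show "cl N' Y = (\<Union>F\<in>{F. F \<subseteq> Y \<and> finite F}. cl N' F)"
    proof
      show "cl N' Y \<subseteq> (\<Union>F\<in>{F. F \<subseteq> Y \<and> finite F}. cl N' F)"
      proof
        fix b assume "b \<in> cl N' Y"
        then obtain a where a: "a \<in> cl N X" "b = h a" unfolding X(2) clh[OF X(1)] by blast
        then obtain F where F: "finite F" "F \<subseteq> X" "a \<in> cl N F" using N.cl_finite[OF X(1)] by blast
        then have "b \<in> cl N' (h ` F)" using a(2) clh[OF order_trans[OF F(2) X(1)]] by blast
        moreover have "h ` F \<subseteq> Y" "finite (h ` F)" using F X(2) by auto
        ultimately show "b \<in> (\<Union>F\<in>{F. F \<subseteq> Y \<and> finite F}. cl N' F)" by blast
      qed
      show "(\<Union>F\<in>{F. F \<subseteq> Y \<and> finite F}. cl N' F) \<subseteq> cl N' Y"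
      proof (rule UN_least, clarify)
        fix F b assume F: "F \<subseteq> Y" "b \<in> cl N' F"
        obtain G where G: "G \<subseteq> X" "F = h ` G" using F(1) X(2) subset_imageE by metis
        have "h ` cl N G \<subseteq> h ` cl N X" using N.cl_mono[OF G(1) X(1)] by (rule image_mono)
        then show "b \<in> cl N' Y"
          using F(2) unfolding G(2) X(2) clh[OF X(1)] clh[OF order_trans[OF G(1) X(1)]] by (rule subsetD)
      qed
    qed
  next
    fix Y Z assume YZ: "Y \<subseteq> Z \<and> Z \<subseteq> Dom N'"
    then obtain X where X: "X \<subseteq> Dom N" "Z = h ` X" using pull[of Z] by auto
    then obtain W where "W \<subseteq> X" "Y = h ` W" using YZ subset_imageE by metis
    then show "cl N' Y \<subseteq> cl N' Z"
      using clh[of W] clh[OF X(1)] N.cl_mono[of W X] X order_trans[of W X "Dom N"] by (simp add: image_mono)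
  next
    fix Y a b assume Y: "Y \<subseteq> Dom N' \<and> a \<in> Dom N' \<and> b \<in> Dom N' \<and> a \<in> cl N' (insert b Y) - cl N' Y"
    then obtain X where X: "X \<subseteq> Dom N" "Y = h ` X" using pull[of Y] by auto
    obtain a' b' where ab: "a' \<in> Dom N" "a = h a'" "b' \<in> Dom N" "b = h b'" using Y bij(2) by blast
    have "h a' \<in> h ` cl N (insert b' X)" "h a' \<notin> h ` cl N X"
      using Y ab X clh[of X] clh[of "insert b' X"] by auto
    then have "b' \<in> cl N (insert a' X)"
      using N.exchange[of X a' b'] hmem[of "insert b' X" a'] hmem[of X a'] X ab by auto
    then show "b \<in> cl N' (insert a Y)" using clh[of "insert a' X"] X ab by auto
  qed
  moreover have "QM3 N'"
    unfolding QM3_def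
  proof (intro allI impI)
    fix A assume A: "finite A \<and> A \<subseteq> Dom N'"
    then obtain F where F: "F \<subseteq> Dom N" "A = h ` F" using pull[of A] by auto
    then have "finite F" using A bij(1) finite_imageD inj_on_subset by metis
    then have "countable (cl N F)" using qN F unfolding QM3_def by blast
    then show "countable (cl N' A)" using clh F by simp
  qed
  moreover have "\<exists>e. Domain e = Y \<and> cemb N' e" if Y: "countable Y" "closed_in N' Y" for Y
  proof -
    have "Y \<subseteq> Dom N'" using Y unfolding closed_in_def by simp
    then obtain H where H: "H \<subseteq> Dom N" "Y = h ` H" using pull[of Y] by auto
    have "h ` cl N H = h ` H" using Y(2) clh[OF H(1)] H(2) unfolding closed_in_def by simp
    then have "cl N H = H" using inj_on_image_eq_iff[OF bij(1) N.cl_D[OF H(1)] H(1)] by simp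
    then have cH: "closed_in N H" using H unfolding closed_in_def by simp
    have "countable H" using Y(1) H inj_on_subset[OF bij(1)] countable_image_inj_on by metis
    then obtain e where e: "Domain e = H" "cemb N e" using eN cH by blast
    then have e': "tpr L N M0 e" "e \<subseteq> Dom N \<times> Dom M0" "closed_in M0 (Range e)"
      "\<And>X. X \<subseteq> H \<Longrightarrow> cl M0 (e `` X) = e `` cl N X"
      unfolding cemb_def by auto
    let ?r = "(\<lambda>x. (x, h x)) ` H"
    have r: "tpr L N N' ?r" using struct_iso_tpr[OF iso wfN H(1)] .
    let ?e = "?r\<inverse> O e"
    have I: "?e `` (h ` X) = e `` X" if "X \<subseteq> H" for X
      using that H(1) inj_onD[OF bij(1)] by (auto simp: Image_def relcomp_unfold) blast+
    have D: "Domain ?e = Y" "Range ?e = Range e"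
      using e(1) unfolding H(2) by blast+
    have "cl M0 (?e `` Z) = ?e `` cl N' Z" if Z: "Z \<subseteq> Y" for Z
    proof -
      obtain X where X: "X \<subseteq> H" "Z = h ` X" using Z H(2) subset_imageE by metis
      have "cl N X \<subseteq> H" using N.cl_mono[OF X(1) H(1)] cH unfolding closed_in_def by simp
      then show ?thesis using I[of X] I[of "cl N X"] e'(4)[of X] X clh[of X] H(1) by simp
    qed
    moreover have "tpr L N' M0 ?e" by (rule tpr_comp[OF tpr_converse[OF r] e'(1)])
    moreover have "?e \<subseteq> Dom N' \<times> Dom M0" using D \<open>Y \<subseteq> Dom N'\<close> e'(2) by blast
    ultimately show ?thesis unfolding cemb_def using D e'(3) by (intro exI[of _ ?e]) simp
  qed
  ultimately show ?thesis unfolding good_def by blast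
qed

text \<open>A countable closed subset of the union need not lie in one member of the chain. The
  closure of a finite set does, so the set is exhausted by closures of finite initial segments and
  their embeddings are glued.\<close>

lemma good_union:
  assumes C: "\<And>S. S \<in> C \<Longrightarrow> good S" and ch: "chain_union L C N"
  shows "good N"
proof -
  have ne: "C \<noteq> {}" and chain: "\<And>S T. S \<in> C \<Longrightarrow> T \<in> C \<Longrightarrow> closed_sub L S T \<or> closed_sub L T S"
    and D: "Dom N = (\<Union>S\<in>C. Dom S)" and pgN: "pregeometry (Dom N) (cl N)"
    and sub: "\<And>S. S \<in> C \<Longrightarrow> closed_sub L S N"
    using ch unfolding chain_union_def by auto
  interpret N: pregeom "Dom N" "cl N" by unfold_locales fact
  have DS: "Dom S \<subseteq> Dom N" if "S \<in> C" for S using D that by blast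
  have fin: "\<exists>S\<in>C. F \<subseteq> Dom S" if "finite F" "F \<subseteq> Dom N" for F
    using that
  proof (induction F)
    case empty then show ?case using ne by blast
  next
    case (insert x F)
    then obtain S T where ST: "S \<in> C" "F \<subseteq> Dom S" "T \<in> C" "x \<in> Dom T" using D by auto
    then have "Dom S \<subseteq> Dom T \<or> Dom T \<subseteq> Dom S"
      using chain[of S T] unfolding closed_sub_def substruct_def by auto
    then show ?case using ST by blast
  qed
  have clS: "cl S X = cl N X" if "S \<in> C" "X \<subseteq> Dom S" for S X
  proof -
    have "cl S X = cl N X \<inter> Dom S" "cl N (Dom S) = Dom S"
      using sub[OF that(1)] that(2) unfolding closed_sub_def closed_in_def by auto
    then show ?thesis using N.cl_mono[OF that(2) DS[OF that(1)]] by (simp add: Int_absorb2)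
  qed
  have wfN: "wf_struct L N"
    unfolding wf_struct_def tuples_def
  proof (intro ballI)
    fix f xs assume f: "f \<in> funs L" "xs \<in> {xs. set xs \<subseteq> Dom N \<and> length xs = farity L f}"
    then obtain S where S: "S \<in> C" "set xs \<subseteq> Dom S" using fin[of "set xs"] by auto
    have "wf_struct L S" using C[OF S(1)] unfolding good_def by simp
    then have "fn S f xs \<in> Some ` Dom S"
      using f S(2) unfolding wf_struct_def tuples_def by simp
    moreover have "fn S f xs = fn N f xs"
      using sub[OF S(1)] f S(2) unfolding closed_sub_def substruct_def tuples_def by auto
    ultimately show "fn N f xs \<in> Some ` Dom N" using DS[OF S(1)] by auto
  qed
  have cfin: "countable (cl N F)" if F: "finite F" "F \<subseteq> Dom N" for F
  proof -
    obtain S where S: "S \<in> C" "F \<subseteq> Dom S" using fin[OF F] by (elim bexE)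
    have "QM3 S" using C[OF S(1)] unfolding good_def by simp
    then have "countable (cl S F)" using S(2) F(1) unfolding QM3_def by simp
    then show ?thesis using clS[OF S] by simp
  qed
  have emb: "\<exists>e. Domain e = cl N F \<and> cemb N e" if F: "finite F" "F \<subseteq> Dom N" for F
  proof -
    obtain S where S: "S \<in> C" "F \<subseteq> Dom S" using fin[OF F] by (elim bexE)
    let ?H = "cl N F"
    have H: "?H \<subseteq> Dom S" using N.cl_mono[OF S(2) DS[OF S(1)]] sub[OF S(1)]
      unfolding closed_sub_def closed_in_def by simp
    then have "closed_in S ?H" using clS[OF S(1) H] N.cl_idem[OF F(2)] unfolding closed_in_def by simp
    moreover have "\<forall>H. countable H \<and> closed_in S H \<longrightarrow> (\<exists>e. Domain e = H \<and> cemb S e)"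
      using C[OF S(1)] unfolding good_def by simp
    ultimately obtain e where e: "Domain e = ?H" "cemb S e"
      using cfin[OF F] by (elim allE[where x = ?H]) auto
    have "substruct L S N" using sub[OF S(1)] unfolding closed_sub_def by simp
    from tpr_converse[OF substruct_tpr[OF this H]]
    have "tpr L N S (Id_on ?H)" by simp
    moreover have "tpr L S M0 e" using e(2) unfolding cemb_def by simp
    ultimately have "tpr L N M0 (Id_on ?H O e)" by (rule tpr_comp)
    moreover have "Id_on ?H O e = e" unfolding e(1)[symmetric] by (auto simp: relcomp_unfold)
    ultimately have "tpr L N M0 e" by simp
    moreover have "cl S X = cl N X" if "X \<subseteq> ?H" for X using clS[OF S(1) order_trans[OF that H]] .
    moreover have "e \<subseteq> Dom N \<times> Dom M0" using e(2) DS[OF S(1)] unfolding cemb_def by blast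
    ultimately have "cemb N e" using e unfolding cemb_def by simp
    then show ?thesis using e(1) by blast
  qed
  have "\<exists>e. Domain e = H \<and> cemb N e" if H: "countable H" "closed_in N H" for H
  proof (cases "H = {}")
    case True
    then show ?thesis using emb[of "{}"] H(2) unfolding closed_in_def by auto
  next
    case False
    define b where "b = from_nat_into H"
    define F where "F = (\<lambda>n. b ` {..<n})"
    have b: "range b = H" unfolding b_def using range_from_nat_into[OF False H(1)] .
    have HN: "H \<subseteq> Dom N" "cl N H = H" using H(2) unfolding closed_in_def by auto
    have FD: "F n \<subseteq> H" "F n \<subseteq> Dom N" "finite (F n)" for n using b HN(1) unfolding F_def by auto
    have FS: "F (Suc n) = insert (b n) (F n)" for n unfolding F_def by (simp add: lessThan_Suc)
    have bD: "b n \<in> Dom N" for n using b HN(1) by auto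
    \<comment> \<open>Embeddings of successive closures may come from different members and
      disagree; \<open>cemb_extend\<close> replaces each of them by an extension of its
      predecessor.\<close>
    have "\<exists>E. \<forall>n. (Domain (E n) = cl N (F n) \<and> cemb N (E n)) \<and> E n \<subseteq> E (Suc n)"
    proof (rule dependent_nat_choice)
      show "\<exists>e. Domain e = cl N (F 0) \<and> cemb N e" by (rule emb[OF FD(3,2)])
      fix e n assume e: "Domain e = cl N (F n) \<and> cemb N e"
      obtain e' where e': "Domain e' = cl N (insert (b n) (F n))" "cemb N e'"
        using emb[OF FD(3,2), of "Suc n"] unfolding FS by (elim exE conjE)
      show "\<exists>e'. (Domain e' = cl N (F (Suc n)) \<and> cemb N e') \<and> e \<subseteq> e'"
        using cemb_extend[OF conjunct2[OF e] e'(2) pgN FD(3,2) bD conjunct1[OF e] e'(1) cfin[OF FD(3,2)]]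
        unfolding FS by blast
    qed
    then obtain E where E0: "\<forall>n. (Domain (E n) = cl N (F n) \<and> cemb N (E n)) \<and> E n \<subseteq> E (Suc n)"
      by (rule exE)
    have E: "\<And>n. Domain (E n) = cl N (F n)" "\<And>n. cemb N (E n)" "\<And>n. E n \<subseteq> E (Suc n)"
      using E0 by (simp_all only:)
    have Et: "tpr L N M0 (E n)" "E n \<subseteq> Dom N \<times> Dom M0" "closed_in M0 (Range (E n))"
      "X \<subseteq> Domain (E n) \<Longrightarrow> cl M0 (E n `` X) = E n `` cl N X" for n X
      using E(2)[of n] unfolding cemb_def by auto
    let ?e = "\<Union>n. E n"
    have t: "tpr L N M0 ?e" by (rule tpr_Union[of L N M0 E, OF Et(1) E(3)])
    have Fmono: "F n \<subseteq> F (Suc n)" for n using FS by auto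
    have Hun: "H \<subseteq> (\<Union>n. F n)" using b unfolding F_def by blast
    have Dm: "Domain ?e = H"
    proof
      show "Domain ?e \<subseteq> H" using E(1) N.cl_mono[OF FD(1) HN(1)] HN(2) by auto
      have "F n \<subseteq> Domain ?e" for n
      proof -
        have "Domain (E n) \<subseteq> Domain ?e" by (rule Domain_mono) blast
        then show ?thesis using N.cl_sub[OF FD(2), of n] unfolding E(1) by (rule order_trans[rotated])
      qed
      then have "(\<Union>n. F n) \<subseteq> Domain ?e" by (rule UN_least)
      with Hun show "H \<subseteq> Domain ?e" by (rule order_trans)
    qed
    have eD: "?e \<subseteq> Dom N \<times> Dom M0" using Et(2) by blast
    have RD: "Range ?e \<subseteq> Dom M0" using eD by blast
    have "cl M0 (Range ?e) \<subseteq> Range ?e"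
    proof
      fix a assume "a \<in> cl M0 (Range ?e)"
      then obtain G where G: "finite G" "G \<subseteq> Range ?e" "a \<in> cl M0 G" using cl_finite[OF RD] by blast
      have "Range ?e = (\<Union>n. Range (E n))" by blast
      then obtain n where "G \<subseteq> Range (E n)"
        using finite_subset_chain[of G "\<lambda>n. Range (E n)"] G(1,2) Range_mono[OF E(3)] by auto
      moreover have "Range (E n) \<subseteq> Dom M0" "cl M0 (Range (E n)) = Range (E n)"
        using Et(3)[of n] unfolding closed_in_def by simp_all
      ultimately have "a \<in> Range (E n)" using G(3) cl_mono[of G "Range (E n)"] by auto
      then show "a \<in> Range ?e" by blast
    qed
    then have cR: "closed_in M0 (Range ?e)" using RD cl_sub[OF RD] unfolding closed_in_def by simp
    have E_eq: "E n `` X = ?e `` X" if XE: "X \<subseteq> Domain (E n)" for n X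
    proof
      show "?e `` X \<subseteq> E n `` X"
      proof
        fix y assume "y \<in> ?e `` X"
        then obtain x where x: "x \<in> X" "(x, y) \<in> ?e" by blast
        then obtain y' where y': "(x, y') \<in> E n" using XE by blast
        then have "(x, y') \<in> ?e" by blast
        from tpr_eq_iff[OF t x(2) this] have "y = y'" by simp
        then show "y \<in> E n `` X" using x(1) y' by blast
      qed
    qed blast
    have "cl M0 (?e `` X) = ?e `` cl N X" if X: "X \<subseteq> H" for X
    proof -
      have XD: "X \<subseteq> Dom N" "?e `` X \<subseteq> Dom M0" using X HN(1) eD by blast+
      have stage: "\<exists>n. G \<subseteq> Domain (E n)" if G: "finite G" "G \<subseteq> H" for G
      proof -
        obtain n where "G \<subseteq> F n" using finite_subset_chain[of G F] G Hun Fmono by auto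
        then have "G \<subseteq> Domain (E n)" using N.cl_sub[OF FD(2), of n] unfolding E(1) by (rule order_trans)
        then show ?thesis ..
      qed
      have Ecl: "cl N G \<subseteq> Domain (E n)" if "G \<subseteq> Domain (E n)" for G n
        using that N.cl_minimal[of G "F n"] FD(2) E(1) by simp
      show ?thesis
      proof
        show "cl M0 (?e `` X) \<subseteq> ?e `` cl N X"
        proof
          fix a assume "a \<in> cl M0 (?e `` X)"
          then obtain G where G: "finite G" "G \<subseteq> ?e `` X" "a \<in> cl M0 G" using cl_finite[OF XD(2)] by blast
          define Y where "Y = (?e\<inverse> `` G) \<inter> X"
          have Y: "finite Y" "Y \<subseteq> X" "?e `` Y = G"
          proof -
            show "finite Y" unfolding Y_def using tpr_finite_Image[OF tpr_converse[OF t] G(1)] by simp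
            show "?e `` Y = G"
            proof
              show "?e `` Y \<subseteq> G" unfolding Y_def using tpr_eq_iff[OF t] by blast
              show "G \<subseteq> ?e `` Y" unfolding Y_def using G(2) by blast
            qed
          qed (simp add: Y_def)
          obtain n where n: "Y \<subseteq> Domain (E n)" using stage[OF Y(1) order_trans[OF Y(2) X]] by (rule exE)
          have "cl M0 G = E n `` cl N Y" using Et(4)[OF n] E_eq[OF n] Y(3) by simp
          also have "\<dots> \<subseteq> ?e `` cl N X" using N.cl_mono[OF Y(2) XD(1)] by blast
          finally show "a \<in> ?e `` cl N X" using G(3) by blast
        qed
        show "?e `` cl N X \<subseteq> cl M0 (?e `` X)"
        proof
          fix a assume "a \<in> ?e `` cl N X"
          then obtain x where x: "x \<in> cl N X" "(x, a) \<in> ?e" by blast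
          then obtain Y where Y: "finite Y" "Y \<subseteq> X" "x \<in> cl N Y" using N.cl_finite[OF XD(1)] by blast
          obtain n where n: "Y \<subseteq> Domain (E n)" using stage[OF Y(1) order_trans[OF Y(2) X]] by (rule exE)
          have "a \<in> E n `` cl N Y" unfolding E_eq[OF Ecl[OF n]] using x(2) Y(3) by (rule ImageI)
          then have "a \<in> cl M0 (?e `` Y)" using Et(4)[OF n] E_eq[OF n] by simp
          moreover have "?e `` Y \<subseteq> ?e `` X" using Y(2) by blast
          then have "cl M0 (?e `` Y) \<subseteq> cl M0 (?e `` X)" using XD(2) by (rule cl_mono)
          ultimately show "a \<in> cl M0 (?e `` X)" by (rule subsetD[rotated])
        qed
      qed
    qed
    then have "cemb N ?e" unfolding cemb_def Dm using t eD cR by (intro conjI allI impI)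
    then show ?thesis using Dm by blast
  qed
  moreover have "QM3 N" unfolding QM3_def using cfin by simp
  ultimately show ?thesis unfolding good_def using wfN pgN by simp
qed

theorem K_class_good: "K_class L M0 N \<Longrightarrow> good N"
proof (induction rule: K_class.induct)
  case (base N)
  then obtain S h where "closed_sub L S M0" "pstruct_iso L S N h" unfolding K_minus_def by blast
  then show ?case using good_iso good_closed_sub by blast
next
  case (iso N N' h)
  then show ?case using good_iso by blast
next
  case (union C N)
  then show ?case using good_union by blast
qed

end

section \<open>The monster model as a homogeneous pregeometry\<close>

lemma countable_ordLess_trans:
  assumes "countable A" "omega1 <o r"
  shows "|A| <o r"
proof -
  obtain f :: "'a \<Rightarrow> nat" where "inj_on f A" using assms(1) unfolding countable_def by blast
  then have "|A| \<le>o |UNIV :: nat set|" using card_of_ordLeq by blast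
  also have "|UNIV :: nat set| =o natLeq" by (rule card_of_nat)
  also have "natLeq <o omega1" by (rule cardSuc_greater[OF natLeq_Card_order])
  also note assms(2)
  finally show ?thesis .
qed

section \<open>Free sequences and closed sets of infinite dimension\<close>

context pregeom begin

definition inf_dim :: "'a set \<Rightarrow> bool" where
  "inf_dim H \<longleftrightarrow> \<not> (\<exists>F. finite F \<and> F \<subseteq> H \<and> cl F = H)"

text \<open>Otherwise exchange would put \<open>i\<close> into the closure of
  \<open>insert u C\<close>, which is contained in \<open>cl (C \<union> E)\<close>.\<close>

lemma ext_step:
  assumes "C \<subseteq> D" "E \<subseteq> D" "i \<in> D" "i \<notin> cl (C \<union> E)" "u \<in> cl (C \<union> E)" "u \<in> cl (insert i C)"
  shows "u \<in> cl C"
proof (rule ccontr)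
  assume u: "u \<notin> cl C"
  have CE: "C \<union> E \<subseteq> D" using assms(1,2) by simp
  have uD: "u \<in> D" using cl_D[OF CE] assms(5) by (rule subsetD)
  have "i \<in> cl (insert u C)" by (rule exchange[OF assms(1) uD assms(3,6) u])
  moreover have "cl (insert u C) \<subseteq> cl (C \<union> E)"
    using assms(5) cl_sub[OF CE] CE by (intro cl_minimal) simp_all
  ultimately show False using assms(4) by (simp add: subset_iff)
qed

lemma free_seq:
  fixes i :: "nat \<Rightarrow> 'a"
  assumes "C \<subseteq> D" "E \<subseteq> D" "\<And>n. i n \<in> D" "\<And>n. i n \<notin> cl (C \<union> E \<union> i ` {..<n})"
    and "u \<in> cl (C \<union> E)" "u \<in> cl (C \<union> i ` {..<n})"
  shows "u \<in> cl C"
  using assms(6)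
proof (induction n)
  case (Suc n)
  have iD: "i ` {..<n} \<subseteq> D" using assms(3) by blast
  have eq: "C \<union> i ` {..<n} \<union> E = C \<union> E \<union> i ` {..<n}" by blast
  have u: "u \<in> cl (C \<union> E \<union> i ` {..<n})"
    using cl_mono[of "C \<union> E" "C \<union> E \<union> i ` {..<n}"] assms(1,2,5) iD by auto
  have "u \<in> cl (C \<union> i ` {..<n})"
    by (rule ext_step[of _ E "i n"]) (use assms iD Suc.prems u eq in \<open>simp_all add: lessThan_Suc\<close>)
  then show ?case by (rule Suc.IH)
qed simp

text \<open>This is how countable models avoiding prescribed elements are built: a sequence free
  over \<open>C \<union> E\<close> generates over \<open>C\<close> a closed set of infinite
  dimension into which \<open>E\<close> brings nothing new.\<close>

lemma free_seq_range:
  fixes i :: "nat \<Rightarrow> 'a"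
  assumes "C \<subseteq> D" "E \<subseteq> D" "\<And>n. i n \<in> D" "\<And>n. i n \<notin> cl (C \<union> E \<union> i ` {..<n})"
    and "u \<in> cl (C \<union> E)" "u \<in> cl (C \<union> range i)"
  shows "u \<in> cl C"
proof -
  have "C \<union> range i \<subseteq> D" using assms(1,3) by blast
  then obtain F where F: "finite F" "F \<subseteq> C \<union> range i" "u \<in> cl F"
    using cl_finite[OF \<open>C \<union> range i \<subseteq> D\<close> assms(6)] by blast
  have "F \<subseteq> (\<Union>n. C \<union> i ` {..<n})" using F(2) by blast
  then obtain n where n: "F \<subseteq> C \<union> i ` {..<n}"
    using finite_subset_chain[of F "\<lambda>n. C \<union> i ` {..<n}"] F(1) by (auto simp: lessThan_Suc)
  have "cl F \<subseteq> cl (C \<union> i ` {..<n})" using n assms(1,3) by (intro cl_mono) auto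
  then have "u \<in> cl (C \<union> i ` {..<n})" using F(3) by (rule subsetD)
  then show ?thesis using free_seq[OF assms(1-5)] by simp
qed

lemma free_seq_inf_dim:
  fixes i :: "nat \<Rightarrow> 'a"
  assumes "C \<subseteq> D" "E \<subseteq> D" "\<And>n. i n \<in> D" "\<And>n. i n \<notin> cl (C \<union> E \<union> i ` {..<n})"
  shows "inf_dim (cl (C \<union> range i))"
  unfolding inf_dim_def
proof (rule notI, elim exE conjE)
  fix F assume F: "finite F" "F \<subseteq> cl (C \<union> range i)" "cl F = cl (C \<union> range i)"
  have CD: "C \<union> range i \<subseteq> D" using assms(1,3) by blast
  have FD: "F \<subseteq> D" using F(2) cl_D[OF CD] by (rule order_trans)
  have "\<forall>x\<in>F. \<exists>n. x \<in> cl (C \<union> i ` {..<n})"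
  proof
    fix x assume "x \<in> F"
    then have "x \<in> cl (C \<union> range i)" using F(2) by (rule subsetD[rotated])
    from cl_finite[OF CD this] obtain G where G: "finite G" "G \<subseteq> C \<union> range i" "x \<in> cl G"
      by blast
    have "G \<subseteq> (\<Union>n. C \<union> i ` {..<n})" using G(2) by blast
    then obtain n where n: "G \<subseteq> C \<union> i ` {..<n}"
      using finite_subset_chain[of G "\<lambda>n. C \<union> i ` {..<n}"] G(1) by (auto simp: lessThan_Suc)
    have "cl G \<subseteq> cl (C \<union> i ` {..<n})" using n assms(1,3) by (intro cl_mono) auto
    then show "\<exists>n. x \<in> cl (C \<union> i ` {..<n})" using G(3) by blast
  qed
  then have "F \<subseteq> (\<Union>n. cl (C \<union> i ` {..<n}))" by blast
  moreover have "cl (C \<union> i ` {..<n}) \<subseteq> cl (C \<union> i ` {..<Suc n})" for n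
    using assms(1,3) by (intro cl_mono) (auto simp: lessThan_Suc)
  ultimately obtain n where n: "F \<subseteq> cl (C \<union> i ` {..<n})"
    using finite_subset_chain[of F "\<lambda>n. cl (C \<union> i ` {..<n})"] F(1) by auto
  have nD: "C \<union> E \<union> i ` {..<n} \<subseteq> D" using assms by auto
  have "i n \<in> cl (C \<union> range i)" using cl_sub[OF CD] by auto
  then have "i n \<in> cl F" using F(3) by simp
  also have "cl F \<subseteq> cl (C \<union> i ` {..<n})" using n assms(1,3) by (intro cl_minimal) auto
  also have "\<dots> \<subseteq> cl (C \<union> E \<union> i ` {..<n})" using nD by (intro cl_mono) auto
  finally show False using assms(4) by simp
qed

end

locale upregeom = pregeom +
  assumes ctbl: "finite F \<Longrightarrow> F \<subseteq> D \<Longrightarrow> countable (cl F)"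
    and unc: "uncountable D"
begin

lemma countable_cl: "countable X \<Longrightarrow> X \<subseteq> D \<Longrightarrow> countable (cl X)"
proof -
  assume X: "countable X" "X \<subseteq> D"
  have "cl X \<subseteq> (\<Union>F\<in>{F. finite F \<and> F \<subseteq> X}. cl F)"
    using cl_finite[OF X(2)] by blast
  moreover have "countable (\<Union>F\<in>{F. finite F \<and> F \<subseteq> X}. cl F)"
    using X(2) countable_Collect_finite_subset[OF X(1)]
    by (intro countable_UN) (auto intro!: ctbl)
  ultimately show ?thesis by (rule countable_subset)
qed

lemma outside: "countable X \<Longrightarrow> X \<subseteq> D \<Longrightarrow> \<exists>a\<in>D. a \<notin> cl X"
  using countable_cl[of X] unc countable_subset[of D "cl X"] by blast

lemma ex_free_seq:
  assumes "countable X" "X \<subseteq> D"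
  shows "\<exists>i :: nat \<Rightarrow> 'a. (\<forall>n. i n \<in> D \<and> i n \<notin> cl (X \<union> i ` {..<n}))"
proof -
  \<comment> \<open>The choice principle sees only the previous state, so each state is a pair of
    the set collected so far and an element outside its closure.\<close>
  have "\<exists>f. \<forall>n. (countable (fst (f n)) \<and> fst (f n) \<subseteq> D \<and> snd (f n) \<in> D \<and> snd (f n) \<notin> cl (fst (f n)) \<and>
    (n = 0 \<longrightarrow> fst (f n) = X)) \<and> fst (f (Suc n)) = insert (snd (f n)) (fst (f n))"
  proof (rule dependent_nat_choice)
    show "\<exists>x. countable (fst x) \<and> fst x \<subseteq> D \<and> snd x \<in> D \<and> snd x \<notin> cl (fst x) \<and> ((0::nat) = 0 \<longrightarrow> fst x = X)"
      using outside[OF assms] assms by auto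
  next
    fix x and n :: nat
    assume x: "countable (fst x) \<and> fst x \<subseteq> D \<and> snd x \<in> D \<and> snd x \<notin> cl (fst x) \<and> (n = 0 \<longrightarrow> fst x = X)"
    then obtain a where "a \<in> D" "a \<notin> cl (insert (snd x) (fst x))"
      using outside[of "insert (snd x) (fst x)"] by auto
    then show "\<exists>y. (countable (fst y) \<and> fst y \<subseteq> D \<and> snd y \<in> D \<and> snd y \<notin> cl (fst y) \<and> (Suc n = 0 \<longrightarrow> fst y = X)) \<and>
        fst y = insert (snd x) (fst x)"
      using x by (intro exI[of _ "(insert (snd x) (fst x), a)"]) simp
  qed
  then obtain f where f0: "\<forall>n. (countable (fst (f n)) \<and> fst (f n) \<subseteq> D \<and> snd (f n) \<in> D \<and> snd (f n) \<notin> cl (fst (f n)) \<and>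
    (n = 0 \<longrightarrow> fst (f n) = X)) \<and> fst (f (Suc n)) = insert (snd (f n)) (fst (f n))"
    by (rule exE)
  have f: "\<And>n. snd (f n) \<in> D" "\<And>n. snd (f n) \<notin> cl (fst (f n))" "fst (f 0) = X"
    "\<And>n. fst (f (Suc n)) = insert (snd (f n)) (fst (f n))"
    using f0 by simp_all
  have "fst (f n) = X \<union> (\<lambda>n. snd (f n)) ` {..<n}" for n
    by (induction n) (auto simp: f lessThan_Suc)
  then show ?thesis using f by (intro exI[of _ "\<lambda>n. snd (f n)"]) auto
qed

end

text \<open>The axioms \<open>homog\<close> and \<open>limit\<close> express that isomorphisms between countable closed sets extend
  to automorphisms.\<close>

locale homog_pregeom = upregeom +
  fixes G :: "('a \<Rightarrow> 'a) set"
  assumes G_bij: "\<pi> \<in> G \<Longrightarrow> bij_betw \<pi> D D"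
    and G_id: "(\<lambda>x. x) \<in> G"
    and G_comp: "\<pi> \<in> G \<Longrightarrow> \<tau> \<in> G \<Longrightarrow> (\<lambda>x. \<pi> (\<tau> x)) \<in> G"
    and G_inv: "\<pi> \<in> G \<Longrightarrow> inv_into D \<pi> \<in> G"
    and G_cl: "\<pi> \<in> G \<Longrightarrow> X \<subseteq> D \<Longrightarrow> cl (\<pi> ` X) = \<pi> ` cl X"
    and homog: "countable C \<Longrightarrow> C \<subseteq> D \<Longrightarrow> x \<in> D - cl C \<Longrightarrow> y \<in> D - cl C \<Longrightarrow>
      \<exists>\<pi>\<in>G. (\<forall>c\<in>cl C. \<pi> c = c) \<and> \<pi> x = y"
    and limit: "countable H \<Longrightarrow> H \<subseteq> D \<Longrightarrow> cl H = H \<Longrightarrow> inf_dim H \<Longrightarrow> Domain p = H \<Longrightarrow> Range p = H \<Longrightarrow>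
      (\<And>q. finite q \<Longrightarrow> q \<subseteq> p \<Longrightarrow> \<exists>\<pi>\<in>G. \<forall>(x, y)\<in>q. \<pi> x = y) \<Longrightarrow> \<exists>\<pi>\<in>G. \<forall>(x, y)\<in>p. \<pi> x = y"

section \<open>Automorphisms of the monster\<close>

locale monster = quasimin L M0
  for L :: "('f, 'r) lang" and M0 :: "('b, 'f, 'r) pstruct" +
  fixes \<delta> :: "'d rel" and M :: "('a, 'f, 'r) pstruct"
  assumes monster: "monster_model L M0 \<delta> M"
    and uncountable_Dom: "uncountable (Dom M)"
begin

lemma good_M: "good M"
  using monster K_class_good unfolding monster_model_def qm_class_def by blast

lemma wfM: "wf_struct L M" and QM3_M: "QM3 M"
  using good_M unfolding good_def by simp_all

sublocale M: upregeom "Dom M" "cl M"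
  using good_M uncountable_Dom by unfold_locales (simp_all add: good_def QM3_def)

definition Gam :: "('a \<Rightarrow> 'a) set" where
  "Gam = {\<pi>. struct_iso L M M \<pi>}"

lemma Aut_monster: "Aut (monster_ambient L M0 \<delta> M) {} = Gam"
  unfolding Aut_def Gam_def monster_ambient_def struct_iso_def struct.truncate_def by simp

lemma ex_cemb:
  assumes "countable X" "X \<subseteq> Dom M"
  shows "\<exists>e. Domain e = cl M X \<and> tpr L M M0 e \<and> e \<subseteq> Dom M \<times> Dom M0 \<and> closed_in M0 (Range e) \<and>
     (\<forall>Y. Y \<subseteq> cl M X \<longrightarrow> cl M0 (e `` Y) = e `` cl M Y)"
proof -
  have "countable (cl M X)" "closed_in M (cl M X)"
    using M.countable_cl[OF assms] M.cl_D[OF assms(2)] M.cl_idem[OF assms(2)] unfolding closed_in_def by simp_all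
  then obtain e where "Domain e = cl M X" "cemb M e"
    using good_M unfolding good_def by (elim conjE allE[where x = "cl M X"]) auto
  then show ?thesis unfolding cemb_def by (intro exI[of _ e]) simp
qed

lemma Gam_tpr:
  assumes "\<pi> \<in> Gam" "r \<subseteq> Dom M \<times> Dom M" "\<forall>(x, y)\<in>r. \<pi> x = y"
  shows "tpr L M M r"
proof -
  have "tpr L M M ((\<lambda>x. (x, \<pi> x)) ` Dom M)"
    using assms(1) wfM unfolding Gam_def by (intro struct_iso_tpr) simp_all
  then show ?thesis by (rule tpr_subset) (use assms(2,3) in auto)
qed

text \<open>A closed embedding of \<open>H\<close> into \<open>M0\<close> pulls closure under
  functions back from its range, where \<open>closed_fn\<close> applies, and its inverse exhibits
  \<open>H\<close> as a copy of a closed substructure of \<open>M0\<close>.\<close>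

lemma closed_sub_M:
  assumes "countable H" "closed_in M H"
  shows "closed_sub L (M\<lparr>Dom := H\<rparr>) M" and "K_minus L M0 (M\<lparr>Dom := H\<rparr>)"
proof -
  have H: "H \<subseteq> Dom M" "cl M H = H" using assms unfolding closed_in_def by auto
  obtain e where e: "Domain e = H" "tpr L M M0 e" "e \<subseteq> Dom M \<times> Dom M0" "closed_in M0 (Range e)"
    "\<And>Y. Y \<subseteq> H \<Longrightarrow> cl M0 (e `` Y) = e `` cl M Y"
    using ex_cemb[OF assms(1) H(1)] unfolding H(2) by (elim exE conjE) simp
  have fnH: "the (fn M f xs) \<in> H" if f: "f \<in> funs L" "set xs \<subseteq> H" "length xs = farity L f" for f xs
  proof -
    define g where "g = (\<lambda>x. SOME y. (x, y) \<in> e)"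
    have g: "(x, g x) \<in> e" if "x \<in> H" for x
      unfolding g_def by (rule someI_ex) (use that e(1) in blast)
    let ?ps = "map (\<lambda>x. (x, g x)) xs"
    have ps: "set ?ps \<subseteq> e" "length ?ps = farity L f" "map fst ?ps = xs" "set (map snd ?ps) \<subseteq> Range e"
      using g f by (auto simp: o_def)
    have "the (fn M0 f (map snd ?ps)) \<in> Range e"
      using closed_fn[OF e(4) f(1) ps(4)] ps(2) by simp
    then obtain a where a: "(a, the (fn M0 f (map snd ?ps))) \<in> e" by blast
    then have "the (fn M f xs) = a" using tpr_fn[OF e(2) f(1) ps(1,2) a] ps(3) by simp
    then show ?thesis using a e(1) by blast
  qed
  have wf: "wf_struct L (M\<lparr>Dom := H\<rparr>)"
    unfolding wf_struct_def tuples_def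
  proof (intro ballI)
    fix f xs assume f: "f \<in> funs L" and "xs \<in> {xs. set xs \<subseteq> Dom (M\<lparr>Dom := H\<rparr>) \<and> length xs = farity L f}"
    then have xs: "set xs \<subseteq> H" "set xs \<subseteq> Dom M" "length xs = farity L f" using H(1) by auto
    have "Some (the (fn M f xs)) \<in> Some ` H"
      using fnH[OF f xs(1,3)] by (rule imageI)
    moreover have "Some (the (fn M f xs)) = fn M f xs"
      using wf_structD[OF wfM f xs(2,3)] by (rule conjunct1[THEN sym])
    ultimately show "fn (M\<lparr>Dom := H\<rparr>) f xs \<in> Some ` Dom (M\<lparr>Dom := H\<rparr>)"
      by simp
  qed
  moreover have "cl M X \<inter> H = cl M X" if "X \<subseteq> H" for X
    using M.cl_mono[OF that H(1)] unfolding H(2) by blast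
  ultimately show "closed_sub L (M\<lparr>Dom := H\<rparr>) M"
    using assms(2) H(1) unfolding closed_sub_def substruct_def by simp
  define g where "g = (\<lambda>y. THE x. (x, y) \<in> e)"
  have g: "g y = x" if "(x, y) \<in> e" for x y
    unfolding g_def by (rule the_equality) (use that tpr_eq_iff[OF e(2)] in blast)+
  have gr: "(\<lambda>x. (x, g x)) ` Range e = e\<inverse>" using g by (auto simp: image_def) 
  have gR: "g ` Range e = H" using g e(1) by (auto simp: image_def)
  have "struct_iso L (M0\<lparr>Dom := Range e\<rparr>) (M\<lparr>Dom := H\<rparr>) g"
  proof (rule tpr_struct_iso)
    show "wf_struct L (M0\<lparr>Dom := Range e\<rparr>)"
      using closed_sub_restrict[OF e(4)] unfolding closed_sub_def substruct_def by simp
  qed (use gr gR wf tpr_converse[OF e(2)] in simp_all)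
  moreover have "cl M (g ` X) = g ` cl M0 X" if X: "X \<subseteq> Range e" for X
  proof -
    have gY: "e `` (g ` Y) = Y" if Y: "Y \<subseteq> Range e" for Y
    proof
      show "e `` (g ` Y) \<subseteq> Y"
      proof
        fix z assume "z \<in> e `` (g ` Y)"
        then obtain y where y: "y \<in> Y" "(g y, z) \<in> e" by blast
        then obtain x where x: "(x, y) \<in> e" using Y by blast
        then have "(x, z) \<in> e" using g[OF x] y(2) by simp
        then show "z \<in> Y" using tpr_eq_iff[OF e(2) x, of x z] y(1) by simp
      qed
      show "Y \<subseteq> e `` (g ` Y)" using Y g by blast
    qed
    have ge: "g ` (e `` Z) = Z" if "Z \<subseteq> H" for Z
      using that e(1) g by (auto simp: image_def) blast
    have "g ` X \<subseteq> H" using X gR by blast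
    then have "cl M0 X = e `` cl M (g ` X)" "cl M (g ` X) \<subseteq> H"
      using e(5)[of "g ` X"] gY[OF X] M.cl_mono[of "g ` X" H] H by simp_all
    then show ?thesis using ge by simp
  qed
  ultimately have "pstruct_iso L (M0\<lparr>Dom := Range e\<rparr>) (M\<lparr>Dom := H\<rparr>) g"
    unfolding pstruct_iso_def by simp
  then show "K_minus L M0 (M\<lparr>Dom := H\<rparr>)"
    using closed_sub_restrict[OF e(4)] unfolding K_minus_def by blast
qed

lemma small_model:
  assumes "countable H" "closed_in M H" "M.inf_dim H"
  shows "H \<in> small_models L M0 \<delta> M"
proof -
  have "K_class L M0 (M\<lparr>Dom := H\<rparr>)" by (rule K_class.base[OF closed_sub_M(2)[OF assms(1,2)]])
  moreover have "infinite_dim (M\<lparr>Dom := H\<rparr>)"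
    using assms(3) unfolding infinite_dim_def M.inf_dim_def by simp
  moreover have "|H| <o \<delta>"
    using countable_ordLess_trans[OF assms(1)] monster unfolding monster_model_def by blast
  ultimately show ?thesis
    unfolding small_models_def qm_class_def using closed_sub_M(1)[OF assms(1,2)] by simp
qed

lemma small_modelsD:
  assumes "A \<in> small_models L M0 \<delta> M"
  shows "A \<subseteq> Dom M" "cl M A = A" "M.inf_dim A"
  using assms unfolding small_models_def closed_sub_def closed_in_def qm_class_def infinite_dim_def M.inf_dim_def
  by auto

text \<open>Domain and range are small models, for which infinite dimension is required on both
  sides; the correspondence is an isomorphism between them, and model homogeneity extends
  it.\<close>

lemma extend_aut:
  assumes r: "tpr L M M r" "r \<subseteq> Dom M \<times> Dom M"
    and A: "countable (Domain r)" "closed_in M (Domain r)" "M.inf_dim (Domain r)"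
    and B: "countable (Range r)" "closed_in M (Range r)" "M.inf_dim (Range r)"
  shows "\<exists>\<pi>\<in>Gam. \<forall>(x, y)\<in>r. \<pi> x = y"
proof -
  define h where "h = (\<lambda>x. THE y. (x, y) \<in> r)"
  have h: "h x = y" if "(x, y) \<in> r" for x y
    unfolding h_def by (rule the_equality) (use that tpr_eq_iff[OF r(1)] in blast)+
  have gr: "(\<lambda>x. (x, h x)) ` Domain r = r" using h by (auto simp: image_def)
  have gR: "h ` Domain r = Range r" using h by (auto simp: image_def)
  have "struct_iso L (M\<lparr>Dom := Domain r\<rparr>) (M\<lparr>Dom := Range r\<rparr>) h"
    by (rule tpr_struct_iso)
      (use closed_sub_M(1)[OF A(1,2)] closed_sub_M(1)[OF B(1,2)] gr gR r in
        \<open>simp_all add: closed_sub_def substruct_def\<close>)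
  moreover have "model_homogeneous L M0 \<delta> M" using monster unfolding monster_model_def by simp
  ultimately obtain \<pi> where \<pi>: "struct_iso L M M \<pi>" "\<forall>a\<in>Domain r. \<pi> a = h a"
    unfolding model_homogeneous_def using small_model[OF A] small_model[OF B] by blast
  have "\<forall>(x, y)\<in>r. \<pi> x = y" using \<pi>(2) h by (auto simp: Domain_iff)
  then show ?thesis using \<pi>(1) unfolding Gam_def by (intro bexI[of _ \<pi>]) simp_all
qed

text \<open>Automorphisms are defined by the language alone, in which closure does not appear. A
  single embedding into \<open>M0\<close> covering \<open>F\<close>, \<open>a\<close> and their
  images lets QM1 show that closure is preserved all the same.\<close>

lemma Gam_cl_mem:
  assumes "\<pi> \<in> Gam" "finite F" "F \<subseteq> Dom M" "a \<in> cl M F"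
  shows "\<pi> a \<in> cl M (\<pi> ` F)"
proof -
  have bij: "bij_betw \<pi> (Dom M) (Dom M)" using assms(1) unfolding Gam_def struct_iso_def by simp
  have a: "a \<in> Dom M" using assms(3,4) M.cl_D by blast
  let ?X = "F \<union> {a} \<union> \<pi> ` (F \<union> {a})"
  have XD: "?X \<subseteq> Dom M" using assms(3) a bij_betwE[OF bij] by auto
  have cX: "countable ?X" using assms(2) by (simp add: countable_finite)
  obtain e where e: "Domain e = cl M ?X" "tpr L M M0 e" "e \<subseteq> Dom M \<times> Dom M0" "closed_in M0 (Range e)"
    "\<And>Y. Y \<subseteq> cl M ?X \<Longrightarrow> cl M0 (e `` Y) = e `` cl M Y"
    using ex_cemb[OF cX XD] by (elim exE conjE) simp
  have XK: "?X \<subseteq> Domain e" unfolding e(1) by (rule M.cl_sub[OF XD])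
  let ?g = "(\<lambda>x. (x, \<pi> x)) ` (insert a F)"
  have g: "tpr L M M ?g" by (rule Gam_tpr[OF assms(1)]) (use XD in auto)
  let ?r = "e\<inverse> O ?g O e"
  have r: "tpr L M0 M0 ?r" by (rule tpr_comp[OF tpr_converse[OF e(2)] tpr_comp[OF g e(2)]])
  have rD: "?r \<subseteq> Dom M0 \<times> Dom M0" using e(3) by blast
  let ?s = "e\<inverse> O ((\<lambda>x. (x, \<pi> x)) ` F) O e"
  have sr: "?s \<subseteq> ?r" by blast
  have "F \<subseteq> Domain e" "\<pi> ` F \<subseteq> Domain e" using XK by auto
  then have s: "Domain ?s = e `` F" "Range ?s = e `` (\<pi> ` F)" by blast+
  obtain u v where uv: "(a, u) \<in> e" "(\<pi> a, v) \<in> e" using XK by blast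
  then have "(u, v) \<in> ?r" by blast
  from cl_tpr[OF r rD sr this] have *: "u \<in> cl M0 (e `` F) \<longleftrightarrow> v \<in> cl M0 (e `` (\<pi> ` F))"
    unfolding s .
  have "F \<subseteq> cl M ?X" "\<pi> ` F \<subseteq> cl M ?X" using XK unfolding e(1) by auto
  then have "u \<in> e `` cl M F \<longleftrightarrow> v \<in> e `` cl M (\<pi> ` F)" using * e(5) by simp
  then have "v \<in> e `` cl M (\<pi> ` F)" using uv(1) assms(4) by blast
  then obtain w where w: "w \<in> cl M (\<pi> ` F)" "(w, v) \<in> e" by blast
  then show ?thesis using tpr_eq_iff[OF e(2) uv(2) w(2)] by simp
qed

lemma Gam_bij: "\<pi> \<in> Gam \<Longrightarrow> bij_betw \<pi> (Dom M) (Dom M)"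
  unfolding Gam_def struct_iso_def by simp

lemma Gam_inv:
  assumes "\<pi> \<in> Gam"
  shows "inv_into (Dom M) \<pi> \<in> Gam"
proof -
  let ?\<tau> = "inv_into (Dom M) \<pi>"
  note bij = Gam_bij[OF assms]
  have \<tau>: "bij_betw ?\<tau> (Dom M) (Dom M)" by (rule bij_betw_inv_into[OF bij])
  let ?g = "(\<lambda>x. (x, \<pi> x)) ` Dom M"
  have "tpr L M M ?g" by (rule Gam_tpr[OF assms]) (use bij_betwE[OF bij] in auto)
  then have "tpr L M M (?g\<inverse>)" by (rule tpr_converse)
  moreover have "(\<lambda>x. (x, ?\<tau> x)) ` Dom M = ?g\<inverse>"
    using bij_betwE[OF \<tau>] bij_betw_inv_into_right[OF bij] bij_betw_inv_into_left[OF bij] bij_betwE[OF bij]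
    by (auto simp: image_def)
  ultimately have "tpr L M M ((\<lambda>x. (x, ?\<tau> x)) ` Dom M)" by simp
  then have "struct_iso L M M ?\<tau>"
    using tpr_struct_iso[OF _ wfM wfM] bij_betw_imp_surj_on[OF \<tau>] by simp
  then show ?thesis unfolding Gam_def by simp
qed

lemma Gam_comp:
  assumes "\<pi> \<in> Gam" "\<tau> \<in> Gam"
  shows "(\<lambda>x. \<pi> (\<tau> x)) \<in> Gam"
proof -
  note bij = Gam_bij[OF assms(1)] Gam_bij[OF assms(2)]
  let ?g = "\<lambda>\<pi>. (\<lambda>x. (x, \<pi> x)) ` Dom M"
  have "tpr L M M (?g \<pi>)" "tpr L M M (?g \<tau>)"
    by (rule Gam_tpr[OF assms(1)], use bij_betwE[OF bij(1)] in auto)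
      (rule Gam_tpr[OF assms(2)], use bij_betwE[OF bij(2)] in auto)
  then have "tpr L M M (?g \<tau> O ?g \<pi>)" by (rule tpr_comp[rotated])
  moreover have "?g \<tau> O ?g \<pi> = ?g (\<lambda>x. \<pi> (\<tau> x))" using bij_betwE[OF bij(2)] by auto
  moreover have "(\<lambda>x. \<pi> (\<tau> x)) ` Dom M = Dom M"
    using bij_betw_imp_surj_on[OF bij(1)] bij_betw_imp_surj_on[OF bij(2)] by (metis image_image)
  ultimately show ?thesis
    unfolding Gam_def using tpr_struct_iso[OF _ wfM wfM, of "\<lambda>x. \<pi> (\<tau> x)"] by simp
qed

lemma Gam_cl_sub:
  assumes "\<pi> \<in> Gam" "X \<subseteq> Dom M"
  shows "\<pi> ` cl M X \<subseteq> cl M (\<pi> ` X)"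
proof
  have XD: "\<pi> ` X \<subseteq> Dom M" using assms(2) bij_betwE[OF Gam_bij[OF assms(1)]] by blast
  fix b assume "b \<in> \<pi> ` cl M X"
  then obtain a where a: "a \<in> cl M X" "b = \<pi> a" by blast
  obtain F where F: "finite F" "F \<subseteq> X" "a \<in> cl M F"
    using M.cl_finite[OF assms(2) a(1)] by (elim exE conjE)
  have "b \<in> cl M (\<pi> ` F)"
    unfolding a(2) by (rule Gam_cl_mem[OF assms(1) F(1) order_trans[OF F(2) assms(2)] F(3)])
  then show "b \<in> cl M (\<pi> ` X)" using M.cl_mono[OF image_mono[OF F(2)] XD] by (rule subsetD[rotated])
qed

lemma Gam_cl:
  assumes "\<pi> \<in> Gam" "X \<subseteq> Dom M"
  shows "cl M (\<pi> ` X) = \<pi> ` cl M X"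
proof
  note bij = Gam_bij[OF assms(1)]
  let ?\<tau> = "inv_into (Dom M) \<pi>"
  have XD: "\<pi> ` X \<subseteq> Dom M" using assms(2) bij_betwE[OF bij] by blast
  have "?\<tau> ` cl M (\<pi> ` X) \<subseteq> cl M (?\<tau> ` \<pi> ` X)" by (rule Gam_cl_sub[OF Gam_inv[OF assms(1)] XD])
  moreover have "?\<tau> ` \<pi> ` X = X"
    by (rule inv_into_image_cancel[OF bij_betw_imp_inj_on[OF bij] assms(2)])
  ultimately have "\<pi> ` ?\<tau> ` cl M (\<pi> ` X) \<subseteq> \<pi> ` cl M X" by (simp add: image_mono)
  moreover have "\<pi> ` ?\<tau> ` cl M (\<pi> ` X) = cl M (\<pi> ` X)"
    by (rule image_inv_into_cancel[OF bij_betw_imp_surj_on[OF bij] M.cl_D[OF XD]])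
  ultimately show "cl M (\<pi> ` X) \<subseteq> \<pi> ` cl M X" by simp
qed (rule Gam_cl_sub[OF assms])

text \<open>The closure of \<open>C\<close> may have finite dimension and then is not a model, so
  model homogeneity does not apply to it directly. It is enlarged to a countable model
  \<open>H\<close> avoiding \<open>x\<close> and \<open>y\<close>; QM4 over \<open>H\<close>,
  transported through an embedding into \<open>M0\<close>, sends \<open>x\<close> to
  \<open>y\<close>.\<close>

lemma homog_M:
  assumes C: "countable C" "C \<subseteq> Dom M" and x: "x \<in> Dom M - cl M C" and y: "y \<in> Dom M - cl M C"
  shows "\<exists>\<pi>\<in>Gam. (\<forall>c\<in>cl M C. \<pi> c = c) \<and> \<pi> x = y"
proof -
  let ?E = "{x, y}"
  have CE: "countable (C \<union> ?E)" "C \<union> ?E \<subseteq> Dom M" "?E \<subseteq> Dom M" using C x y by auto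
  \<comment> \<open>The sequence is free over \<open>C\<close> together with both \<open>x\<close>
    and \<open>y\<close>; this keeps the two elements outside \<open>H\<close>.\<close>
  obtain i where i0: "\<forall>n::nat. i n \<in> Dom M \<and> i n \<notin> cl M (C \<union> ?E \<union> i ` {..<n})"
    using M.ex_free_seq[OF CE(1,2)] by (rule exE)
  have i: "\<And>n::nat. i n \<in> Dom M" "\<And>n. i n \<notin> cl M (C \<union> ?E \<union> i ` {..<n})"
    by (rule conjunct1[OF i0[rule_format]]) (rule conjunct2[OF i0[rule_format]])
  define H where "H = cl M (C \<union> range i)"
  have CiD: "C \<union> range i \<subseteq> Dom M" "countable (C \<union> range i)" using C i by auto
  have H: "countable H" "H \<subseteq> Dom M" "cl M H = H" "M.inf_dim H"
    unfolding H_def using M.countable_cl[OF CiD(2,1)] M.cl_D[OF CiD(1)] M.cl_idem[OF CiD(1)]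
      M.free_seq_inf_dim[OF C(2) CE(3) i] by simp_all
  have CH: "cl M C \<subseteq> H" unfolding H_def by (rule M.cl_mono[OF _ CiD(1)]) simp
  have notH: "u \<notin> H" if "u \<in> ?E" for u
  proof
    assume "u \<in> H"
    moreover have "u \<in> cl M (C \<union> ?E)" using M.cl_sub[OF CE(2)] that by auto
    ultimately have "u \<in> cl M C" using M.free_seq_range[OF C(2) CE(3) i] unfolding H_def by simp
    then show False using that x y by auto
  qed
  let ?X = "H \<union> ?E"
  have X: "countable ?X" "?X \<subseteq> Dom M" using H CE by auto
  obtain e where e: "Domain e = cl M ?X" "tpr L M M0 e" "e \<subseteq> Dom M \<times> Dom M0" "closed_in M0 (Range e)"
    "\<And>Y. Y \<subseteq> cl M ?X \<Longrightarrow> cl M0 (e `` Y) = e `` cl M Y"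
    using ex_cemb[OF X] by (elim exE conjE) simp
  have XK: "?X \<subseteq> Domain e" unfolding e(1) by (rule M.cl_sub[OF X(2)])
  obtain u v where uv: "(x, u) \<in> e" "(y, v) \<in> e" using XK by blast
  define p where "p = Id_on (e `` H)"
  have p: "Domain p = e `` H" "Range p = e `` H" unfolding p_def by auto
  have eHD: "e `` H \<subseteq> Dom M0" using e(3) by blast
  have cp: "closed_in M0 (Domain p)" "closed_in M0 (Range p)"
    using e(5)[of H] XK eHD unfolding p closed_in_def H(3) e(1) by simp_all
  have "countable e" by (rule tpr_countable[OF e(2)]) (use M.countable_cl[OF X] e(1) in simp)
  then have "countable (e `` H)" using countable_subset[of "e `` H" "snd ` e"] by force
  then have ctp: "countable p" unfolding p_def by (simp add: Id_on_def)
  have "(\<lambda>x. (x, x)) ` (e `` H) = p" unfolding p_def by auto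
  then have tp: "tpr L M0 M0 p" using tpr_family[of L M0 M0 "\<lambda>x. x" "\<lambda>x. x" "e `` H"] by simp
  have "u \<notin> e `` H" "v \<notin> e `` H"
    using notH uv tpr_eq_iff[OF e(2)] by blast+
  then have t: "tpr L M0 M0 (p \<union> {(u, v)})"
    using QM4'[OF tp ctp cp, of u v] uv e(3) p by auto
  have pD: "p \<union> {(u, v)} \<subseteq> Dom M0 \<times> Dom M0" using eHD uv e(3) unfolding p_def by auto
  obtain r where r: "p \<union> {(u, v)} \<subseteq> r" "tpr L M0 M0 r"
      "Domain r = cl M0 (Domain (p \<union> {(u, v)}))" "Range r = cl M0 (Range (p \<union> {(u, v)}))"
    using extend_cl[OF ctp _ _ t pD] cp by auto
  have img: "e `` (insert x H) = insert u (e `` H)" "e `` (insert y H) = insert v (e `` H)"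
    using uv tpr_eq_iff[OF e(2)] by blast+
  have d: "Domain (p \<union> {(u, v)}) = e `` (insert x H)" "Range (p \<union> {(u, v)}) = e `` (insert y H)"
    unfolding img Domain_Un_eq Range_Un_eq p by simp_all
  have "insert x H \<subseteq> cl M ?X" "insert y H \<subseteq> cl M ?X" using XK unfolding e(1) by simp_all
  from e(5)[OF this(1)] e(5)[OF this(2)]
  have Dr: "Domain r = e `` cl M (insert x H)" "Range r = e `` cl M (insert y H)"
    unfolding r(3,4) d by (simp_all only:)
  have sub: "cl M (insert x H) \<subseteq> Domain e" "cl M (insert y H) \<subseteq> Domain e"
    unfolding e(1) by (rule M.cl_mono[OF _ X(2)]; simp add: subset_insertI2)+
  \<comment> \<open>Back in \<open>M\<close> this is an isomorphism between the closures of
    \<open>insert x H\<close> and \<open>insert y H\<close>. It is the identity on \<open>H\<close>,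
    and both of its sides are small models.\<close>
  let ?r = "e O r O e\<inverse>"
  have tr: "tpr L M M ?r" by (rule tpr_comp[OF e(2) tpr_comp[OF r(2) tpr_converse[OF e(2)]]])
  have eI: "e\<inverse> `` (e `` Z) = Z" if "Z \<subseteq> Domain e" for Z
    using that tpr_eq_iff[OF e(2)] by blast
  have "Domain ?r = e\<inverse> `` Domain r" using Dr sub by blast
  then have Dr': "Domain ?r = cl M (insert x H)" unfolding Dr eI[OF sub(1)] .
  have "Range ?r = e\<inverse> `` Range r" using Dr sub by blast
  then have Rr': "Range ?r = cl M (insert y H)" unfolding Dr eI[OF sub(2)] .
  have props: "countable (cl M (insert w H)) \<and> closed_in M (cl M (insert w H)) \<and> M.inf_dim (cl M (insert w H))"
    if w: "w \<in> ?E" for w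
  proof -
    have wD: "insert w H \<subseteq> Dom M" "countable (insert w H)" using w H CE by auto
    have wE: "insert w C \<union> ?E = C \<union> ?E" using w by auto
    have wC: "insert w C \<subseteq> Dom M" using w C CE by auto
    then have wiD: "insert w C \<union> range i \<subseteq> Dom M" using CiD(1) by simp
    have "cl M (insert w H) = cl M (insert w C \<union> range i)"
    proof
      have "H \<subseteq> cl M (insert w C \<union> range i)" unfolding H_def by (rule M.cl_mono[OF _ wiD]) auto
      then show "cl M (insert w H) \<subseteq> cl M (insert w C \<union> range i)"
        using M.cl_sub[OF wiD] by (intro M.cl_minimal[OF _ wiD]) simp
      have "C \<union> range i \<subseteq> H" unfolding H_def by (rule M.cl_sub[OF CiD(1)])
      then show "cl M (insert w C \<union> range i) \<subseteq> cl M (insert w H)"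
        by (intro M.cl_mono[OF _ wD(1)]) auto
    qed
    then have "M.inf_dim (cl M (insert w H))"
      using M.free_seq_inf_dim[OF wC CE(3) i(1) i(2)[folded wE]] by simp
    then show ?thesis
      using M.countable_cl[OF wD(2,1)] M.cl_D[OF wD(1)] M.cl_idem[OF wD(1)] unfolding closed_in_def by simp
  qed
  have rD: "?r \<subseteq> Dom M \<times> Dom M" using e(3) by blast
  obtain \<pi> where \<pi>: "\<pi> \<in> Gam" "\<forall>(x, y)\<in>?r. \<pi> x = y"
    using extend_aut[OF tr rD] props[of x] props[of y] unfolding Dr' Rr' by auto
  have "\<pi> c = c" if "c \<in> cl M C" for c
  proof -
    have "c \<in> H" using CH that by (rule subsetD)
    moreover obtain d where "(c, d) \<in> e" using XK \<open>c \<in> H\<close> by blast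
    ultimately have "(c, c) \<in> ?r" using r(1) unfolding p_def by blast
    from bspec[OF \<pi>(2) this] show ?thesis by (simp only: prod.case)
  qed
  moreover have "(x, y) \<in> ?r" using uv r(1) by blast
  from bspec[OF \<pi>(2) this] have "\<pi> x = y" by (simp only: prod.case)
  ultimately show ?thesis using \<pi>(1) by blast
qed

text \<open>Quantifier-free types are finitary: automorphisms matching the finite parts of
  \<open>p\<close> make \<open>p\<close> a correspondence, to which \<open>extend_aut\<close>
  applies.\<close>

lemma limit_M:
  assumes H: "countable H" "H \<subseteq> Dom M" "cl M H = H" "M.inf_dim H" "Domain p = H" "Range p = H"
    and q: "\<And>q. finite q \<Longrightarrow> q \<subseteq> p \<Longrightarrow> \<exists>\<pi>\<in>Gam. \<forall>(x, y)\<in>q. \<pi> x = y"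
  shows "\<exists>\<pi>\<in>Gam. \<forall>(x, y)\<in>p. \<pi> x = y"
proof (rule extend_aut)
  show pD: "p \<subseteq> Dom M \<times> Dom M" by (rule rel_subset_Times) (use H in simp_all)
  show "tpr L M M p"
  proof (rule tpr_compact)
    fix q assume "finite q" "q \<subseteq> p"
    then obtain \<pi> where "\<pi> \<in> Gam" "\<forall>(x, y)\<in>q. \<pi> x = y" using q by blast
    then show "tpr L M M q" using order_trans[OF \<open>q \<subseteq> p\<close> pD] by (intro Gam_tpr)
  qed
qed (use H in \<open>simp_all add: closed_in_def\<close>)

lemma Gam_id: "(\<lambda>x. x) \<in> Gam"
  unfolding Gam_def struct_iso_def by (simp add: option.map_ident bij_betw_def)

sublocale H: homog_pregeom "Dom M" "cl M" Gam
  by (unfold_locales; (rule Gam_bij Gam_id Gam_comp Gam_inv Gam_cl homog_M limit_M; assumption))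

end

section \<open>Independence and conjugacy\<close>

context pregeom begin

primrec indep :: "'a set \<Rightarrow> 'a list \<Rightarrow> bool" where
  "indep C [] \<longleftrightarrow> True"
| "indep C (d # ds) \<longleftrightarrow> d \<in> D \<and> d \<notin> cl C \<and> indep (insert d C) ds"

lemma indep_D: "indep C ds \<Longrightarrow> set ds \<subseteq> D"
  by (induction ds arbitrary: C) auto

lemma indep_append: "indep C (xs @ ys) \<longleftrightarrow> indep C xs \<and> indep (C \<union> set xs) ys"
  by (induction xs arbitrary: C) auto

lemma indep_antimono: "indep C ds \<Longrightarrow> C' \<subseteq> cl C \<Longrightarrow> C \<subseteq> D \<Longrightarrow> indep C' ds"
proof (induction ds arbitrary: C C')
  case (Cons d ds)
  have d: "d \<in> D" "d \<notin> cl C" "indep (insert d C) ds" using Cons.prems(1) by auto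
  have dC: "insert d C \<subseteq> D" using d Cons.prems(3) by simp
  have "cl C' \<subseteq> cl C" by (rule cl_minimal[OF Cons.prems(2,3)])
  moreover have "insert d C' \<subseteq> cl (insert d C)"
    using cl_sub[OF dC] order_trans[OF Cons.prems(2) cl_mono[OF subset_insertI dC]] by simp
  ultimately show ?case using d Cons.IH[OF d(3) _ dC] by auto
qed simp

text \<open>\<open>indep\<close> is checked from left to right, so reordering a list costs exchange.
  Moving the head to the end is enough to interchange two blocks.\<close>

lemma indep_rotate1: "indep C (x # ys) \<Longrightarrow> C \<subseteq> D \<Longrightarrow> indep C (ys @ [x])"
proof (induction ys arbitrary: C)
  case (Cons y ys)
  have *: "x \<in> D" "y \<in> D" "x \<notin> cl C" "y \<notin> cl (insert x C)" "indep (insert y (insert x C)) ys"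
    using Cons.prems(1) by auto
  have xC: "insert x C \<subseteq> D" using *(1) Cons.prems(2) by simp
  have "y \<notin> cl C" using cl_mono[OF subset_insertI xC] *(4) by (rule contra_subsetD)
  moreover have "x \<notin> cl (insert y C)"
    using exchange[OF Cons.prems(2) *(1,2) _ *(3)] *(4) by blast
  moreover have "indep (insert y C) (ys @ [x])"
    by (rule Cons.IH) (use * calculation Cons.prems(2) in \<open>simp_all add: insert_commute\<close>)
  ultimately show ?case using *(2) by simp
qed simp

lemma indep_swap: "indep C (xs @ ys) \<Longrightarrow> C \<subseteq> D \<Longrightarrow> indep C (ys @ xs)"
proof (induction xs arbitrary: ys)
  case (Cons x xs)
  then have "indep C (xs @ (ys @ [x]))" using indep_rotate1[of C x "xs @ ys"] by simp
  from Cons.IH[OF this Cons.prems(2)] show ?case by simp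
qed simp

lemma indep_swap_over:
  assumes "indep C xs" "indep (C \<union> set xs) ys" "C \<subseteq> D"
  shows "indep (C \<union> set ys) xs"
  using indep_swap[of C xs ys] assms by (simp add: indep_append)

text \<open>Iterates \<open>ext_step\<close>, removing the elements of \<open>ds\<close> from the
  last to the first.\<close>

lemma indep_Int:
  assumes "indep (C \<union> E) ds" "C \<subseteq> D" "E \<subseteq> D" "u \<in> cl (C \<union> E)" "u \<in> cl (C \<union> set ds)"
  shows "u \<in> cl C"
  using assms(1,5)
proof (induction ds rule: rev_induct)
  case (snoc d ds)
  have *: "indep (C \<union> E) ds" "d \<in> D" "d \<notin> cl (C \<union> E \<union> set ds)"
    using snoc.prems(1) by (simp_all add: indep_append)
  have dsD: "set ds \<subseteq> D" by (rule indep_D[OF *(1)])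
  have eq: "C \<union> set ds \<union> E = C \<union> E \<union> set ds" by blast
  have CE: "C \<union> E \<union> set ds \<subseteq> D" using assms(2,3) dsD by simp
  have u: "u \<in> cl (C \<union> E \<union> set ds)" using cl_mono[OF Un_upper1 CE] assms(4) by (rule subsetD)
  have "u \<in> cl (C \<union> set ds)"
    by (rule ext_step[of _ E d]) (use assms(2,3) dsD * eq u snoc.prems(2) in simp_all)
  then show ?case using snoc.IH *(1) by simp
qed simp

lemma ex_basis:
  assumes "C \<subseteq> D" "set xs \<subseteq> D"
  shows "\<exists>ds. indep C ds \<and> set ds \<subseteq> set xs \<and> set xs \<subseteq> cl (C \<union> set ds)"
  using assms
proof (induction xs arbitrary: C)
  case Nil
  then show ?case by (intro exI[of _ "[]"]) simp
next
  case (Cons x xs)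
  show ?case
  proof (cases "x \<in> cl C")
    case True
    obtain ds where ds: "indep C ds" "set ds \<subseteq> set xs" "set xs \<subseteq> cl (C \<union> set ds)"
      using Cons.IH[of C] Cons.prems by auto
    have "cl C \<subseteq> cl (C \<union> set ds)" using Cons.prems indep_D[OF ds(1)] by (intro cl_mono) simp_all
    then show ?thesis using ds True by (intro exI[of _ ds]) auto
  next
    case False
    obtain ds where ds: "indep (insert x C) ds" "set ds \<subseteq> set xs" "set xs \<subseteq> cl (insert x C \<union> set ds)"
      using Cons.IH[of "insert x C"] Cons.prems by auto
    have "x \<in> cl (C \<union> set (x # ds))"
      using cl_sub[of "C \<union> set (x # ds)"] Cons.prems indep_D[OF ds(1)] by simp
    then show ?thesis using ds False Cons.prems by (intro exI[of _ "x # ds"]) auto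
  qed
qed

lemma indep_shorter:
  assumes "\<not> indep C ds" "C \<subseteq> D" "set ds \<subseteq> D" "X \<subseteq> cl (C \<union> set ds)"
  shows "\<exists>es. length es < length ds \<and> set es \<subseteq> set ds \<and> X \<subseteq> cl (C \<union> set es)"
  using assms
proof (induction ds arbitrary: C)
  case (Cons d ds)
  have D: "insert d C \<subseteq> D" "set ds \<subseteq> D" "C \<union> set ds \<subseteq> D" using Cons.prems(2,3) by simp_all
  show ?case
  proof (cases "d \<in> cl C")
    case True
    have "C \<union> set (d # ds) \<subseteq> cl (C \<union> set ds)"
      using cl_sub[OF D(3)] cl_mono[OF Un_upper1 D(3)] True by auto
    then have "cl (C \<union> set (d # ds)) \<subseteq> cl (C \<union> set ds)" by (rule cl_minimal[OF _ D(3)])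
    then show ?thesis using Cons.prems(4) by (intro exI[of _ ds]) auto
  next
    case False
    then have "\<not> indep (insert d C) ds" using Cons.prems(1,3) by simp
    then obtain es where es: "length es < length ds" "set es \<subseteq> set ds" "X \<subseteq> cl (insert d C \<union> set es)"
      using Cons.IH[of "insert d C"] D Cons.prems(4) by auto
    then show ?thesis by (intro exI[of _ "d # es"]) auto
  qed
qed simp

lemma cl_finite_set:
  assumes "finite X" "X \<subseteq> cl (C \<union> E)" "C \<subseteq> D" "E \<subseteq> D"
  shows "\<exists>F. finite F \<and> F \<subseteq> C \<and> X \<subseteq> cl (F \<union> E)"
  using assms(1,2)
proof (induction X)
  case (insert x X)
  then obtain F where F: "finite F" "F \<subseteq> C" "X \<subseteq> cl (F \<union> E)" by auto
  have CE: "C \<union> E \<subseteq> D" using assms by simp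
  have "x \<in> cl (C \<union> E)" using insert.prems by simp
  from cl_finite[OF CE this] obtain F' where F': "finite F'" "F' \<subseteq> C \<union> E" "x \<in> cl F'" by blast
  have sub: "F \<union> (F' \<inter> C) \<union> E \<subseteq> D" using F(2) CE by auto
  have "cl F' \<subseteq> cl (F \<union> (F' \<inter> C) \<union> E)" using F'(2) by (intro cl_mono[OF _ sub]) auto
  moreover have "cl (F \<union> E) \<subseteq> cl (F \<union> (F' \<inter> C) \<union> E)" by (intro cl_mono[OF _ sub]) auto
  ultimately have "insert x X \<subseteq> cl (F \<union> (F' \<inter> C) \<union> E)" using F(3) F'(3) by auto
  then show ?case using F(1,2) F'(1) by (intro exI[of _ "F \<union> (F' \<inter> C)"]) auto
qed auto

lemma inf_dim_outside:
  assumes "A \<subseteq> D" "cl A = A" "inf_dim A" "finite F" "F \<subseteq> A"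
  shows "\<exists>a\<in>A. a \<notin> cl F"
proof -
  have "cl F \<subseteq> A" using cl_mono[OF assms(5,1)] assms(2) by simp
  moreover have "cl F \<noteq> A" using assms(3-5) unfolding inf_dim_def by blast
  ultimately show ?thesis by blast
qed

lemma inf_dim_indep:
  assumes "A \<subseteq> D" "cl A = A" "inf_dim A" "finite C" "C \<subseteq> A"
  shows "\<exists>ds. length ds = n \<and> indep C ds \<and> set ds \<subseteq> A"
  using assms(4,5)
proof (induction n arbitrary: C)
  case (Suc n)
  obtain d where d: "d \<in> A" "d \<notin> cl C" using inf_dim_outside[OF assms(1-3) Suc.prems] by blast
  obtain ds where "length ds = n" "indep (insert d C) ds" "set ds \<subseteq> A"
    using Suc.IH[of "insert d C"] Suc.prems d by auto
  then show ?case using d assms(1) by (intro exI[of _ "d # ds"]) auto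
qed simp

lemma inf_dim_free_seq:
  assumes A: "A \<subseteq> D" "cl A = A" "inf_dim A" and F: "finite F" "F \<subseteq> A"
  shows "\<exists>i :: nat \<Rightarrow> 'a. \<forall>n. i n \<in> A \<and> i n \<notin> cl (F \<union> i ` {..<n})"
proof -
  have "\<exists>f. \<forall>n. (finite (fst (f n)) \<and> fst (f n) \<subseteq> A \<and> snd (f n) \<in> A \<and> snd (f n) \<notin> cl (fst (f n)) \<and>
    (n = 0 \<longrightarrow> fst (f n) = F)) \<and> fst (f (Suc n)) = insert (snd (f n)) (fst (f n))"
  proof (rule dependent_nat_choice)
    show "\<exists>x. finite (fst x) \<and> fst x \<subseteq> A \<and> snd x \<in> A \<and> snd x \<notin> cl (fst x) \<and> ((0::nat) = 0 \<longrightarrow> fst x = F)"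
      using inf_dim_outside[OF A F] F by auto
  next
    fix x and n :: nat
    assume x: "finite (fst x) \<and> fst x \<subseteq> A \<and> snd x \<in> A \<and> snd x \<notin> cl (fst x) \<and> (n = 0 \<longrightarrow> fst x = F)"
    then obtain a where "a \<in> A" "a \<notin> cl (insert (snd x) (fst x))"
      using inf_dim_outside[OF A, of "insert (snd x) (fst x)"] by auto
    then show "\<exists>y. (finite (fst y) \<and> fst y \<subseteq> A \<and> snd y \<in> A \<and> snd y \<notin> cl (fst y) \<and> (Suc n = 0 \<longrightarrow> fst y = F)) \<and>
        fst y = insert (snd x) (fst x)"
      using x by (intro exI[of _ "(insert (snd x) (fst x), a)"]) simp
  qed
  then obtain f where f0: "\<forall>n. (finite (fst (f n)) \<and> fst (f n) \<subseteq> A \<and> snd (f n) \<in> A \<and> snd (f n) \<notin> cl (fst (f n)) \<and>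
    (n = 0 \<longrightarrow> fst (f n) = F)) \<and> fst (f (Suc n)) = insert (snd (f n)) (fst (f n))"
    by (rule exE)
  have f: "\<And>n. snd (f n) \<in> A" "\<And>n. snd (f n) \<notin> cl (fst (f n))" "fst (f 0) = F"
    "\<And>n. fst (f (Suc n)) = insert (snd (f n)) (fst (f n))"
    using f0 by simp_all
  have "fst (f n) = F \<union> (\<lambda>n. snd (f n)) ` {..<n}" for n
    by (induction n) (auto simp: f lessThan_Suc)
  then show ?thesis using f by (intro exI[of _ "\<lambda>n. snd (f n)"]) auto
qed

end

section \<open>Stabilisers and conjugacy of tuples\<close>

context homog_pregeom begin

definition stab :: "'a set \<Rightarrow> ('a \<Rightarrow> 'a) set" where
  "stab A = {\<pi>\<in>G. \<forall>a\<in>A. \<pi> a = a}"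

text \<open>Equality of Galois types over all of \<open>A\<close> at once, which for infinite
  \<open>A\<close> is a priori more than equality of weak types.\<close>

definition conjg :: "'a set \<Rightarrow> 'a list \<Rightarrow> 'a list \<Rightarrow> bool" where
  "conjg A xs ys \<longleftrightarrow> (\<exists>\<pi>\<in>stab A. map \<pi> xs = ys)"

lemma stab_G: "\<pi> \<in> stab A \<Longrightarrow> \<pi> \<in> G"
  and stab_fix: "\<pi> \<in> stab A \<Longrightarrow> a \<in> A \<Longrightarrow> \<pi> a = a"
  unfolding stab_def by simp_all

lemma stab_empty: "stab {} = G"
  unfolding stab_def by simp

lemma stab_mono: "A \<subseteq> B \<Longrightarrow> \<pi> \<in> stab B \<Longrightarrow> \<pi> \<in> stab A"
  unfolding stab_def by auto

lemma stab_cl: "\<pi> \<in> stab (cl A) \<Longrightarrow> A \<subseteq> D \<Longrightarrow> \<pi> \<in> stab A"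
  by (rule stab_mono[OF cl_sub])

lemma stab_id: "(\<lambda>x. x) \<in> stab A"
  using G_id unfolding stab_def by simp

lemma stab_comp: "\<pi> \<in> stab A \<Longrightarrow> \<tau> \<in> stab A \<Longrightarrow> (\<lambda>x. \<pi> (\<tau> x)) \<in> stab A"
  using G_comp unfolding stab_def by simp

lemma G_mem: "\<pi> \<in> G \<Longrightarrow> x \<in> D \<Longrightarrow> \<pi> x \<in> D"
  using G_bij bij_betwE by blast

lemma G_image: "\<pi> \<in> G \<Longrightarrow> X \<subseteq> D \<Longrightarrow> \<pi> ` X \<subseteq> D"
  using G_mem by blast

lemma G_inj: "\<pi> \<in> G \<Longrightarrow> inj_on \<pi> D"
  using G_bij bij_betw_imp_inj_on by blast

lemma stab_inv: "\<pi> \<in> stab A \<Longrightarrow> A \<subseteq> D \<Longrightarrow> \<exists>\<tau>\<in>stab A. \<forall>x\<in>D. \<tau> (\<pi> x) = x \<and> \<pi> (\<tau> x) = x"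
proof -
  assume \<pi>: "\<pi> \<in> stab A" and A: "A \<subseteq> D"
  note bij = G_bij[OF stab_G[OF \<pi>]]
  let ?\<tau> = "inv_into D \<pi>"
  have *: "?\<tau> (\<pi> x) = x \<and> \<pi> (?\<tau> x) = x" if "x \<in> D" for x
    using bij_betw_inv_into_left[OF bij that] bij_betw_inv_into_right[OF bij that] by simp
  have "?\<tau> a = a" if "a \<in> A" for a
    using *[of a] stab_fix[OF \<pi> that] that A by auto
  then have "?\<tau> \<in> stab A" using G_inv[OF stab_G[OF \<pi>]] unfolding stab_def by simp
  with * show ?thesis by blast
qed

lemma G_mem_cl: "\<pi> \<in> G \<Longrightarrow> X \<subseteq> D \<Longrightarrow> x \<in> D \<Longrightarrow> \<pi> x \<in> cl (\<pi> ` X) \<longleftrightarrow> x \<in> cl X"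
  using G_cl[of \<pi> X] inj_on_image_mem_iff[OF G_inj _ cl_D] by simp

lemma conjgI: "\<pi> \<in> stab A \<Longrightarrow> map \<pi> xs = ys \<Longrightarrow> conjg A xs ys"
  unfolding conjg_def by blast

lemma conjg_refl: "conjg A xs xs"
  using stab_id by (rule conjgI) simp

lemma conjg_length: "conjg A xs ys \<Longrightarrow> length xs = length ys"
  unfolding conjg_def by auto

lemma conjg_D: "conjg A xs ys \<Longrightarrow> set xs \<subseteq> D \<Longrightarrow> set ys \<subseteq> D"
proof -
  assume "conjg A xs ys" "set xs \<subseteq> D"
  then obtain \<pi> where \<pi>: "\<pi> \<in> stab A" "ys = map \<pi> xs" unfolding conjg_def by blast
  then show ?thesis using G_image[OF stab_G[OF \<pi>(1)] \<open>set xs \<subseteq> D\<close>] by simp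
qed

lemma conjg_sym: "conjg A xs ys \<Longrightarrow> A \<subseteq> D \<Longrightarrow> set xs \<subseteq> D \<Longrightarrow> conjg A ys xs"
proof -
  assume *: "conjg A xs ys" "A \<subseteq> D" "set xs \<subseteq> D"
  then obtain \<pi> where \<pi>: "\<pi> \<in> stab A" "map \<pi> xs = ys" unfolding conjg_def by blast
  obtain \<tau> where \<tau>: "\<tau> \<in> stab A" "\<forall>x\<in>D. \<tau> (\<pi> x) = x \<and> \<pi> (\<tau> x) = x"
    using stab_inv[OF \<pi>(1) *(2)] by blast
  have "map \<tau> ys = xs" unfolding \<pi>(2)[symmetric] using \<tau>(2) *(3) by (auto intro!: map_idI)
  with \<tau>(1) show ?thesis by (rule conjgI)
qed

lemma conjg_trans: "conjg A xs ys \<Longrightarrow> conjg A ys zs \<Longrightarrow> conjg A xs zs"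
proof -
  assume "conjg A xs ys" "conjg A ys zs"
  then obtain \<pi> \<tau> where *: "\<pi> \<in> stab A" "map \<pi> xs = ys" "\<tau> \<in> stab A" "map \<tau> ys = zs"
    unfolding conjg_def by blast
  have "map (\<lambda>x. \<tau> (\<pi> x)) xs = zs" using *(2,4) by auto
  with stab_comp[OF *(3,1)] show ?thesis by (rule conjgI)
qed

text \<open>Keeping \<open>us\<close> in both tuples amounts to fixing it pointwise. This turns
  parameters into entries of tuples and back, as statements about splitting need.\<close>

lemma conjg_params:
  assumes "length xs = length ys"
  shows "conjg A (xs @ us) (ys @ us) \<longleftrightarrow> conjg (A \<union> set us) xs ys"
proof
  assume "conjg A (xs @ us) (ys @ us)"
  then obtain \<pi> where \<pi>: "\<pi> \<in> stab A" "map \<pi> xs = ys" "map \<pi> us = us"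
    using assms unfolding conjg_def by auto
  have "\<forall>u\<in>set us. \<pi> u = u" using \<pi>(3) by (metis in_set_conv_nth nth_map)
  then have "\<pi> \<in> stab (A \<union> set us)" using \<pi>(1) unfolding stab_def by auto
  then show "conjg (A \<union> set us) xs ys" using \<pi>(2) by (rule conjgI)
next
  assume "conjg (A \<union> set us) xs ys"
  then obtain \<pi> where \<pi>: "\<pi> \<in> stab (A \<union> set us)" "map \<pi> xs = ys" unfolding conjg_def by blast
  have "map \<pi> us = us" using stab_fix[OF \<pi>(1)] by (intro map_idI) simp
  then show "conjg A (xs @ us) (ys @ us)"
    using \<pi>(2) stab_mono[OF _ \<pi>(1), of A] by (intro conjgI[of \<pi>]) simp_all
qed

lemma conjg_image: "\<tau> \<in> stab A \<Longrightarrow> conjg A xs (map \<tau> xs)"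
  unfolding conjg_def by blast

lemma indep_image: "\<pi> \<in> G \<Longrightarrow> C \<subseteq> D \<Longrightarrow> indep C ds \<Longrightarrow> indep (\<pi> ` C) (map \<pi> ds)"
proof (induction ds arbitrary: C)
  case (Cons d ds)
  then have *: "d \<in> D" "d \<notin> cl C" "indep (insert d C) ds" by auto
  have "indep (\<pi> ` insert d C) (map \<pi> ds)"
    using Cons.IH[OF Cons.prems(1) _ *(3)] Cons.prems(2) *(1) by simp
  then show ?case using G_mem_cl[OF Cons.prems(1,2) *(1)] *(2) G_mem[OF Cons.prems(1) *(1)] by simp
qed simp

lemma homog_list:
  assumes "countable C" "C \<subseteq> D" "indep C ds" "indep C es" "length ds = length es"
  shows "\<exists>\<pi>\<in>stab (cl C). map \<pi> ds = es"
  using assms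
proof (induction es arbitrary: C ds)
  case Nil
  then show ?case using stab_id by auto
next
  case (Cons e es C ds')
  obtain d ds where ds': "ds' = d # ds" using Cons.prems(5) by (cases ds') auto
  have *: "d \<in> D" "d \<notin> cl C" "indep (insert d C) ds" "e \<in> D" "e \<notin> cl C" "indep (insert e C) es"
    using Cons.prems ds' by auto
  obtain \<pi> where \<pi>: "\<pi> \<in> stab (cl C)" "\<pi> d = e"
    using homog[OF Cons.prems(1,2), of d e] * unfolding stab_def by blast
  have "\<pi> ` insert d C = insert e C"
    using stab_fix[OF stab_cl[OF \<pi>(1) Cons.prems(2)]] \<pi>(2) by auto
  then have ind: "indep (insert e C) (map \<pi> ds)"
    using indep_image[OF stab_G[OF \<pi>(1)] _ *(3)] *(1) Cons.prems(2) by simp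
  have eC: "insert e C \<subseteq> D" "countable (insert e C)" using *(4) Cons.prems(1,2) by simp_all
  have "length (map \<pi> ds) = length es" using Cons.prems(5) ds' by simp
  from Cons.IH[OF eC(2,1) ind *(6) this]
  obtain \<tau> where \<tau>: "\<tau> \<in> stab (cl (insert e C))" "map \<tau> (map \<pi> ds) = es" by blast
  have "\<tau> e = e" using stab_fix[OF stab_cl[OF \<tau>(1) eC(1)]] by simp
  then have "map (\<lambda>x. \<tau> (\<pi> x)) ds' = e # es" using \<pi>(2) \<tau>(2) ds' by (simp add: o_def)
  moreover have "\<tau> \<in> stab (cl C)" by (rule stab_mono[OF cl_mono[OF subset_insertI eC(1)] \<tau>(1)])
  then have "(\<lambda>x. \<tau> (\<pi> x)) \<in> stab (cl C)" by (rule stab_comp[OF _ \<pi>(1)])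
  ultimately show ?case by (rule bexI)
qed

lemma stab_image_cl:
  assumes "\<tau> \<in> stab (cl C)" "C \<subseteq> D" "set ds \<subseteq> D" "set xs \<subseteq> cl (C \<union> set ds)"
  shows "set (map \<tau> xs) \<subseteq> cl (C \<union> set (map \<tau> ds))"
proof -
  have "\<tau> ` (C \<union> set ds) = C \<union> set (map \<tau> ds)"
    using stab_fix[OF stab_cl[OF assms(1,2)]] by (auto simp: image_Un)
  then have "cl (C \<union> set (map \<tau> ds)) = \<tau> ` cl (C \<union> set ds)"
    using G_cl[OF stab_G[OF assms(1)], of "C \<union> set ds"] assms(2,3) by simp
  then show ?thesis using assms(4) by auto
qed

text \<open>A basis of \<open>xs\<close> over \<open>C\<close> is sent to independent elements of
  \<open>A\<close>; the rest of \<open>xs\<close> follows because \<open>A\<close> is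
  closed.\<close>

lemma move_into:
  assumes "A \<subseteq> D" "cl A = A" "inf_dim A" "finite C" "C \<subseteq> A" "set xs \<subseteq> D"
  shows "\<exists>\<tau>\<in>stab (cl C). set (map \<tau> xs) \<subseteq> A"
proof -
  have CD: "C \<subseteq> D" using assms(1,5) by (rule order_trans[rotated])
  obtain ds where ds: "indep C ds" "set xs \<subseteq> cl (C \<union> set ds)" using ex_basis[OF CD assms(6)] by blast
  obtain es where es: "length es = length ds" "indep C es" "set es \<subseteq> A"
    using inf_dim_indep[OF assms(1-5)] by blast
  obtain \<tau> where \<tau>: "\<tau> \<in> stab (cl C)" "map \<tau> ds = es"
    using homog_list[OF countable_finite[OF assms(4)] CD ds(1) es(2) es(1)[symmetric]] by blast
  have "set (map \<tau> xs) \<subseteq> cl (C \<union> set es)"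
    using stab_image_cl[OF \<tau>(1) CD indep_D[OF ds(1)] ds(2)] unfolding \<tau>(2) .
  also have "\<dots> \<subseteq> A" using cl_mono[of "C \<union> set es" A] assms(1,2,5) es(3) by simp
  finally show ?thesis using \<tau>(1) by blast
qed

lemma ex_indep:
  assumes "countable C" "C \<subseteq> D"
  shows "\<exists>ds. length ds = n \<and> indep C ds"
  using assms
proof (induction n arbitrary: C)
  case (Suc n)
  obtain d where d: "d \<in> D" "d \<notin> cl C" using outside[OF Suc.prems] by blast
  obtain ds where "length ds = n" "indep (insert d C) ds"
    using Suc.IH[of "insert d C"] Suc.prems d by auto
  then show ?case using d by (intro exI[of _ "d # ds"]) auto
qed simp

text \<open>The same idea in the opposite direction: a basis of \<open>xs\<close> over
  \<open>A\<close> is sent to elements independent over \<open>A \<union> E\<close>.\<close>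

lemma free_copy:
  assumes "finite A" "A \<subseteq> D" "countable E" "E \<subseteq> D" "set xs \<subseteq> D"
  shows "\<exists>\<tau>\<in>stab (cl A). \<exists>ds. indep (A \<union> E) ds \<and> set (map \<tau> xs) \<subseteq> cl (A \<union> set ds)"
proof -
  obtain ds where ds: "indep A ds" "set xs \<subseteq> cl (A \<union> set ds)" using ex_basis[OF assms(2,5)] by blast
  have AE: "countable (A \<union> E)" "A \<union> E \<subseteq> D" using assms by (simp_all add: countable_finite)
  obtain es where es: "length es = length ds" "indep (A \<union> E) es" using ex_indep[OF AE] by blast
  have "A \<subseteq> cl (A \<union> E)" using cl_sub[OF AE(2)] by simp
  from indep_antimono[OF es(2) this AE(2)] have "indep A es" .
  then obtain \<tau> where \<tau>: "\<tau> \<in> stab (cl A)" "map \<tau> ds = es"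
    using homog_list[OF countable_finite[OF assms(1)] assms(2) ds(1) _ es(1)[symmetric]] by blast
  have "set (map \<tau> xs) \<subseteq> cl (A \<union> set es)"
    using stab_image_cl[OF \<tau>(1) assms(2) indep_D[OF ds(1)] ds(2)] unfolding \<tau>(2) .
  then show ?thesis using \<tau>(1) es(2) by blast
qed

text \<open>A basis of any finite tuple over \<open>C\<close> can be moved onto an initial segment
  of one fixed free sequence. Every orbit therefore meets the lists over a single countable closed
  set; this plays the role of \<omega>-stability.\<close>

lemma countable_orbits:
  assumes "countable C" "C \<subseteq> D"
  shows "\<exists>T. countable T \<and> (\<forall>xs. set xs \<subseteq> D \<longrightarrow> (\<exists>\<pi>\<in>stab (cl C). map \<pi> xs \<in> T))"
proof -
  obtain i where i: "\<forall>n::nat. i n \<in> D \<and> i n \<notin> cl (C \<union> i ` {..<n})"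
    using ex_free_seq[OF assms] by (rule exE)
  have ind: "indep (C \<union> i ` {..<m}) (map i [m..<m + n])" for m n
  proof (induction n arbitrary: m)
    case (Suc n)
    have "[m..<m + Suc n] = m # [Suc m..<Suc m + n]" by (simp add: upt_conv_Cons)
    moreover have "insert (i m) (C \<union> i ` {..<m}) = C \<union> i ` {..<Suc m}" by (auto simp: lessThan_Suc)
    ultimately show ?case using i Suc.IH[of "Suc m"] by simp
  qed simp
  let ?K = "cl (C \<union> range i)"
  have KD: "C \<union> range i \<subseteq> D" "countable (C \<union> range i)" using i assms by auto
  have "countable (lists ?K)" using countable_cl[OF KD(2,1)] by (rule countable_lists)
  moreover have "\<exists>\<pi>\<in>stab (cl C). map \<pi> xs \<in> lists ?K" if xs: "set xs \<subseteq> D" for xs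
  proof -
    obtain ds where ds: "indep C ds" "set xs \<subseteq> cl (C \<union> set ds)" using ex_basis[OF assms(2) xs] by blast
    have "indep C (map i [0..<length ds])" using ind[of 0 "length ds"] by simp
    from homog_list[OF assms ds(1) this]
    obtain \<tau> where \<tau>: "\<tau> \<in> stab (cl C)" "map \<tau> ds = map i [0..<length ds]" by auto
    have "set (map \<tau> xs) \<subseteq> cl (C \<union> set (map i [0..<length ds]))"
      using stab_image_cl[OF \<tau>(1) assms(2) indep_D[OF ds(1)] ds(2)] unfolding \<tau>(2) .
    also have "\<dots> \<subseteq> ?K" by (rule cl_mono[OF _ KD(1)]) auto
    finally have "map \<tau> xs \<in> lists ?K" by (simp add: lists_eq_set)
    with \<tau>(1) show ?thesis by blast
  qed
  ultimately show ?thesis by blast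
qed

text \<open>Back-and-forth with finite maps on \<open>H\<close> that are induced by automorphisms of
  the whole structure. The axiom \<open>limit\<close> glues them to an automorphism that maps
  \<open>H\<close> onto itself.\<close>

lemma conjg_within:
  assumes H: "countable H" "H \<subseteq> D" "cl H = H" "inf_dim H"
    and A: "finite A" "A \<subseteq> H" and bc: "set b \<subseteq> H" "set c \<subseteq> H" "conjg A b c"
  shows "\<exists>\<pi>\<in>stab A. \<pi> ` H = H \<and> map \<pi> b = c"
proof -
  define Good where "Good = (\<lambda>p. finite p \<and> p \<subseteq> H \<times> H \<and> (\<exists>\<pi>\<in>G. \<forall>(x, y)\<in>p. \<pi> x = y))"
  let ?p0 = "Id_on A \<union> set (zip b c)"
  obtain \<pi>0 where \<pi>0: "\<pi>0 \<in> stab A" "map \<pi>0 b = c" using bc(3) unfolding conjg_def by blast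
  have zip: "set (zip b c) = (\<lambda>x. (x, \<pi>0 x)) ` set b"
    unfolding \<pi>0(2)[symmetric] by (simp add: zip_map2 zip_same_conv_map)
  have "\<pi>0 ` set b = set c" unfolding \<pi>0(2)[symmetric] by simp
  then have "?p0 \<subseteq> H \<times> H" using A(2) bc(1,2) unfolding zip by blast
  moreover have "\<forall>(x, y)\<in>?p0. \<pi>0 x = y" using stab_fix[OF \<pi>0(1)] unfolding zip by auto
  moreover have "finite ?p0" using A(1) by (auto simp: Id_on_def)
  ultimately have Good0: "Good ?p0" unfolding Good_def using stab_G[OF \<pi>0(1)] by blast
  have forth: "\<exists>y. Good (insert (x, y) p)" if p: "Good p" and x: "x \<in> H" for p x
  proof -
    from p obtain \<pi> where *: "finite p" "p \<subseteq> H \<times> H" "\<pi> \<in> G" "\<forall>(x, y)\<in>p. \<pi> x = y"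
      unfolding Good_def by (elim conjE bexE)
    have \<pi>: "finite p" "p \<subseteq> H \<times> H" "\<pi> \<in> G" "\<And>x y. (x, y) \<in> p \<Longrightarrow> \<pi> x = y"
      using * by auto
    have R: "finite (Range p)" "Range p \<subseteq> H" "Range p \<subseteq> D"
      using \<pi>(1,2) H(2) by (auto simp: finite_Range)
    have "\<pi> x \<in> D" using G_mem[OF \<pi>(3)] x H(2) by blast
    \<comment> \<open>The image of \<open>x\<close> may leave \<open>H\<close>; an automorphism
      fixing the range reached so far brings it back.\<close>
    then obtain \<tau> where \<tau>: "\<tau> \<in> stab (cl (Range p))" "\<tau> (\<pi> x) \<in> H"
      using move_into[OF H(2-4) R(1,2), of "[\<pi> x]"] by auto
    have "\<tau> y = y" if "(x', y) \<in> p" for x' y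
      using stab_fix[OF stab_cl[OF \<tau>(1) R(3)]] that by blast
    then have "\<forall>(x', y')\<in>insert (x, \<tau> (\<pi> x)) p. \<tau> (\<pi> x') = y'" using \<pi>(4) by auto
    moreover have "(\<lambda>x. \<tau> (\<pi> x)) \<in> G" by (rule G_comp[OF stab_G[OF \<tau>(1)] \<pi>(3)])
    ultimately have "Good (insert (x, \<tau> (\<pi> x)) p)" unfolding Good_def using \<pi>(1,2) \<tau>(2) x
      by (intro conjI bexI[of _ "\<lambda>x. \<tau> (\<pi> x)"]) simp_all
    then show ?thesis ..
  qed
  have bwd: "\<exists>x. Good (insert (x, y) p)" if p: "Good p" and y: "y \<in> H" for p y
  proof -
    from p obtain \<pi> where *: "finite p" "p \<subseteq> H \<times> H" "\<pi> \<in> G" "\<forall>(x, y)\<in>p. \<pi> x = y"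
      unfolding Good_def by (elim conjE bexE)
    have \<pi>: "finite p" "p \<subseteq> H \<times> H" "\<pi> \<in> G" "\<And>x y. (x, y) \<in> p \<Longrightarrow> \<pi> x = y"
      using * by auto
    have R: "finite (Domain p)" "Domain p \<subseteq> H" "Domain p \<subseteq> D"
      using \<pi>(1,2) H(2) by (auto simp: finite_Domain)
    have yD: "y \<in> D" using y H(2) by blast
    obtain \<rho> where \<rho>: "\<rho> \<in> G" "\<And>x. x \<in> D \<Longrightarrow> \<pi> (\<rho> x) = x"
      using stab_inv[of \<pi> "{}"] \<pi>(3) unfolding stab_empty by auto
    have "\<rho> y \<in> D" by (rule G_mem[OF \<rho>(1) yD])
    then obtain \<tau> where \<tau>: "\<tau> \<in> stab (cl (Domain p))" "\<tau> (\<rho> y) \<in> H"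
      using move_into[OF H(2-4) R(1,2), of "[\<rho> y]"] by auto
    obtain \<tau>' where \<tau>': "\<tau>' \<in> stab (cl (Domain p))" "\<And>x. x \<in> D \<Longrightarrow> \<tau>' (\<tau> x) = x"
      using stab_inv[OF \<tau>(1) cl_D[OF R(3)]] by blast
    have "\<tau>' x = x" if "(x, y') \<in> p" for x y'
      using stab_fix[OF stab_cl[OF \<tau>'(1) R(3)]] that by blast
    then have "\<forall>(x', y')\<in>insert (\<tau> (\<rho> y), y) p. \<pi> (\<tau>' x') = y'"
      using \<pi>(4) \<tau>'(2)[OF \<open>\<rho> y \<in> D\<close>] \<rho>(2)[OF yD] by auto
    moreover have "(\<lambda>x. \<pi> (\<tau>' x)) \<in> G" by (rule G_comp[OF \<pi>(3) stab_G[OF \<tau>'(1)]])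
    ultimately have "Good (insert (\<tau> (\<rho> y), y) p)" unfolding Good_def using \<pi>(1,2) \<tau>(2) y
      by (intro conjI bexI[of _ "\<lambda>x. \<pi> (\<tau>' x)"]) simp_all
    then show ?thesis ..
  qed
  obtain P where P: "P 0 = ?p0" "\<forall>n. Good (P n) \<and> P n \<subseteq> P (Suc n)"
    "H \<subseteq> Domain (\<Union>n. P n)" "H \<subseteq> Range (\<Union>n. P n)"
    using back_and_forth[of H H Good, OF H(1) H(1) Good0 forth bwd] by blast
  have PS: "P n \<subseteq> P (Suc n)" and PG: "\<exists>\<pi>\<in>G. \<forall>(x, y)\<in>P n. \<pi> x = y" and PH': "P n \<subseteq> H \<times> H" for n
    using P(2)[rule_format, of n] unfolding Good_def by simp_all
  have PH: "(\<Union>n. P n) \<subseteq> H \<times> H" by (rule UN_least) (rule PH')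
  have "\<exists>\<pi>\<in>G. \<forall>(x, y)\<in>(\<Union>n. P n). \<pi> x = y"
  proof (rule limit[OF H])
    show "Domain (\<Union>n. P n) = H" "Range (\<Union>n. P n) = H" using P(3,4) PH by blast+
    fix q assume q: "finite q" "q \<subseteq> (\<Union>n. P n)"
    from finite_subset_chain[OF q PS] obtain n where n: "q \<subseteq> P n" by blast
    obtain \<pi> where "\<pi> \<in> G" "\<forall>(x, y)\<in>P n. \<pi> x = y" using PG by (rule bexE)
    then show "\<exists>\<pi>\<in>G. \<forall>(x, y)\<in>q. \<pi> x = y" using n by (intro bexI[of _ \<pi>]) auto
  qed
  then obtain \<pi> where \<pi>1: "\<pi> \<in> G" "\<forall>(x, y)\<in>(\<Union>n. P n). \<pi> x = y" by (elim bexE)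
  have \<pi>: "\<pi> \<in> G" "\<And>x y n. (x, y) \<in> P n \<Longrightarrow> \<pi> x = y" using \<pi>1 by auto
  have "\<pi> a = a" if "a \<in> A" for a using \<pi>(2)[of a a 0] that P(1) by auto
  then have "\<pi> \<in> stab A" using \<pi>(1) unfolding stab_def by simp
  moreover have "\<pi> ` H = H"
  proof
    show "\<pi> ` H \<subseteq> H"
    proof
      fix z assume "z \<in> \<pi> ` H"
      then obtain x where "x \<in> H" "z = \<pi> x" by blast
      moreover obtain y n where "(x, y) \<in> P n" using P(3) \<open>x \<in> H\<close> by blast
      ultimately show "z \<in> H" using \<pi>(2) PH by blast
    qed
    show "H \<subseteq> \<pi> ` H"
    proof
      fix y assume "y \<in> H"
      then obtain x n where "(x, y) \<in> P n" using P(4) by blast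
      then show "y \<in> \<pi> ` H" using \<pi>(2) PH by blast
    qed
  qed
  moreover have "map \<pi> b = c"
  proof -
    have "\<pi> x = \<pi>0 x" if "x \<in> set b" for x
      using \<pi>(2)[of x "\<pi>0 x" 0] that unfolding P(1) zip by blast
    then show ?thesis unfolding \<pi>0(2)[symmetric] by simp
  qed
  ultimately show ?thesis by (intro bexI[of _ \<pi>] conjI)
qed

text \<open>A Baire category argument: the automorphisms of \<open>H\<close> fixing the type of \<open>a\<close> over \<open>H\<close> form a
  closed subgroup of countable index, hence an open one. If it were not open, a diagonalisation
  would produce an automorphism of \<open>H\<close> in none of its countably many cosets.\<close>

lemma type_support:
  assumes H: "countable H" "H \<subseteq> D" "cl H = H" "inf_dim H" and a: "set a \<subseteq> D"
  shows "\<exists>A. finite A \<and> A \<subseteq> H \<and>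
    (\<forall>\<pi>\<in>stab A. \<pi> ` H = H \<longrightarrow> (\<forall>h. set h \<subseteq> H \<longrightarrow> conjg {} (a @ h) (a @ map \<pi> h)))"
proof (rule ccontr)
  assume neg: "\<not> ?thesis"
  have no: "\<exists>\<pi>\<in>stab A. \<pi> ` H = H \<and> (\<exists>h. set h \<subseteq> H \<and> \<not> conjg {} (a @ h) (a @ map \<pi> h))"
    if "finite A" "A \<subseteq> H" for A
  proof -
    have "\<not> (\<forall>\<pi>\<in>stab A. \<pi> ` H = H \<longrightarrow> (\<forall>h. set h \<subseteq> H \<longrightarrow> conjg {} (a @ h) (a @ map \<pi> h)))"
      by (rule notI, rule notE[OF neg], rule exI[of _ A], intro conjI that)
    then show ?thesis by simp
  qed
  \<comment> \<open>A countable set meeting the orbit of every finite tuple over \<open>H\<close>;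
    the diagonalisation has to escape all of its members.\<close>
  obtain T where T: "countable T" "\<And>xs. set xs \<subseteq> D \<Longrightarrow> \<exists>\<pi>\<in>stab H. map \<pi> xs \<in> T"
    using countable_orbits[OF H(1,2)] unfolding H(3) by blast
  have "T \<noteq> {}" using T(2)[OF a] by blast
  then have t: "range (from_nat_into T) = T" using T(1) by (rule range_from_nat_into)
  let ?t = "from_nat_into T"
  have "H \<noteq> {}" using inf_dim_outside[OF H(2-4), of "{}"] by auto
  then have e: "range (from_nat_into H) = H" using H(1) by (rule range_from_nat_into)
  let ?e = "from_nat_into H"
  have eH: "?e n \<in> H" for n using e by blast
  have enum: "\<exists>n. x = ?e n" if "x \<in> H" for x
  proof -
    have "x \<in> range ?e" using that e by simp
    then show ?thesis by auto
  qed
  define OK where "OK = (\<lambda>(\<pi>, A). \<pi> \<in> G \<and> \<pi> ` H = H \<and> finite A \<and> A \<subseteq> H)"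
  \<comment> \<open>One step of the diagonalisation: the finite set \<open>A'\<close> freezes enough
    of the new map that no automorphism of \<open>H\<close> agreeing with it on \<open>A'\<close>
    can take \<open>a\<close> to a tuple conjugate over \<open>H\<close> to the n-th member of
    \<open>T\<close>. The n-th element of \<open>H\<close> enters both domain and range.\<close>
  define St where "St = (\<lambda>n (\<pi>, A) (\<pi>', A'). A \<subseteq> A' \<and> (\<forall>x\<in>A. \<pi>' x = \<pi> x) \<and> ?e n \<in> A' \<and> ?e n \<in> \<pi>' ` A' \<and>
    (\<forall>\<rho>\<in>G. \<rho> ` H = H \<and> (\<forall>x\<in>A'. \<rho> x = \<pi>' x) \<longrightarrow> \<not> (\<exists>\<tau>\<in>stab H. map \<tau> (map \<rho> a) = ?t n)))"
  have GD: "set (map \<pi> a) \<subseteq> D" if "\<pi> \<in> G" for \<pi> using G_mem[OF that] a by auto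
  have step: "\<exists>y. OK y \<and> St n x y" if x: "OK x" for x n
  proof -
    obtain \<pi> A where xA: "x = (\<pi>, A)" and \<pi>: "\<pi> \<in> G" "\<pi> ` H = H" "finite A" "A \<subseteq> H"
      using x unfolding OK_def by (cases x) auto
    obtain \<pi>' h where \<pi>': "\<pi>' \<in> G" "\<pi>' ` H = H" "\<And>x. x \<in> A \<Longrightarrow> \<pi>' x = \<pi> x"
      and h: "set h \<subseteq> H" "\<not> conjg {} (map \<pi>' a @ h) (?t n @ h)"
    \<comment> \<open>If the image of \<open>a\<close> already differs in type over \<open>H\<close>
      from the n-th target, nothing is changed. Otherwise the map is precomposed with the inverse of
      some \<open>\<kappa>\<close> that fixes \<open>A\<close> and changes the type of
      \<open>a\<close> over \<open>H\<close>.\<close>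
    proof (cases "\<exists>h. set h \<subseteq> H \<and> \<not> conjg {} (map \<pi> a @ h) (?t n @ h)")
      case True
      then obtain h where "set h \<subseteq> H" "\<not> conjg {} (map \<pi> a @ h) (?t n @ h)" by (elim exE conjE)
      then show ?thesis by (intro that[of \<pi> h] \<pi>) simp_all
    next
      case False
      obtain \<kappa> h where \<kappa>: "\<kappa> \<in> stab A" "\<kappa> ` H = H" "set h \<subseteq> H" "\<not> conjg {} (a @ h) (a @ map \<kappa> h)"
        using no[OF \<pi>(3,4)] by (elim bexE exE conjE)
      have AD: "A \<subseteq> D" using \<pi>(4) H(2) by (rule order_trans)
      obtain \<mu> where \<mu>: "\<mu> \<in> stab A" "\<forall>x\<in>D. \<mu> (\<kappa> x) = x \<and> \<kappa> (\<mu> x) = x"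
        using stab_inv[OF \<kappa>(1) AD] by blast
      let ?s = "\<lambda>x. \<pi> (\<mu> x)"
      have s: "?s \<in> G" by (rule G_comp[OF \<pi>(1) stab_G[OF \<mu>(1)]])
      have "\<mu> ` H = H"
      proof -
        have "\<mu> ` (\<kappa> ` H) = H" using \<mu>(2) H(2) by (force simp: image_image)
        then show ?thesis unfolding \<kappa>(2) .
      qed
      then have sH: "?s ` H = H" using \<pi>(2) by (metis image_image)
      have hD: "set h \<subseteq> D" "set (map \<kappa> h) \<subseteq> D" using \<kappa>(2,3) H(2) by auto
      have \<mu>h: "map \<mu> (map \<kappa> h) = h" using \<mu>(2) hD(1) by (auto intro!: map_idI)
      have 1: "conjg {} (a @ map \<kappa> h) (map ?s a @ map \<pi> h)"
      proof -
        have "map ?s (map \<kappa> h) = map \<pi> (map \<mu> (map \<kappa> h))" by simp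
        then have "map ?s (map \<kappa> h) = map \<pi> h" unfolding \<mu>h .
        then show ?thesis
          using conjg_image[of ?s "{}" "a @ map \<kappa> h"] s unfolding stab_empty map_append by (simp only:)
      qed
      have 2: "conjg {} (a @ h) (map \<pi> a @ map \<pi> h)"
        using conjg_image[of \<pi> "{}" "a @ h"] \<pi>(1) unfolding stab_empty by simp
      have \<pi>h: "set (map \<pi> h) \<subseteq> H" using \<pi>(2) \<kappa>(3) by auto
      then have 3: "conjg {} (map \<pi> a @ map \<pi> h) (?t n @ map \<pi> h)" using False by blast
      have sD: "set (map ?s a @ map \<pi> h) \<subseteq> D" using GD[OF s] \<pi>h H(2) by simp
      have "\<not> conjg {} (map ?s a @ map \<pi> h) (?t n @ map \<pi> h)"
      proof
        assume 4: "conjg {} (map ?s a @ map \<pi> h) (?t n @ map \<pi> h)"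
        have "conjg {} (a @ map \<kappa> h) (?t n @ map \<pi> h)" by (rule conjg_trans[OF 1 4])
        then have "conjg {} (?t n @ map \<pi> h) (a @ map \<kappa> h)"
          by (rule conjg_sym) (use a hD in simp_all)
        with conjg_trans[OF 2 3] have "conjg {} (a @ h) (a @ map \<kappa> h)" by (rule conjg_trans)
        with \<kappa>(4) show False by (rule notE)
      qed
      then show ?thesis
        by (intro that[of ?s "map \<pi> h"] s sH \<pi>h) (use stab_fix[OF \<mu>(1)] in simp)
    qed
    have inv: "\<exists>x\<in>H. \<pi>' x = y" if y: "y \<in> H" for y
    proof -
      have "y \<in> \<pi>' ` H" using y unfolding \<pi>'(2) .
      then show ?thesis by auto
    qed
    obtain z where z: "z \<in> H" "\<pi>' z = ?e n" using inv[OF eH] by blast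
    have "\<exists>g. set g \<subseteq> H \<and> map \<pi>' g = h" using h(1)
    proof (induction h)
      case (Cons y h)
      then obtain g where "set g \<subseteq> H" "map \<pi>' g = h" by auto
      moreover obtain x where "x \<in> H" "\<pi>' x = y" using inv Cons.prems by auto
      ultimately show ?case by (intro exI[of _ "x # g"]) simp
    qed simp
    then obtain g where g: "set g \<subseteq> H" "map \<pi>' g = h" by blast
    \<comment> \<open>Freezing the preimage \<open>g\<close> of \<open>h\<close> preserves the
      witness: any \<open>\<rho>\<close> agreeing with \<open>\<pi>'\<close> there gives its image
      of \<open>a\<close> the same type over \<open>h\<close> as before.\<close>
    let ?A' = "A \<union> {?e n, z} \<union> set g"
    have "\<not> (\<exists>\<tau>\<in>stab H. map \<tau> (map \<rho> a) = ?t n)"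
      if \<rho>: "\<rho> \<in> G" "\<rho> ` H = H" "\<forall>x\<in>?A'. \<rho> x = \<pi>' x" for \<rho>
    proof
      assume "\<exists>\<tau>\<in>stab H. map \<tau> (map \<rho> a) = ?t n"
      then obtain \<tau> where \<tau>: "\<tau> \<in> stab H" "map \<tau> (map \<rho> a) = ?t n" by blast
      have "map \<tau> h = h" using stab_fix[OF \<tau>(1)] h(1) by (intro map_idI) blast
      then have 1: "conjg {} (map \<rho> a @ h) (?t n @ h)"
        using conjg_image[of \<tau> "{}" "map \<rho> a @ h"] stab_G[OF \<tau>(1)] \<tau>(2) unfolding stab_empty by simp
      have "map \<rho> g = h" using \<rho>(3) g(2) by auto
      then have 2: "conjg {} (a @ g) (map \<rho> a @ h)"
        using conjg_image[of \<rho> "{}" "a @ g"] \<rho>(1) unfolding stab_empty by simp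
      have 3: "conjg {} (a @ g) (map \<pi>' a @ h)"
        using conjg_image[of \<pi>' "{}" "a @ g"] \<pi>'(1) g(2) unfolding stab_empty by simp
      have "conjg {} (map \<pi>' a @ h) (a @ g)"
        using a g(1) H(2) by (intro conjg_sym[OF 3]) auto
      from h(2) conjg_trans[OF conjg_trans[OF this 2] 1] show False by (rule notE)
    qed
    then have "St n (\<pi>, A) (\<pi>', ?A')"
      unfolding St_def using \<pi>'(3) z(2) by (auto intro: image_eqI[of _ _ z])
    moreover have "OK (\<pi>', ?A')" unfolding OK_def using \<pi>' \<pi>(3,4) eH z(1) g(1) by auto
    ultimately show ?thesis unfolding xA by blast
  qed
  have "\<exists>f. \<forall>n. OK (f n) \<and> St n (f n) (f (Suc n))"
  proof (rule dependent_nat_choice)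
    show "\<exists>x. OK x" unfolding OK_def using G_id by (intro exI[of _ "(\<lambda>x. x, {})"]) simp
  qed (rule step)
  then obtain f where f0: "\<forall>n. OK (f n) \<and> St n (f n) (f (Suc n))" by (rule exE)
  have f: "\<And>n. OK (f n)" "\<And>n. St n (f n) (f (Suc n))" using f0 by simp_all
  define s where "s = (\<lambda>n. fst (f n))"
  define A where "A = (\<lambda>n. snd (f n))"
  have fs: "f n = (s n, A n)" for n unfolding s_def A_def by simp
  have s: "s n \<in> G" "s n ` H = H" "finite (A n)" "A n \<subseteq> H" for n
    using f(1)[of n] unfolding fs OK_def by auto
  have A: "A n \<subseteq> A (Suc n)" "\<And>x. x \<in> A n \<Longrightarrow> s (Suc n) x = s n x" "?e n \<in> A (Suc n)"
    "?e n \<in> s (Suc n) ` A (Suc n)"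
    "\<And>\<rho>. \<rho> \<in> G \<Longrightarrow> \<rho> ` H = H \<Longrightarrow> (\<And>x. x \<in> A (Suc n) \<Longrightarrow> \<rho> x = s (Suc n) x) \<Longrightarrow>
      \<not> (\<exists>\<tau>\<in>stab H. map \<tau> (map \<rho> a) = ?t n)" for n
    using f(2)[of n] unfolding fs St_def by auto
  define P where "P = (\<lambda>n. (\<lambda>x. (x, s n x)) ` A n)"
  have PS: "P n \<subseteq> P (Suc n)" for n
  proof
    fix z assume "z \<in> P n"
    then obtain x where x: "x \<in> A n" "z = (x, s n x)" unfolding P_def by blast
    then have "z = (x, s (Suc n) x)" "x \<in> A (Suc n)" using A(2)[OF x(1)] A(1)[of n] by auto
    then show "z \<in> P (Suc n)" unfolding P_def by blast
  qed
  have PH: "P n \<subseteq> H \<times> H" for n unfolding P_def using s(2,4)[of n] by auto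
  have "\<exists>\<pi>\<in>G. \<forall>(x, y)\<in>(\<Union>n. P n). \<pi> x = y"
  proof (rule limit[OF H])
    have "y \<in> Domain (\<Union>n. P n) \<and> y \<in> Range (\<Union>n. P n)" if y: "y \<in> H" for y
    proof -
      obtain n where "y = ?e n" using enum[OF y] by blast
      then have "y \<in> A (Suc n)" "y \<in> s (Suc n) ` A (Suc n)" using A(3,4)[of n] by simp_all
      then have "y \<in> Domain (P (Suc n))" "y \<in> Range (P (Suc n))" unfolding P_def by auto
      then show ?thesis by blast
    qed
    then show "Domain (\<Union>n. P n) = H" "Range (\<Union>n. P n) = H" using PH by blast+
    fix q assume q: "finite q" "q \<subseteq> (\<Union>n. P n)"
    from finite_subset_chain[OF q PS] obtain n where "q \<subseteq> P n" by blast
    then show "\<exists>\<pi>\<in>G. \<forall>(x, y)\<in>q. \<pi> x = y"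
      using s(1)[of n] unfolding P_def by (intro bexI[of _ "s n"]) auto
  qed
  then obtain \<pi> where \<pi>0: "\<pi> \<in> G" "\<forall>(x, y)\<in>(\<Union>n. P n). \<pi> x = y" by (elim bexE)
  have \<pi>: "\<pi> \<in> G" "\<And>x y n. (x, y) \<in> P n \<Longrightarrow> \<pi> x = y" using \<pi>0 by auto
  have \<pi>A: "\<pi> x = s n x" if "x \<in> A n" for x n using \<pi>(2)[of x "s n x" n] that unfolding P_def by blast
  have "\<pi> ` H = H"
  proof
    show "\<pi> ` H \<subseteq> H"
    proof
      fix z assume "z \<in> \<pi> ` H"
      then obtain x n where "z = \<pi> x" "x = ?e n" using enum by blast
      then have "z = \<pi> (?e n)" by simp
      then have "z = s (Suc n) (?e n)" using \<pi>A A(3) by simp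
      then show "z \<in> H" using s(2) eH by blast
    qed
    show "H \<subseteq> \<pi> ` H"
    proof
      fix y assume "y \<in> H"
      then obtain n where "y = ?e n" using enum by blast
      then obtain x where "x \<in> A (Suc n)" "y = s (Suc n) x" using A(4)[of n] by blast
      then have "y = \<pi> x" "x \<in> H" using \<pi>A[of x "Suc n"] s(4)[of "Suc n"] by auto
      then show "y \<in> \<pi> ` H" by (rule image_eqI)
    qed
  qed
  then have "\<not> (\<exists>\<tau>\<in>stab H. map \<tau> (map \<pi> a) = ?t n)" for n
    by (rule A(5)[OF \<pi>(1)]) (rule \<pi>A)
  moreover obtain \<tau> where \<tau>: "\<tau> \<in> stab H" "map \<tau> (map \<pi> a) \<in> T" using T(2)[OF GD[OF \<pi>(1)]] by blast
  moreover have "map \<tau> (map \<pi> a) \<in> range ?t" using \<tau>(2) t by simp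
  then obtain n where "map \<tau> (map \<pi> a) = ?t n" by (rule rangeE)
  ultimately show False by blast
qed

text \<open>\<open>type_support\<close> concerns automorphisms of a countable \<open>H\<close>,
  whereas \<open>b\<close> and \<open>c\<close> are arbitrary tuples from which \<open>e\<close> is
  free. An automorphism fixing \<open>e\<close>, and hence \<open>a\<close>, moves \<open>b\<close>
  and \<open>c\<close> into \<open>H\<close>, where \<open>conjg_within\<close> realises their
  conjugacy by an automorphism preserving \<open>H\<close>.\<close>

lemma nonsplitting:
  assumes A: "A \<subseteq> D" "cl A = A" "inf_dim A" and e: "indep A e" and a: "set a \<subseteq> cl (A \<union> set e)"
  shows "\<exists>B. finite B \<and> B \<subseteq> A \<and> set a \<subseteq> cl (B \<union> set e) \<and>
    (\<forall>b c. set b \<subseteq> D \<and> set c \<subseteq> D \<and> indep (B \<union> set b \<union> set c) e \<and> conjg B b c \<longrightarrow> conjg B (a @ b) (a @ c))"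
proof -
  have eD: "set e \<subseteq> D" by (rule indep_D[OF e])
  have AeD: "A \<union> set e \<subseteq> D" using A(1) eD by simp
  have aD: "set a \<subseteq> D" using a cl_D[OF AeD] by (rule order_trans)
  obtain B1 where B1: "finite B1" "B1 \<subseteq> A" "set a \<subseteq> cl (B1 \<union> set e)"
    using cl_finite_set[OF _ a A(1) eD] by auto
  obtain i where i0: "\<forall>n::nat. i n \<in> A \<and> i n \<notin> cl (B1 \<union> i ` {..<n})"
    using inf_dim_free_seq[OF A B1(1,2)] by (rule exE)
  have iA: "\<And>n. i n \<in> A" and i2: "\<And>n. i n \<notin> cl (B1 \<union> {} \<union> i ` {..<n})"
    unfolding Un_empty_right by (rule conjunct1[OF i0[rule_format]], rule conjunct2[OF i0[rule_format]])
  have i: "\<And>n. i n \<in> D" "\<And>n. i n \<notin> cl (B1 \<union> {} \<union> i ` {..<n})" "range i \<subseteq> A"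
    by (rule subsetD[OF A(1) iA], rule i2, rule image_subsetI, rule iA)
  have B1D: "B1 \<subseteq> D" using B1(2) A(1) by (rule order_trans)
  have BiD: "B1 \<union> range i \<subseteq> D" "countable (B1 \<union> range i)" "B1 \<union> range i \<subseteq> A"
    using B1(2) B1D i(1,3) countable_finite[OF B1(1)] by auto
  define H where "H = cl (B1 \<union> range i)"
  have H: "countable H" "H \<subseteq> D" "cl H = H" "inf_dim H"
    unfolding H_def using countable_cl[OF BiD(2,1)] cl_D[OF BiD(1)] cl_idem[OF BiD(1)]
      free_seq_inf_dim[OF B1D empty_subsetI i(1,2)] by simp_all
  have HA: "H \<subseteq> A" unfolding H_def using cl_mono[OF BiD(3) A(1)] A(2) by simp
  have B1H: "B1 \<subseteq> H" unfolding H_def using cl_sub[OF BiD(1)] by simp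
  obtain B2 where B2: "finite B2" "B2 \<subseteq> H" "\<And>\<pi> h. \<pi> \<in> stab B2 \<Longrightarrow> \<pi> ` H = H \<Longrightarrow> set h \<subseteq> H \<Longrightarrow>
      conjg {} (a @ h) (a @ map \<pi> h)"
    using type_support[OF H aD] by (elim exE conjE) auto
  let ?B = "B1 \<union> B2"
  have B: "finite ?B" "?B \<subseteq> H" "?B \<subseteq> D" "?B \<subseteq> A" "countable ?B"
    using B1(1) B2(1,2) B1H H(2) HA by (auto simp: countable_finite)
  have eH: "indep H e" using indep_antimono[OF e _ A(1), of H] HA A(2) by simp
  have aB: "set a \<subseteq> cl (?B \<union> set e)"
    by (rule order_trans[OF B1(3) cl_mono]) (use B(3) eD in auto)
  have main: "conjg ?B (a @ b) (a @ c)"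
    if b: "set b \<subseteq> D" and c: "set c \<subseteq> D" and ebc: "indep (?B \<union> set b \<union> set c) e" and bc: "conjg ?B b c" for b c
  proof -
    have bcD: "set (b @ c) \<subseteq> D" "?B \<union> set b \<union> set c \<subseteq> D" using b c B(3) by simp_all
    obtain d where d: "indep ?B d" "set d \<subseteq> set (b @ c)" "set (b @ c) \<subseteq> cl (?B \<union> set d)"
      using ex_basis[OF B(3) bcD(1)] by blast
    have dD: "set d \<subseteq> D" by (rule indep_D[OF d(1)])
    have "?B \<union> set d \<subseteq> cl (?B \<union> set b \<union> set c)"
      using cl_sub[OF bcD(2)] d(2) by auto
    from indep_swap_over[OF d(1) indep_antimono[OF ebc this bcD(2)] B(3)]
    have d': "indep (?B \<union> set e) d" .
    obtain d2 where d2: "length d2 = length d" "indep ?B d2" "set d2 \<subseteq> H"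
      using inf_dim_indep[OF H(2-4) B(1,2)] by blast
    have "?B \<union> set d2 \<subseteq> cl H" unfolding H(3) using B(2) d2(3) by simp
    from indep_swap_over[OF d2(2) indep_antimono[OF eH this H(2)] B(3)]
    have d2': "indep (?B \<union> set e) d2" .
    have Be: "countable (?B \<union> set e)" "?B \<union> set e \<subseteq> D" using B(3,5) eD by (simp_all add: countable_finite)
    \<comment> \<open>The basis \<open>d\<close> of \<open>b\<close> and \<open>c\<close>, and its
      copy \<open>d2\<close> in \<open>H\<close>, are both independent over \<open>?B\<close> and
      \<open>e\<close>. So \<open>\<tau>\<close> can fix \<open>e\<close> while it moves
      \<open>d\<close> into \<open>H\<close>.\<close>
    obtain \<tau> where \<tau>: "\<tau> \<in> stab (cl (?B \<union> set e))" "map \<tau> d = d2"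
      using homog_list[OF Be d' d2' d2(1)[symmetric]] by blast
    have \<tau>B: "\<tau> \<in> stab ?B" by (rule stab_mono[OF _ stab_cl[OF \<tau>(1) Be(2)]]) simp
    have \<tau>clB: "\<tau> \<in> stab (cl ?B)" by (rule stab_mono[OF cl_mono[OF Un_upper1 Be(2)] \<tau>(1)])
    have "set (map \<tau> (b @ c)) \<subseteq> cl (?B \<union> set d2)"
      using stab_image_cl[OF \<tau>clB B(3) dD d(3)] unfolding \<tau>(2) .
    also have "\<dots> \<subseteq> H" using cl_mono[of "?B \<union> set d2" H] B(2) d2(3) H(2,3) by simp
    finally have bcH: "set (map \<tau> b) \<subseteq> H" "set (map \<tau> c) \<subseteq> H" by simp_all
    have \<tau>a: "map \<tau> a = a" using stab_fix[OF \<tau>(1)] aB by (intro map_idI) auto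
    have "conjg ?B (map \<tau> b) b" by (rule conjg_sym[OF conjg_image[OF \<tau>B] B(3) b])
    from conjg_trans[OF conjg_trans[OF this bc] conjg_image[OF \<tau>B]]
    have "conjg ?B (map \<tau> b) (map \<tau> c)" .
    from conjg_within[OF H B(1,2) bcH this]
    obtain \<kappa> where \<kappa>: "\<kappa> \<in> stab ?B" "\<kappa> ` H = H" "map \<kappa> (map \<tau> b) = map \<tau> c" by blast
    \<comment> \<open>\<open>type_support\<close> gives conjugacy over the empty set; appending an
      enumeration of \<open>?B\<close> to the tuples makes it conjugacy over
      \<open>?B\<close>.\<close>
    obtain l where l: "set l = ?B" using finite_list[OF B(1)] by blast
    have \<kappa>l: "map \<kappa> l = l" using stab_fix[OF \<kappa>(1)] l by (intro map_idI) simp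
    have lH: "set (map \<tau> b @ l) \<subseteq> H" using bcH(1) l B(2) by simp
    have "conjg {} (a @ map \<tau> b @ l) (a @ map \<kappa> (map \<tau> b @ l))"
      by (rule B2(3)[OF stab_mono[OF _ \<kappa>(1)] \<kappa>(2) lH]) simp
    then have "conjg {} ((a @ map \<tau> b) @ l) ((a @ map \<tau> c) @ l)" unfolding map_append \<kappa>(3) \<kappa>l by simp
    moreover have len: "length (a @ map \<tau> b) = length (a @ map \<tau> c)" using conjg_length[OF bc] by simp
    ultimately have "conjg ?B (a @ map \<tau> b) (a @ map \<tau> c)"
      using conjg_params[OF len, of "{}" l] l by simp
    then have 2: "conjg ?B (map \<tau> (a @ b)) (map \<tau> (a @ c))" by (simp add: \<tau>a)
    have abD: "set (a @ b) \<subseteq> D" "set (a @ c) \<subseteq> D" using aD b c by simp_all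
    show ?thesis
      by (rule conjg_trans[OF conjg_trans[OF conjg_image[OF \<tau>B] 2] conjg_sym[OF conjg_image[OF \<tau>B] B(3) abD(2)]])
  qed
  show ?thesis
    by (rule exI[of _ ?B], intro conjI allI impI B(1,4) aB) (elim conjE, rule main)
qed

end

lemma map_fix: "map f xs = xs \<Longrightarrow> x \<in> set xs \<Longrightarrow> f x = x"
  by (induction xs) auto

section \<open>Stationary types\<close>

context pregeom begin

text \<open>If finitely many elements spanned the larger set, then \<open>A\<close> would lie in the
  closure of \<open>d\<close> and a finite \<open>F' \<subseteq> A\<close>. An \<open>x\<close> in
  \<open>A\<close> outside \<open>cl F'\<close> could then replace \<open>d\<close> by exchange,
  leaving no room for a further independent \<open>y\<close> in \<open>A\<close>.\<close>

lemma inf_dim_insert: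
  assumes A: "A \<subseteq> D" "cl A = A" "inf_dim A" and d: "d \<in> D"
  shows "inf_dim (cl (insert d A))"
  unfolding inf_dim_def
proof (rule notI, elim exE conjE)
  fix F assume F: "finite F" "F \<subseteq> cl (insert d A)" "cl F = cl (insert d A)"
  have dA: "insert d A \<subseteq> D" using A(1) d by simp
  have FD: "F \<subseteq> D" using F(2) cl_D[OF dA] by (rule order_trans)
  have "F \<subseteq> cl (A \<union> {d})" using F(2) by simp
  then obtain F' where F': "finite F'" "F' \<subseteq> A" "F \<subseteq> cl (F' \<union> {d})"
    using cl_finite_set[OF F(1) _ A(1), of "{d}"] d by auto
  have F'D: "F' \<subseteq> D" "F' \<union> {d} \<subseteq> D" using F'(2) A(1) d by auto
  have "A \<subseteq> cl F" unfolding F(3) using cl_sub[OF dA] by simp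
  also have "cl F \<subseteq> cl (F' \<union> {d})" by (rule cl_minimal[OF F'(3) F'D(2)])
  finally have sub: "A \<subseteq> cl (insert d F')" by simp
  obtain x where x: "x \<in> A" "x \<notin> cl F'" using inf_dim_outside[OF A F'(1,2)] by blast
  have "finite (insert x F')" "insert x F' \<subseteq> A" using F'(1,2) x(1) by simp_all
  then obtain y where y: "y \<in> A" "y \<notin> cl (insert x F')" using inf_dim_outside[OF A] by blast
  have xD: "x \<in> D" "insert x F' \<subseteq> D" using x(1) A(1) F'D(1) by auto
  have "d \<in> cl (insert x F')"
    by (rule exchange[OF F'D(1) xD(1) d _ x(2)]) (use sub x(1) in blast)
  then have "insert d F' \<subseteq> cl (insert x F')" using cl_sub[OF xD(2)] by simp
  from cl_minimal[OF this xD(2)] sub y show False by blast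
qed

lemma indep_free_seq:
  fixes i :: "nat \<Rightarrow> 'a"
  assumes "indep C ds" "C \<subseteq> D" "E \<subseteq> D" "set ds \<subseteq> E"
    and "\<And>n. i n \<in> D" "\<And>n. i n \<notin> cl (C \<union> E \<union> i ` {..<n})"
  shows "indep (C \<union> range i) ds"
  using assms(1,2,4,6)
proof (induction ds arbitrary: C)
  case (Cons d ds)
  have d: "d \<in> D" "d \<notin> cl C" "indep (insert d C) ds" "d \<in> E" "set ds \<subseteq> E" using Cons.prems(1,3) by auto
  have CE: "C \<union> E \<subseteq> D" using Cons.prems(2) assms(3) by simp
  have "d \<in> cl (C \<union> E)" using cl_sub[OF CE] d(4) by auto
  then have "d \<notin> cl (C \<union> range i)"
    using free_seq_range[OF Cons.prems(2) assms(3,5) Cons.prems(4)] d(2) by blast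
  moreover have "insert d C \<union> E = C \<union> E" using d(4) by auto
  then have "indep (insert d C \<union> range i) ds"
    using Cons.IH[OF d(3) _ d(5)] Cons.prems(2,4) d(1) by simp
  ultimately show ?case using d(1) by simp
qed simp

end

context homog_pregeom begin

text \<open>The head carries the dimension and the remaining entries are meant to lie in its closure
  over the parameters. The last clause is non-splitting over \<open>B\<close>, limited to tuples
  from which the head is free.\<close>

definition stationary :: "'a set \<Rightarrow> 'a list \<Rightarrow> bool" where
  "stationary B x \<longleftrightarrow> set x \<subseteq> D \<and> x \<noteq> [] \<and>
    (\<forall>b c. set b \<subseteq> D \<and> set c \<subseteq> D \<and> hd x \<notin> cl (B \<union> set b \<union> set c) \<and> conjg B b c \<longrightarrow> conjg B (x @ b) (x @ c))"

lemma ex_stationary: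
  assumes "A \<subseteq> D" "cl A = A" "inf_dim A" "x \<noteq> []" "hd x \<in> D" "hd x \<notin> A" "set x \<subseteq> cl (insert (hd x) A)"
  shows "\<exists>B. finite B \<and> B \<subseteq> A \<and> stationary B x"
proof -
  have i: "indep A [hd x]" using assms(2,5,6) by simp
  have s: "set x \<subseteq> cl (A \<union> set [hd x])" using assms(7) by simp
  from nonsplitting[OF assms(1-3) i s] obtain B where B: "finite B" "B \<subseteq> A" 
    "\<And>b c. set b \<subseteq> D \<and> set c \<subseteq> D \<and> indep (B \<union> set b \<union> set c) [hd x] \<and> conjg B b c \<Longrightarrow> conjg B (x @ b) (x @ c)"
    by (elim exE conjE) auto
  have "set x \<subseteq> D" using assms(7) cl_D[of "insert (hd x) A"] assms(1,5) by auto
  then have "stationary B x" unfolding stationary_def using B(3) assms(4,5) by simp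
  with B(1,2) show ?thesis by blast
qed

text \<open>The two conjugating automorphisms pull \<open>C\<close> back to tuples \<open>b1\<close>
  and \<open>b2\<close> of the same type over \<open>A\<close>, each with \<open>hd x\<close> free
  from it. It remains to compare \<open>x\<close> together with \<open>b1\<close> and
  \<open>x\<close> together with \<open>b2\<close>, which is a matter of non-splitting.\<close>

lemma stationary_conjg:
  assumes st: "stationary B x" and A: "finite A" "A \<subseteq> D" "B \<subseteq> A"
    and x': "conjg A x x'" "conjg A x x''" and C: "finite C" "C \<subseteq> D"
    and gen: "hd x' \<notin> cl (A \<union> C)" "hd x'' \<notin> cl (A \<union> C)"
  shows "conjg (A \<union> C) x' x''"
proof -
  have xD: "set x \<subseteq> D" "x \<noteq> []" "hd x \<in> D"
    and ns: "\<And>b c. set b \<subseteq> D \<Longrightarrow> set c \<subseteq> D \<Longrightarrow> hd x \<notin> cl (B \<union> set b \<union> set c) \<Longrightarrow> conjg B b c \<Longrightarrow>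
      conjg B (x @ b) (x @ c)"
    using st unfolding stationary_def by auto
  obtain c where c: "set c = C" using finite_list[OF C(1)] by blast
  obtain l where l: "set l = A" using finite_list[OF A(1)] by blast
  have pull: "\<exists>b. set b \<subseteq> D \<and> conjg A (y @ c) (x @ b) \<and> conjg A c b \<and> hd x \<notin> cl (A \<union> set b)"
    if y: "conjg A x y" "hd y \<notin> cl (A \<union> C)" for y
  proof -
    obtain \<pi> where \<pi>: "\<pi> \<in> stab A" "map \<pi> x = y" using y(1) unfolding conjg_def by blast
    obtain \<tau> where \<tau>: "\<tau> \<in> stab A" "\<forall>x\<in>D. \<tau> (\<pi> x) = x \<and> \<pi> (\<tau> x) = x" using stab_inv[OF \<pi>(1) A(2)] by blast
    have "map \<tau> y = x" unfolding \<pi>(2)[symmetric] using \<tau>(2) xD(1) by (auto intro!: map_idI)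
    then have "conjg A (y @ c) (x @ map \<tau> c)" using conjg_image[OF \<tau>(1), of "y @ c"] by simp
    moreover have bD: "set (map \<tau> c) \<subseteq> D" using G_image[OF stab_G[OF \<tau>(1)] C(2)] c by simp
    moreover have "hd x \<notin> cl (A \<union> set (map \<tau> c))"
    proof
      assume *: "hd x \<in> cl (A \<union> set (map \<tau> c))"
      have "map \<pi> (map \<tau> c) = c" using \<tau>(2) C(2) c by (auto intro!: map_idI)
      then have "\<pi> ` set (map \<tau> c) = C" using c by (metis set_map)
      moreover have "\<pi> ` A = A" using stab_fix[OF \<pi>(1)] by force
      ultimately have "\<pi> ` (A \<union> set (map \<tau> c)) = A \<union> C" by (simp only: image_Un)
      moreover have "\<pi> (hd x) \<in> cl (\<pi> ` (A \<union> set (map \<tau> c)))"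
        using G_mem_cl[OF stab_G[OF \<pi>(1)] _ xD(3), of "A \<union> set (map \<tau> c)"] A(2) bD * by simp
      moreover have "\<pi> (hd x) = hd y" using \<pi>(2) xD(2) by (auto simp: hd_map)
      ultimately show False using y(2) by simp
    qed
    ultimately show ?thesis using conjg_image[OF \<tau>(1), of c] by blast
  qed
  obtain b1 where b1: "set b1 \<subseteq> D" "conjg A (x' @ c) (x @ b1)" "conjg A c b1" "hd x \<notin> cl (A \<union> set b1)"
    using pull[OF x'(1) gen(1)] by blast
  obtain b2 where b2: "set b2 \<subseteq> D" "conjg A (x'' @ c) (x @ b2)" "conjg A c b2" "hd x \<notin> cl (A \<union> set b2)"
    using pull[OF x'(2) gen(2)] by blast
  let ?E = "insert (hd x) (set b1 \<union> set b2)"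
  have E: "countable ?E" "?E \<subseteq> D" using xD(3) b1(1) b2(1) by (simp_all add: countable_finite)
  \<comment> \<open>\<open>hd x\<close> may depend on \<open>b1\<close> and \<open>b2\<close>
    jointly, so non-splitting does not apply to this pair. Each of them is compared instead with a
    third copy that is free from everything present.\<close>
  obtain \<tau> ds where \<tau>: "\<tau> \<in> stab (cl A)" and ds: "indep (A \<union> ?E) ds" "set (map \<tau> b1) \<subseteq> cl (A \<union> set ds)"
    using free_copy[OF A(1,2) E b1(1)] by blast
  have \<tau>A: "\<tau> \<in> stab A" by (rule stab_cl[OF \<tau> A(2)])
  let ?b3 = "map \<tau> b1"
  have b3D: "set ?b3 \<subseteq> D" using G_image[OF stab_G[OF \<tau>] b1(1)] by simp
  have dsD: "set ds \<subseteq> D" by (rule indep_D[OF ds(1)])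
  have key: "conjg A (x @ b) (x @ ?b3)"
    if b: "set b \<subseteq> set b1 \<union> set b2" "hd x \<notin> cl (A \<union> set b)" "conjg A b ?b3" for b
  proof -
    have bD: "set b \<subseteq> D" using b(1) E(2) by auto
    have AbD: "A \<union> set b \<subseteq> D" "A \<union> set b \<union> ?E \<subseteq> D" "A \<union> set b \<union> set ds \<subseteq> D"
      using A(2) bD E(2) dsD by simp_all
    have "hd x \<notin> cl (A \<union> set b \<union> set ds)"
    proof
      assume *: "hd x \<in> cl (A \<union> set b \<union> set ds)"
      have eq: "A \<union> set b \<union> ?E = A \<union> ?E" using b(1) by auto
      have "hd x \<in> cl (A \<union> set b \<union> ?E)" using cl_sub[OF AbD(2)] by auto
      from indep_Int[OF ds(1)[folded eq] AbD(1) E(2) this *] b(2) show False by blast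
    qed
    moreover have "cl (A \<union> set b \<union> set ?b3) \<subseteq> cl (A \<union> set b \<union> set ds)"
    proof (rule cl_minimal[OF _ AbD(3)])
      have "cl (A \<union> set ds) \<subseteq> cl (A \<union> set b \<union> set ds)" by (rule cl_mono[OF _ AbD(3)]) auto
      then show "A \<union> set b \<union> set ?b3 \<subseteq> cl (A \<union> set b \<union> set ds)"
        using cl_sub[OF AbD(3)] ds(2) by auto
    qed
    moreover have "B \<union> set (b @ l) \<union> set (?b3 @ l) = A \<union> set b \<union> set ?b3" using A(3) l by auto
    ultimately have "hd x \<notin> cl (B \<union> set (b @ l) \<union> set (?b3 @ l))" by auto
    moreover have len: "length b = length ?b3" by (rule conjg_length[OF b(3)])
    moreover have "conjg B (b @ l) (?b3 @ l)"
      using b(3) conjg_params[OF len, of B l] l A(3) by (simp add: Un_absorb1)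
    moreover have "set (b @ l) \<subseteq> D" "set (?b3 @ l) \<subseteq> D" using bD b3D l A(2) by simp_all
    ultimately have "conjg B ((x @ b) @ l) ((x @ ?b3) @ l)" using ns[of "b @ l" "?b3 @ l"] by simp
    then show ?thesis
      using conjg_params[of "x @ b" "x @ ?b3" B l] len l A(3) by (simp add: Un_absorb1)
  qed
  have c1: "conjg A b1 ?b3" by (rule conjg_image[OF \<tau>A])
  have cD: "set c \<subseteq> D" using c C(2) by simp
  have c2: "conjg A b2 ?b3"
    by (rule conjg_trans[OF conjg_trans[OF conjg_sym[OF b2(3) A(2) cD] b1(3)] c1])
  have x'D: "set x' \<subseteq> D" "set x'' \<subseteq> D" using conjg_D[OF x'(1) xD(1)] conjg_D[OF x'(2) xD(1)] by simp_all
  have k1: "conjg A (x @ b1) (x @ ?b3)" by (rule key[OF _ b1(4) c1]) simp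
  have k2: "conjg A (x @ b2) (x @ ?b3)" by (rule key[OF _ b2(4) c2]) simp
  have "set (x @ b2) \<subseteq> D" "set (x'' @ c) \<subseteq> D" using xD(1) b2(1) x'D(2) cD by simp_all
  note s = conjg_sym[OF k2 A(2) this(1)] conjg_sym[OF b2(2) A(2) this(2)]
  have "conjg A (x' @ c) (x'' @ c)"
    by (rule conjg_trans[OF conjg_trans[OF conjg_trans[OF b1(2) k1] s(1)] s(2)])
  moreover have "length x' = length x''" using conjg_length[OF x'(1)] conjg_length[OF x'(2)] by simp
  ultimately show ?thesis using conjg_params[of x' x'' A c] c by simp
qed

end

section \<open>Ranks\<close>

text \<open>An ambient structure \<open>N\<close> all of whose elements are imaginaries of the pregeometry:
  \<open>act\<close> is the induced action of the automorphisms, \<open>hm\<close> the embedding of the home sort, and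
  \<open>mdl\<close> sends the underlying set of a model to the corresponding model inside \<open>N\<close>.\<close>

locale interp = homog_pregeom D cl G
  for D :: "'a set" and cl and G +
  fixes Mods :: "'a set set" and N :: "('c, 'g, 's) ambient"
    and act :: "('a \<Rightarrow> 'a) \<Rightarrow> 'c \<Rightarrow> 'c" and hm :: "'a \<Rightarrow> 'c" and mdl :: "'a set \<Rightarrow> 'c set"
  assumes act_Aut: "\<pi> \<in> G \<Longrightarrow> act \<pi> \<in> Aut N {}"
    and Aut_act: "\<theta> \<in> Aut N {} \<Longrightarrow> \<exists>\<pi>\<in>G. \<forall>u\<in>elems N. \<theta> u = act \<pi> u"
    and act_comp: "\<pi> \<in> G \<Longrightarrow> \<tau> \<in> G \<Longrightarrow> u \<in> elems N \<Longrightarrow> act (\<lambda>x. \<pi> (\<tau> x)) u = act \<pi> (act \<tau> u)"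
    and act_cong: "\<pi> \<in> G \<Longrightarrow> (\<forall>x\<in>D. \<pi> x = x) \<Longrightarrow> u \<in> elems N \<Longrightarrow> act \<pi> u = u"
    and act_mem: "\<pi> \<in> G \<Longrightarrow> u \<in> elems N \<Longrightarrow> act \<pi> u \<in> elems N"
    and hm_mem: "a \<in> D \<Longrightarrow> hm a \<in> elems N"
    and act_hm: "\<pi> \<in> G \<Longrightarrow> a \<in> D \<Longrightarrow> act \<pi> (hm a) = hm (\<pi> a)"
    and hm_inj: "inj_on hm D"
    and models_mdl: "models N = mdl ` Mods"
    and Mods_closed: "A \<in> Mods \<Longrightarrow> A \<subseteq> D \<and> cl A = A \<and> inf_dim A"
    and Mods_countable: "countable A \<Longrightarrow> A \<subseteq> D \<Longrightarrow> cl A = A \<Longrightarrow> inf_dim A \<Longrightarrow> A \<in> Mods"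
    and mdl_elems: "A \<in> Mods \<Longrightarrow> mdl A \<subseteq> elems N"
    and mdl_mono: "A \<subseteq> A' \<Longrightarrow> mdl A \<subseteq> mdl A'"
    and hm_mdl: "A \<in> Mods \<Longrightarrow> a \<in> D \<Longrightarrow> hm a \<in> mdl A \<longleftrightarrow> a \<in> A"
    and mdl_supp: "A \<in> Mods \<Longrightarrow> u \<in> mdl A \<Longrightarrow> \<exists>b. set b \<subseteq> A \<and> (\<forall>\<pi>\<in>stab (set b). act \<pi> u = u)"
    and rep: "u \<in> elems N \<Longrightarrow> \<exists>a. set a \<subseteq> D \<and> (\<forall>\<pi>\<in>G. \<forall>A\<in>Mods. \<pi> ` set a \<subseteq> A \<longrightarrow> act \<pi> u \<in> mdl A)"
begin

definition supp :: "'a list \<Rightarrow> 'c list \<Rightarrow> bool" where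
  "supp a us \<longleftrightarrow> (\<forall>\<pi>\<in>stab (set a). map (act \<pi>) us = us)"

lemma Aut_eq: "Aut N A = {\<tau>\<in>Aut N {}. \<forall>a\<in>A. \<tau> a = a}"
  unfolding Aut_def by auto

lemma galois_tp_act:
  assumes "set us \<subseteq> elems N" "A \<subseteq> elems N"
  shows "galois_tp N us A = {map (act \<rho>) us | \<rho>. \<rho> \<in> G \<and> (\<forall>a\<in>A. act \<rho> a = a)}"
proof
  show "galois_tp N us A \<subseteq> {map (act \<rho>) us | \<rho>. \<rho> \<in> G \<and> (\<forall>a\<in>A. act \<rho> a = a)}"
  proof
    fix vs assume "vs \<in> galois_tp N us A"
    then obtain \<tau> where \<tau>: "\<tau> \<in> Aut N {}" "\<forall>a\<in>A. \<tau> a = a" "vs = map \<tau> us"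
      unfolding galois_tp_def by (subst (asm) Aut_eq) blast
    obtain \<rho> where \<rho>: "\<rho> \<in> G" "\<forall>u\<in>elems N. \<tau> u = act \<rho> u" using Aut_act[OF \<tau>(1)] by blast
    have "vs = map (act \<rho>) us" unfolding \<tau>(3) using \<rho>(2) assms(1) by auto
    moreover have "\<forall>a\<in>A. act \<rho> a = a" using \<rho>(2) \<tau>(2) assms(2) by (metis subsetD)
    ultimately show "vs \<in> {map (act \<rho>) us | \<rho>. \<rho> \<in> G \<and> (\<forall>a\<in>A. act \<rho> a = a)}" using \<rho>(1) by blast
  qed
  show "{map (act \<rho>) us | \<rho>. \<rho> \<in> G \<and> (\<forall>a\<in>A. act \<rho> a = a)} \<subseteq> galois_tp N us A"
    unfolding galois_tp_def by (subst Aut_eq) (use act_Aut in blast)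
qed

lemma act_inv:
  assumes "\<rho> \<in> G"
  shows "\<exists>\<rho>'\<in>G. \<forall>u\<in>elems N. act \<rho>' (act \<rho> u) = u \<and> act \<rho> (act \<rho>' u) = u"
proof -
  obtain \<rho>' where \<rho>': "\<rho>' \<in> G" "\<forall>x\<in>D. \<rho>' (\<rho> x) = x \<and> \<rho> (\<rho>' x) = x"
    using stab_inv[of \<rho> "{}"] assms unfolding stab_empty by auto
  have "act \<rho>' (act \<rho> u) = u \<and> act \<rho> (act \<rho>' u) = u" if u: "u \<in> elems N" for u
    using act_comp[OF \<rho>'(1) assms u] act_comp[OF assms \<rho>'(1) u]
      act_cong[OF G_comp[OF \<rho>'(1) assms] _ u] act_cong[OF G_comp[OF assms \<rho>'(1)] _ u] \<rho>'(2) by simp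
  then show ?thesis using \<rho>'(1) by (intro bexI[of _ \<rho>']) simp_all
qed

lemma galois_tp_eq_iff:
  assumes "set us \<subseteq> elems N" "set vs \<subseteq> elems N" "A \<subseteq> elems N"
  shows "galois_tp N us A = galois_tp N vs A \<longleftrightarrow>
    (\<exists>\<rho>\<in>G. (\<forall>a\<in>A. act \<rho> a = a) \<and> map (act \<rho>) us = vs)"
proof
  assume "galois_tp N us A = galois_tp N vs A"
  moreover have "vs \<in> galois_tp N vs A"
    unfolding galois_tp_act[OF assms(2,3)] using act_cong[OF G_id] assms
    by (intro CollectI exI[of _ "\<lambda>x. x"]) (auto intro!: map_idI[symmetric] simp: G_id)
  ultimately have "vs \<in> galois_tp N us A" by simp
  then show "\<exists>\<rho>\<in>G. (\<forall>a\<in>A. act \<rho> a = a) \<and> map (act \<rho>) us = vs"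
    unfolding galois_tp_act[OF assms(1,3)] by blast
next
  assume "\<exists>\<rho>\<in>G. (\<forall>a\<in>A. act \<rho> a = a) \<and> map (act \<rho>) us = vs"
  then obtain \<rho> where \<rho>: "\<rho> \<in> G" "\<forall>a\<in>A. act \<rho> a = a" "map (act \<rho>) us = vs" by blast
  obtain \<rho>' where \<rho>': "\<rho>' \<in> G" "\<forall>u\<in>elems N. act \<rho>' (act \<rho> u) = u \<and> act \<rho> (act \<rho>' u) = u"
    using act_inv[OF \<rho>(1)] by blast
  have fix': "act \<rho>' a = a" if "a \<in> A" for a
    using \<rho>'(2) \<rho>(2) that assms(3) by (metis subsetD)
  have us: "map (act \<rho>') vs = us" unfolding \<rho>(3)[symmetric] using \<rho>'(2) assms(1) by (auto intro!: map_idI)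
  have sub: "galois_tp N vs' A \<subseteq> galois_tp N us' A"
    if us': "set us' \<subseteq> elems N" "set vs' \<subseteq> elems N" and r: "r \<in> G" "\<forall>a\<in>A. act r a = a" "map (act r) us' = vs'"
    for us' vs' r
  proof
    fix ws assume "ws \<in> galois_tp N vs' A"
    then obtain q where q: "q \<in> G" "\<forall>a\<in>A. act q a = a" "ws = map (act q) vs'"
      unfolding galois_tp_act[OF us'(2) assms(3)] by blast
    have qr: "(\<lambda>x. q (r x)) \<in> G" by (rule G_comp[OF q(1) r(1)])
    have "act (\<lambda>x. q (r x)) u = act q (act r u)" if "u \<in> elems N" for u
      by (rule act_comp[OF q(1) r(1) that])
    note c = this
    have "\<forall>u\<in>set us'. act q (act r u) = act (\<lambda>x. q (r x)) u" using c us'(1) by (metis subsetD)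
    then have "ws = map (act (\<lambda>x. q (r x))) us'" unfolding q(3) r(3)[symmetric] by simp
    moreover have "act (\<lambda>x. q (r x)) a = a" if "a \<in> A" for a
      using c[of a] q(2) r(2) assms(3) that by auto
    ultimately show "ws \<in> galois_tp N us' A"
      unfolding galois_tp_act[OF us'(1) assms(3)] using qr by blast
  qed
  show "galois_tp N us A = galois_tp N vs A"
    using sub[OF assms(1,2) \<rho>] sub[OF assms(2,1) \<rho>'(1) _ us] fix' by blast
qed

lemma same_tpI:
  assumes "\<rho> \<in> G" "\<forall>a\<in>A. act \<rho> a = a" "map (act \<rho>) us = vs"
    and "set us \<subseteq> elems N" "A \<subseteq> elems N"
  shows "same_tp N A us vs"
  unfolding same_tp_def
proof (intro allI impI)
  fix A0 assume A0: "finite A0 \<and> A0 \<subseteq> A"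
  have "set vs \<subseteq> elems N" unfolding assms(3)[symmetric] using act_mem[OF assms(1)] assms(4) by auto
  moreover have "A0 \<subseteq> elems N" using A0 assms(5) by auto
  ultimately show "galois_tp N us A0 = galois_tp N vs A0"
    using galois_tp_eq_iff[OF assms(4)] assms(1-3) A0 by blast
qed

lemma same_tpD:
  assumes "same_tp N A us vs" "finite A" "A \<subseteq> elems N" "set us \<subseteq> elems N" "set vs \<subseteq> elems N"
  shows "\<exists>\<rho>\<in>G. (\<forall>a\<in>A. act \<rho> a = a) \<and> map (act \<rho>) us = vs"
  using assms(1,2) galois_tp_eq_iff[OF assms(4,5,3)] unfolding same_tp_def by blast

lemma supp_cong:
  assumes "supp a us" "set us \<subseteq> elems N" "\<pi> \<in> G" "\<tau> \<in> G" "map \<pi> a = map \<tau> a" "set a \<subseteq> D"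
  shows "map (act \<pi>) us = map (act \<tau>) us"
proof -
  obtain \<tau>' where \<tau>': "\<tau>' \<in> G" "\<forall>x\<in>D. \<tau>' (\<tau> x) = x \<and> \<tau> (\<tau>' x) = x"
    using stab_inv[of \<tau> "{}"] assms(4) unfolding stab_empty by auto
  let ?k = "\<lambda>x. \<tau>' (\<pi> x)"
  have kG: "?k \<in> G" by (rule G_comp[OF \<tau>'(1) assms(3)])
  have "?k x = x" if "x \<in> set a" for x
    using assms(5) that \<tau>'(2) assms(6) by (metis map_eq_conv subsetD)
  then have "?k \<in> stab (set a)" using kG unfolding stab_def by simp
  then have k: "map (act ?k) us = us" using assms(1) unfolding supp_def by blast
  have "act \<tau> (act ?k u) = act \<pi> u" if u: "u \<in> elems N" for u
  proof -
    have \<pi>u: "act \<pi> u \<in> elems N" by (rule act_mem[OF assms(3) u])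
    have "act ?k u = act \<tau>' (act \<pi> u)" by (rule act_comp[OF \<tau>'(1) assms(3) u])
    then have "act \<tau> (act ?k u) = act (\<lambda>x. \<tau> (\<tau>' x)) (act \<pi> u)"
      using act_comp[OF assms(4) \<tau>'(1) \<pi>u] by simp
    also have "\<dots> = act \<pi> u"
      using act_cong[OF G_comp[OF assms(4) \<tau>'(1)] _ \<pi>u] \<tau>'(2) by simp
    finally show ?thesis .
  qed
  then have "map (act \<tau>) (map (act ?k) us) = map (act \<pi>) us" using assms(2) by auto
  then show ?thesis unfolding k by simp
qed

lemma mdl_supp_list:
  assumes "A \<in> Mods" "set us \<subseteq> mdl A"
  shows "\<exists>b. set b \<subseteq> A \<and> supp b us"
  using assms(2)
proof (induction us)
  case Nil
  then show ?case by (intro exI[of _ "[]"]) (simp add: supp_def)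
next
  case (Cons u us)
  then obtain b where b: "set b \<subseteq> A" "supp b us" by auto
  have "u \<in> mdl A" using Cons.prems by simp
  from mdl_supp[OF assms(1) this]
  obtain c where c: "set c \<subseteq> A" "\<forall>\<pi>\<in>stab (set c). act \<pi> u = u" by (elim exE conjE)
  have "supp (b @ c) (u # us)"
    unfolding supp_def
  proof
    fix \<pi> assume "\<pi> \<in> stab (set (b @ c))"
    then have "\<pi> \<in> stab (set b)" "\<pi> \<in> stab (set c)" unfolding stab_def by auto
    then show "map (act \<pi>) (u # us) = u # us" using b(2) c(2) unfolding supp_def by simp
  qed
  then show ?case using b(1) c(1) by (intro exI[of _ "b @ c"]) simp
qed

text \<open>Non-splitting is known for tuples of the home sort, while the parameters here are
  imaginaries. Conjugate imaginaries are replaced by conjugate tuples supporting them, to which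
  \<open>nonsplitting\<close> applies.\<close>

lemma ns_indepI:
  assumes A: "A \<in> Mods" "B \<in> Mods" "A \<subseteq> B" and e: "indep B e" and a: "set a \<subseteq> cl (A \<union> set e)"
    and gs: "set gs \<subseteq> elems N" "supp a gs"
  shows "ns_indep N gs (mdl A) (mdl B)"
proof -
  have AD: "A \<subseteq> D" "cl A = A" "inf_dim A" and BD: "B \<subseteq> D" "cl B = B" "inf_dim B"
    using Mods_closed A(1,2) by auto
  have eD: "set e \<subseteq> D" by (rule indep_D[OF e])
  have aD: "set a \<subseteq> D" using a cl_D[of "A \<union> set e"] AD(1) eD by auto
  have "indep A e" using indep_antimono[OF e _ BD(1), of A] A(3) BD(2) by simp
  from nonsplitting[OF AD this a] obtain S where S: "finite S" "S \<subseteq> A"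
    "\<And>b c. set b \<subseteq> D \<and> set c \<subseteq> D \<and> indep (S \<union> set b \<union> set c) e \<and> conjg S b c \<Longrightarrow> conjg S (a @ b) (a @ c)"
    by (elim exE conjE) auto
  have SD: "S \<subseteq> D" "S \<subseteq> B" using S(2) AD(1) A(3) by auto
  let ?S = "hm ` S"
  have hS: "finite ?S" "?S \<subseteq> mdl A" "?S \<subseteq> elems N"
    using S(1,2) SD(1) hm_mdl[OF A(1)] hm_mem by auto
  have "\<not> splits N gs (mdl A \<union> mdl B) ?S"
  proof
    assume "splits N gs (mdl A \<union> mdl B) ?S"
    then obtain b' c' where bc: "set b' \<subseteq> mdl B" "set c' \<subseteq> mdl B" "same_tp N ?S b' c'"
      "\<not> same_tp N ?S (gs @ b') (gs @ c')"
      unfolding splits_def using mdl_mono[OF A(3)] by (auto simp: Un_absorb1)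
    have bcE: "set b' \<subseteq> elems N" "set c' \<subseteq> elems N" using bc(1,2) mdl_elems[OF A(2)] by auto
    obtain \<pi> where \<pi>: "\<pi> \<in> G" "\<forall>a\<in>?S. act \<pi> a = a" "map (act \<pi>) b' = c'"
      using same_tpD[OF bc(3) hS(1,3) bcE] by blast
    have "\<pi> s = s" if "s \<in> S" for s
    proof -
      have "hm (\<pi> s) = hm s" using \<pi>(2) act_hm[OF \<pi>(1) subsetD[OF SD(1) that]] that by simp
      then show ?thesis using inj_onD[OF hm_inj] G_mem[OF \<pi>(1)] that SD(1) by blast
    qed
    then have \<pi>S: "\<pi> \<in> stab S" using \<pi>(1) unfolding stab_def by simp
    obtain b where b: "set b \<subseteq> B" "supp b b'" using mdl_supp_list[OF A(2) bc(1)] by blast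
    obtain c where c: "set c \<subseteq> B" "supp c c'" using mdl_supp_list[OF A(2) bc(2)] by blast
    have bD: "set b \<subseteq> D" "set (map \<pi> b) \<subseteq> D" using b(1) BD(1) G_image[OF \<pi>(1), of "set b"] by auto
    have Sc: "finite (S \<union> set c)" "S \<union> set c \<subseteq> B" "S \<union> set c \<subseteq> D" using S(1) SD c(1) BD(1) by auto
    \<comment> \<open>The image of \<open>b\<close> under \<open>\<pi>\<close> supports
      \<open>c'\<close> but may lie outside \<open>B\<close>. The correction \<open>\<tau>\<close>
      brings it into \<open>B\<close> and, as it fixes \<open>c\<close>, does not disturb
      \<open>c'\<close>.\<close>
    obtain \<tau> where \<tau>: "\<tau> \<in> stab (cl (S \<union> set c))" "set (map \<tau> (map \<pi> b)) \<subseteq> B"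
      using move_into[OF BD Sc(1,2) bD(2)] by blast
    have \<tau>Sc: "\<tau> \<in> stab (S \<union> set c)" by (rule stab_cl[OF \<tau>(1) Sc(3)])
    let ?r = "\<lambda>x. \<tau> (\<pi> x)"
    have r: "?r \<in> stab S" by (rule stab_comp[OF stab_mono[OF _ \<tau>Sc] \<pi>S]) simp
    have "set b \<subseteq> D" "set (map ?r b) \<subseteq> D" "S \<union> set b \<union> set (map ?r b) \<subseteq> cl B"
      using bD(1) b(1) SD(2) BD(1) \<tau>(2) unfolding BD(2) by auto
    then have "conjg S (a @ b) (a @ map ?r b)"
      using S(3)[of b "map ?r b"] indep_antimono[OF e _ BD(1), of "S \<union> set b \<union> set (map ?r b)"]
        conjg_image[OF r, of b] by blast
    then obtain \<kappa> where \<kappa>: "\<kappa> \<in> stab S" "map \<kappa> a = a" "map \<kappa> b = map ?r b"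
      unfolding conjg_def by auto
    have \<kappa>G: "\<kappa> \<in> G" by (rule stab_G[OF \<kappa>(1)])
    have "map (act \<kappa>) gs = gs"
    proof -
      have "\<forall>x\<in>set a. \<kappa> x = x" by (rule ballI) (rule map_fix[OF \<kappa>(2)])
      then have "\<kappa> \<in> stab (set a)" using \<kappa>G unfolding stab_def by simp
      then show ?thesis using gs(2) unfolding supp_def by blast
    qed
    moreover have "map (act \<kappa>) b' = c'"
    proof -
      have "map (act \<kappa>) b' = map (act ?r) b'"
        by (rule supp_cong[OF b(2) bcE(1) \<kappa>G stab_G[OF r] \<kappa>(3) bD(1)])
      also have "\<dots> = map (act \<tau>) (map (act \<pi>) b')"
        using act_comp[OF stab_G[OF \<tau>(1)] \<pi>(1)] bcE(1) by auto
      also have "\<dots> = c'" unfolding \<pi>(3) using c(2) stab_mono[OF _ \<tau>Sc, of "set c"] unfolding supp_def by simp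
      finally show ?thesis .
    qed
    moreover have "\<forall>s\<in>?S. act \<kappa> s = s" using act_hm[OF \<kappa>G] stab_fix[OF \<kappa>(1)] SD(1) by auto
    ultimately have "same_tp N ?S (gs @ b') (gs @ c')"
      using gs(1) bcE hS(3) by (intro same_tpI[OF \<kappa>G]) simp_all
    with bc(4) show False by blast
  qed
  with hS(1,2) show ?thesis unfolding ns_indep_def by blast
qed

text \<open>Over any finite part of the smaller model, \<open>u\<close> has a conjugate inside that
  model. Without splitting, some automorphism would fix \<open>gs\<close> and move \<open>u\<close>
  to this conjugate, although \<open>u\<close> is one of the entries of \<open>gs\<close>.\<close>

lemma not_ns_indepI:
  assumes A: "A \<in> Mods" "B \<in> Mods" "A \<subseteq> B" and gs: "set gs \<subseteq> elems N"
    and u: "u \<in> set gs" "u \<in> mdl B" "u \<notin> mdl A"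
  shows "\<not> ns_indep N gs (mdl A) (mdl B)"
proof
  assume "ns_indep N gs (mdl A) (mdl B)"
  then obtain S where S: "finite S" "S \<subseteq> mdl A" "\<not> splits N gs (mdl A \<union> mdl B) S"
    unfolding ns_indep_def by blast
  have AD: "A \<subseteq> D" "cl A = A" "inf_dim A" using Mods_closed[OF A(1)] by auto
  have SE: "S \<subseteq> elems N" using S(2) mdl_elems[OF A(1)] by auto
  have uE: "u \<in> elems N" using u(1) gs by auto
  obtain l where l: "set l = S" using finite_list[OF S(1)] by blast
  obtain b where b: "set b \<subseteq> A" "supp b l" using mdl_supp_list[OF A(1)] S(2) l by blast
  obtain a where a: "set a \<subseteq> D" "\<forall>\<pi>\<in>G. \<forall>A\<in>Mods. \<pi> ` set a \<subseteq> A \<longrightarrow> act \<pi> u \<in> mdl A"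
    using rep[OF uE] by blast
  have bD: "set b \<subseteq> D" using b(1) AD(1) by auto
  obtain \<tau> where \<tau>: "\<tau> \<in> stab (cl (set b))" "set (map \<tau> a) \<subseteq> A"
    using move_into[OF AD finite_set b(1) a(1)] by blast
  have \<tau>b: "\<tau> \<in> stab (set b)" by (rule stab_cl[OF \<tau>(1) bD])
  have \<tau>G: "\<tau> \<in> G" by (rule stab_G[OF \<tau>b])
  have u': "act \<tau> u \<in> mdl A" using a(2) \<tau>G A(1) \<tau>(2) by simp
  have "map (act \<tau>) l = l" by (rule bspec[OF b(2)[unfolded supp_def] \<tau>b])
  from map_fix[OF this] have "\<forall>s\<in>S. act \<tau> s = s" unfolding l by (rule ballI)
  then have "same_tp N S [u] [act \<tau> u]" using uE SE by (intro same_tpI[OF \<tau>G]) simp_all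
  then have s2: "same_tp N S (gs @ [u]) (gs @ [act \<tau> u])"
  proof (rule contrapos_pp)
    assume "\<not> same_tp N S (gs @ [u]) (gs @ [act \<tau> u])"
    then show "\<not> same_tp N S [u] [act \<tau> u]"
      using S(3) u(2) u' unfolding splits_def by (elim contrapos_nn, intro exI[of _ "[u]"] exI[of _ "[act \<tau> u]"]) simp
  qed
  then obtain \<rho> where \<rho>: "\<rho> \<in> G" "map (act \<rho>) (gs @ [u]) = gs @ [act \<tau> u]"
    using same_tpD[OF _ S(1) SE, of "gs @ [u]" "gs @ [act \<tau> u]"] gs uE act_mem[OF \<tau>G uE] by auto
  then have "map (act \<rho>) gs = gs" "act \<rho> u = act \<tau> u" by auto
  moreover have "act \<rho> u = u" by (rule map_fix[OF \<open>map (act \<rho>) gs = gs\<close> u(1)])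
  ultimately show False using u(3) u' by simp
qed

lemma mdl_subset_iff: "A \<in> Mods \<Longrightarrow> B \<in> Mods \<Longrightarrow> mdl A \<subseteq> mdl B \<longleftrightarrow> A \<subseteq> B"
proof
  assume *: "A \<in> Mods" "B \<in> Mods" "mdl A \<subseteq> mdl B"
  show "A \<subseteq> B"
  proof
    fix a assume "a \<in> A"
    moreover have "a \<in> D" using Mods_closed[OF *(1)] \<open>a \<in> A\<close> by auto
    ultimately show "a \<in> B" using hm_mdl[OF *(1), of a] hm_mdl[OF *(2), of a] *(3) by blast
  qed
qed (rule mdl_mono)

text \<open>By \<open>ns_indepI\<close>, an extension of models over which dependence arises makes
  the spanning list dependent, so it can be shortened. Each unit of rank costs one element.\<close>

lemma U_ge_le:
  assumes gs: "set gs \<subseteq> elems N" "supp a gs"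
  shows "U_ge N gs n (mdl A) \<Longrightarrow> A \<in> Mods \<Longrightarrow> set a \<subseteq> cl (A \<union> set ds) \<Longrightarrow> set ds \<subseteq> D \<Longrightarrow> n \<le> length ds"
proof (induction n arbitrary: A ds)
  case (Suc n)
  obtain B where B: "B \<in> Mods" "mdl A \<subseteq> mdl B" "\<not> ns_indep N gs (mdl A) (mdl B)" "U_ge N gs n (mdl B)"
    using Suc.prems(1) unfolding U_ge.simps models_mdl by blast
  have AB: "A \<subseteq> B" using mdl_subset_iff[OF Suc.prems(2) B(1)] B(2) by simp
  have BD: "B \<subseteq> D" using Mods_closed[OF B(1)] by simp
  have "\<not> indep B ds" using ns_indepI[OF Suc.prems(2) B(1) AB _ Suc.prems(3) gs] B(3) by blast
  moreover have "set a \<subseteq> cl (B \<union> set ds)"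
    by (rule order_trans[OF Suc.prems(3) cl_mono]) (use AB BD Suc.prems(4) in auto)
  ultimately obtain es where es: "length es < length ds" "set es \<subseteq> set ds" "set a \<subseteq> cl (B \<union> set es)"
    using indep_shorter[OF _ BD Suc.prems(4)] by blast
  have "set es \<subseteq> D" using es(2) Suc.prems(4) by auto
  from Suc.IH[OF B(4,1) es(3) this] es(1) show ?case by simp
qed simp

text \<open>The supporting tuple may be chosen anew for each model; the bound on the rank of the
  group relies on this freedom.\<close>

lemma U_fin_le:
  assumes "set gs \<subseteq> elems N"
    and "\<And>A. A \<in> Mods \<Longrightarrow> S \<subseteq> mdl A \<Longrightarrow>
      \<exists>a ds. supp a gs \<and> set a \<subseteq> cl (A \<union> set ds) \<and> set ds \<subseteq> D \<and> length ds \<le> n"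
  shows "U_fin N gs S \<le> enat n"
  unfolding U_fin_def
proof (rule SUP_least)
  fix A' assume "A' \<in> {A \<in> models N. S \<subseteq> A}"
  then obtain A where A: "A \<in> Mods" "A' = mdl A" "S \<subseteq> mdl A" unfolding models_mdl by blast
  obtain a ds where a: "supp a gs" "set a \<subseteq> cl (A \<union> set ds)" "set ds \<subseteq> D" "length ds \<le> n"
    using assms(2)[OF A(1,3)] by blast
  show "U_model N gs A' \<le> enat n"
    unfolding U_model_def A(2)
  proof (rule SUP_least)
    fix m assume "m \<in> {m. U_ge N gs m (mdl A)}"
    then have "m \<le> length ds" using U_ge_le[OF assms(1) a(1) _ A(1) a(2,3)] by simp
    then show "enat m \<le> enat n" using a(4) by simp
  qed
qed

lemma U_fin_ge:
  assumes "A \<in> Mods" "S \<subseteq> mdl A" "U_ge N gs n (mdl A)"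
  shows "enat n \<le> U_fin N gs S"
proof -
  have "enat n \<le> U_model N gs (mdl A)" unfolding U_model_def by (rule SUP_upper) (use assms(3) in simp)
  also have "\<dots> \<le> U_fin N gs S"
    unfolding U_fin_def by (rule SUP_upper) (use assms(1,2) models_mdl in auto)
  finally show ?thesis .
qed

text \<open>Adjoining the elements of \<open>ds\<close> to the model one at a time gives a chain in
  which every step brings an entry of \<open>gs\<close> into the model, so
  \<open>not_ns_indepI\<close> applies to each step.\<close>

lemma U_ge_indep:
  assumes "countable A" "A \<in> Mods" "indep A ds" "set gs \<subseteq> elems N" "hm ` set ds \<subseteq> set gs"
  shows "U_ge N gs (length ds) (mdl A)"
  using assms
proof (induction ds arbitrary: A)
  case (Cons d ds)
  have AD: "A \<subseteq> D" "cl A = A" "inf_dim A" using Mods_closed[OF Cons.prems(2)] by auto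
  have d: "d \<in> D" "d \<notin> A" "indep (insert d A) ds" using Cons.prems(3) AD(2) by auto
  let ?B = "cl (insert d A)"
  have dA: "insert d A \<subseteq> D" "countable (insert d A)" using AD(1) d(1) Cons.prems(1) by simp_all
  have B: "countable ?B" "?B \<subseteq> D" "cl ?B = ?B" "inf_dim ?B"
    using countable_cl[OF dA(2,1)] cl_D[OF dA(1)] cl_idem[OF dA(1)] inf_dim_insert[OF AD d(1)] by simp_all
  have BM: "?B \<in> Mods" by (rule Mods_countable[OF B])
  have sub: "A \<subseteq> ?B" "d \<in> ?B" using cl_sub[OF dA(1)] by simp_all
  have "indep ?B ds" by (rule indep_antimono[OF d(3) _ dA(1)]) simp
  then have "U_ge N gs (length ds) (mdl ?B)" using Cons.IH[OF B(1) BM] Cons.prems(4,5) by simp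
  moreover have "\<not> ns_indep N gs (mdl A) (mdl ?B)"
    by (rule not_ns_indepI[OF Cons.prems(2) BM sub(1) Cons.prems(4), of "hm d"])
      (use Cons.prems(5) hm_mdl[OF BM d(1)] hm_mdl[OF Cons.prems(2) d(1)] sub(2) d(2) in simp_all)
  moreover have "mdl ?B \<in> models N" unfolding models_mdl using BM by (rule imageI)
  ultimately show ?case using mdl_mono[OF sub(1)] by auto
qed simp

text \<open>The model is the closure of \<open>B\<close> with a sequence free over \<open>B\<close>
  and \<open>ds\<close>, so \<open>ds\<close> stays independent over it.\<close>

lemma ex_countable_model:
  assumes "finite B" "B \<subseteq> D" "indep B ds"
  shows "\<exists>A. countable A \<and> A \<in> Mods \<and> B \<subseteq> A \<and> indep A ds"
proof -
  have dsD: "set ds \<subseteq> D" by (rule indep_D[OF assms(3)])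
  have BE: "countable (B \<union> set ds)" "B \<union> set ds \<subseteq> D" using assms(1,2) dsD by (simp_all add: countable_finite)
  obtain i where i0: "\<forall>n::nat. i n \<in> D \<and> i n \<notin> cl (B \<union> set ds \<union> i ` {..<n})"
    using ex_free_seq[OF BE] by (rule exE)
  have i: "\<And>n. i n \<in> D" "\<And>n. i n \<notin> cl (B \<union> set ds \<union> i ` {..<n})"
    by (rule conjunct1[OF i0[rule_format]], rule conjunct2[OF i0[rule_format]])
  have BiD: "B \<union> range i \<subseteq> D" "countable (B \<union> range i)" using assms(1,2) i(1) by (auto simp: countable_finite)
  have "indep (B \<union> range i) ds" by (rule indep_free_seq[OF assms(3,2) dsD order_refl i])
  then have "indep (cl (B \<union> range i)) ds" by (rule indep_antimono[OF _ order_refl BiD(1)])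
  moreover have "cl (B \<union> range i) \<in> Mods"
    using countable_cl[OF BiD(2,1)] cl_D[OF BiD(1)] cl_idem[OF BiD(1)] free_seq_inf_dim[OF assms(2) dsD i]
    by (intro Mods_countable)
  moreover have "B \<subseteq> cl (B \<union> range i)" using cl_sub[OF BiD(1)] by simp
  ultimately show ?thesis using countable_cl[OF BiD(2,1)] by blast
qed

end

context monster begin

sublocale I: interp "Dom M" "cl M" Gam "small_models L M0 \<delta> M" "monster_ambient L M0 \<delta> M"
  "\<lambda>\<pi>. \<pi>" "\<lambda>x. x" "\<lambda>A. A"
proof unfold_locales
  have e: "elems (monster_ambient L M0 \<delta> M) = Dom M" "models (monster_ambient L M0 \<delta> M) = small_models L M0 \<delta> M"
    unfolding monster_ambient_def struct.truncate_def by simp_all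
  show "\<pi> \<in> Gam \<Longrightarrow> \<pi> \<in> Aut (monster_ambient L M0 \<delta> M) {}" for \<pi> unfolding Aut_monster .
  show "\<tau> \<in> Aut (monster_ambient L M0 \<delta> M) {} \<Longrightarrow> \<exists>\<pi>\<in>Gam. \<forall>u\<in>elems (monster_ambient L M0 \<delta> M). \<tau> u = \<pi> u" for \<tau>
    unfolding Aut_monster by blast
  show "u \<in> elems (monster_ambient L M0 \<delta> M)
    \<Longrightarrow> \<exists>a. set a \<subseteq> Dom M \<and> (\<forall>\<pi>\<in>Gam. \<forall>A\<in>small_models L M0 \<delta> M. \<pi> ` set a \<subseteq> A \<longrightarrow> \<pi> u \<in> A)" for u
    unfolding e by (intro exI[of _ "[u]"]) simp
  show "A \<in> small_models L M0 \<delta> M \<Longrightarrow> u \<in> A \<Longrightarrow> \<exists>b. set b \<subseteq> A \<and> (\<forall>\<pi>\<in>H.stab (set b). \<pi> u = u)" for A u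
    by (intro exI[of _ "[u]"]) (simp add: H.stab_def)
  show "A \<in> small_models L M0 \<delta> M \<Longrightarrow> A \<subseteq> Dom M \<and> cl M A = A \<and> M.inf_dim A" for A
    using small_modelsD by blast
  show "\<pi> \<in> Gam \<Longrightarrow> u \<in> elems (monster_ambient L M0 \<delta> M) \<Longrightarrow> \<pi> u \<in> elems (monster_ambient L M0 \<delta> M)" for \<pi> u
    unfolding e by (rule H.G_mem)
  show "countable A \<Longrightarrow> A \<subseteq> Dom M \<Longrightarrow> cl M A = A \<Longrightarrow> M.inf_dim A \<Longrightarrow> A \<in> small_models L M0 \<delta> M" for A
    by (rule small_model) (simp_all add: closed_in_def)
  show "A \<in> small_models L M0 \<delta> M \<Longrightarrow> A \<subseteq> elems (monster_ambient L M0 \<delta> M)" for A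
    unfolding e using small_modelsD(1) by blast
qed (simp_all add: monster_ambient_def struct.truncate_def)

end

section \<open>The group of a line\<close>

context homog_pregeom begin

text \<open>The conclusion of \<open>stationary_conjg\<close> over a fixed \<open>A\<close>,
  combined with the requirement that the head be generic over \<open>A\<close> and span the
  tuple.\<close>

definition statl where
  "statl A t \<longleftrightarrow> set t \<subseteq> D \<and> t \<noteq> [] \<and> hd t \<notin> cl A \<and> set t \<subseteq> cl (insert (hd t) A) \<and>
    (\<forall>C t' t''. finite C \<and> C \<subseteq> D \<and> conjg A t t' \<and> conjg A t t'' \<and>
      hd t' \<notin> cl (A \<union> C) \<and> hd t'' \<notin> cl (A \<union> C) \<longrightarrow> conjg (A \<union> C) t' t'')"

text \<open>Any two heads are independent and span the third. The last three clauses stand in for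
  algebraicity: automorphisms fixing two of the tuples may move the head of the third, but only
  inside its own closure over \<open>A\<close>.\<close>

definition line where
  "line A x y z \<longleftrightarrow> finite A \<and> A \<subseteq> D \<and> statl A x \<and> statl A y \<and> statl A z \<and>
    hd y \<notin> cl (insert (hd x) A) \<and> hd z \<in> cl (insert (hd x) (insert (hd y) A)) \<and>
    hd z \<notin> cl (insert (hd x) A) \<and> hd z \<notin> cl (insert (hd y) A) \<and>
    (\<forall>\<pi>\<in>stab (A \<union> set x \<union> set y). \<pi> (hd z) \<in> cl (insert (hd z) A)) \<and>
    (\<forall>\<pi>\<in>stab (A \<union> set y \<union> set z). \<pi> (hd x) \<in> cl (insert (hd x) A)) \<and>
    (\<forall>\<pi>\<in>stab (A \<union> set x \<union> set z). \<pi> (hd y) \<in> cl (insert (hd y) A))"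

definition rel3 where
  "rel3 A x0 y0 z0 x y z \<longleftrightarrow> (\<exists>\<pi>\<in>stab A. map \<pi> x0 = x \<and> map \<pi> y0 = y \<and> map \<pi> z0 = z)"

text \<open>Belonging to triples with the same first two coordinates is symmetric but not evidently
  transitive, hence the generated relation. It is reflexive on all lists, including those that occur
  in no triple.\<close>

definition eq3 where
  "eq3 A x0 y0 z0 = (\<lambda>z z'. \<exists>x y. rel3 A x0 y0 z0 x y z \<and> rel3 A x0 y0 z0 x y z')\<^sup>*\<^sup>*"

lemma statl_D: "statl A t \<Longrightarrow> set t \<subseteq> D" "statl A t \<Longrightarrow> t \<noteq> []" "statl A t \<Longrightarrow> hd t \<in> D"
  "statl A t \<Longrightarrow> hd t \<notin> cl A" "statl A t \<Longrightarrow> set t \<subseteq> cl (insert (hd t) A)"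
  unfolding statl_def using list.set_sel(1) by auto

lemma statl_conjg: "statl A t \<Longrightarrow> finite C \<Longrightarrow> C \<subseteq> D \<Longrightarrow> conjg A t t' \<Longrightarrow> conjg A t t'' \<Longrightarrow>
  hd t' \<notin> cl (A \<union> C) \<Longrightarrow> hd t'' \<notin> cl (A \<union> C) \<Longrightarrow> conjg (A \<union> C) t' t''"
  unfolding statl_def by simp

lemma lineD:
  assumes "line A x y z"
  shows "finite A" "A \<subseteq> D" "statl A x" "statl A y" "statl A z"
    "hd y \<notin> cl (insert (hd x) A)" "hd z \<in> cl (insert (hd x) (insert (hd y) A))"
    "hd z \<notin> cl (insert (hd x) A)" "hd z \<notin> cl (insert (hd y) A)"
  using assms unfolding line_def by simp_all

lemma lineS:
  assumes "line A x y z"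
  shows "\<pi> \<in> stab (A \<union> set x \<union> set y) \<Longrightarrow> \<pi> (hd z) \<in> cl (insert (hd z) A)"
    "\<pi> \<in> stab (A \<union> set y \<union> set z) \<Longrightarrow> \<pi> (hd x) \<in> cl (insert (hd x) A)"
    "\<pi> \<in> stab (A \<union> set x \<union> set z) \<Longrightarrow> \<pi> (hd y) \<in> cl (insert (hd y) A)"
  using assms unfolding line_def by blast+

text \<open>Only exchange is involved. With \<open>line_swap\<close> this makes the three
  coordinates interchangeable, so later facts need a proof for one coordinate only.\<close>

lemma line_rot:
  assumes "line A x y z"
  shows "line A y z x"
proof -
  note l = lineD[OF assms]
  have D: "hd x \<in> D" "hd y \<in> D" "hd z \<in> D" using l(3-5) statl_D(3) by simp_all
  have yA: "insert (hd y) A \<subseteq> D" using l(2) D by simp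
  have 1: "hd x \<in> cl (insert (hd y) (insert (hd z) A))"
    using exchange[OF yA D(3,1) l(7,9)] by (simp add: insert_commute)
  have 2: "hd x \<notin> cl (insert (hd y) A)"
    using exchange[OF l(2) D(1,2)] statl_D(4)[OF l(3)] l(6) by blast
  have 3: "hd x \<notin> cl (insert (hd z) A)"
    using exchange[OF l(2) D(1,3)] statl_D(4)[OF l(3)] l(8) by blast
  have *: "A \<union> set y \<union> set x = A \<union> set x \<union> set y" "A \<union> set z \<union> set x = A \<union> set x \<union> set z" by auto
  show ?thesis
    unfolding line_def * by (intro conjI ballI; (rule l 1 2 3 | erule lineS[OF assms]))
qed

lemma line_swap:
  assumes "line A x y z"
  shows "line A y x z"
proof -
  note l = lineD[OF assms]
  have D: "hd x \<in> D" "hd y \<in> D" "hd z \<in> D" using l(3-5) statl_D(3) by simp_all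
  have 2: "hd x \<notin> cl (insert (hd y) A)"
    using exchange[OF l(2) D(1,2)] statl_D(4)[OF l(3)] l(6) by blast
  have *: "A \<union> set y \<union> set x = A \<union> set x \<union> set y" by auto
  show ?thesis
    unfolding line_def * insert_commute[of "hd y" "hd x"]
    by (intro conjI ballI; (rule l 2 | erule lineS[OF assms]))
qed

lemma rel3_rot: "rel3 A y0 z0 x0 y z x \<longleftrightarrow> rel3 A x0 y0 z0 x y z"
  unfolding rel3_def by (simp only: conj_ac)

lemma rel3_swap: "rel3 A y0 x0 z0 y x z \<longleftrightarrow> rel3 A x0 y0 z0 x y z"
  unfolding rel3_def by (simp only: conj_ac)

lemma eq3_swap: "eq3 A y0 x0 z0 = eq3 A x0 y0 z0"
proof -
  have "(\<exists>x y. rel3 A y0 x0 z0 x y z \<and> rel3 A y0 x0 z0 x y z') \<longleftrightarrow>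
    (\<exists>x y. rel3 A x0 y0 z0 x y z \<and> rel3 A x0 y0 z0 x y z')" for z z'
    using rel3_swap[of A y0 x0 z0] by metis
  then show ?thesis unfolding eq3_def by simp
qed

lemma eq3_refl: "eq3 A x0 y0 z0 z z"
  unfolding eq3_def by simp

lemma eq3_trans: "eq3 A x0 y0 z0 z z' \<Longrightarrow> eq3 A x0 y0 z0 z' z'' \<Longrightarrow> eq3 A x0 y0 z0 z z''"
  unfolding eq3_def by (rule rtranclp_trans)

lemma eq3_sym: "eq3 A x0 y0 z0 z z' \<Longrightarrow> eq3 A x0 y0 z0 z' z"
  unfolding eq3_def
proof -
  let ?r = "\<lambda>z z'. \<exists>x y. rel3 A x0 y0 z0 x y z \<and> rel3 A x0 y0 z0 x y z'"
  assume z: "?r\<^sup>*\<^sup>* z z'"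
  have "symp ?r" by (rule sympI) (elim exE conjE, intro exI conjI)
  then have "symp ?r\<^sup>*\<^sup>*" by (rule symp_rtranclp)
  then show "?r\<^sup>*\<^sup>* z' z" using z by (rule sympD)
qed

lemma eq3_base: "rel3 A x0 y0 z0 x y z \<Longrightarrow> rel3 A x0 y0 z0 x y z' \<Longrightarrow> eq3 A x0 y0 z0 z z'"
  unfolding eq3_def by (rule r_into_rtranclp) blast

lemma rel3_image:
  assumes "rel3 A x0 y0 z0 x y z" "\<tau> \<in> stab A"
  shows "rel3 A x0 y0 z0 (map \<tau> x) (map \<tau> y) (map \<tau> z)"
proof -
  obtain \<pi> where \<pi>: "\<pi> \<in> stab A" "map \<pi> x0 = x" "map \<pi> y0 = y" "map \<pi> z0 = z"
    using assms(1) unfolding rel3_def by (elim bexE conjE)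
  show ?thesis
    unfolding rel3_def
    by (rule bexI[OF _ stab_comp[OF assms(2) \<pi>(1)]]) (simp add: \<pi>(2-4)[symmetric])
qed

lemma eq3_image: "eq3 A x0 y0 z0 z z' \<Longrightarrow> \<tau> \<in> stab A \<Longrightarrow> eq3 A x0 y0 z0 (map \<tau> z) (map \<tau> z')"
  unfolding eq3_def
proof (induction rule: rtranclp_induct)
  case (step z z')
  then obtain x y where r: "rel3 A x0 y0 z0 x y z" "rel3 A x0 y0 z0 x y z'" by (elim exE conjE)
  show ?case
    by (rule rtranclp.rtrancl_into_rtrancl[OF step.IH[OF step.prems]])
      (intro exI[of _ "map \<tau> x"] exI[of _ "map \<tau> y"] conjI rel3_image[OF r(1) step.prems] rel3_image[OF r(2) step.prems])
qed simp

lemma rel3_conjg: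
  assumes "rel3 A x0 y0 z0 x y z"
  shows "conjg A x0 x" "conjg A y0 y" "conjg A z0 z"
proof -
  obtain \<pi> where "\<pi> \<in> stab A" "map \<pi> x0 = x" "map \<pi> y0 = y" "map \<pi> z0 = z"
    using assms unfolding rel3_def by (elim bexE conjE)
  then show "conjg A x0 x" "conjg A y0 y" "conjg A z0 z" by (auto intro: conjgI)
qed

lemma conjg_hd: "conjg A t t' \<Longrightarrow> statl A t \<Longrightarrow> t' \<noteq> [] \<and> hd t' \<in> D \<and> set t' \<subseteq> D"
proof -
  assume c: "conjg A t t'" and t: "statl A t"
  have "set t' \<subseteq> D" by (rule conjg_D[OF c statl_D(1)[OF t]])
  moreover have "t' \<noteq> []" using conjg_length[OF c] statl_D(2)[OF t] by auto
  ultimately show ?thesis using list.set_sel(1)[of t'] by auto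
qed

lemma stab_cl_iff:
  assumes "\<pi> \<in> stab A" "A \<subseteq> D" "C \<subseteq> D" "a \<in> D"
  shows "\<pi> a \<in> cl (\<pi> ` C \<union> A) \<longleftrightarrow> a \<in> cl (C \<union> A)"
proof -
  have "\<pi> ` A = A" using stab_fix[OF assms(1)] by force
  then have "\<pi> ` (C \<union> A) = \<pi> ` C \<union> A" by (simp only: image_Un)
  then show ?thesis using G_mem_cl[OF stab_G[OF assms(1)] _ assms(4), of "C \<union> A"] assms(2,3) by simp
qed

lemma conjg_statl_cl:
  assumes "conjg A t t'" "statl A t" "A \<subseteq> D"
  shows "set t' \<subseteq> cl (insert (hd t') A)" "hd t' \<notin> cl A"
proof -
  obtain \<pi> where \<pi>: "\<pi> \<in> stab A" "map \<pi> t = t'" using assms(1) unfolding conjg_def by blast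
  have hd: "hd t' = \<pi> (hd t)" using \<pi>(2) statl_D(2)[OF assms(2)] by (auto simp: hd_map)
  note t = statl_D[OF assms(2)]
  show "hd t' \<notin> cl A" using stab_cl_iff[OF \<pi>(1) assms(3) empty_subsetI t(3)] t(4) hd by simp
  show "set t' \<subseteq> cl (insert (hd t') A)"
  proof
    fix b assume "b \<in> set t'"
    then obtain a where a: "a \<in> set t" "b = \<pi> a" using \<pi>(2) by auto
    then show "b \<in> cl (insert (hd t') A)"
      using stab_cl_iff[OF \<pi>(1) assms(3), of "{hd t}" a] t(1,3,5) hd by auto
  qed
qed

lemma rel3_line:
  assumes l: "line A x0 y0 z0" and r: "rel3 A x0 y0 z0 x y z"
  shows "hd x \<in> D" "hd y \<in> D" "hd z \<in> D" "hd y \<notin> cl (insert (hd x) A)" "hd x \<notin> cl (insert (hd y) A)"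
    "hd z \<in> cl (insert (hd x) (insert (hd y) A))" "hd z \<notin> cl (insert (hd x) A)"
    "hd z \<notin> cl (insert (hd y) A)" "hd x \<in> cl (insert (hd y) (insert (hd z) A))"
    "hd y \<in> cl (insert (hd x) (insert (hd z) A))"
    "hd x \<notin> cl (insert (hd z) A)" "hd y \<notin> cl (insert (hd z) A)"
proof -
  note l1 = lineD[OF l] and l2 = lineD[OF line_rot[OF l]] and l3 = lineD[OF line_rot[OF line_rot[OF l]]]
  obtain \<pi> where \<pi>: "\<pi> \<in> stab A" "map \<pi> x0 = x" "map \<pi> y0 = y" "map \<pi> z0 = z"
    using r unfolding rel3_def by (elim bexE conjE)
  have hd: "hd x = \<pi> (hd x0)" "hd y = \<pi> (hd y0)" "hd z = \<pi> (hd z0)"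
    using \<pi>(2-4) statl_D(2) l1(3-5) by (auto simp: hd_map)
  note D = statl_D(3)[OF l1(3)] statl_D(3)[OF l1(4)] statl_D(3)[OF l1(5)]
  show "hd x \<in> D" "hd y \<in> D" "hd z \<in> D" unfolding hd using D G_mem[OF stab_G[OF \<pi>(1)]] by simp_all
  have 1: "\<pi> a \<in> cl (insert (\<pi> b) A) \<longleftrightarrow> a \<in> cl (insert b A)" if "a \<in> D" "b \<in> D" for a b
    using stab_cl_iff[OF \<pi>(1) l1(2) _ that(1), of "{b}"] that by simp
  have 2: "\<pi> a \<in> cl (insert (\<pi> b) (insert (\<pi> c) A)) \<longleftrightarrow> a \<in> cl (insert b (insert c A))"
    if "a \<in> D" "b \<in> D" "c \<in> D" for a b c
    using stab_cl_iff[OF \<pi>(1) l1(2) _ that(1), of "{b, c}"] that by simp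
  show "hd y \<notin> cl (insert (hd x) A)" "hd x \<notin> cl (insert (hd y) A)"
    "hd z \<in> cl (insert (hd x) (insert (hd y) A))" "hd z \<notin> cl (insert (hd x) A)"
    "hd z \<notin> cl (insert (hd y) A)" "hd x \<in> cl (insert (hd y) (insert (hd z) A))"
    "hd y \<in> cl (insert (hd x) (insert (hd z) A))"
    "hd x \<notin> cl (insert (hd z) A)" "hd y \<notin> cl (insert (hd z) A)"
    unfolding hd using 1 2 D l1(6-9) l2(6-9) l3(6-9) by (simp_all add: insert_commute)
qed

text \<open>Conjugating the base triple realises \<open>x\<close> together with some conjugate of
  \<open>y0\<close>. That conjugate and \<open>y\<close> are both generic over \<open>x\<close>, so
  stationarity moves one to the other while fixing \<open>x\<close>.\<close>

lemma rel3_exists: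
  assumes l: "line A x0 y0 z0" and x: "conjg A x0 x" and y: "conjg A y0 y" and gen: "hd y \<notin> cl (insert (hd x) A)"
  shows "\<exists>z. rel3 A x0 y0 z0 x y z"
proof -
  note l1 = lineD[OF l]
  obtain \<pi> where \<pi>: "\<pi> \<in> stab A" "map \<pi> x0 = x" using x unfolding conjg_def by blast
  have r: "rel3 A x0 y0 z0 x (map \<pi> y0) (map \<pi> z0)" unfolding rel3_def
    by (intro bexI[OF _ \<pi>(1)] conjI \<pi>(2) refl)
  have y': "conjg A y0 (map \<pi> y0)" by (rule conjg_image[OF \<pi>(1)])
  have xD: "set x \<subseteq> D" "hd x \<in> D" "x \<noteq> []" using conjg_hd[OF x l1(3)] by auto
  have xA: "insert (hd x) A \<subseteq> D" using xD(2) l1(2) by simp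
  have "A \<union> set x \<subseteq> cl (insert (hd x) A)"
    using conjg_statl_cl(1)[OF x l1(3,2)] cl_sub[OF xA] by simp
  from cl_minimal[OF this xA] have sub: "cl (A \<union> set x) \<subseteq> cl (insert (hd x) A)" .
  have "conjg (A \<union> set x) (map \<pi> y0) y"
    by (rule statl_conjg[OF l1(4) finite_set xD(1) y' y]) (use rel3_line(4)[OF l r] gen sub in auto)
  then obtain \<tau> where \<tau>: "\<tau> \<in> stab (A \<union> set x)" "map \<tau> (map \<pi> y0) = y" unfolding conjg_def by blast
  have \<tau>x: "map \<tau> x = x" using stab_fix[OF \<tau>(1)] by (intro map_idI) simp
  have "\<tau> \<in> stab A" by (rule stab_mono[OF _ \<tau>(1)]) simp
  from rel3_image[OF r this] show ?thesis unfolding \<tau>x \<tau>(2) by (rule exI)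
qed

text \<open>Two triples sharing \<open>x\<close> and \<open>y\<close> differ by an automorphism
  which, pulled back to the base triple, fixes \<open>x0\<close> and \<open>y0\<close>; a clause of
  \<open>line\<close> then confines the image of \<open>hd z0\<close>.\<close>

lemma rel3_interalg:
  assumes l: "line A x0 y0 z0" and r: "rel3 A x0 y0 z0 x y z" "rel3 A x0 y0 z0 x y z'"
  shows "hd z' \<in> cl (insert (hd z) A)"
proof -
  note l1 = lineD[OF l]
  obtain \<pi> where \<pi>: "\<pi> \<in> stab A" "map \<pi> x0 = x" "map \<pi> y0 = y" "map \<pi> z0 = z"
    using r(1) unfolding rel3_def by (elim bexE conjE)
  obtain \<tau> where \<tau>: "\<tau> \<in> stab A" "map \<tau> x0 = x" "map \<tau> y0 = y" "map \<tau> z0 = z'"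
    using r(2) unfolding rel3_def by (elim bexE conjE)
  obtain \<rho> where \<rho>: "\<rho> \<in> stab A" "\<forall>x\<in>D. \<rho> (\<pi> x) = x \<and> \<pi> (\<rho> x) = x" using stab_inv[OF \<pi>(1) l1(2)] by blast
  let ?k = "\<lambda>x. \<rho> (\<tau> x)"
  have fix0: "?k a = a" if "a \<in> set x0 \<union> set y0" for a
  proof -
    have "\<tau> a = \<pi> a" using \<pi>(2,3) \<tau>(2,3) that by (metis Un_iff map_eq_conv)
    then show ?thesis using \<rho>(2) that statl_D(1)[OF l1(3)] statl_D(1)[OF l1(4)] by auto
  qed
  have "?k \<in> stab A" by (rule stab_comp[OF \<rho>(1) \<tau>(1)])
  then have "?k \<in> stab (A \<union> set x0 \<union> set y0)" using fix0 unfolding stab_def by auto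
  then have k: "?k (hd z0) \<in> cl (insert (hd z0) A)" by (rule lineS(1)[OF l])
  have z0: "hd z0 \<in> D" "z0 \<noteq> []" using statl_D[OF l1(5)] by simp_all
  have \<tau>z: "\<tau> (hd z0) \<in> D" by (rule G_mem[OF stab_G[OF \<tau>(1)] z0(1)])
  have kD: "?k (hd z0) \<in> D" by (rule G_mem[OF stab_G[OF \<rho>(1)] \<tau>z])
  have "\<pi> (?k (hd z0)) \<in> cl (insert (\<pi> (hd z0)) A)"
    using stab_cl_iff[OF \<pi>(1) l1(2) _ kD, of "{hd z0}"] z0(1) k by simp
  moreover have "\<pi> (?k (hd z0)) = \<tau> (hd z0)" using \<rho>(2) \<tau>z by simp
  moreover have "\<pi> (hd z0) = hd z" "\<tau> (hd z0) = hd z'" using \<pi>(4) \<tau>(4) z0(2) by (auto simp: hd_map)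
  ultimately show ?thesis by simp
qed

lemma eq3_cl:
  assumes l: "line A x0 y0 z0" and e: "eq3 A x0 y0 z0 z z'" and z: "conjg A z0 z"
  shows "conjg A z0 z' \<and> cl (insert (hd z') A) = cl (insert (hd z) A)"
  using e unfolding eq3_def
proof (induction rule: rtranclp_induct)
  case base
  then show ?case using z by simp
next
  case (step w w')
  then obtain x y where r: "rel3 A x0 y0 z0 x y w" "rel3 A x0 y0 z0 x y w'" by (elim exE conjE)
  have w: "insert (hd w) A \<subseteq> D" "insert (hd w') A \<subseteq> D"
    using rel3_line(3)[OF l r(1)] rel3_line(3)[OF l r(2)] lineD(2)[OF l] by simp_all
  have "insert (hd w') A \<subseteq> cl (insert (hd w) A)" "insert (hd w) A \<subseteq> cl (insert (hd w') A)"
    using rel3_interalg[OF l r] rel3_interalg[OF l r(2,1)] cl_sub[OF w(1)] cl_sub[OF w(2)] by simp_all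
  then have "cl (insert (hd w') A) = cl (insert (hd w) A)"
    using cl_minimal[OF _ w(1)] cl_minimal[OF _ w(2)] by blast
  then show ?case using step.IH rel3_conjg(3)[OF r(2)] by simp
qed

text \<open>By stationarity, the witness for an elementary step of the equivalence can be moved to the given
  second coordinate.\<close>

lemma eq3_transfer:
  assumes l: "line A x0 y0 z0" and x: "conjg A x0 x" and e: "eq3 A y0 z0 x0 x x'"
    and r: "rel3 A x0 y0 z0 x y z" "rel3 A x0 y0 z0 x' y z'"
  shows "eq3 A x0 y0 z0 z z'"
proof -
  note l1 = lineD[OF l] and l2 = line_rot[OF l]
  have main: "(\<lambda>w w'. \<exists>u v. rel3 A y0 z0 x0 u v w \<and> rel3 A y0 z0 x0 u v w')\<^sup>*\<^sup>* x x' \<Longrightarrow>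
    rel3 A x0 y0 z0 x' y z' \<Longrightarrow> eq3 A x0 y0 z0 z z'" for z'
  proof (induction arbitrary: z' rule: rtranclp_induct)
    case base
    show ?case by (rule eq3_base[OF r(1) base])
  next
    case (step x1 x')
    then obtain y1 w where w0: "rel3 A y0 z0 x0 y1 w x1" "rel3 A y0 z0 x0 y1 w x'"
      by (elim exE conjE)
    note w = rel3_rot[THEN iffD1, OF w0(1)] rel3_rot[THEN iffD1, OF w0(2)]
    have ex1: "eq3 A y0 z0 x0 x x1" using step.hyps(1) unfolding eq3_def .
    have e1: "eq3 A y0 z0 x0 x1 x'" by (rule eq3_base[OF w0])
    have x1: "conjg A x0 x1" by (rule rel3_conjg(1)[OF w(1)])
    have x': "conjg A x0 x'" by (rule rel3_conjg(1)[OF w(2)])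
    have cl1: "cl (insert (hd x') A) = cl (insert (hd x1) A)" using eq3_cl[OF l2 e1 x1] by simp
    have y: "conjg A y0 y" "hd y \<notin> cl (insert (hd x1) A)"
      using rel3_conjg(2)[OF r(1)] rel3_line(4)[OF l step.prems] cl1 by simp_all
    obtain z1 where z1: "rel3 A x0 y0 z0 x1 y z1" using rel3_exists[OF l x1 y] by blast
    have IH: "eq3 A x0 y0 z0 z z1" by (rule step.IH[OF z1])
    have D: "set x1 \<subseteq> D" "hd x1 \<in> D" "set x' \<subseteq> D" using conjg_hd[OF x1 l1(3)] conjg_hd[OF x' l1(3)] by auto
    have x1A: "insert (hd x1) A \<subseteq> D" using D(2) l1(2) by simp
    \<comment> \<open>Equivalent first coordinates have the same closure, so freeness from
      \<open>hd x1\<close> is freeness from both tuples together.\<close>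
    have "A \<union> (set x1 \<union> set x') \<subseteq> cl (insert (hd x1) A)"
      using conjg_statl_cl(1)[OF x1 l1(3,2)] conjg_statl_cl(1)[OF x' l1(3,2)] cl_sub[OF x1A] cl1 by simp
    from cl_minimal[OF this x1A] have sub: "cl (A \<union> (set x1 \<union> set x')) \<subseteq> cl (insert (hd x1) A)" .
    have "conjg (A \<union> (set x1 \<union> set x')) y1 y"
      by (rule statl_conjg[OF l1(4) _ _ rel3_conjg(2)[OF w(1)] y(1)])
        (use D rel3_line(4)[OF l w(1)] y(2) sub in auto)
    then obtain \<tau> where \<tau>: "\<tau> \<in> stab (A \<union> (set x1 \<union> set x'))" "map \<tau> y1 = y" unfolding conjg_def by blast
    have "map \<tau> x1 = x1" "map \<tau> x' = x'" using stab_fix[OF \<tau>(1)] by (auto intro!: map_idI)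
    moreover have \<tau>A: "\<tau> \<in> stab A" by (rule stab_mono[OF _ \<tau>(1)]) simp
    ultimately have w': "rel3 A x0 y0 z0 x1 y (map \<tau> w)" "rel3 A x0 y0 z0 x' y (map \<tau> w)"
      using rel3_image[OF w(1) \<tau>A] rel3_image[OF w(2) \<tau>A] \<tau>(2) by simp_all
    show ?case
      by (rule eq3_trans[OF IH eq3_trans[OF eq3_base[OF z1 w'(1)] eq3_base[OF w'(2) step.prems]]])
  qed
  show ?thesis by (rule main[OF e[unfolded eq3_def] r(2)])
qed

text \<open>The coordinates are changed one after the other. The intermediate triple on
  \<open>x'\<close> and \<open>y\<close> exists because \<open>x\<close> and \<open>x'\<close> span
  the same closure.\<close>

lemma eq3_transfer2:
  assumes l: "line A x0 y0 z0" and e: "eq3 A y0 z0 x0 x x'" "eq3 A z0 x0 y0 y y'"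
    and r: "rel3 A x0 y0 z0 x y z" "rel3 A x0 y0 z0 x' y' z'"
  shows "eq3 A x0 y0 z0 z z'"
proof -
  note x = rel3_conjg(1)[OF r(1)] and y = rel3_conjg(2)[OF r(1)]
  have "cl (insert (hd x') A) = cl (insert (hd x) A)" using eq3_cl[OF line_rot[OF l] e(1) x] by simp
  then have "hd y \<notin> cl (insert (hd x') A)" using rel3_line(4)[OF l r(1)] by simp
  then obtain z1 where z1: "rel3 A x0 y0 z0 x' y z1" using rel3_exists[OF l rel3_conjg(1)[OF r(2)] y] by blast
  have "eq3 A x0 y0 z0 z z1" by (rule eq3_transfer[OF l x e(1) r(1) z1])
  moreover have "eq3 A y0 x0 z0 z1 z'"
    by (rule eq3_transfer[OF line_swap[OF l] y])
      (rule e(2)[folded eq3_swap[of A x0 z0 y0]] rel3_swap[THEN iffD2, OF z1] rel3_swap[THEN iffD2, OF r(2)])+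
  then have "eq3 A x0 y0 z0 z1 z'" unfolding eq3_swap[of A y0 x0 z0] .
  ultimately show ?thesis by (rule eq3_trans)
qed

end

text \<open>The assumption \<open>quad\<close> is the quadrangle condition at the level of closures.\<close>

locale net = homog_pregeom +
  fixes A :: "'a set" and x0 y0 z0 :: "'a list"
  assumes line: "line A x0 y0 z0"
    and quad: "\<And>x1 x2 y1 y2 z11 z12 z21 z22. indep A [hd y1, hd y2, hd x1, hd x2] \<Longrightarrow>
      rel3 A x0 y0 z0 x1 y1 z11 \<Longrightarrow> rel3 A x0 y0 z0 x1 y2 z12 \<Longrightarrow> rel3 A x0 y0 z0 x2 y1 z21 \<Longrightarrow>
      rel3 A x0 y0 z0 x2 y2 z22 \<Longrightarrow> hd z22 \<in> cl (A \<union> {hd z11, hd z12, hd z21})"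
begin

abbreviation R where "R \<equiv> rel3 A x0 y0 z0"
abbreviation eqX where "eqX \<equiv> eq3 A y0 z0 x0"
abbreviation eqY where "eqY \<equiv> eq3 A z0 x0 y0"
abbreviation eqZ where "eqZ \<equiv> eq3 A x0 y0 z0"

definition X where "X = {x. conjg A x0 x}"
definition Y where "Y = {y. conjg A y0 y}"

lemma AD: "A \<subseteq> D" "finite A"
  using lineD(1,2)[OF line] by simp_all

lemma XY_D: "x \<in> X \<Longrightarrow> hd x \<in> D" "y \<in> Y \<Longrightarrow> hd y \<in> D"
  using conjg_hd[OF _ lineD(3)[OF line]] conjg_hd[OF _ lineD(4)[OF line]] unfolding X_def Y_def by auto

lemma R_XY: "R x y z \<Longrightarrow> x \<in> X" "R x y z \<Longrightarrow> y \<in> Y"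
  unfolding X_def Y_def using rel3_conjg by auto

lemma X_eq: "eqX x x' \<Longrightarrow> x \<in> X \<Longrightarrow> x' \<in> X \<and> cl (insert (hd x') A) = cl (insert (hd x) A)"
  using eq3_cl[OF line_rot[OF line]] unfolding X_def by auto

lemma Z_eq: "eqZ z z' \<Longrightarrow> R x y z \<Longrightarrow> cl (insert (hd z') A) = cl (insert (hd z) A)"
  by (rule conjunct2[OF eq3_cl[OF line _ rel3_conjg(3)]])

lemma R_ex_z: "x \<in> X \<Longrightarrow> y \<in> Y \<Longrightarrow> hd y \<notin> cl (insert (hd x) A) \<Longrightarrow> \<exists>z. R x y z"
  unfolding X_def Y_def using rel3_exists[OF line] by simp

lemma R_ex_x: "y \<in> Y \<Longrightarrow> R u v z \<Longrightarrow> hd z \<notin> cl (insert (hd y) A) \<Longrightarrow> \<exists>x. R x y z"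
  using rel3_exists[OF line_rot[OF line], of y z] rel3_conjg(3)[of A x0 y0 z0 u v z]
    rel3_rot[of A y0 z0 x0 y z] unfolding Y_def by auto

lemma R_ex_y: "x \<in> X \<Longrightarrow> R u v z \<Longrightarrow> hd z \<notin> cl (insert (hd x) A) \<Longrightarrow> \<exists>y. R x y z"
  using rel3_exists[OF line_swap[OF line_rot[OF line_rot[OF line]]], of x z] rel3_conjg(3)[of A x0 y0 z0 u v z]
    rel3_swap[of A x0 z0 y0 x z] rel3_rot[of A z0 x0 y0 z x] rel3_rot[of A y0 z0 x0 _ z x]
  unfolding X_def by auto

lemma eqZ_transfer: "eqX x x' \<Longrightarrow> eqY y y' \<Longrightarrow> R x y z \<Longrightarrow> R x' y' z' \<Longrightarrow> eqZ z z'"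
  by (rule eq3_transfer2[OF line])

lemma eqX_transfer: "eqY y y' \<Longrightarrow> eqZ z z' \<Longrightarrow> R x y z \<Longrightarrow> R x' y' z' \<Longrightarrow> eqX x x'"
  by (rule eq3_transfer2[OF line_rot[OF line]]) (simp_all only: rel3_rot[of A y0 z0 x0])

lemma eqY_transfer: "eqZ z z' \<Longrightarrow> eqX x x' \<Longrightarrow> R x y z \<Longrightarrow> R x' y' z' \<Longrightarrow> eqY y y'"
  by (rule eq3_transfer2[OF line_rot[OF line_rot[OF line]]]) (simp_all only: rel3_rot[of A z0 x0 y0] rel3_rot[of A y0 z0 x0])

text \<open>By \<open>quad\<close>, all four of the z's lie in a closure over which
  \<open>x1\<close> and \<open>x1'\<close> are generic. Stationarity gives an automorphism taking
  \<open>x1\<close> to \<open>x1'\<close> and fixing the four z's. After applying it, both second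
  coordinates, then the second row and finally the fourth corner agree with the primed configuration
  up to equivalence.\<close>

lemma quadrangle:
  assumes R: "R x1 y1 z11" "R x1 y2 z12" "R x2 y1 z21" "R x2 y2 z22"
    and R': "R x1' y1' z11'" "R x1' y2' z12'" "R x2' y1' z21'" "R x2' y2' z22'"
    and e: "eqZ z11 z11'" "eqZ z12 z12'" "eqZ z21 z21'"
    and gen: "hd x1 \<notin> cl (A \<union> {hd z11, hd z12, hd z21})" "hd x1' \<notin> cl (A \<union> {hd z11, hd z12, hd z21})"
    and ind: "indep A [hd y1, hd y2, hd x1, hd x2]"
  shows "eqZ z22 z22'"
proof -
  note zD = rel3_line(3)[OF line R(1)] rel3_line(3)[OF line R(2)] rel3_line(3)[OF line R(3)] rel3_line(3)[OF line R(4)]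
  let ?H = "A \<union> {hd z11, hd z12, hd z21}"
  have HD: "?H \<subseteq> D" using AD(1) zD by simp
  have z22: "hd z22 \<in> cl ?H" by (rule quad[OF ind R])
  let ?C = "set z11 \<union> set z12 \<union> set z21 \<union> set z22"
  have sub: "set z \<subseteq> cl ?H \<and> set z \<subseteq> D" if z: "R x y z" "hd z \<in> cl ?H" for x y z
  proof -
    have "set z \<subseteq> cl (insert (hd z) A)"
      by (rule conjg_statl_cl(1)[OF rel3_conjg(3)[OF z(1)] lineD(5)[OF line] AD(1)])
    also have "\<dots> \<subseteq> cl ?H" using z(2) cl_sub[OF HD] by (intro cl_minimal[OF _ HD]) simp
    finally show ?thesis using cl_D[OF HD] by auto
  qed
  have CH: "?C \<subseteq> cl ?H \<and> ?C \<subseteq> D"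
    using sub[OF R(1)] sub[OF R(2)] sub[OF R(3)] sub[OF R(4) z22] cl_sub[OF HD] by simp
  then have "A \<union> ?C \<subseteq> cl ?H" using cl_sub[OF HD] by simp
  from cl_minimal[OF this HD] have clC: "cl (A \<union> ?C) \<subseteq> cl ?H" .
  have "conjg (A \<union> ?C) x1 x1'"
    by (rule statl_conjg[OF lineD(3)[OF line] _ _ rel3_conjg(1)[OF R(1)] rel3_conjg(1)[OF R'(1)]])
      (use CH clC gen in auto)
  then obtain \<pi> where \<pi>: "\<pi> \<in> stab (A \<union> ?C)" "map \<pi> x1 = x1'" unfolding conjg_def by blast
  have \<pi>A: "\<pi> \<in> stab A" by (rule stab_mono[OF _ \<pi>(1)]) simp
  have \<pi>z: "map \<pi> z11 = z11" "map \<pi> z12 = z12" "map \<pi> z21 = z21" "map \<pi> z22 = z22"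
    using stab_fix[OF \<pi>(1)] by (auto intro!: map_idI)
  note S = rel3_image[OF R(1) \<pi>A, unfolded \<pi>z \<pi>(2)] rel3_image[OF R(2) \<pi>A, unfolded \<pi>z \<pi>(2)]
    rel3_image[OF R(3) \<pi>A, unfolded \<pi>z] rel3_image[OF R(4) \<pi>A, unfolded \<pi>z]
  have y1: "eqY (map \<pi> y1) y1'" by (rule eqY_transfer[OF e(1) eq3_refl S(1) R'(1)])
  have y2: "eqY (map \<pi> y2) y2'" by (rule eqY_transfer[OF e(2) eq3_refl S(2) R'(2)])
  have x2: "eqX (map \<pi> x2) x2'" by (rule eqX_transfer[OF y1 e(3) S(3) R'(3)])
  show ?thesis by (rule eqZ_transfer[OF x2 y2 S(4) R'(4)])
qed

end

context pregeom begin

lemma indep_length: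
  assumes "indep C ds" "set ds \<subseteq> cl (C \<union> set es)" "C \<subseteq> D" "set es \<subseteq> D"
  shows "length ds \<le> length es"
  using assms
proof (induction ds arbitrary: C es)
  case (Cons d ds)
  have d: "d \<in> D" "d \<notin> cl C" "indep (insert d C) ds" using Cons.prems(1) by auto
  have "\<exists>us e vs. es = us @ e # vs \<and> d \<notin> cl (C \<union> set us) \<and> d \<in> cl (C \<union> set us \<union> {e})"
    if "d \<in> cl (C \<union> set es)" for es
    using that
  proof (induction es rule: rev_induct)
    case Nil
    then show ?case using d(2) by simp
  next
    case (snoc e es)
    show ?case
    proof (cases "d \<in> cl (C \<union> set es)")
      case True
      from snoc.IH[OF this]
      obtain us e' vs where "es = us @ e' # vs" "d \<notin> cl (C \<union> set us)" "d \<in> cl (C \<union> set us \<union> {e'})"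
        by (elim exE conjE)
      then show ?thesis by (intro exI[of _ us] exI[of _ e'] exI[of _ "vs @ [e]"]) simp
    next
      case False
      then show ?thesis using snoc.prems by (intro exI[of _ es] exI[of _ e] exI[of _ "[]"]) simp
    qed
  qed
  moreover have "d \<in> cl (C \<union> set es)" using Cons.prems(2) by simp
  ultimately obtain us e vs where es: "es = us @ e # vs" "d \<notin> cl (C \<union> set us)" "d \<in> cl (C \<union> set us \<union> {e})"
    by blast
  have eD: "e \<in> D" "C \<union> set us \<subseteq> D" using Cons.prems(3,4) es(1) by simp_all
  have e: "e \<in> cl (insert d (C \<union> set us))"
    by (rule exchange[OF eD(2) d(1) eD(1)]) (use es in simp_all)
  have UD: "insert d C \<union> set (us @ vs) \<subseteq> D" using Cons.prems(3,4) es(1) d(1) by simp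
  have "cl (insert d (C \<union> set us)) \<subseteq> cl (insert d C \<union> set (us @ vs))"
    by (rule cl_mono[OF _ UD]) auto
  then have "C \<union> set es \<subseteq> cl (insert d C \<union> set (us @ vs))"
    using cl_sub[OF UD] e es(1) by auto
  from cl_minimal[OF this UD] have "set ds \<subseteq> cl (insert d C \<union> set (us @ vs))"
    using Cons.prems(2) by auto
  from Cons.IH[OF d(3) this] show ?case using UD es(1) by simp
qed simp

lemma indep_span:
  assumes "indep C ds" "set ds \<subseteq> cl (C \<union> set es)" "C \<subseteq> D" "set es \<subseteq> D" "length es \<le> length ds"
  shows "indep C es"
proof (rule ccontr)
  assume "\<not> indep C es"
  from indep_shorter[OF this assms(3,4,2)] obtain es' where
    es': "length es' < length es" "set es' \<subseteq> set es" "set ds \<subseteq> cl (C \<union> set es')" by blast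
  have "length ds \<le> length es'" by (rule indep_length[OF assms(1) es'(3) assms(3)]) (use es'(2) assms(4) in auto)
  then show False using es'(1) assms(5) by simp
qed

text \<open>\<open>F\<close> need not be contained in \<open>A\<close>, so infinite dimension of
  \<open>A\<close> cannot be invoked directly. Instead, one more independent element of
  \<open>A\<close> is taken than \<open>F\<close> could span over \<open>C\<close>.\<close>

lemma inf_dim_outside2:
  assumes A: "A \<subseteq> D" "cl A = A" "inf_dim A" and C: "finite C" "C \<subseteq> A" and F: "finite F" "F \<subseteq> D"
  shows "\<exists>a\<in>A. a \<notin> cl (C \<union> F)"
proof (rule ccontr)
  assume *: "\<not> ?thesis"
  obtain es where es: "set es = F" using finite_list[OF F(1)] by blast
  obtain ds where ds: "length ds = Suc (length es)" "indep C ds" "set ds \<subseteq> A"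
    using inf_dim_indep[OF A C] by blast
  have "set ds \<subseteq> cl (C \<union> set es)" using * ds(3) es by auto
  from indep_length[OF ds(2) this] show False using ds(1) C(2) A(1) F(2) es by auto
qed

end

section \<open>Closures over the fixed parameters\<close>

context net begin

abbreviation K where "K C \<equiv> cl (A \<union> C)"

lemma K_sub: "C \<subseteq> D \<Longrightarrow> c \<in> C \<Longrightarrow> c \<in> K C"
  using cl_sub[of "A \<union> C"] AD(1) by auto

lemma K_mono: "C \<subseteq> C' \<Longrightarrow> C' \<subseteq> D \<Longrightarrow> c \<in> K C \<Longrightarrow> c \<in> K C'"
  using cl_mono[of "A \<union> C" "A \<union> C'"] AD(1) by auto

lemma notK_mono: "c \<notin> K C' \<Longrightarrow> C' \<subseteq> D \<Longrightarrow> C \<subseteq> C' \<Longrightarrow> c \<notin> K C"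
  by (erule contrapos_nn) (rule K_mono)

lemma K_min: "C \<subseteq> K E \<Longrightarrow> E \<subseteq> D \<Longrightarrow> c \<in> K C \<Longrightarrow> c \<in> K E"
proof -
  assume *: "C \<subseteq> K E" "E \<subseteq> D" "c \<in> K C"
  have "A \<union> E \<subseteq> D" using AD(1) *(2) by simp
  then have "K C \<subseteq> K E" using cl_sub[of "A \<union> E"] *(1) by (intro cl_minimal) auto
  then show ?thesis using *(3) by blast
qed

lemma K_exchange: "C \<subseteq> D \<Longrightarrow> a \<in> D \<Longrightarrow> b \<in> D \<Longrightarrow> a \<in> K (insert b C) \<Longrightarrow> a \<notin> K C \<Longrightarrow> b \<in> K (insert a C)"
  using exchange[of "A \<union> C" a b] AD(1) by simp

lemma K_insert: "cl (insert a A) = K {a}" "cl (insert a (insert b A)) = K {a, b}"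
  by simp_all

lemma R_D: "R x y z \<Longrightarrow> hd x \<in> D" "R x y z \<Longrightarrow> hd y \<in> D" "R x y z \<Longrightarrow> hd z \<in> D"
  using rel3_line(1-3)[OF line] by simp_all

lemma R_K:
  assumes "R x y z" "C \<subseteq> D"
  shows "hd x \<in> K C \<Longrightarrow> hd y \<in> K C \<Longrightarrow> hd z \<in> K C"
    and "hd y \<in> K C \<Longrightarrow> hd z \<in> K C \<Longrightarrow> hd x \<in> K C"
    and "hd x \<in> K C \<Longrightarrow> hd z \<in> K C \<Longrightarrow> hd y \<in> K C"
proof -
  note r = rel3_line(6,9,10)[OF line assms(1), unfolded K_insert]
  show "hd x \<in> K C \<Longrightarrow> hd y \<in> K C \<Longrightarrow> hd z \<in> K C" by (rule K_min[OF _ assms(2) r(1)]) simp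
  show "hd y \<in> K C \<Longrightarrow> hd z \<in> K C \<Longrightarrow> hd x \<in> K C" by (rule K_min[OF _ assms(2) r(2)]) simp
  show "hd x \<in> K C \<Longrightarrow> hd z \<in> K C \<Longrightarrow> hd y \<in> K C" by (rule K_min[OF _ assms(2) r(3)]) simp
qed

lemma eqX_K: "eqX x x' \<Longrightarrow> x \<in> X \<Longrightarrow> C \<subseteq> D \<Longrightarrow> hd x \<in> K C \<longleftrightarrow> hd x' \<in> K C"
proof -
  assume *: "eqX x x'" "x \<in> X" "C \<subseteq> D"
  have e: "x' \<in> X" "K {hd x'} = K {hd x}" using X_eq[OF *(1,2)] unfolding K_insert by simp_all
  have "hd x' \<in> K {hd x}" "hd x \<in> K {hd x'}"
    using K_sub[of "{hd x}" "hd x"] K_sub[of "{hd x'}" "hd x'"] XY_D(1)[OF *(2)] XY_D(1)[OF e(1)] e(2) by simp_all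
  then show ?thesis using K_min[of "{hd x}" C "hd x'"] K_min[of "{hd x'}" C "hd x"] *(3) by auto
qed

lemma eqZ_K: "eqZ z z' \<Longrightarrow> R x y z \<Longrightarrow> R x' y' z' \<Longrightarrow> C \<subseteq> D \<Longrightarrow> hd z \<in> K C \<longleftrightarrow> hd z' \<in> K C"
proof -
  assume *: "eqZ z z'" "R x y z" "R x' y' z'" "C \<subseteq> D"
  have e: "K {hd z'} = K {hd z}" using Z_eq[OF *(1,2)] unfolding K_insert .
  have "hd z' \<in> K {hd z}" "hd z \<in> K {hd z'}"
    using K_sub[of "{hd z}" "hd z"] K_sub[of "{hd z'}" "hd z'"] R_D(3)[OF *(2)] R_D(3)[OF *(3)] e by simp_all
  then show ?thesis using K_min[of "{hd z}" C "hd z'"] K_min[of "{hd z'}" C "hd z"] *(4) by auto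
qed

lemma XY_K: "x \<in> X \<Longrightarrow> hd x \<notin> K {}" "y \<in> Y \<Longrightarrow> hd y \<notin> K {}"
  using conjg_statl_cl(2)[OF _ lineD(3)[OF line] AD(1)] conjg_statl_cl(2)[OF _ lineD(4)[OF line] AD(1)]
  unfolding X_def Y_def by simp_all

text \<open>All elements generic over \<open>A\<close> are conjugate over \<open>A\<close>, so the
  head of a conjugate can be prescribed.\<close>

lemma statl_conj_generic:
  assumes "statl A t" "d \<in> D" "d \<notin> cl A"
  shows "\<exists>t'. conjg A t t' \<and> hd t' = d"
proof -
  obtain \<pi> where \<pi>: "\<pi> \<in> G" "\<forall>a\<in>cl A. \<pi> a = a" "\<pi> (hd t) = d"
    using homog[OF countable_finite[OF AD(2)] AD(1), of "hd t" d] statl_D[OF assms(1)] assms(2,3) by auto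
  have "\<pi> \<in> stab A" using \<pi>(1,2) cl_sub[OF AD(1)] unfolding stab_def by auto
  then show ?thesis using \<pi>(3) statl_D(2)[OF assms(1)]
    by (intro exI[of _ "map \<pi> t"] conjI conjg_image) (simp_all add: hd_map)
qed

lemma ex_X: "finite C \<Longrightarrow> C \<subseteq> D \<Longrightarrow> \<exists>x\<in>X. hd x \<notin> K C"
proof -
  assume *: "finite C" "C \<subseteq> D"
  obtain d where d: "d \<in> D" "d \<notin> K C" using outside[of "A \<union> C"] AD * by (auto simp: countable_finite)
  then have "d \<notin> cl A" using K_mono[of "{}" C d] *(2) by auto
  then show ?thesis using statl_conj_generic[OF lineD(3)[OF line] d(1)] d(2) unfolding X_def by auto
qed

lemma ex_Y:
  assumes "d \<in> D" "d \<notin> cl A"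
  shows "\<exists>y\<in>Y. hd y = d"
  using statl_conj_generic[OF lineD(4)[OF line] assms] unfolding Y_def by auto

lemma ex_Y_generic: "finite C \<Longrightarrow> C \<subseteq> D \<Longrightarrow> \<exists>y\<in>Y. hd y \<notin> K C"
proof -
  assume *: "finite C" "C \<subseteq> D"
  obtain d where d: "d \<in> D" "d \<notin> K C" using outside[of "A \<union> C"] AD * by (auto simp: countable_finite)
  then have "d \<notin> cl A" using K_mono[of "{}" C d] *(2) by auto
  then show ?thesis using ex_Y[OF d(1)] d(2) by auto
qed

lemma Y_stab: "y \<in> Y \<Longrightarrow> \<pi> \<in> stab A \<Longrightarrow> map \<pi> y \<in> Y"
  unfolding Y_def using conjg_trans[OF _ conjg_image] by blast

lemma Y_cl: "y \<in> Y \<Longrightarrow> set y \<subseteq> K {hd y}"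
  using conjg_statl_cl(1)[OF _ lineD(4)[OF line] AD(1)] unfolding Y_def K_insert by simp

lemma Y_set: "y \<in> Y \<Longrightarrow> set y \<subseteq> D" "y \<in> Y \<Longrightarrow> y \<noteq> []" "y \<in> Y \<Longrightarrow> length y = length y0"
  using conjg_hd[OF _ lineD(4)[OF line]] conjg_length[of A y0 y] unfolding Y_def by auto

subsection \<open>Germs\<close>

text \<open>The graph of the passage from \<open>x\<close> along \<open>y\<close> to a point
  \<open>z\<close> and back along \<open>y'\<close> to \<open>x'\<close>. The point has to be
  matched only up to \<open>eqZ\<close>, so the relation is single-valued up to
  \<open>eqX\<close>.\<close>

definition Th where
  "Th y y' x x' \<longleftrightarrow> (\<exists>z z'. R x y z \<and> eqZ z z' \<and> R x' y' z')"

lemma ThE: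
  assumes "Th y y' x x'"
  obtains z z' where "R x y z" "eqZ z z'" "R x' y' z'"
  using assms unfolding Th_def by blast

lemma Th_XY: "Th y y' x x' \<Longrightarrow> x \<in> X \<and> x' \<in> X \<and> y \<in> Y \<and> y' \<in> Y"
  using R_XY by (elim ThE) blast

lemma Th_exists:
  assumes "x \<in> X" "y \<in> Y" "y' \<in> Y" "hd x \<notin> K {hd y, hd y'}"
  shows "\<exists>x'. Th y y' x x'"
proof -
  note D = XY_D(1)[OF assms(1)] XY_D(2)[OF assms(2)] XY_D(2)[OF assms(3)]
  have C: "{hd y, hd y'} \<subseteq> D" using D by simp
  have "hd y \<notin> K {hd x}"
  proof
    assume "hd y \<in> K {hd x}"
    then have "hd x \<in> K {hd y}" using K_exchange[of "{}" "hd y" "hd x"] D XY_K(2)[OF assms(2)] by simp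
    with K_mono[OF _ C] assms(4) show False by blast
  qed
  then obtain z where z: "R x y z" using R_ex_z[OF assms(1,2)] by auto
  have "hd z \<notin> K {hd y'}"
  proof
    assume "hd z \<in> K {hd y'}"
    then have "hd z \<in> K {hd y, hd y'}" using K_mono[OF _ C] by blast
    then show False using R_K(2)[OF z C K_sub[OF C]] assms(4) by simp
  qed
  then obtain x' where "R x' y' z" using R_ex_x[OF assms(3) z] by auto
  then show ?thesis unfolding Th_def using z eq3_refl by blast
qed

lemma Th_sym: "Th y y' x x' \<Longrightarrow> Th y' y x' x"
  by (elim ThE) (auto simp: Th_def intro: eq3_sym)

lemma Th_generic1:
  assumes "Th y y' x x'" "C \<subseteq> D" "hd y \<in> K C" "hd y' \<in> K C" "hd x \<in> K C"
  shows "hd x' \<in> K C"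
  using assms(1)
proof (rule ThE)
  fix z z' assume z: "R x y z" "eqZ z z'" "R x' y' z'"
  have "hd z \<in> K C" by (rule R_K(1)[OF z(1) assms(2,5,3)])
  then have "hd z' \<in> K C" using eqZ_K[OF z(2,1,3) assms(2)] by simp
  then show ?thesis by (rule R_K(2)[OF z(3) assms(2,4)])
qed

lemma Th_generic:
  assumes "Th y y' x x'" "C \<subseteq> D" "hd y \<in> C" "hd y' \<in> C"
  shows "hd x \<in> K C \<longleftrightarrow> hd x' \<in> K C"
  using Th_generic1[OF assms(1,2) K_sub[OF assms(2,3)] K_sub[OF assms(2,4)]]
    Th_generic1[OF Th_sym[OF assms(1)] assms(2) K_sub[OF assms(2,4)] K_sub[OF assms(2,3)]] by blast

lemma Th_unique:
  assumes "eqX x1 x2" "Th y y' x1 x1'" "Th y y' x2 x2'"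
  shows "eqX x1' x2'"
proof -
  obtain z1 z1' where z1: "R x1 y z1" "eqZ z1 z1'" "R x1' y' z1'" using assms(2) by (rule ThE)
  obtain z2 z2' where z2: "R x2 y z2" "eqZ z2 z2'" "R x2' y' z2'" using assms(3) by (rule ThE)
  have "eqZ z1 z2" by (rule eqZ_transfer[OF assms(1) eq3_refl z1(1) z2(1)])
  then have "eqZ z1' z2'" by (rule eq3_trans[OF eq3_sym[OF z1(2)] eq3_trans[OF _ z2(2)]])
  then show ?thesis by (rule eqX_transfer[OF eq3_refl _ z1(3) z2(3)])
qed

lemma Th_comp:
  assumes "Th y y' x x'" "Th y' y'' x' x''"
  shows "Th y y'' x x''"
proof -
  obtain z z' where z: "R x y z" "eqZ z z'" "R x' y' z'" using assms(1) by (rule ThE)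
  obtain w w' where w: "R x' y' w" "eqZ w w'" "R x'' y'' w'" using assms(2) by (rule ThE)
  have "eqZ z' w" by (rule eqZ_transfer[OF eq3_refl eq3_refl z(3) w(1)])
  then have "eqZ z w'" by (rule eq3_trans[OF z(2) eq3_trans[OF _ w(2)]])
  then show ?thesis unfolding Th_def using z(1) w(3) by blast
qed

lemma Th_image: "Th y y' x x' \<Longrightarrow> \<pi> \<in> stab A \<Longrightarrow> Th (map \<pi> y) (map \<pi> y') (map \<pi> x) (map \<pi> x')"
  by (elim ThE) (use rel3_image eq3_image in \<open>unfold Th_def, blast\<close>)

text \<open>Germs are compared at elements generic over a finite set, which \<open>geq\<close>
  quantifies existentially. It can always be enlarged, so the sets belonging to several germs can be
  merged and made to contain all the heads involved.\<close>

definition geq_on where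
  "geq_on C y y' m m' \<longleftrightarrow> finite C \<and> C \<subseteq> D \<and> y \<in> Y \<and> y' \<in> Y \<and> m \<in> Y \<and> m' \<in> Y \<and>
    (\<forall>x x' x''. hd x \<notin> K C \<and> Th y y' x x' \<and> Th m m' x x'' \<longrightarrow> eqX x' x'')"

definition geq where
  "geq y y' m m' \<longleftrightarrow> (\<exists>C. geq_on C y y' m m')"

lemma geq_onI:
  assumes "finite C" "C \<subseteq> D" "y \<in> Y" "y' \<in> Y" "m \<in> Y" "m' \<in> Y"
    "\<And>x x' x''. hd x \<notin> K (C \<union> {hd y, hd y', hd m, hd m'}) \<Longrightarrow> hd x \<notin> K C \<Longrightarrow> Th y y' x x' \<Longrightarrow> Th m m' x x'' \<Longrightarrow> eqX x' x''"
  shows "geq y y' m m'"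
proof -
  let ?C = "C \<union> {hd y, hd y', hd m, hd m'}"
  have C: "?C \<subseteq> D" using assms(2) XY_D(2) assms(3-6) by simp
  have "hd x \<notin> K C" if "hd x \<notin> K ?C" for x using K_mono[OF _ C, of C "hd x"] that by blast
  then have "geq_on ?C y y' m m'" unfolding geq_on_def using assms C by auto
  then show ?thesis unfolding geq_def by blast
qed

lemma geqE:
  assumes "geq y y' m m'"
  obtains C where "finite C" "C \<subseteq> D" "y \<in> Y" "y' \<in> Y" "m \<in> Y" "m' \<in> Y"
    "hd y \<in> C" "hd y' \<in> C" "hd m \<in> C" "hd m' \<in> C"
    "\<And>x x' x''. hd x \<notin> K C \<Longrightarrow> Th y y' x x' \<Longrightarrow> Th m m' x x'' \<Longrightarrow> eqX x' x''"
proof -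
  obtain C where C: "geq_on C y y' m m'" using assms unfolding geq_def by blast
  let ?C = "C \<union> {hd y, hd y', hd m, hd m'}"
  have D: "?C \<subseteq> D" using C XY_D(2) unfolding geq_on_def by simp
  have Y: "finite ?C" "y \<in> Y" "y' \<in> Y" "m \<in> Y" "m' \<in> Y" using C unfolding geq_on_def by simp_all
  have "eqX x' x''" if x: "hd x \<notin> K ?C" "Th y y' x x'" "Th m m' x x''" for x x' x''
  proof -
    have "hd x \<notin> K C" using K_mono[OF _ D, of C "hd x"] x(1) by blast
    with C x(2,3) show ?thesis unfolding geq_on_def by blast
  qed
  with that[OF Y(1) D Y(2-5)] show ?thesis by simp
qed

lemma geq_Y: "geq y y' m m' \<Longrightarrow> y \<in> Y \<and> y' \<in> Y \<and> m \<in> Y \<and> m' \<in> Y"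
  unfolding geq_def geq_on_def by blast

lemma geq_refl: "y \<in> Y \<Longrightarrow> y' \<in> Y \<Longrightarrow> geq y y' y y'"
  by (rule geq_onI[of "{}"]) (simp_all add: Th_unique[OF eq3_refl])

lemma geq_sym: "geq y y' m m' \<Longrightarrow> geq m m' y y'"
proof (erule geqE)
  fix C assume C: "finite C" "C \<subseteq> D" "y \<in> Y" "y' \<in> Y" "m \<in> Y" "m' \<in> Y"
    and e: "\<And>x x' x''. hd x \<notin> K C \<Longrightarrow> Th y y' x x' \<Longrightarrow> Th m m' x x'' \<Longrightarrow> eqX x' x''"
  show "geq m m' y y'"
    by (rule geq_onI[OF C(1,2,5,6,3,4)]) (rule eq3_sym[OF e])
qed

lemma geq_trans:
  assumes "geq y y' m m'" "geq m m' n n'"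
  shows "geq y y' n n'"
proof -
  obtain C where C: "finite C" "C \<subseteq> D" "y \<in> Y" "y' \<in> Y" "m \<in> Y" "m' \<in> Y" "hd m \<in> C" "hd m' \<in> C"
    "\<And>x x' x''. hd x \<notin> K C \<Longrightarrow> Th y y' x x' \<Longrightarrow> Th m m' x x'' \<Longrightarrow> eqX x' x''"
    using assms(1) by (rule geqE) (rule that; assumption)
  obtain E where E: "finite E" "E \<subseteq> D" "n \<in> Y" "n' \<in> Y"
    "\<And>x x' x''. hd x \<notin> K E \<Longrightarrow> Th m m' x x' \<Longrightarrow> Th n n' x x'' \<Longrightarrow> eqX x' x''"
    using assms(2) by (rule geqE) (rule that; assumption)
  have CE: "C \<union> E \<subseteq> D" "finite (C \<union> E)" using C(1,2) E(1,2) by simp_all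
  show ?thesis
  proof (rule geq_onI[OF CE(2,1) C(3,4) E(3,4)])
    fix x x' x'' assume x: "hd x \<notin> K (C \<union> E)" "Th y y' x x'" "Th n n' x x''"
    have g: "hd x \<notin> K C" "hd x \<notin> K E" "hd x \<notin> K {hd m, hd m'}"
      using notK_mono[OF x(1) CE(1), of C] notK_mono[OF x(1) CE(1), of E] notK_mono[OF x(1) CE(1), of "{hd m, hd m'}"] C(7,8)
      by simp_all
    obtain w where w: "Th m m' x w" using Th_exists[OF _ C(5,6) g(3)] Th_XY[OF x(2)] by blast
    show "eqX x' x''" by (rule eq3_trans[OF C(9)[OF g(1) x(2) w] E(5)[OF g(2) w x(3)]])
  qed
qed

text \<open>A generic element has a generic image by \<open>Th_generic\<close>, so the given
  agreement can be used at the image; \<open>Th_unique\<close> then brings it back to the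
  preimages.\<close>

lemma geq_inv:
  assumes "geq y y' m m'"
  shows "geq y' y m' m"
proof -
  obtain C where C: "finite C" "C \<subseteq> D" "y \<in> Y" "y' \<in> Y" "m \<in> Y" "m' \<in> Y"
    "hd y \<in> C" "hd y' \<in> C" "hd m \<in> C" "hd m' \<in> C"
    "\<And>x x' x''. hd x \<notin> K C \<Longrightarrow> Th y y' x x' \<Longrightarrow> Th m m' x x'' \<Longrightarrow> eqX x' x''"
    using assms by (rule geqE) (rule that; assumption)
  show ?thesis
  proof (rule geq_onI[OF C(1,2,4,3,6,5)])
    fix x x' x'' assume x: "hd x \<notin> K C" "Th y' y x x'" "Th m' m x x''"
    note s = Th_sym[OF x(2)] Th_sym[OF x(3)]
    have g: "hd x' \<notin> K C" using Th_generic[OF x(2) C(2,8,7)] x(1) by simp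
    have "hd x' \<notin> K {hd m, hd m'}" using notK_mono[OF g C(2), of "{hd m, hd m'}"] C(9,10) by simp
    then obtain w where w: "Th m m' x' w" using Th_exists[OF _ C(5,6)] Th_XY[OF x(2)] by blast
    have "eqX x w" by (rule C(11)[OF g s(1) w])
    then have "eqX x'' x'" by (rule Th_unique[OF _ x(3) Th_sym[OF w]])
    then show "eqX x' x''" by (rule eq3_sym)
  qed
qed

text \<open>The four passages are compared at images of a generic \<open>x\<close>, which are again
  generic. This is what makes the product of germs independent of how they are presented.\<close>

lemma geq_comp:
  assumes "geq y k m k'" "geq k y' k' n"
  shows "geq y y' m n"
proof -
  obtain C where C: "finite C" "C \<subseteq> D" "y \<in> Y" "k \<in> Y" "m \<in> Y" "k' \<in> Y"
    "hd y \<in> C" "hd k \<in> C" "hd m \<in> C" "hd k' \<in> C"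
    "\<And>x x' x''. hd x \<notin> K C \<Longrightarrow> Th y k x x' \<Longrightarrow> Th m k' x x'' \<Longrightarrow> eqX x' x''"
    using assms(1) by (rule geqE) (rule that; assumption)
  obtain E where E: "finite E" "E \<subseteq> D" "y' \<in> Y" "n \<in> Y" "hd y' \<in> E" "hd n \<in> E"
    "\<And>x x' x''. hd x \<notin> K E \<Longrightarrow> Th k y' x x' \<Longrightarrow> Th k' n x x'' \<Longrightarrow> eqX x' x''"
    using assms(2) by (rule geqE) (rule that; assumption)
  have CE: "C \<union> E \<subseteq> D" "finite (C \<union> E)" using C(1,2) E(1,2) by simp_all
  have gen: "\<exists>x'. Th a b x x'" if "x \<in> X" "hd x \<notin> K (C \<union> E)" "a \<in> Y" "b \<in> Y" "hd a \<in> C \<union> E" "hd b \<in> C \<union> E" for a b x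
  proof -
    have "hd x \<notin> K {hd a, hd b}" using notK_mono[OF that(2) CE(1), of "{hd a, hd b}"] that(5,6) by simp
    then show ?thesis by (rule Th_exists[OF that(1,3,4)])
  qed
  show ?thesis
  proof (rule geq_onI[OF CE(2,1) C(3) E(3) C(5) E(4)])
    fix x x' x'' assume x: "hd x \<notin> K (C \<union> E)" "Th y y' x x'" "Th m n x x''"
    have xX: "x \<in> X" using Th_XY[OF x(2)] by blast
    obtain x1 where x1: "Th y k x x1" using gen[OF xX x(1) C(3,4)] C(7,8) by auto
    obtain x2 where x2: "Th m k' x x2" using gen[OF xX x(1) C(5,6)] C(9,10) by auto
    have x1g: "x1 \<in> X" "hd x1 \<notin> K (C \<union> E)"
      using Th_XY[OF x1] Th_generic[OF x1 CE(1)] C(7,8) x(1) by auto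
    have x2g: "x2 \<in> X" "hd x2 \<notin> K (C \<union> E)"
      using Th_XY[OF x2] Th_generic[OF x2 CE(1)] C(9,10) x(1) by auto
    have gC: "hd x \<notin> K C" "hd x1 \<notin> K E"
      using notK_mono[OF x(1) CE(1), of C] notK_mono[OF x1g(2) CE(1), of E] by simp_all
    obtain w1 where w1: "Th k y' x1 w1" using gen[OF x1g C(4) E(3)] C(8) E(5) by auto
    obtain w2 where w2: "Th k' n x2 w2" using gen[OF x2g C(6) E(4)] C(10) E(6) by auto
    obtain w3 where w3: "Th k' n x1 w3" using gen[OF x1g C(6) E(4)] C(10) E(6) by auto
    have e1: "eqX x' w1" by (rule Th_unique[OF eq3_refl x(2) Th_comp[OF x1 w1]])
    have e2: "eqX w1 w3" by (rule E(7)[OF gC(2) w1 w3])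
    have e3: "eqX w3 w2" by (rule Th_unique[OF C(11)[OF gC(1) x1 x2] w3 w2])
    have e4: "eqX w2 x''" by (rule Th_unique[OF eq3_refl Th_comp[OF x2 w2] x(3)])
    show "eqX x' x''" by (rule eq3_trans[OF e1 eq3_trans[OF e2 eq3_trans[OF e3 e4]]])
  qed
qed

lemma geq_id: "y \<in> Y \<Longrightarrow> m \<in> Y \<Longrightarrow> geq y y m m"
proof (rule geq_onI[of "{}"])
  have *: "eqX x x'" if "Th y y x x'" for x x' y
    using that
  proof (rule ThE)
    fix z z' assume z: "R x y z" "eqZ z z'" "R x' y z'"
    show "eqX x x'" by (rule eqX_transfer[OF eq3_refl z(2,1,3)])
  qed
  fix x x' x'' assume x: "Th y y x x'" "Th m m x x''"
  show "eqX x' x''" by (rule eq3_trans[OF eq3_sym[OF *[OF x(1)]] *[OF x(2)]])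
qed auto

text \<open>At an \<open>x\<close> generic over all four heads, the coordinates \<open>b1\<close>,
  \<open>b2\<close> and \<open>b4\<close> determine from \<open>x\<close> the point where
  \<open>x\<close> meets \<open>b3\<close>, and hence \<open>b3\<close>. Were \<open>b3\<close>
  outside the closure of the other three, exchange would put \<open>x\<close> into the closure of
  the four.\<close>

lemma geq_cl:
  assumes "geq b1 b2 b3 b4"
  shows "hd b3 \<in> K {hd b1, hd b2, hd b4}"
proof (rule ccontr)
  assume n: "hd b3 \<notin> K {hd b1, hd b2, hd b4}"
  obtain C where C: "finite C" "C \<subseteq> D" "b1 \<in> Y" "b2 \<in> Y" "b3 \<in> Y" "b4 \<in> Y"
    "hd b1 \<in> C" "hd b2 \<in> C" "hd b3 \<in> C" "hd b4 \<in> C"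
    "\<And>x x' x''. hd x \<notin> K C \<Longrightarrow> Th b1 b2 x x' \<Longrightarrow> Th b3 b4 x x'' \<Longrightarrow> eqX x' x''"
    using assms by (rule geqE) (rule that; assumption)
  obtain x where x: "x \<in> X" "hd x \<notin> K C" using ex_X[OF C(1,2)] by blast
  have sub: "hd x \<notin> K C'" if "C' \<subseteq> C" for C' by (rule notK_mono[OF x(2) C(2) that])
  obtain x' where x': "Th b1 b2 x x'" using Th_exists[OF x(1) C(3,4) sub] C(7,8) by auto
  obtain x'' where x'': "Th b3 b4 x x''" using Th_exists[OF x(1) C(5,6) sub] C(9,10) by auto
  have e: "eqX x' x''" by (rule C(11)[OF x(2) x' x''])
  obtain w w' where w: "R x b3 w" "eqZ w w'" "R x'' b4 w'" using x'' by (rule ThE)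
  let ?S = "{hd b1, hd b2, hd b4}"
  let ?E = "insert (hd x) ?S"
  have ED: "?E \<subseteq> D" "?S \<subseteq> D" using C(2,7,8,10) XY_D(1)[OF x(1)] by auto
  have k: "hd b1 \<in> K ?E" "hd b2 \<in> K ?E" "hd b4 \<in> K ?E" "hd x \<in> K ?E" by (rule K_sub[OF ED(1)]; simp)+
  have "hd x' \<in> K ?E" by (rule Th_generic1[OF x' ED(1) k(1,2,4)])
  then have "hd x'' \<in> K ?E" using eqX_K[OF e _ ED(1)] Th_XY[OF x'] by blast
  then have "hd w' \<in> K ?E" by (rule R_K(1)[OF w(3) ED(1) _ k(3)])
  then have "hd w \<in> K ?E" using eqZ_K[OF w(2,1,3) ED(1)] by simp
  then have "hd b3 \<in> K ?E" by (rule R_K(3)[OF w(1) ED(1) k(4)])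
  from K_exchange[OF ED(2) _ _ this n] have "hd x \<in> K (insert (hd b3) ?S)"
    using C(2,9) XY_D(1)[OF x(1)] by blast
  with sub[of "insert (hd b3) ?S"] C(7-10) show False by blast
qed

text \<open>The finite set witnessing the equality moves along with \<open>\<pi>\<close>, and
  elements generic over its image are pulled back by the inverse.\<close>

lemma geq_stab1:
  assumes "geq y y' m m'" "\<pi> \<in> stab A"
  shows "geq (map \<pi> y) (map \<pi> y') (map \<pi> m) (map \<pi> m')"
proof -
  obtain C where C: "finite C" "C \<subseteq> D" "y \<in> Y" "y' \<in> Y" "m \<in> Y" "m' \<in> Y"
    "\<And>x x' x''. hd x \<notin> K C \<Longrightarrow> Th y y' x x' \<Longrightarrow> Th m m' x x'' \<Longrightarrow> eqX x' x''"
    using assms(1) by (rule geqE) (rule that; assumption)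
  obtain \<tau> where \<tau>: "\<tau> \<in> stab A" "\<forall>x\<in>D. \<tau> (\<pi> x) = x \<and> \<pi> (\<tau> x) = x" using stab_inv[OF assms(2) AD(1)] by blast
  have \<pi>C: "\<pi> ` C \<subseteq> D" by (rule G_image[OF stab_G[OF assms(2)] C(2)])
  have XD: "set x \<subseteq> D \<and> x \<noteq> []" if "x \<in> X" for x using conjg_hd[OF _ lineD(3)[OF line]] that unfolding X_def by auto
  have ts: "map \<tau> (map \<pi> y) = y" if "set y \<subseteq> D" for y using \<tau>(2) that by (auto intro!: map_idI)
  have st: "map \<pi> (map \<tau> y) = y" if "set y \<subseteq> D" for y using \<tau>(2) that by (auto intro!: map_idI)
  show ?thesis
  proof (rule geq_onI[of "\<pi> ` C"])
    fix x x' x'' assume x: "hd x \<notin> K (\<pi> ` C)" "Th (map \<pi> y) (map \<pi> y') x x'" "Th (map \<pi> m) (map \<pi> m') x x''"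
    have X: "x \<in> X" "x' \<in> X" "x'' \<in> X" using Th_XY[OF x(2)] Th_XY[OF x(3)] by auto
    have 1: "Th y y' (map \<tau> x) (map \<tau> x')" "Th m m' (map \<tau> x) (map \<tau> x'')"
      using Th_image[OF x(2) \<tau>(1)] Th_image[OF x(3) \<tau>(1)] C(3-6) Y_set(1) by (simp_all only: ts)
    have "hd (map \<tau> x) \<notin> K C"
    proof
      assume *: "hd (map \<tau> x) \<in> K C"
      have \<tau>x: "\<tau> (hd x) \<in> D" by (rule G_mem[OF stab_G[OF \<tau>(1)] XY_D(1)[OF X(1)]])
      have "hd (map \<tau> x) = \<tau> (hd x)" using XD[OF X(1)] by (simp add: hd_map)
      then have "\<pi> (\<tau> (hd x)) \<in> K (\<pi> ` C)"
        using stab_cl_iff[OF assms(2) AD(1) C(2) \<tau>x] * by (simp add: Un_commute)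
      then show False using x(1) \<tau>(2) XY_D(1)[OF X(1)] by simp
    qed
    from C(7)[OF this 1] have "eqX (map \<tau> x') (map \<tau> x'')" .
    from eq3_image[OF this assms(2)] show "eqX x' x''" using XD X(2,3) by (simp only: st)
  qed (use C(1,3-6) \<pi>C Y_stab[OF _ assms(2)] in simp_all)
qed

text \<open>A single generic element \<open>a\<close> dictates \<open>m\<close>: it is chosen so
  that the germs (y, y') and (n, m) agree at \<open>a\<close>. The quadrangle with rows
  \<open>a\<close> and \<open>c\<close> carries the agreement from \<open>a\<close> to every other
  generic \<open>c\<close>.\<close>

lemma geq_represent1:
  assumes Y: "y \<in> Y" "y' \<in> Y" "n \<in> Y" and ind: "hd y' \<notin> K {hd y}" "hd n \<notin> K {hd y, hd y'}"
  shows "\<exists>m. geq y y' n m"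
proof -
  note D = XY_D(2)[OF Y(1)] XY_D(2)[OF Y(2)] XY_D(2)[OF Y(3)]
  have C0: "{hd y, hd y', hd n} \<subseteq> D" using D by simp
  obtain a where a: "a \<in> X" "hd a \<notin> K {hd y, hd y', hd n}" using ex_X[OF _ C0] by auto
  have aD: "hd a \<in> D" by (rule XY_D(1)[OF a(1)])
  obtain a' where a': "Th y y' a a'" using Th_exists[OF a(1) Y(1,2) notK_mono[OF a(2) C0]] by auto
  obtain z11 z11' where z11: "R a y z11" "eqZ z11 z11'" "R a' y' z11'" using a' by (rule ThE)
  have a'D: "hd a' \<in> D" by (rule R_D(1)[OF z11(3)])
  have ind4: "indep A [hd y, hd y', hd n, hd a]"
    using D aD ind a(2) XY_K(2)[OF Y(1)] by (simp add: insert_commute)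
  then have "indep A [hd y, hd y', hd a, hd n]"
    using indep_append[of A "[hd y, hd y']" "[hd n, hd a]"] indep_append[of A "[hd y, hd y']" "[hd a, hd n]"]
      indep_rotate1[of "A \<union> {hd y, hd y'}" "hd n" "[hd a]"] D AD(1) by simp
  then have n: "hd n \<notin> K {hd y, hd y', hd a}" by (simp add: insert_commute)
  have E: "{hd y, hd y', hd a} \<subseteq> D" using D aD by simp
  have k: "hd y \<in> K {hd y, hd y', hd a}" "hd y' \<in> K {hd y, hd y', hd a}" "hd a \<in> K {hd y, hd y', hd a}"
    by (rule K_sub[OF E]; simp)+
  have a'k: "hd a' \<in> K {hd y, hd y', hd a}" by (rule Th_generic1[OF a' E k])
  have "hd n \<notin> K {hd a}" by (rule notK_mono[OF n E]) simp
  then obtain z12 where z12: "R a n z12" using R_ex_z[OF a(1) Y(3)] by auto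
  have "hd z12 \<notin> K {hd a'}"
  proof
    assume "hd z12 \<in> K {hd a'}"
    then have "hd z12 \<in> K {hd y, hd y', hd a}" using K_min[OF _ E, of "{hd a'}"] a'k by blast
    from R_K(3)[OF z12 E k(3) this] n show False by blast
  qed
  \<comment> \<open>Row \<open>a\<close> meets column \<open>n\<close> in \<open>z12\<close>; the
    column \<open>m\<close> is chosen so that row \<open>a'\<close> has the same entry
    there.\<close>
  then obtain m where m: "R a' m z12" using R_ex_y[OF _ z12, of a'] R_XY(1)[OF z11(3)] by auto
  have mY: "m \<in> Y" by (rule R_XY(2)[OF m])
  let ?C = "{hd a, hd y, hd y', hd n, hd m}"
  have CD: "?C \<subseteq> D" "finite ?C" using D aD XY_D(2)[OF mY] by simp_all
  have "geq y y' n m"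
  proof (rule geq_onI[OF CD(2,1) Y(1,2,3) mY])
    fix c c' c'' assume c: "hd c \<notin> K ?C" "Th y y' c c'" "Th n m c c''"
    have cD: "hd c \<in> D" using Th_XY[OF c(2)] XY_D(1) by blast
    obtain z21 z21' where z21: "R c y z21" "eqZ z21 z21'" "R c' y' z21'" using c(2) by (rule ThE)
    obtain z22 w22 where z22: "R c n z22" "eqZ z22 w22" "R c'' m w22" using c(3) by (rule ThE)
    note zD = R_D(3)[OF z11(1)] R_D(3)[OF z12] R_D(3)[OF z21(1)]
    have "hd c' \<notin> K ?C" using Th_generic[OF c(2) CD(1)] c(1) by simp
    then have "hd c' \<notin> K {hd m}" by (rule notK_mono[OF _ CD(1)]) simp
    then have "hd m \<notin> K {hd c'}"
      using K_exchange[of "{}" "hd m" "hd c'"] XY_D(2)[OF mY] R_D(1)[OF z21(3)] XY_K(2)[OF mY] by auto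
    then obtain z22' where z22': "R c' m z22'" using R_ex_z[OF R_XY(1)[OF z21(3)] mY] by auto
    have c0: "hd c \<notin> K {hd y, hd y', hd n, hd a}" by (rule notK_mono[OF c(1) CD(1)]) simp
    have ind5: "indep A [hd y, hd y', hd n, hd a, hd c]"
      using ind4 c0 cD by (simp add: insert_commute)
    have "indep A ([hd y', hd n, hd a, hd c] @ [hd y])" using indep_rotate1[OF ind5 AD(1)] .
    from indep_rotate1[OF this[unfolded append_Cons] AD(1)]
    have "indep A [hd n, hd a, hd c, hd y, hd y']" by simp
    then have y': "hd y' \<notin> K {hd y, hd n, hd a, hd c}" by (simp add: insert_commute)
    have "indep A [hd n, hd a, hd c, hd y]"
      using \<open>indep A [hd n, hd a, hd c, hd y, hd y']\<close> indep_append[of A "[hd n, hd a, hd c, hd y]" "[hd y']"] by simp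
    then have "indep A ([hd y] @ [hd n, hd a, hd c])"
      using indep_swap[of A "[hd n, hd a, hd c]" "[hd y]"] AD(1) by simp
    then have q: "indep A [hd y, hd n, hd a, hd c]" by simp
    let ?Z = "{hd z11, hd z12, hd z21}"
    have Z4: "insert (hd a) ?Z \<subseteq> D" using zD aD by simp
    have "hd a \<in> K (insert (hd a) ?Z)" "hd z11 \<in> K (insert (hd a) ?Z)" "hd z12 \<in> K (insert (hd a) ?Z)" "hd z21 \<in> K (insert (hd a) ?Z)"
      by (rule K_sub[OF Z4]; simp)+
    moreover from this have "hd y \<in> K (insert (hd a) ?Z)" by (intro R_K(3)[OF z11(1) Z4])
    moreover have "hd n \<in> K (insert (hd a) ?Z)" using calculation by (intro R_K(3)[OF z12 Z4])
    moreover have "hd c \<in> K (insert (hd a) ?Z)" using calculation by (intro R_K(2)[OF z21(1) Z4])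
    \<comment> \<open>Four independent elements spanned by four: the three entries and
      \<open>a\<close> are therefore independent as well, and \<open>a\<close> is generic over the
      entries.\<close>
    ultimately have "set [hd y, hd n, hd a, hd c] \<subseteq> K (set [hd z11, hd z12, hd z21, hd a])"
      by (simp add: insert_commute)
    from indep_span[OF q this AD(1)] have "indep A [hd z11, hd z12, hd z21, hd a]" using zD aD by simp
    then have g1: "hd a \<notin> K ?Z" by (simp add: insert_commute)
    have S: "{hd y, hd n, hd a, hd c} \<subseteq> D" using D aD cD by simp
    have s: "hd y \<in> K {hd y, hd n, hd a, hd c}" "hd n \<in> K {hd y, hd n, hd a, hd c}"
      "hd a \<in> K {hd y, hd n, hd a, hd c}" "hd c \<in> K {hd y, hd n, hd a, hd c}"
      by (rule K_sub[OF S]; simp)+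
    have ZS: "hd z11 \<in> K {hd y, hd n, hd a, hd c}" "hd z12 \<in> K {hd y, hd n, hd a, hd c}" "hd z21 \<in> K {hd y, hd n, hd a, hd c}"
      by (rule R_K(1)[OF z11(1) S s(3,1)], rule R_K(1)[OF z12 S s(3,2)], rule R_K(1)[OF z21(1) S s(4,1)])
    then have ZS': "hd z11' \<in> K {hd y, hd n, hd a, hd c}" using eqZ_K[OF z11(2,1,3) S] by simp
    \<comment> \<open>If \<open>a'\<close> were in the closure of the three entries, then
      \<open>a'\<close> and \<open>z11'\<close> would determine \<open>y'\<close> inside the closure
      of four elements from which \<open>y'\<close> is free.\<close>
    have g2: "hd a' \<notin> K ?Z"
    proof
      assume "hd a' \<in> K ?Z"
      then have "hd a' \<in> K {hd y, hd n, hd a, hd c}" using K_min[OF _ S, of ?Z] ZS by blast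
      from R_K(3)[OF z11(3) S this ZS'] y' show False by blast
    qed
    \<comment> \<open>Rows \<open>a\<close>, \<open>c\<close> and columns \<open>y\<close>,
      \<open>n\<close> are compared with rows \<open>a'\<close>, \<open>c'\<close> and columns
      \<open>y'\<close>, \<open>m\<close>. Three corners agree by construction.\<close>
    have "eqZ z22 z22'"
      by (rule quadrangle[OF z11(1) z12 z21(1) z22(1) z11(3) m z21(3) z22' z11(2) eq3_refl z21(2) g1 g2 q])
    from eq3_trans[OF eq3_sym[OF this] z22(2)] have "eqZ z22' w22" .
    then show "eqX c' c''" by (rule eqX_transfer[OF eq3_refl _ z22' z22(3)])
  qed
  then show ?thesis by (rule exI)
qed

text \<open>An auxiliary generic \<open>k\<close> avoids the independence of \<open>y\<close> and
  \<open>y'\<close>: the germs (y', k) and (k, y) are represented one after the other, and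
  \<open>geq_comp\<close> removes \<open>k\<close>. \<open>geq_cl\<close> ensures that the
  intermediate \<open>k'\<close> is generic enough for the second application.\<close>

lemma geq_represent:
  assumes Y: "y \<in> Y" "y' \<in> Y" "n \<in> Y" and n: "hd n \<notin> K {hd y, hd y'}"
  shows "\<exists>m. geq y y' m n"
proof -
  note D = XY_D(2)[OF Y(1)] XY_D(2)[OF Y(2)] XY_D(2)[OF Y(3)]
  have S: "{hd y, hd y', hd n} \<subseteq> D" using D by simp
  obtain k where k: "k \<in> Y" "hd k \<notin> K {hd y, hd y', hd n}" using ex_Y_generic[OF _ S] by auto
  have kD: "hd k \<in> D" by (rule XY_D(2)[OF k(1)])
  have k1: "hd k \<notin> K {hd y'}" "hd k \<notin> K {hd y}"
    by (rule notK_mono[OF k(2) S]; simp)+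
  have n1: "hd n \<notin> K {hd k, hd y, hd y'}"
    using K_exchange[of "{hd y, hd y'}" "hd n" "hd k"] D kD n k(2) by (auto simp: insert_commute)
  have S': "{hd k, hd y, hd y'} \<subseteq> D" using D kD by simp
  have "hd n \<notin> K {hd y', hd k}" by (rule notK_mono[OF n1 S']) simp
  from geq_represent1[OF Y(2) k(1) Y(3) k1(1) this] obtain k' where k': "geq y' k n k'" by blast
  have k'Y: "k' \<in> Y" using geq_Y[OF k'] by simp
  have "hd k' \<notin> K {hd k, hd y}"
  proof
    assume "hd k' \<in> K {hd k, hd y}"
    then have "hd k' \<in> K {hd k, hd y, hd y'}" using K_mono[OF _ S', of "{hd k, hd y}"] by blast
    moreover have "hd n \<in> K {hd y', hd k, hd k'}" by (rule geq_cl[OF k'])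
    moreover have "hd y' \<in> K {hd k, hd y, hd y'}" "hd k \<in> K {hd k, hd y, hd y'}" by (rule K_sub[OF S']; simp)+
    ultimately show False using n1 K_min[OF _ S', of "{hd y', hd k, hd k'}" "hd n"] by blast
  qed
  moreover have "hd y \<notin> K {hd k}"
    using K_exchange[of "{}" "hd y" "hd k"] D kD XY_K(2)[OF Y(1)] k1(2) by auto
  ultimately obtain m where m: "geq k y k' m" using geq_represent1[OF k(1) Y(1) k'Y] by blast
  show ?thesis by (rule exI) (rule geq_comp[OF geq_inv[OF m] geq_inv[OF k']])
qed

lemma geq_represent': "y \<in> Y \<Longrightarrow> y' \<in> Y \<Longrightarrow> n \<in> Y \<Longrightarrow> hd n \<notin> K {hd y, hd y'} \<Longrightarrow> \<exists>m. geq y y' n m"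
  using geq_represent[of y' y n] geq_inv[of y' y _ n] by (auto simp: insert_commute)

end

section \<open>From an array to a line\<close>

context homog_pregeom begin

text \<open>After moving \<open>l\<close> to \<open>l'\<close>, the image of \<open>s\<close> and
  the tuple \<open>s'\<close> are generic conjugates of \<open>t\<close> over \<open>l'\<close>,
  hence conjugate. Iterating this shows that independent conjugates of stationary tuples have only
  one joint type.\<close>

lemma statl_extend:
  assumes l: "conjg A l l'" "set l \<subseteq> D" and A: "A \<subseteq> D" and t: "statl A t" "conjg A t s" "conjg A t s'"
    and g: "hd s \<notin> cl (A \<union> set l)" "hd s' \<notin> cl (A \<union> set l')"
  shows "conjg A (s @ l) (s' @ l')"
proof -
  obtain \<pi> where \<pi>: "\<pi> \<in> stab A" "map \<pi> l = l'" using l(1) unfolding conjg_def by blast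
  have s: "s \<noteq> []" "hd s \<in> D" using conjg_hd[OF t(2,1)] by simp_all
  have l'D: "set l' \<subseteq> D" by (rule conjg_D[OF l])
  have "\<pi> ` set l = set l'" using \<pi>(2) by (metis set_map)
  then have "\<pi> (hd s) \<notin> cl (A \<union> set l')"
    using stab_cl_iff[OF \<pi>(1) A l(2) s(2)] g(1) by (simp add: Un_commute)
  then have "hd (map \<pi> s) \<notin> cl (A \<union> set l')" using s(1) by (simp add: hd_map)
  then have "conjg (A \<union> set l') (map \<pi> s) s'"
    using statl_conjg[OF t(1) finite_set l'D conjg_trans[OF t(2) conjg_image[OF \<pi>(1)]] t(3) _ g(2)] by simp
  moreover have "length (map \<pi> s) = length s'" using conjg_length[OF t(2)] conjg_length[OF t(3)] by simp
  ultimately have "conjg A (map \<pi> s @ l') (s' @ l')" using conjg_params by blast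
  moreover have "conjg A (s @ l) (map \<pi> s @ l')" using conjg_image[OF \<pi>(1), of "s @ l"] \<pi>(2) by simp
  ultimately show ?thesis by (rule conjg_trans[rotated])
qed

lemma stationary_statl:
  assumes "stationary C t" "finite A" "A \<subseteq> D" "C \<subseteq> A" "hd t \<notin> cl A" "set t \<subseteq> cl (insert (hd t) A)"
  shows "statl A t"
proof -
  have "set t \<subseteq> D" "t \<noteq> []" using assms(1) unfolding stationary_def by simp_all
  moreover have "conjg (A \<union> E) t' t''"
    if "finite E" "E \<subseteq> D" "conjg A t t'" "conjg A t t''" "hd t' \<notin> cl (A \<union> E)" "hd t'' \<notin> cl (A \<union> E)" for E t' t''
    by (rule stationary_conjg[OF assms(1-4) that(3,4,1,2,5,6)])
  ultimately show ?thesis unfolding statl_def using assms(5,6) by blast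
qed

lemma stab_fix_cl:
  assumes "\<pi> \<in> stab A" "X \<subseteq> A" "A \<subseteq> D" "u \<in> cl X"
  shows "\<pi> u \<in> cl X"
proof -
  have XD: "X \<subseteq> D" using assms(2,3) by simp
  have "\<pi> ` X = X" using stab_fix[OF assms(1)] assms(2) by force
  then show ?thesis using G_mem_cl[OF stab_G[OF assms(1)] XD, of u] cl_D[OF XD] assms(4) by auto
qed

lemma conjg_statl_sub:
  assumes "conjg A t s" "statl A t" "A \<subseteq> D" "A \<union> E \<subseteq> D" "hd s \<in> E"
  shows "set s \<subseteq> cl (A \<union> E)"
  using conjg_statl_cl(1)[OF assms(1-3)] cl_mono[of "insert (hd s) A" "A \<union> E"] assms(4,5) by auto

text \<open>By \<open>statl_extend\<close>, all independent choices of two rows and two columns are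
  conjugate over \<open>A\<close>, so the quadrangle condition has to be verified for one of
  them.\<close>

lemma quad_transfer:
  assumes l: "line A x0 y0 z0" and X: "conjg A x0 X1" "conjg A x0 X2" "conjg A y0 Y1" "conjg A y0 Y2"
    and I: "indep A [hd Y1, hd Y2, hd X1, hd X2]"
    and base: "\<And>z11 z12 z21 z22. rel3 A x0 y0 z0 X1 Y1 z11 \<Longrightarrow> rel3 A x0 y0 z0 X1 Y2 z12 \<Longrightarrow>
      rel3 A x0 y0 z0 X2 Y1 z21 \<Longrightarrow> rel3 A x0 y0 z0 X2 Y2 z22 \<Longrightarrow> hd z22 \<in> cl (A \<union> {hd z11, hd z12, hd z21})"
    and i: "indep A [hd y1, hd y2, hd x1, hd x2]"
    and r: "rel3 A x0 y0 z0 x1 y1 z11" "rel3 A x0 y0 z0 x1 y2 z12" "rel3 A x0 y0 z0 x2 y1 z21" "rel3 A x0 y0 z0 x2 y2 z22"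
  shows "hd z22 \<in> cl (A \<union> {hd z11, hd z12, hd z21})"
proof -
  note l1 = lineD[OF l]
  note x = rel3_conjg(1)[OF r(1)] rel3_conjg(1)[OF r(3)] rel3_conjg(2)[OF r(1)] rel3_conjg(2)[OF r(2)]
  have sub: "hd u \<notin> cl (A \<union> \<Union> (set ` set us))"
    if u: "hd u \<notin> cl (A \<union> hd ` set us)" "\<And>v. v \<in> set us \<Longrightarrow> \<exists>t. statl A t \<and> conjg A t v" for u us
  proof
    have D: "A \<union> hd ` set us \<subseteq> D" using u(2) conjg_hd l1(2) by blast
    have "set v \<subseteq> cl (A \<union> hd ` set us)" if v: "v \<in> set us" for v
    proof -
      obtain t where t: "statl A t" "conjg A t v" using u(2)[OF v] by blast
      show ?thesis by (rule conjg_statl_sub[OF t(2,1) l1(2) D]) (use v in simp)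
    qed
    then have "A \<union> \<Union> (set ` set us) \<subseteq> cl (A \<union> hd ` set us)" using cl_sub[OF D] by blast
    then have "cl (A \<union> \<Union> (set ` set us)) \<subseteq> cl (A \<union> hd ` set us)" by (rule cl_minimal[OF _ D])
    then show "hd u \<in> cl (A \<union> \<Union> (set ` set us)) \<Longrightarrow> False" using u(1) by blast
  qed
  have step: "conjg A (x2 @ x1 @ y2 @ y1) (X2 @ X1 @ Y2 @ Y1)"
  proof -
    have n: "hd y1 \<notin> cl A" "hd y2 \<notin> cl (A \<union> set y1)" "hd x1 \<notin> cl (A \<union> set (y2 @ y1))" "hd x2 \<notin> cl (A \<union> set (x1 @ y2 @ y1))"
      using i sub[of y2 "[y1]"] sub[of x1 "[y2, y1]"] sub[of x2 "[x1, y2, y1]"] x l1(3,4)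
      by (auto simp: insert_commute Un_ac)
    have N: "hd Y1 \<notin> cl A" "hd Y2 \<notin> cl (A \<union> set Y1)" "hd X1 \<notin> cl (A \<union> set (Y2 @ Y1))" "hd X2 \<notin> cl (A \<union> set (X1 @ Y2 @ Y1))"
      using I sub[of Y2 "[Y1]"] sub[of X1 "[Y2, Y1]"] sub[of X2 "[X1, Y2, Y1]"] X l1(3,4)
      by (auto simp: insert_commute Un_ac)
    have D: "set x1 \<subseteq> D" "set y1 \<subseteq> D" "set y2 \<subseteq> D"
      using conjg_hd[OF x(1) l1(3)] conjg_hd[OF x(3) l1(4)] conjg_hd[OF x(4) l1(4)] by simp_all
    have 1: "conjg A y1 Y1"
      using statl_extend[OF conjg_refl[of A "[]"] _ l1(2,4) x(3) X(3)] n(1) N(1) by simp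
    have 2: "conjg A (y2 @ y1) (Y2 @ Y1)" by (rule statl_extend[OF 1 D(2) l1(2,4) x(4) X(4) n(2) N(2)])
    have 3: "conjg A (x1 @ y2 @ y1) (X1 @ Y2 @ Y1)"
      by (rule statl_extend[OF 2 _ l1(2,3) x(1) X(1) n(3) N(3)]) (use D in simp)
    show ?thesis by (rule statl_extend[OF 3 _ l1(2,3) x(2) X(2) n(4) N(4)]) (use D in simp)
  qed
  then obtain \<rho> where \<rho>: "\<rho> \<in> stab A" "map \<rho> (x2 @ x1 @ y2 @ y1) = X2 @ X1 @ Y2 @ Y1" unfolding conjg_def by blast
  have len: "length x1 = length X1" "length x2 = length X2" "length y1 = length Y1" "length y2 = length Y2"
    using conjg_length[OF x(1)] conjg_length[OF x(2)] conjg_length[OF x(3)] conjg_length[OF x(4)]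
      conjg_length[OF X(1)] conjg_length[OF X(2)] conjg_length[OF X(3)] conjg_length[OF X(4)] by simp_all
  have m: "map \<rho> x1 = X1" "map \<rho> x2 = X2" "map \<rho> y1 = Y1" "map \<rho> y2 = Y2" using \<rho>(2) len by auto
  note R = rel3_image[OF r(1) \<rho>(1), unfolded m] rel3_image[OF r(2) \<rho>(1), unfolded m]
    rel3_image[OF r(3) \<rho>(1), unfolded m] rel3_image[OF r(4) \<rho>(1), unfolded m]
  have hd: "hd (map \<rho> z) = \<rho> (hd z)" if "rel3 A x0 y0 z0 x y z" for x y z
    using conjg_hd[OF rel3_conjg(3)[OF that] l1(5)] by (simp add: hd_map)
  have "\<rho> (hd z22) \<in> cl (\<rho> ` {hd z11, hd z12, hd z21} \<union> A)"
    using base[OF R] hd[OF r(1)] hd[OF r(2)] hd[OF r(3)] hd[OF r(4)] by (simp add: Un_commute)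
  moreover have "{hd z11, hd z12, hd z21} \<subseteq> D" "hd z22 \<in> D"
    using rel3_line(3)[OF l r(1)] rel3_line(3)[OF l r(2)] rel3_line(3)[OF l r(3)] rel3_line(3)[OF l r(4)] by simp_all
  ultimately show ?thesis using stab_cl_iff[OF \<rho>(1) l1(2), of "{hd z11, hd z12, hd z21}" "hd z22"] by simp
qed

end

text \<open>Indiscernibility and type, restated for finite index sets instead of increasing lists.
  The \<omega>-sequence \<open>g\<close> lies below all of \<open>U\<close>: its entries will
  generate a countable model, and the uncountable set \<open>U\<close> serves a pigeonhole argument
  over that model.\<close>

locale array = homog_pregeom +
  fixes B :: "'a set" and lt :: "'i \<Rightarrow> 'i \<Rightarrow> bool" and Ix :: "'i set" and g :: "nat \<Rightarrow> 'i" and U :: "'i set"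
    and f :: "'i \<Rightarrow> 'i \<Rightarrow> 'a"
  assumes B: "finite B" "B \<subseteq> D"
    and f_D: "i \<in> Ix \<Longrightarrow> j \<in> Ix \<Longrightarrow> f i j \<in> D"
    and lt_irrefl: "i \<in> Ix \<Longrightarrow> \<not> lt i i"
    and lt_asym: "i \<in> Ix \<Longrightarrow> j \<in> Ix \<Longrightarrow> lt i j \<Longrightarrow> \<not> lt j i"
    and g: "g n \<in> Ix" "m < n \<Longrightarrow> lt (g m) (g n)"
    and U: "uncountable U" "U \<subseteq> Ix" "u \<in> U \<Longrightarrow> lt (g n) u"
    and array_hom: "finite S \<Longrightarrow> finite T \<Longrightarrow> S \<subseteq> Ix \<Longrightarrow> T \<subseteq> Ix \<Longrightarrow> \<phi> ` S \<subseteq> Ix \<Longrightarrow> \<psi> ` T \<subseteq> Ix \<Longrightarrow>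
      (\<And>i i'. i \<in> S \<Longrightarrow> i' \<in> S \<Longrightarrow> lt i i' \<Longrightarrow> lt (\<phi> i) (\<phi> i')) \<Longrightarrow>
      (\<And>j j'. j \<in> T \<Longrightarrow> j' \<in> T \<Longrightarrow> lt j j' \<Longrightarrow> lt (\<psi> j) (\<psi> j')) \<Longrightarrow>
      \<exists>\<pi>\<in>stab B. \<forall>i\<in>S. \<forall>j\<in>T. \<pi> (f i j) = f (\<phi> i) (\<psi> j)"
    and array_dim: "finite S \<Longrightarrow> finite T \<Longrightarrow> S \<subseteq> Ix \<Longrightarrow> T \<subseteq> Ix \<Longrightarrow> S \<noteq> {} \<Longrightarrow> T \<noteq> {} \<Longrightarrow>
      \<exists>ds. indep B ds \<and> (\<forall>d\<in>set ds. \<exists>i\<in>S. \<exists>j\<in>T. d = f i j) \<and> (\<forall>i\<in>S. \<forall>j\<in>T. f i j \<in> cl (B \<union> set ds)) \<and>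
        length ds = card S + card T - 1"
begin

abbreviation gf where "gf m n \<equiv> f (g m) (g n)"
abbreviation Kb where "Kb X \<equiv> cl (B \<union> X)"

lemma Kb_sub: "X \<subseteq> D \<Longrightarrow> x \<in> X \<Longrightarrow> x \<in> Kb X"
  using cl_sub[of "B \<union> X"] B(2) by auto

lemma Kb_min: "x \<in> Kb X \<Longrightarrow> X \<subseteq> Kb Y \<Longrightarrow> Y \<subseteq> D \<Longrightarrow> x \<in> Kb Y"
proof -
  assume *: "x \<in> Kb X" "X \<subseteq> Kb Y" "Y \<subseteq> D"
  have "B \<union> Y \<subseteq> D" using B(2) *(3) by simp
  then have "Kb X \<subseteq> Kb Y" using cl_sub[of "B \<union> Y"] *(2) by (intro cl_minimal) auto
  then show ?thesis using *(1) by blast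
qed

lemma index_distinct [simp]: "g m = g n \<longleftrightarrow> m = n" "u \<in> U \<Longrightarrow> g n \<noteq> u" "u \<in> U \<Longrightarrow> u \<noteq> g n"
  and index_mem [simp]: "g n \<in> Ix" "u \<in> U \<Longrightarrow> u \<in> Ix"
proof -
  show *: "g n \<in> Ix" "u \<in> U \<Longrightarrow> u \<in> Ix" for n u using g(1) U(2) by auto
  show "g m = g n \<longleftrightarrow> m = n"
    using g(2)[of m n] g(2)[of n m] lt_irrefl[OF *(1)[of n]] lt_irrefl[OF *(1)[of m]] by (metis nat_neq_iff)
  show "u \<in> U \<Longrightarrow> g n \<noteq> u" "u \<in> U \<Longrightarrow> u \<noteq> g n" using U(3)[of u n] lt_irrefl[OF *(1)] by auto
qed

lemma g_notin_U [simp]: "g n \<notin> U"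
  using index_distinct(2)[of "g n" n] by blast

lemma g_image [simp]: "g ` X \<subseteq> Ix"
  by auto

lemma array_hom_ball:
  assumes "finite S" "finite T" "S \<subseteq> Ix" "T \<subseteq> Ix" "\<phi> ` S \<subseteq> Ix" "\<psi> ` T \<subseteq> Ix"
    "\<forall>i\<in>S. \<forall>i'\<in>S. lt i i' \<longrightarrow> lt (\<phi> i) (\<phi> i')" "\<forall>j\<in>T. \<forall>j'\<in>T. lt j j' \<longrightarrow> lt (\<psi> j) (\<psi> j')"
  shows "\<exists>\<pi>\<in>stab B. \<forall>i\<in>S. \<forall>j\<in>T. \<pi> (f i j) = f (\<phi> i) (\<psi> j)"
  by (rule array_hom[OF assms(1-6)]) (use assms(7,8) in simp_all)

text \<open>A list spanning a subarray and no longer than the rank of the subarray cannot be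
  shortened. Independence of lists of entries is checked below by counting in this way.\<close>

lemma indep_ent:
  assumes "finite S" "finite T" "S \<subseteq> Ix" "T \<subseteq> Ix" "S \<noteq> {}" "T \<noteq> {}"
    and "\<And>i j. i \<in> S \<Longrightarrow> j \<in> T \<Longrightarrow> f i j \<in> Kb (set es)" "set es \<subseteq> D" "length es \<le> card S + card T - 1"
  shows "indep B es"
proof -
  obtain ds where ds: "indep B ds" "\<forall>d\<in>set ds. \<exists>i\<in>S. \<exists>j\<in>T. d = f i j" "length ds = card S + card T - 1"
    using array_dim[OF assms(1-6)] by blast
  show ?thesis
    by (rule indep_span[OF ds(1) _ B(2) assms(8)]) (use ds(2,3) assms(7,9) in auto)
qed

text \<open>Homogeneity of the array moves \<open>j\<close> and \<open>j'\<close> to any pair in the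
  same order. Two elements would then span three entries of row \<open>i\<close>, which have rank 1
  + 3 - 1.\<close>

lemma row_corner:
  assumes "i \<in> Ix" "i' \<in> Ix" "j \<in> Ix" "j' \<in> Ix" "i \<noteq> i'" "j \<noteq> j'"
  shows "f i j' \<notin> Kb {f i j, f i' j}"
proof
  assume *: "f i j' \<in> Kb {f i j, f i' j}"
  have move: "f i b \<in> Kb {f i a, f i' a}" if ab: "a \<in> Ix" "b \<in> Ix" "lt j j' \<longrightarrow> lt a b" "lt j' j \<longrightarrow> lt b a" for a b
  proof -
    obtain \<pi> where \<pi>: "\<pi> \<in> stab B" "\<forall>r\<in>{i, i'}. \<forall>c\<in>{j, j'}. \<pi> (f r c) = f r (if c = j then a else b)"
      using array_hom_ball[of "{i, i'}" "{j, j'}" "\<lambda>r. r" "\<lambda>c. if c = j then a else b"] assms ab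
        lt_irrefl[OF assms(3)] lt_irrefl[OF assms(4)] by auto
    have "\<pi> (f i j') \<in> cl (\<pi> ` {f i j, f i' j} \<union> B)"
      using stab_cl_iff[OF \<pi>(1) B(2), of "{f i j, f i' j}" "f i j'"] f_D assms * by (simp add: Un_commute)
    then show ?thesis using \<pi>(2) assms(6) by (simp add: Un_commute)
  qed
  \<comment> \<open>Two indices \<open>b\<close> and \<open>c\<close> on the same side of
    \<open>a\<close>; which side depends on the order of \<open>j\<close> and
    \<open>j'\<close>.\<close>
  have "\<exists>a b c. a \<in> Ix \<and> b \<in> Ix \<and> c \<in> Ix \<and> a \<noteq> b \<and> b \<noteq> c \<and> a \<noteq> c \<and> f i b \<in> Kb {f i a, f i' a} \<and> f i c \<in> Kb {f i a, f i' a}"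
  proof (cases "lt j j'")
    case True
    then show ?thesis using lt_asym[OF assms(3,4)] g(2) move[of "g 0" "g 1"] move[of "g 0" "g 2"]
      by (intro exI[of _ "g 0"] exI[of _ "g 1"] exI[of _ "g 2"]) simp
  next
    case False
    then show ?thesis using g(2) move[of "g 2" "g 1"] move[of "g 2" "g 0"]
      by (intro exI[of _ "g 2"] exI[of _ "g 1"] exI[of _ "g 0"]) simp
  qed
  then obtain a b c where abc: "a \<in> Ix" "b \<in> Ix" "c \<in> Ix" "a \<noteq> b" "b \<noteq> c" "a \<noteq> c"
    "f i b \<in> Kb {f i a, f i' a}" "f i c \<in> Kb {f i a, f i' a}" by blast
  obtain ds where ds: "indep B ds" "\<forall>d\<in>set ds. \<exists>r\<in>{i}. \<exists>c\<in>{a, b, c}. d = f r c"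
    "length ds = card {i} + card {a, b, c} - 1"
    using array_dim[of "{i}" "{a, b, c}"] abc(1-3) assms(1) by auto
  have E: "set [f i a, f i' a] \<subseteq> D" using f_D assms abc(1) by simp
  then have "f i a \<in> Kb {f i a, f i' a}" by (intro Kb_sub) simp_all
  then have "set ds \<subseteq> Kb (set [f i a, f i' a])" using ds(2) abc(7,8) by auto
  from indep_length[OF ds(1) this B(2) E] show False using ds(3) abc(4-6) by simp
qed

text \<open>Three of the entries are independent by \<open>row_corner\<close>, while the whole minor
  has rank 2 + 2 - 1 = 3.\<close>

lemma minor:
  assumes "i \<in> Ix" "i' \<in> Ix" "j \<in> Ix" "j' \<in> Ix" "i \<noteq> i'" "j \<noteq> j'"
  shows "f i' j' \<in> Kb {f i j, f i j', f i' j}"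
proof (rule ccontr)
  assume n: "\<not> ?thesis"
  have D: "f i j \<in> D" "f i' j \<in> D" "f i j' \<in> D" "f i' j' \<in> D" using f_D assms by simp_all
  have s: "x \<in> Kb (set [f i j, f i' j])" if "x \<in> set [f i j, f i' j]" for x
    by (rule Kb_sub[OF _ that]) (use D in simp)
  have "indep B [f i j, f i' j]"
    by (rule indep_ent[of "{i, i'}" "{j}"]) (use assms D s in auto)
  then have "indep B [f i j, f i' j, f i j', f i' j']"
    using n row_corner[OF assms] D by (simp add: insert_commute)
  moreover obtain ds where ds: "indep B ds" "\<forall>r\<in>{i, i'}. \<forall>c\<in>{j, j'}. f r c \<in> Kb (set ds)"
    "length ds = card {i, i'} + card {j, j'} - 1"
    using array_dim[of "{i, i'}" "{j, j'}"] assms(1-4) by auto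
  ultimately have "length [f i j, f i' j, f i j', f i' j'] \<le> length ds"
    using ds(2) by (intro indep_length[OF _ _ B(2) indep_D[OF ds(1)]]) simp_all
  then show False using ds(3) assms(5,6) by simp
qed

text \<open>Includes degenerate minors with equal rows or columns, so a rectangle can be filled in
  from one row and one column without case distinctions.\<close>

lemma minor_in:
  assumes X: "X \<subseteq> D" and i: "i \<in> Ix" "i' \<in> Ix" "j \<in> Ix" "j' \<in> Ix"
    and f: "f i j \<in> Kb X" "f i j' \<in> Kb X" "f i' j \<in> Kb X"
  shows "f i' j' \<in> Kb X"
proof (cases "i = i' \<or> j = j'")
  case False
  then have "i \<noteq> i'" "j \<noteq> j'" by simp_all
  from Kb_min[OF minor[OF i this] _ X] show ?thesis using f by simp
qed (use f in auto)

lemma transpose_array: "array D cl G B lt Ix g U (\<lambda>i j. f j i)"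
proof unfold_locales
  fix S T :: "'i set" and \<phi> \<psi> :: "'i \<Rightarrow> 'i"
  show "\<exists>\<pi>\<in>stab B. \<forall>i\<in>S. \<forall>j\<in>T. \<pi> (f j i) = f (\<psi> j) (\<phi> i)"
    if a: "finite S" "finite T" "S \<subseteq> Ix" "T \<subseteq> Ix" "\<phi> ` S \<subseteq> Ix" "\<psi> ` T \<subseteq> Ix"
      and m: "\<And>i i'. i \<in> S \<Longrightarrow> i' \<in> S \<Longrightarrow> lt i i' \<Longrightarrow> lt (\<phi> i) (\<phi> i')"
        "\<And>j j'. j \<in> T \<Longrightarrow> j' \<in> T \<Longrightarrow> lt j j' \<Longrightarrow> lt (\<psi> j) (\<psi> j')"
  proof -
    have "\<exists>\<pi>\<in>stab B. \<forall>i\<in>T. \<forall>j\<in>S. \<pi> (f i j) = f (\<psi> i) (\<phi> j)"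
      by (rule array_hom[OF a(2,1,4,3,6,5)]; erule (2) m)
    then obtain \<pi> where "\<pi> \<in> stab B" "\<forall>i\<in>T. \<forall>j\<in>S. \<pi> (f i j) = f (\<psi> i) (\<phi> j)"
      by (elim bexE)
    then show ?thesis by (intro bexI[of _ \<pi>] ballI) simp_all
  qed
  assume *: "finite S" "finite T" "S \<subseteq> Ix" "T \<subseteq> Ix" "S \<noteq> {}" "T \<noteq> {}"
  show "\<exists>ds. indep B ds \<and> (\<forall>d\<in>set ds. \<exists>i\<in>S. \<exists>j\<in>T. d = f j i) \<and> (\<forall>i\<in>S. \<forall>j\<in>T. f j i \<in> Kb (set ds)) \<and>
        length ds = card S + card T - 1"
  proof -
    obtain ds where ds: "indep B ds" "\<forall>d\<in>set ds. \<exists>i\<in>T. \<exists>j\<in>S. d = f i j"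
      "\<forall>i\<in>T. \<forall>j\<in>S. f i j \<in> Kb (set ds)" "length ds = card T + card S - 1"
      using array_dim[OF *(2,1,4,3,6,5)] by (elim exE conjE)
    have "\<exists>i\<in>S. \<exists>j\<in>T. d = f j i" if "d \<in> set ds" for d using bspec[OF ds(2) that] by blast
    then show ?thesis using ds(1,3,4) by (intro exI[of _ ds] conjI ballI) simp_all
  qed
qed (assumption | rule B f_D lt_irrefl lt_asym g U)+

section \<open>The countable model generated by the grid\<close>

definition grid :: "'a set" where
  "grid = {gf m n | m n. True}"

definition H where "H = Kb grid"

lemma grid_D: "grid \<subseteq> D"
  unfolding grid_def using f_D by auto

lemma BgD: "B \<union> grid \<subseteq> D"
  using B(2) grid_D by simp

lemma grid_finite:
  assumes "finite F" "F \<subseteq> B \<union> grid"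
  shows "\<exists>n. F \<subseteq> B \<union> {gf a b | a b. a \<le> n \<and> b \<le> n}"
  using assms
proof (induction F)
  case (insert x F)
  then obtain n where n: "F \<subseteq> B \<union> {gf a b | a b. a \<le> n \<and> b \<le> n}" by auto
  show ?case
  proof (cases "x \<in> B")
    case False
    then obtain a b where x: "x = gf a b" using insert.prems unfolding grid_def by auto
    have "{gf a b | a b. a \<le> n \<and> b \<le> n} \<subseteq> {f (g a') (g b') | a' b'. a' \<le> n + a + b \<and> b' \<le> n + a + b}"
      by fastforce
    moreover have "x \<in> {f (g a') (g b') | a' b'. a' \<le> n + a + b \<and> b' \<le> n + a + b}"
      unfolding x by (intro CollectI exI[of _ a] exI[of _ b]) simp
    ultimately show ?thesis using n by (intro exI[of _ "n + a + b"]) blast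
  next
    case True
    then show ?thesis using n by blast
  qed
qed simp

lemma grid_basis:
  "\<exists>ds. indep B ds \<and> (\<forall>d\<in>set ds. \<exists>a b. d = gf a b) \<and>
    (\<forall>a\<le>n. \<forall>b\<le>n. gf a b \<in> Kb (set ds)) \<and> length ds = 2 * n + 1"
proof -
  have ne: "finite (g ` {..n})" "g ` {..n} \<noteq> {}" by auto
  obtain ds where ds: "indep B ds" "\<forall>d\<in>set ds. \<exists>i\<in>g ` {..n}. \<exists>j\<in>g ` {..n}. d = f i j"
    "\<forall>i\<in>g ` {..n}. \<forall>j\<in>g ` {..n}. f i j \<in> Kb (set ds)" "length ds = card (g ` {..n}) + card (g ` {..n}) - 1"
    using array_dim[OF ne(1,1) g_image g_image ne(2,2)] by (elim exE conjE)
  have c: "card (g ` {..n}) = Suc n" by (simp add: card_image inj_on_def)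
  have "\<exists>a b. d = gf a b" if "d \<in> set ds" for d using bspec[OF ds(2) that] by blast
  then show ?thesis using ds(1,3,4) c by (intro exI[of _ ds]) simp
qed

text \<open>The \<open>(n + 1) \<times> (n + 1)\<close> corner of the grid has rank \<open>2n + 1\<close>, and each new row and each new
  column adds one to the rank.\<close>

lemma grid_rank:
  assumes k: "distinct ks" "set ks \<subseteq> Ix - range g" and j: "distinct js" "set js \<subseteq> Ix - range g"
    and es: "set es \<subseteq> D" "\<And>k. k \<in> set ks \<Longrightarrow> f k (g 0) \<in> cl (B \<union> grid \<union> set es)"
      "\<And>j. j \<in> set js \<Longrightarrow> f (g 0) j \<in> cl (B \<union> grid \<union> set es)"
  shows "length ks + length js \<le> length es"
proof -
  let ?Z = "(\<lambda>k. f k (g 0)) ` set ks \<union> (\<lambda>j. f (g 0) j) ` set js"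
  have "finite ?Z" "?Z \<subseteq> cl ((B \<union> grid) \<union> set es)" using es by auto
  from cl_finite_set[OF this BgD es(1)]
  obtain F where F: "finite F" "F \<subseteq> B \<union> grid" "?Z \<subseteq> cl (F \<union> set es)" by (elim exE conjE)
  obtain n where n: "F \<subseteq> B \<union> {gf a b | a b. a \<le> n \<and> b \<le> n}" using grid_finite[OF F(1,2)] by (elim exE)
  obtain ds where ds: "indep B ds" "\<forall>a\<le>n. \<forall>b\<le>n. gf a b \<in> Kb (set ds)" "length ds = 2 * n + 1"
    using grid_basis[of n] by (elim exE conjE)
  have inj: "inj_on g X" for X by (simp add: inj_on_def)
  let ?E = "set (ds @ es)"
  have E: "?E \<subseteq> D" "B \<union> ?E \<subseteq> D" "B \<union> set ds \<subseteq> D" using indep_D[OF ds(1)] es(1) B(2) by simp_all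
  have "Kb (set ds) \<subseteq> Kb ?E" by (rule cl_mono[OF _ E(2)]) auto
  then have gg: "gf a b \<in> Kb ?E" if "a \<le> n" "b \<le> n" for a b using ds(2) that by auto
  have "F \<union> set es \<subseteq> Kb ?E" using n gg cl_sub[OF E(2)] by auto
  from cl_minimal[OF this E(2)] F(3) have Z: "?Z \<subseteq> Kb ?E" by blast
  let ?S = "g ` {..n} \<union> set ks" and ?T = "g ` {..n} \<union> set js"
  have ST: "finite ?S" "finite ?T" "?S \<subseteq> Ix" "?T \<subseteq> Ix" "?S \<noteq> {}" "?T \<noteq> {}" using k(2) j(2) by auto
  have gj: "f (g a) c \<in> Kb ?E" if "a \<le> n" "c \<in> set js" for a c
  proof (cases "a = 0")
    case False
    then show ?thesis
      by (intro minor_in[OF E(1), of "g 0" "g a" "g 0" c]) (use that j(2) Z gg in auto)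
  qed (use that Z in auto)
  have kg: "f r (g b) \<in> Kb ?E" if "b \<le> n" "r \<in> set ks" for b r
  proof (cases "b = 0")
    case False
    then show ?thesis
      by (intro minor_in[OF E(1), of "g 0" r "g 0" "g b"]) (use that k(2) Z gg in auto)
  qed (use that Z in auto)
  have kj: "f r c \<in> Kb ?E" if "r \<in> set ks" "c \<in> set js" for r c
    by (rule minor_in[OF E(1), of "g 0" r "g 0" c]) (use that k(2) j(2) gg gj kg in auto)
  obtain bs where bs: "indep B bs" "\<forall>d\<in>set bs. \<exists>i\<in>?S. \<exists>j\<in>?T. d = f i j" "length bs = card ?S + card ?T - 1"
    using array_dim[OF ST] by (elim exE conjE)
  have "set bs \<subseteq> Kb (set (ds @ es))"
  proof
    fix d assume "d \<in> set bs"
    then obtain i c where "i \<in> ?S" "c \<in> ?T" "d = f i c" using bs(2) by blast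
    then show "d \<in> Kb (set (ds @ es))" using gg gj kg kj by auto
  qed
  \<comment> \<open>The enlarged subarray has n + 1 + |ks| rows and n + 1 + |js| columns, hence rank
    2n + 1 + |ks| + |js|. It is spanned by the 2n + 1 elements of \<open>ds\<close> together with
    \<open>es\<close>.\<close>
  from indep_length[OF bs(1) this B(2) E(1)] have "card ?S + card ?T - 1 \<le> length ds + length es"
    using bs(3) by simp
  moreover have "card ?S = Suc n + length ks" "card ?T = Suc n + length js"
    using k j by (subst card_Un_disjoint; auto simp: card_image[OF inj] distinct_card)+
  ultimately show ?thesis using ds(3) by simp
qed

text \<open>Infinite dimension holds because a finite spanning set would lie in the closure of one
  corner of the grid, and the next larger corner has greater rank.\<close>

lemma H: "countable H" "H \<subseteq> D" "cl H = H" "inf_dim H" "B \<subseteq> H" "gf m n \<in> H"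
proof -
  have "grid = (\<lambda>(m, n). gf m n) ` UNIV" unfolding grid_def by auto
  then have "countable (B \<union> grid)" using B(1) by (simp add: countable_finite)
  then show "countable H" "H \<subseteq> D" "cl H = H"
    unfolding H_def using countable_cl[OF _ BgD] cl_D[OF BgD] cl_idem[OF BgD] by simp_all
  show "B \<subseteq> H" "gf m n \<in> H" unfolding H_def using cl_sub[OF BgD] unfolding grid_def by auto
  show "inf_dim H" unfolding inf_dim_def
  proof (rule notI, elim exE conjE)
    fix F assume F: "finite F" "F \<subseteq> H" "cl F = H"
    have "F \<subseteq> cl (B \<union> grid \<union> {})" using F(2) unfolding H_def by simp
    from cl_finite_set[OF F(1) this BgD empty_subsetI]
    obtain F' where F': "finite F'" "F' \<subseteq> B \<union> grid" "F \<subseteq> cl (F' \<union> {})" by (elim exE conjE)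
    obtain n where n: "F' \<subseteq> B \<union> {gf a b | a b. a \<le> n \<and> b \<le> n}" using grid_finite[OF F'(1,2)] by (elim exE)
    obtain ds where ds: "indep B ds" "\<forall>a\<le>n. \<forall>b\<le>n. gf a b \<in> Kb (set ds)" "length ds = 2 * n + 1"
      using grid_basis[of n] by (elim exE conjE)
    have E: "B \<union> set ds \<subseteq> D" using indep_D[OF ds(1)] B(2) by simp
    have "F' \<subseteq> Kb (set ds)" using n ds(2) cl_sub[OF E] by auto
    then have "cl F' \<subseteq> Kb (set ds)" by (rule cl_minimal[OF _ E])
    then have "cl F \<subseteq> Kb (set ds)" using F'(3) by (intro cl_minimal[OF _ E]) simp
    then have sub: "H \<subseteq> Kb (set ds)" unfolding F(3) .
    obtain bs where bs: "indep B bs" "\<forall>d\<in>set bs. \<exists>a b. d = gf a b" "length bs = 2 * Suc n + 1"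
      using grid_basis[of "Suc n"] by (elim exE conjE)
    have "gf a b \<in> H" for a b unfolding H_def using cl_sub[OF BgD] unfolding grid_def by auto
    then have "set bs \<subseteq> Kb (set ds)" using bs(2) sub by fastforce
    from indep_length[OF bs(1) this B(2) indep_D[OF ds(1)]] show False
      using bs(3) ds(3) by simp
  qed
qed

text \<open>A dependence would let three elements span, over the grid, the first entries of two new
  rows and two new columns, contrary to \<open>grid_rank\<close>.\<close>

lemma indep_H:
  assumes "k \<in> U" "k' \<in> U" "k \<noteq> k'" "j \<in> U" "j' \<in> U" "j \<noteq> j'"
  shows "indep H [f (g 0) j, f (g 0) j', f k (g 0), f k' (g 0)]"
proof (rule ccontr)
  let ?ds = "[f (g 0) j, f (g 0) j', f k (g 0), f k' (g 0)]"
  assume n: "\<not> indep H ?ds"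
  have D: "set ?ds \<subseteq> D" using f_D assms by simp
  have HE: "H \<union> set ?ds \<subseteq> D" using H(2) D by simp
  have sub: "set ?ds \<subseteq> cl (H \<union> set ?ds)" using cl_sub[OF HE] by blast
  obtain es where es: "length es < length ?ds" "set es \<subseteq> set ?ds" "set ?ds \<subseteq> cl (H \<union> set es)"
    using indep_shorter[OF n H(2) D sub] by blast
  have esD: "set es \<subseteq> D" using es(2) D by (rule order_trans)
  have E: "B \<union> grid \<union> set es \<subseteq> D" using BgD esD by simp
  have "H \<subseteq> cl (B \<union> grid \<union> set es)" unfolding H_def by (rule cl_mono[OF _ E]) auto
  then have "cl (H \<union> set es) \<subseteq> cl (B \<union> grid \<union> set es)"
    using cl_sub[OF E] by (intro cl_minimal[OF _ E]) auto
  then have z: "set ?ds \<subseteq> cl (B \<union> grid \<union> set es)" using es(3) by (rule order_trans[rotated])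
  have "length [k, k'] + length [j, j'] \<le> length es"
    by (rule grid_rank[OF _ _ _ _ esD]) (use assms z in auto)
  then show False using es(1) by simp
qed

text \<open>Homogeneity moves row 2 to row \<open>k\<close> on three columns and fixes row 0 there,
  but it may move the two extra parameters. These are independent over the rows concerned both
  before and after, so \<open>homog_list\<close> puts them back.\<close>

lemma row_shift:
  assumes k: "k \<in> U" and j: "j \<in> U"
  shows "\<exists>\<pi>\<in>stab (B \<union> {gf 2 4, gf 3 4}).
    \<forall>c\<in>{g 0, g 1, j}. \<pi> (f (g 0) c) = f (g 0) c \<and> \<pi> (f (g 2) c) = f k c"
proof -
  let ?J = "{g 0, g 1, j}"
  let ?P = "\<lambda>r. (\<lambda>c. f (g 0) c) ` {g 0, g 1, j} \<union> (\<lambda>c. f r c) ` {g 0, g 1, j}"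
  let ?q = "[gf 2 4, gf 3 4]"
  have rlt: "lt (g 0) k" "lt (g 0) (g 2)" "lt (g 0) (g 2)" using g(2) U(3) k by simp_all
  obtain \<pi> where \<pi>: "\<pi> \<in> stab B"
    "\<forall>i\<in>{g 0, g 2}. \<forall>c\<in>{g 0, g 1, j}. \<pi> (f i c) = f (if i = g 2 then k else g 0) c"
    using array_hom_ball[of "{g 0, g 2}" "{g 0, g 1, j}" "\<lambda>i. if i = g 2 then k else g 0" "\<lambda>c. c"]
      k j rlt lt_irrefl lt_asym[of "g 0" "g 2"] by auto
  have fD: "f r c \<in> D" if "r \<in> {g 0, g 1, g 2, g 3, g 4, k, j}" "c \<in> {g 0, g 1, g 2, g 3, g 4, k, j}" for r c
    using that k j f_D by auto
  have PD: "B \<union> ?P k \<subseteq> D" "B \<union> ?P (g 2) \<subseteq> D" using B(2) fD by auto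
  have img: "\<pi> ` (B \<union> ?P (g 2)) = B \<union> ?P k"
  proof -
    have "\<pi> ` B = B" using stab_fix[OF \<pi>(1)] by force
    moreover have "\<pi> ` ?P (g 2) = ?P k" using \<pi>(2) by (simp add: insert_commute)
    ultimately show ?thesis by (simp only: image_Un)
  qed
  have 1: "indep (B \<union> ?P (g 2)) ?q"
  proof -
    let ?es = "[gf 0 0, gf 0 1, f (g 0) j, gf 2 0]"
    let ?X = "set (?es @ ?q)"
    have X: "?X \<subseteq> D" "set ?es \<subseteq> D" "B \<union> set ?es \<subseteq> D" using fD B(2) by simp_all
    have s: "gf 0 0 \<in> Kb ?X" "gf 0 1 \<in> Kb ?X" "f (g 0) j \<in> Kb ?X" "gf 2 0 \<in> Kb ?X" "gf 2 4 \<in> Kb ?X" "gf 3 4 \<in> Kb ?X"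
      by (rule Kb_sub[OF X(1)]; simp)+
    have s': "gf 0 0 \<in> Kb (set ?es)" "gf 0 1 \<in> Kb (set ?es)" "f (g 0) j \<in> Kb (set ?es)" "gf 2 0 \<in> Kb (set ?es)"
      by (rule Kb_sub[OF X(2)]; simp)+
    have 2: "f (g 2) c \<in> Kb ?X" if "c \<in> ?J" for c
      by (rule minor_in[OF X(1), of "g 0" "g 2" "g 0" c]) (use that s j in auto)
    have 04: "gf 0 4 \<in> Kb ?X"
      by (rule minor_in[OF X(1), of "g 2" "g 0" "g 0" "g 4"]) (use s in simp_all)
    have 3: "f (g 3) c \<in> Kb ?X" if "c \<in> ?J" for c
      by (rule minor_in[OF X(1), of "g 2" "g 3" "g 4" c]) (use that s 2[OF that] j in auto)
    \<comment> \<open>Six elements span the subarray of rows 0, 2, 3 and columns 0, 1, 4,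
      \<open>j\<close>, whose rank is 3 + 4 - 1.\<close>
    have "indep B (?es @ ?q)"
      by (rule indep_ent[of "{g 0, g 2, g 3}" "{g 0, g 1, g 4, j}", OF _ _ _ _ _ _ _ X(1)])
        (use j s 2[of "g 0"] 2[of "g 1"] 2[of j] 3[of "g 0"] 3[of "g 1"] 3[of j] 04 in auto)
    then have "indep (B \<union> set ?es) ?q" unfolding indep_append by simp
    moreover have "f (g 2) c \<in> Kb (set ?es)" if "c \<in> ?J" for c
      by (rule minor_in[OF X(2), of "g 0" "g 2" "g 0" c]) (use that s' j in auto)
    then have "B \<union> ?P (g 2) \<subseteq> Kb (set ?es)" using cl_sub[OF X(3)] s' by auto
    ultimately show ?thesis by (rule indep_antimono[OF _ _ X(3)])
  qed
  have 2: "indep (B \<union> ?P k) ?q"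
  proof -
    let ?es = "[gf 0 0, gf 0 1, f (g 0) j, f k (g 0), gf 2 0]"
    let ?X = "set (?es @ ?q)"
    have X: "?X \<subseteq> D" "set ?es \<subseteq> D" "B \<union> set ?es \<subseteq> D" using fD B(2) by simp_all
    have s: "gf 0 0 \<in> Kb ?X" "gf 0 1 \<in> Kb ?X" "f (g 0) j \<in> Kb ?X" "f k (g 0) \<in> Kb ?X" "gf 2 0 \<in> Kb ?X" "gf 2 4 \<in> Kb ?X" "gf 3 4 \<in> Kb ?X"
      by (rule Kb_sub[OF X(1)]; simp)+
    have s': "gf 0 0 \<in> Kb (set ?es)" "gf 0 1 \<in> Kb (set ?es)" "f (g 0) j \<in> Kb (set ?es)" "f k (g 0) \<in> Kb (set ?es)" "gf 2 0 \<in> Kb (set ?es)"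
      by (rule Kb_sub[OF X(2)]; simp)+
    have 2: "f (g 2) c \<in> Kb ?X" if "c \<in> ?J" for c
      by (rule minor_in[OF X(1), of "g 0" "g 2" "g 0" c]) (use that s j in auto)
    have k1: "f k c \<in> Kb ?X" if "c \<in> ?J" for c
      by (rule minor_in[OF X(1), of "g 0" k "g 0" c]) (use that s j k in auto)
    have 04: "gf 0 4 \<in> Kb ?X"
      by (rule minor_in[OF X(1), of "g 2" "g 0" "g 0" "g 4"]) (use s in simp_all)
    have k4: "f k (g 4) \<in> Kb ?X"
      by (rule minor_in[OF X(1), of "g 0" k "g 0" "g 4"]) (use s 04 k in simp_all)
    have 3: "f (g 3) c \<in> Kb ?X" if "c \<in> ?J" for c
      by (rule minor_in[OF X(1), of "g 2" "g 3" "g 4" c]) (use that s 2[OF that] j in auto)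
    \<comment> \<open>With row \<open>k\<close> there are four rows and four columns, of rank 7. The
      entry in row 2 and column 0 is added to reach the seven elements.\<close>
    have "indep B (?es @ ?q)"
      by (rule indep_ent[of "{g 0, g 2, g 3, k}" "{g 0, g 1, g 4, j}", OF _ _ _ _ _ _ _ X(1)])
        (use j k s 2[of "g 0"] 2[of "g 1"] 2[of j] 3[of "g 0"] 3[of "g 1"] 3[of j] 04 k1[of "g 0"] k1[of "g 1"] k1[of j] k4 in auto)
    then have "indep (B \<union> set ?es) ?q" unfolding indep_append by simp
    moreover have "f k c \<in> Kb (set ?es)" if "c \<in> ?J" for c
      by (rule minor_in[OF X(2), of "g 0" k "g 0" c]) (use that s' j k in auto)
    then have "B \<union> ?P k \<subseteq> Kb (set ?es)" using cl_sub[OF X(3)] s' by auto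
    ultimately show ?thesis by (rule indep_antimono[OF _ _ X(3)])
  qed
  have 3: "indep (B \<union> ?P k) (map \<pi> ?q)"
    using indep_image[OF stab_G[OF \<pi>(1)] PD(2) 1] unfolding img .
  have "countable (B \<union> ?P k)" using B(1) by (simp add: countable_finite)
  from homog_list[OF this PD(1) 3 2] obtain \<tau> where
    \<tau>: "\<tau> \<in> stab (cl (B \<union> ?P k))" "map \<tau> (map \<pi> ?q) = ?q" by auto
  have \<tau>': "\<tau> \<in> stab (B \<union> ?P k)" by (rule stab_cl[OF \<tau>(1) PD(1)])
  have "(\<lambda>x. \<tau> (\<pi> x)) \<in> stab B" by (rule stab_comp[OF stab_mono[OF Un_upper1 \<tau>'] \<pi>(1)])
  then have "(\<lambda>x. \<tau> (\<pi> x)) \<in> stab (B \<union> {gf 2 4, gf 3 4})"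
    using \<tau>(2) unfolding stab_def by auto
  moreover have "\<tau> (\<pi> (f (g 0) c)) = f (g 0) c \<and> \<tau> (\<pi> (f (g 2) c)) = f k c" if "c \<in> ?J" for c
    using \<pi>(2) stab_fix[OF \<tau>', of "f (g 0) c"] stab_fix[OF \<tau>', of "f k c"] that by auto
  ultimately show ?thesis by (intro bexI[of _ "\<lambda>x. \<tau> (\<pi> x)"] ballI)
qed

text \<open>Over \<open>f k j\<close>, the two minors contribute disjoint pairs of entries, and all
  five elements are independent because they span a 3 by 3 subarray of rank 5. So
  \<open>indep_Int\<close> applies.\<close>

lemma entry_Int:
  assumes k: "k \<in> U" and j: "j \<in> U"
    and u: "u \<in> Kb {gf 0 0, f k (g 0), f (g 0) j}" "u \<in> Kb {gf 1 1, f k (g 1), f (g 1) j}"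
  shows "u \<in> Kb {f k j}"
proof -
  have fD: "f r c \<in> D" if "r \<in> {g 0, g 1, k, j}" "c \<in> {g 0, g 1, k, j}" for r c
    using that k j f_D by auto
  let ?es = "[f k j, f k (g 0), f (g 0) j, f k (g 1), f (g 1) j]"
  let ?X = "set ?es"
  have X: "?X \<subseteq> D" using fD by simp
  have s: "f k j \<in> Kb ?X" "f k (g 0) \<in> Kb ?X" "f (g 0) j \<in> Kb ?X" "f k (g 1) \<in> Kb ?X" "f (g 1) j \<in> Kb ?X"
    by (rule Kb_sub[OF X]; simp)+
  have "f a b \<in> Kb ?X" if "a \<in> {g 0, g 1}" "b \<in> {g 0, g 1}" for a b
    by (rule minor_in[OF X, of k a j b]) (use that s k j in auto)
  then have "indep B ?es"
    by (intro indep_ent[of "{g 0, g 1, k}" "{g 0, g 1, j}", OF _ _ _ _ _ _ _ X]) (use s k j in auto)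
  then have i: "indep ((B \<union> {f k j}) \<union> {f k (g 0), f (g 0) j}) [f k (g 1), f (g 1) j]"
    using indep_append[of B "[f k j, f k (g 0), f (g 0) j]" "[f k (g 1), f (g 1) j]"] by (simp add: insert_commute)
  have 1: "u \<in> Kb {f k j, f k n, f n j}"
    if "u \<in> Kb {f n n, f k n, f n j}" "n \<in> {g 0, g 1}" for n
  proof (rule Kb_min[OF that(1)])
    show Y: "{f k j, f k n, f n j} \<subseteq> D" using fD that(2) by auto
    have s: "x \<in> Kb {f k j, f k n, f n j}" if "x \<in> {f k j, f k n, f n j}" for x using Kb_sub[OF Y that] .
    have "f n n \<in> Kb {f k j, f k n, f n j}"
      by (rule minor_in[OF Y, of k n j n]) (use that s k j in auto)
    then show "{f n n, f k n, f n j} \<subseteq> Kb {f k j, f k n, f n j}" using s by simp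
  qed
  have "u \<in> cl ((B \<union> {f k j}) \<union> {f k (g 0), f (g 0) j})" using 1[OF u(1)] by (simp add: insert_commute)
  moreover have "u \<in> cl ((B \<union> {f k j}) \<union> set [f k (g 1), f (g 1) j])" using 1[OF u(2)] by (simp add: insert_commute)
  ultimately show ?thesis using indep_Int[OF i] fD B(2) by simp
qed

text \<open>Another minor for \<open>f (g 0) j\<close> taken from rows 0 and \<open>k\<close> would
  also contain \<open>f k j\<close>, and the closures would share too much. A row parallel to row
  \<open>k\<close> is needed. The parameters \<open>gf 2 4\<close> and \<open>gf 3 4\<close>
  determine row 3 from row 2 entry by entry; shifting row 2 to row \<open>k\<close> turns row 3 into
  such a parallel row, with the entries \<open>e\<close> and \<open>e'\<close>.\<close>

lemma row_extend:
  assumes k: "k \<in> U" and j: "j \<in> U"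
  shows "\<exists>e e'. e \<in> Kb {f k (g 1), gf 2 4, gf 3 4} \<and> e' \<in> Kb {f k j, gf 2 4, gf 3 4} \<and>
    f (g 0) j \<in> Kb {gf 0 1, e, e'} \<and>
    (\<forall>u. u \<in> Kb {gf 0 0, f k (g 0), f k j} \<and> u \<in> Kb {gf 0 1, e, e'} \<longrightarrow> u \<in> Kb {f (g 0) j})"
proof -
  let ?J = "{g 0, g 1, j}"
  obtain \<pi> where \<pi>: "\<pi> \<in> stab (B \<union> {gf 2 4, gf 3 4})"
    "\<And>c. c \<in> ?J \<Longrightarrow> \<pi> (f (g 0) c) = f (g 0) c \<and> \<pi> (f (g 2) c) = f k c"
    using row_shift[OF k j] by blast
  have \<pi>B: "\<pi> \<in> stab B" by (rule stab_mono[OF _ \<pi>(1)]) blast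
  have \<pi>4: "\<pi> (gf 2 4) = gf 2 4" "\<pi> (gf 3 4) = gf 3 4" using stab_fix[OF \<pi>(1)] by simp_all
  have fD: "f r c \<in> D" if "r \<in> {g 0, g 1, g 2, g 3, g 4, k, j}" "c \<in> {g 0, g 1, g 2, g 3, g 4, k, j}" for r c
    using that k j f_D by auto
  have cl: "\<pi> x \<in> Kb (\<pi> ` X) \<longleftrightarrow> x \<in> Kb X" if "X \<subseteq> D" "x \<in> D" for x X
    using stab_cl_iff[OF \<pi>B B(2) that] by (simp add: Un_commute)
  let ?e = "\<pi> (gf 3 1)" and ?e' = "\<pi> (f (g 3) j)"
  have \<pi>': "\<pi> (f (g 0) j) = f (g 0) j" "\<pi> (gf 0 0) = gf 0 0" "\<pi> (gf 0 1) = gf 0 1"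
    "\<pi> (f (g 2) j) = f k j" "\<pi> (gf 2 0) = f k (g 0)" "\<pi> (gf 2 1) = f k (g 1)"
    using \<pi>(2) by simp_all
  have min: "f (g 3) c \<in> Kb {f (g 2) c, gf 2 4, gf 3 4}" if "c \<in> {g 1, j}" for c
  proof -
    have "f (g 3) c \<in> Kb {gf 2 4, f (g 2) c, gf 3 4}" by (rule minor) (use that j in auto)
    then show ?thesis by (simp add: insert_commute)
  qed
  have e: "?e \<in> Kb {f k (g 1), gf 2 4, gf 3 4}" "?e' \<in> Kb {f k j, gf 2 4, gf 3 4}"
    using cl[of "{gf 2 1, gf 2 4, gf 3 4}" "gf 3 1"]
      cl[of "{f (g 2) j, gf 2 4, gf 3 4}" "f (g 3) j"] min fD \<pi>4 \<pi>' by simp_all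
  have "f (g 0) j \<in> Kb {gf 3 1, f (g 3) j, gf 0 1}" by (rule minor) (use j in auto)
  then have e0: "f (g 0) j \<in> Kb {gf 0 1, ?e, ?e'}"
    using cl[of "{gf 3 1, f (g 3) j, gf 0 1}" "f (g 0) j"] fD \<pi>' by (simp add: insert_commute)
  have "gf 0 1 \<in> Kb {f (g 3) j, gf 3 1, f (g 0) j}" by (rule minor) (use j in auto)
  then have e1: "gf 0 1 \<in> Kb {f (g 0) j, ?e, ?e'}"
    using cl[of "{f (g 3) j, gf 3 1, f (g 0) j}" "gf 0 1"] fD \<pi>' by (simp add: insert_commute)
  have "gf 0 0 \<in> Kb {f k j, f k (g 0), f (g 0) j}" by (rule minor) (use j k in auto)
  then have e2: "gf 0 0 \<in> Kb {f (g 0) j, f k (g 0), f k j}" by (simp add: insert_commute)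
  \<comment> \<open>Five entries spanning a 3 by 3 subarray, hence independent. Their images under
    \<open>\<pi>\<close> are the elements on which the intersection argument rests.\<close>
  let ?es = "[f (g 0) j, gf 2 0, f (g 2) j, gf 3 1, f (g 3) j]"
  let ?X = "set ?es"
  have X: "?X \<subseteq> D" using fD by simp
  have s: "f (g 0) j \<in> Kb ?X" "gf 2 0 \<in> Kb ?X" "f (g 2) j \<in> Kb ?X" "gf 3 1 \<in> Kb ?X" "f (g 3) j \<in> Kb ?X"
    by (rule Kb_sub[OF X]; simp)+
  have 00: "gf 0 0 \<in> Kb ?X" by (rule minor_in[OF X, of "g 2" _ j]) (use s j in simp_all)
  have 01: "gf 0 1 \<in> Kb ?X" by (rule minor_in[OF X, of "g 3" _ j]) (use s j in simp_all)
  have 21: "gf 2 1 \<in> Kb ?X" by (rule minor_in[OF X, of "g 3" _ j]) (use s j in simp_all)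
  have 30: "gf 3 0 \<in> Kb ?X" by (rule minor_in[OF X, of "g 2" _ j]) (use s j in simp_all)
  have "indep B ?es"
    by (rule indep_ent[of "{g 0, g 2, g 3}" "{g 0, g 1, j}", OF _ _ _ _ _ _ _ X]) (use s j 00 01 21 30 in auto)
  from indep_image[OF stab_G[OF \<pi>B] B(2) this]
  have "indep (\<pi> ` B) [f (g 0) j, f k (g 0), f k j, ?e, ?e']" using \<pi>' by simp
  moreover have "\<pi> ` B = B" using stab_fix[OF \<pi>B] by force
  ultimately have i: "indep ((B \<union> {f (g 0) j}) \<union> {f k (g 0), f k j}) [?e, ?e']"
    using indep_append[of B "[f (g 0) j, f k (g 0), f k j]" "[?e, ?e']"] by (simp add: insert_commute)
  have eD: "?e \<in> D" "?e' \<in> D" using fD G_mem[OF stab_G[OF \<pi>B]] by simp_all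
  have "u \<in> Kb {f (g 0) j}" if u: "u \<in> Kb {gf 0 0, f k (g 0), f k j}" "u \<in> Kb {gf 0 1, ?e, ?e'}" for u
  proof -
    have Y: "{f (g 0) j, f k (g 0), f k j} \<subseteq> D" "{f (g 0) j, ?e, ?e'} \<subseteq> D" using fD eD by simp_all
    have "u \<in> Kb {f (g 0) j, f k (g 0), f k j}"
      by (rule Kb_min[OF u(1) _ Y(1)]) (use e2 Kb_sub[OF Y(1)] in simp)
    moreover have "u \<in> Kb {f (g 0) j, ?e, ?e'}"
      by (rule Kb_min[OF u(2) _ Y(2)]) (use e1 Kb_sub[OF Y(2)] in simp)
    ultimately show ?thesis using indep_Int[OF i, of u] fD B(2) by (simp add: insert_commute)
  qed
  then show ?thesis using e e0 by (intro exI[of _ ?e] exI[of _ ?e']) blast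
qed

text \<open>There are uncountably many rows in \<open>U\<close> but only countably many orbits of
  pairs over the countable set \<open>H\<close>.\<close>

lemma ex_conj_rows:
  "\<exists>k\<in>U. \<exists>k'\<in>U. k \<noteq> k' \<and> conjg H [f k (g 0), f k (g 1)] [f k' (g 0), f k' (g 1)]"
proof -
  obtain T where T: "countable T" "\<And>xs. set xs \<subseteq> D \<Longrightarrow> \<exists>\<pi>\<in>stab H. map \<pi> xs \<in> T"
    using countable_orbits[OF H(1,2)] unfolding H(3) by blast
  let ?t = "\<lambda>k. [f k (g 0), f k (g 1)]"
  have tD: "set (?t k) \<subseteq> D" if "k \<in> U" for k using f_D that by simp
  have "\<exists>t. t \<in> T \<and> conjg H (?t k) t" if k: "k \<in> U" for k
  proof -
    obtain \<pi> where "\<pi> \<in> stab H" "map \<pi> (?t k) \<in> T" using T(2)[OF tD[OF k]] by (elim bexE)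
    then show ?thesis using conjg_image[of \<pi> H "?t k"] by (intro exI[of _ "map \<pi> (?t k)"] conjI)
  qed
  then have "\<exists>h. \<forall>k\<in>U. h k \<in> T \<and> conjg H (?t k) (h k)" by (intro bchoice ballI)
  then obtain h where h0: "\<forall>k\<in>U. h k \<in> T \<and> conjg H (?t k) (h k)" by (rule exE)
  have h: "h k \<in> T \<and> conjg H (?t k) (h k)" if "k \<in> U" for k by (rule bspec[OF h0 that])
  have "\<not> inj_on h U"
  proof
    assume "inj_on h U"
    moreover have "h ` U \<subseteq> T" using h by auto
    ultimately show False using U(1) T(1) countable_subset countable_image_inj_on by blast
  qed
  then obtain k k' where k: "k \<in> U" "k' \<in> U" "k \<noteq> k'" "h k = h k'" unfolding inj_on_def by blast
  have "conjg H (?t k) (h k)" "conjg H (h k) (?t k')"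
    using h[OF k(1)] conjg_sym[OF conjunct2[OF h[OF k(2)]] H(2) tD[OF k(2)]] k(4) by simp_all
  then have "conjg H (?t k) (?t k')" by (rule conjg_trans)
  then show ?thesis using k(1-3) by blast
qed

text \<open>The triple consists of the first entry of a new row, the first entry of a new column and
  their common entry, each enlarged to make two minors available for every coordinate. A second row
  and a second column of the same types over \<open>H\<close> supply the configuration at which the
  quadrangle condition is checked.\<close>

lemma ex_net: "\<exists>A x0 y0 z0. net D cl G A x0 y0 z0"
proof -
  \<comment> \<open>What holds for rows is needed for columns too; the transposed array has the same
    grid and the same \<open>H\<close>.\<close>
  interpret T: array D cl G B lt Ix g U "\<lambda>i j. f j i" by (rule transpose_array)
  have "T.grid = grid" unfolding T.grid_def grid_def by auto
  then have TH: "T.H = H" unfolding T.H_def H_def by simp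
  obtain k k2 where k: "k \<in> U" "k2 \<in> U" "k \<noteq> k2"
    and kc: "conjg H [f k (g 0), f k (g 1)] [f k2 (g 0), f k2 (g 1)]" using ex_conj_rows by blast
  obtain j j2 where j: "j \<in> U" "j2 \<in> U" "j \<noteq> j2"
    and jc: "conjg H [f (g 0) j, f (g 1) j] [f (g 0) j2, f (g 1) j2]" using T.ex_conj_rows unfolding TH by blast
  obtain e e' where e: "e \<in> Kb {f k (g 1), gf 2 4, gf 3 4}" "e' \<in> Kb {f k j, gf 2 4, gf 3 4}"
    "f (g 0) j \<in> Kb {gf 0 1, e, e'}"
    and eI: "\<forall>u. u \<in> Kb {gf 0 0, f k (g 0), f k j} \<and> u \<in> Kb {gf 0 1, e, e'} \<longrightarrow> u \<in> Kb {f (g 0) j}"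
    using row_extend[OF k(1) j(1)] by (elim exE conjE)
  obtain d d' where d: "d \<in> Kb {f (g 1) j, gf 4 2, gf 4 3}" "d' \<in> Kb {f k j, gf 4 2, gf 4 3}"
    "f k (g 0) \<in> Kb {gf 1 0, d, d'}"
    and dI: "\<forall>u. u \<in> Kb {gf 0 0, f (g 0) j, f k j} \<and> u \<in> Kb {gf 1 0, d, d'} \<longrightarrow> u \<in> Kb {f k (g 0)}"
    using T.row_extend[OF j(1) k(1)] by (elim exE conjE)
  \<comment> \<open>The first four are the fixed corners of the minors. The last four determine the
    entries of the parallel row and the parallel column.\<close>
  let ?P = "{gf 0 0, gf 0 1, gf 1 0, gf 1 1, gf 2 4, gf 3 4, gf 4 2, gf 4 3}"
  \<comment> \<open>The heads are the three entries of the first minor. The second minor of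
    \<open>f k j\<close> uses \<open>f k (g 1)\<close> and \<open>f (g 1) j\<close>, that of
    \<open>f (g 0) j\<close> uses \<open>e\<close> and \<open>e'\<close>, and that of
    \<open>f k (g 0)\<close> uses \<open>d\<close> and \<open>d'\<close>.\<close>
  let ?x = "[f k (g 0), f k (g 1), e]" and ?y = "[f (g 0) j, f (g 1) j, d]" and ?z = "[f k j, e', d']"
  have fD [simp]: "f r c \<in> D" if "r \<in> range g \<union> U" "c \<in> range g \<union> U" for r c using that f_D by auto
  have PH: "?P \<subseteq> H" using H(6) by simp
  have PD: "?P \<subseteq> D" using PH H(2) by (rule order_trans)
  have xP: "set ?x \<subseteq> Kb (insert (f k (g 0)) ?P)"
  proof -
    have X: "insert (f k (g 0)) ?P \<subseteq> D" using PD k by simp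
    note s = Kb_sub[OF X]
    have 1: "f k (g 1) \<in> Kb (insert (f k (g 0)) ?P)"
      by (rule minor_in[OF X, of "g 0" k "g 0" "g 1"]) (use s k in simp_all)
    moreover have "e \<in> Kb (insert (f k (g 0)) ?P)" by (rule Kb_min[OF e(1) _ X]) (use 1 s in simp)
    ultimately show ?thesis using s by simp
  qed
  have yP: "set ?y \<subseteq> Kb (insert (f (g 0) j) ?P)"
  proof -
    have X: "insert (f (g 0) j) ?P \<subseteq> D" using PD j by simp
    note s = Kb_sub[OF X]
    have 1: "f (g 1) j \<in> Kb (insert (f (g 0) j) ?P)"
      by (rule minor_in[OF X, of "g 0" "g 1" "g 0" j]) (use s j in simp_all)
    moreover have "d \<in> Kb (insert (f (g 0) j) ?P)" by (rule Kb_min[OF d(1) _ X]) (use 1 s in simp)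
    ultimately show ?thesis using s by simp
  qed
  have zP: "set ?z \<subseteq> Kb (insert (f k j) ?P)"
  proof -
    have X: "insert (f k j) ?P \<subseteq> D" using PD j k by simp
    note s = Kb_sub[OF X]
    have "e' \<in> Kb (insert (f k j) ?P)" by (rule Kb_min[OF e(2) _ X]) (use s in simp)
    moreover have "d' \<in> Kb (insert (f k j) ?P)" by (rule Kb_min[OF d(2) _ X]) (use s in simp)
    ultimately show ?thesis using s by simp
  qed
  have aD: "insert a H \<subseteq> D" if "a \<in> D" for a using H(2) that by simp
  have up: "Kb (insert a ?P) \<subseteq> cl (insert a C)" if "B \<union> ?P \<subseteq> C" "C \<subseteq> D" "a \<in> D" for a C
    by (rule cl_mono) (use that in auto)
  have BP: "B \<union> ?P \<subseteq> H" using H(5) PH by simp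
  have I4: "indep H [f (g 0) j, f (g 0) j2, f k (g 0), f k2 (g 0)]" by (rule indep_H[OF k j])
  have n1: "f (g 0) j \<notin> H" using I4 H(3) by simp
  have fDs: "f (g 0) j \<in> D" "f k (g 0) \<in> D" "f k j \<in> D" "gf 0 0 \<in> D" using k j by simp_all
  have n2: "f k (g 0) \<notin> cl (insert (f (g 0) j) H)"
  proof -
    have "insert (f (g 0) j2) (insert (f (g 0) j) H) \<subseteq> D" using H(2) k j by simp
    from cl_mono[OF subset_insertI this] show ?thesis using I4 by auto
  qed
  have n3: "f (g 0) j \<notin> cl (insert (f k (g 0)) H)"
    using exchange[OF H(2) fDs(1,2)] n1 n2 H(3) by auto
  have n4: "f k (g 0) \<notin> H" using n2 cl_sub[OF aD[OF fDs(1)]] by auto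
  have HX: "x \<in> Kb X \<Longrightarrow> X \<subseteq> cl (insert a H) \<Longrightarrow> a \<in> D \<Longrightarrow> x \<in> cl (insert a H)" for x X a
    using cl_minimal[of "B \<union> X" "insert a H"] aD[of a] cl_sub[of "insert a H"] H(5) by blast
  have aH: "insert a H \<subseteq> cl (insert a H)" if "a \<in> D" for a by (rule cl_sub[OF aD[OF that]])
  have m1: "f k j \<in> Kb {gf 0 0, f k (g 0), f (g 0) j}" "f k j \<in> Kb {gf 1 1, f k (g 1), f (g 1) j}"
    using minor[of "g 0" k "g 0" j] minor[of "g 1" k "g 1" j] k j by (simp_all add: insert_commute)
  have m2: "f (g 0) j \<in> Kb {gf 0 0, f k (g 0), f k j}" "f k (g 0) \<in> Kb {gf 0 0, f (g 0) j, f k j}"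
    using minor[of k "g 0" "g 0" j] minor[of "g 0" k j "g 0"] k j by (simp_all add: insert_commute)
  have n5: "f k j \<notin> cl (insert (f k (g 0)) H)" "f k j \<notin> cl (insert (f (g 0) j) H)"
    using HX[OF m2(1), of "f k (g 0)"] HX[OF m2(2), of "f (g 0) j"] n2 n3 fDs aH[OF fDs(1)] aH[OF fDs(2)] H(6)[of 0 0] by auto
  have n6: "f k j \<notin> H" using n5(1) aH[OF fDs(2)] by auto
  have xH: "set ?x \<subseteq> cl (insert (hd ?x) H)" "set ?y \<subseteq> cl (insert (hd ?y) H)" "set ?z \<subseteq> cl (insert (hd ?z) H)"
    using xP yP zP up[OF BP H(2)] fDs by (simp_all only: list.sel) blast+
  obtain Bx where Bx: "finite Bx" "Bx \<subseteq> H" "stationary Bx ?x"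
    using ex_stationary[OF H(2-4) _ _ _ xH(1)] n4 fDs by auto
  obtain By where By: "finite By" "By \<subseteq> H" "stationary By ?y"
    using ex_stationary[OF H(2-4) _ _ _ xH(2)] n1 fDs by auto
  obtain Bz where Bz: "finite Bz" "Bz \<subseteq> H" "stationary Bz ?z"
    using ex_stationary[OF H(2-4) _ _ _ xH(3)] n6 fDs by auto
  \<comment> \<open>A finite subset of \<open>H\<close> suffices: it holds the constants of the
    minors and the bases of the three stationary types, and what is generic over \<open>H\<close> is
    generic over \<open>A\<close>.\<close>
  define A where "A = B \<union> ?P \<union> Bx \<union> By \<union> Bz"
  have A: "finite A" "A \<subseteq> H" "B \<union> ?P \<subseteq> A" "Bx \<subseteq> A" "By \<subseteq> A" "Bz \<subseteq> A"
    unfolding A_def using B(1) Bx By Bz BP by auto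
  have AD: "A \<subseteq> D" using A(2) H(2) by (rule order_trans)
  have clA: "cl A \<subseteq> H" using cl_mono[OF A(2) H(2)] H(3) by simp
  have clA1: "cl (insert a A) \<subseteq> cl (insert a H)" if "a \<in> D" for a
    by (rule cl_mono[OF insert_mono[OF A(2)] aD[OF that]])
  have xA: "set ?x \<subseteq> cl (insert (hd ?x) A)" "set ?y \<subseteq> cl (insert (hd ?y) A)" "set ?z \<subseteq> cl (insert (hd ?z) A)"
    using xP yP zP up[OF A(3) AD] fDs by (simp_all only: list.sel) blast+
  have st: "statl A ?x" "statl A ?y" "statl A ?z"
    using stationary_statl[OF Bx(3) A(1) AD A(4) _ xA(1)] stationary_statl[OF By(3) A(1) AD A(5) _ xA(2)]
      stationary_statl[OF Bz(3) A(1) AD A(6) _ xA(3)] clA n1 n4 n6 by auto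
  have KbA: "Kb X \<subseteq> cl (X \<union> A)" if "X \<subseteq> D" for X by (rule cl_mono) (use that AD A(3) in auto)
  have eD: "e \<in> D" "e' \<in> D" "d \<in> D" "d' \<in> D" using statl_D(1)[OF st(1)] statl_D(1)[OF st(2)] statl_D(1)[OF st(3)] by simp_all
  have l: "line A ?x ?y ?z"
    unfolding line_def
  proof (intro conjI A(1) AD st ballI)
    show "hd ?y \<notin> cl (insert (hd ?x) A)" "hd ?z \<notin> cl (insert (hd ?x) A)" "hd ?z \<notin> cl (insert (hd ?y) A)"
      using n3 n5 clA1 fDs by auto
    have "{gf 0 0, f k (g 0), f (g 0) j} \<union> A = insert (hd ?x) (insert (hd ?y) A)" using A(3) by auto
    then show "hd ?z \<in> cl (insert (hd ?x) (insert (hd ?y) A))" using KbA[of "{gf 0 0, f k (g 0), f (g 0) j}"] m1(1) fDs by auto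
    have one: "Kb {a} \<subseteq> cl (insert a A)" if "a \<in> D" for a using KbA[of "{a}"] that by simp
    have fx: "\<pi> u \<in> Kb X" if "\<pi> \<in> stab C" "B \<union> X \<subseteq> C" "C \<subseteq> D" "u \<in> Kb X" for \<pi> u X C
      by (rule stab_fix_cl[OF that])
    have xyzD: "A \<union> set ?x \<union> set ?y \<subseteq> D" "A \<union> set ?x \<union> set ?z \<subseteq> D" "A \<union> set ?y \<union> set ?z \<subseteq> D"
      using AD statl_D(1)[OF st(1)] statl_D(1)[OF st(2)] statl_D(1)[OF st(3)] by simp_all
    show "\<pi> (hd ?z) \<in> cl (insert (hd ?z) A)" if \<pi>: "\<pi> \<in> stab (A \<union> set ?x \<union> set ?y)" for \<pi>
    proof -
      have 1: "\<pi> (f k j) \<in> Kb {gf 0 0, f k (g 0), f (g 0) j}"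
        by (rule fx[OF \<pi> _ xyzD(1) m1(1)]) (use A(3) in auto)
      have 2: "\<pi> (f k j) \<in> Kb {gf 1 1, f k (g 1), f (g 1) j}"
        by (rule fx[OF \<pi> _ xyzD(1) m1(2)]) (use A(3) in auto)
      from entry_Int[OF k(1) j(1) 1 2] show ?thesis using one[OF fDs(3)] by auto
    qed
    show "\<pi> (hd ?y) \<in> cl (insert (hd ?y) A)" if \<pi>: "\<pi> \<in> stab (A \<union> set ?x \<union> set ?z)" for \<pi>
    proof -
      have "\<pi> (f (g 0) j) \<in> Kb {gf 0 0, f k (g 0), f k j}"
        by (rule fx[OF \<pi> _ xyzD(2) m2(1)]) (use A(3) in auto)
      moreover have "\<pi> (f (g 0) j) \<in> Kb {gf 0 1, e, e'}"
        by (rule fx[OF \<pi> _ xyzD(2) e(3)]) (use A(3) in auto)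
      ultimately have "\<pi> (f (g 0) j) \<in> Kb {f (g 0) j}" using eI by simp
      then show ?thesis using one[OF fDs(1)] by auto
    qed
    show "\<pi> (hd ?x) \<in> cl (insert (hd ?x) A)" if \<pi>: "\<pi> \<in> stab (A \<union> set ?y \<union> set ?z)" for \<pi>
    proof -
      have "\<pi> (f k (g 0)) \<in> Kb {gf 0 0, f (g 0) j, f k j}"
        by (rule fx[OF \<pi> _ xyzD(3) m2(2)]) (use A(3) in auto)
      moreover have "\<pi> (f k (g 0)) \<in> Kb {gf 1 0, d, d'}"
        by (rule fx[OF \<pi> _ xyzD(3) d(3)]) (use A(3) in auto)
      ultimately have "\<pi> (f k (g 0)) \<in> Kb {f k (g 0)}" using dI by simp
      then show ?thesis using one[OF fDs(2)] by auto
    qed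
  qed
  \<comment> \<open>The second row and column are reached by automorphisms fixing \<open>H\<close>
    and thus \<open>A\<close>, so their tuples are conjugates of the chosen ones.\<close>
  obtain \<kappa> where \<kappa>: "\<kappa> \<in> stab H" "map \<kappa> [f k (g 0), f k (g 1)] = [f k2 (g 0), f k2 (g 1)]"
    using kc unfolding conjg_def by (elim bexE)
  obtain \<mu> where \<mu>: "\<mu> \<in> stab H" "map \<mu> [f (g 0) j, f (g 1) j] = [f (g 0) j2, f (g 1) j2]"
    using jc unfolding conjg_def by (elim bexE)
  note \<kappa>A = stab_mono[OF A(2) \<kappa>(1)] and \<mu>A = stab_mono[OF A(2) \<mu>(1)]
  let ?x2 = "map \<kappa> ?x" and ?y2 = "map \<mu> ?y"
  have x2: "?x2 = [f k2 (g 0), f k2 (g 1), \<kappa> e]" "?y2 = [f (g 0) j2, f (g 1) j2, \<mu> d]" using \<kappa>(2) \<mu>(2) by simp_all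
  have I: "indep A [hd ?y, hd ?y2, hd ?x, hd ?x2]"
    using indep_antimono[OF I4 _ H(2), of A] A(2) H(3) unfolding x2 by simp
  \<comment> \<open>Both minors of the third coordinate persist in any triple whose first two
    coordinates begin with genuine array entries; by \<open>entry_Int\<close>, its head is then
    interalgebraic over \<open>A\<close> with the entry at that row and column.\<close>
  have Z: "hd w \<in> cl (insert (f r c) A) \<and> f r c \<in> cl (insert (hd w) A)"
    if w: "rel3 A ?x ?y ?z [f r (g 0), f r (g 1), a] [f (g 0) c, f (g 1) c, b] w" and rc: "r \<in> U" "c \<in> U" for w r c a b
  proof -
    obtain \<pi> where \<pi>: "\<pi> \<in> stab A" "map \<pi> ?x = [f r (g 0), f r (g 1), a]"
      "map \<pi> ?y = [f (g 0) c, f (g 1) c, b]" "map \<pi> ?z = w" using w unfolding rel3_def by (elim bexE conjE)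
    have w0: "hd w = \<pi> (f k j)" using \<pi>(4) by auto
    have mv: "\<pi> u \<in> Kb (\<pi> ` X)" if "u \<in> Kb X" "X \<subseteq> D" "u \<in> D" for u X
      using stab_cl_iff[OF stab_mono[OF _ \<pi>(1)] B(2) that(2,3)] that(1) A(3) by (simp add: Un_commute)
    have \<pi>f: "\<pi> (gf 0 0) = gf 0 0" "\<pi> (gf 1 1) = gf 1 1"
      using stab_fix[OF \<pi>(1)] A(3) by simp_all
    have "hd w \<in> Kb {gf 0 0, f r (g 0), f (g 0) c}" "hd w \<in> Kb {gf 1 1, f r (g 1), f (g 1) c}"
      using mv[OF m1(1)] mv[OF m1(2)] \<pi>(2,3) \<pi>f fDs k(1) j(1) unfolding w0 by simp_all
    from entry_Int[OF rc this] have 1: "hd w \<in> cl (insert (f r c) A)" using KbA[of "{f r c}"] rc by auto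
    have wD: "hd w \<in> D" and wA: "hd w \<notin> cl A"
      using rel3_line(3)[OF l w] conjg_statl_cl(2)[OF rel3_conjg(3)[OF w] st(3) AD] by simp_all
    have "f r c \<in> cl (insert (hd w) A)" by (rule exchange[OF AD wD _ 1 wA]) (use rc in simp)
    with 1 show ?thesis ..
  qed
  \<comment> \<open>Up to interalgebraicity over \<open>A\<close>, the four third coordinates are
    the corners of a 2 by 2 minor of the array.\<close>
  have base: "hd z22 \<in> cl (A \<union> {hd z11, hd z12, hd z21})"
    if r: "rel3 A ?x ?y ?z ?x ?y z11" "rel3 A ?x ?y ?z ?x ?y2 z12" "rel3 A ?x ?y ?z ?x2 ?y z21" "rel3 A ?x ?y ?z ?x2 ?y2 z22"
    for z11 z12 z21 z22
  proof -
    note r' = r[unfolded x2]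
    let ?E = "A \<union> {hd z11, hd z12, hd z21}"
    have E: "?E \<subseteq> D" using AD rel3_line(3)[OF l r(1)] rel3_line(3)[OF l r(2)] rel3_line(3)[OF l r(3)] by simp
    have lift: "f r c \<in> cl ?E" if "f r c \<in> cl (insert a A)" "a \<in> {hd z11, hd z12, hd z21}" for r c a
      using cl_mono[OF _ E, of "insert a A"] that by auto
    have "f k j \<in> cl ?E" "f k j2 \<in> cl ?E" "f k2 j \<in> cl ?E"
      using lift[OF conjunct2[OF Z[OF r'(1) k(1) j(1)]]] lift[OF conjunct2[OF Z[OF r'(2) k(1) j(2)]]]
        lift[OF conjunct2[OF Z[OF r'(3) k(2) j(1)]]] by simp_all
    moreover have "B \<subseteq> cl ?E" using A(3) cl_sub[OF E] by auto
    ultimately have "B \<union> {f k j, f k j2, f k2 j} \<subseteq> cl ?E" by simp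
    from cl_minimal[OF this E] have "f k2 j2 \<in> cl ?E"
      using minor[of k k2 j j2] k j by auto
    then have "insert (f k2 j2) A \<subseteq> cl ?E" using cl_sub[OF E] by simp
    from cl_minimal[OF this E] show ?thesis using Z[OF r'(4) k(2) j(2)] by blast
  qed
  have "net D cl G A ?x ?y ?z"
  proof (intro net.intro homog_pregeom_axioms net_axioms.intro)
    show "line A ?x ?y ?z" by (rule l)
    show "hd z22 \<in> cl (A \<union> {hd z11, hd z12, hd z21})"
      if i: "indep A [hd y1, hd y2, hd x1, hd x2]"
        and r: "rel3 A ?x ?y ?z x1 y1 z11" "rel3 A ?x ?y ?z x1 y2 z12" "rel3 A ?x ?y ?z x2 y1 z21" "rel3 A ?x ?y ?z x2 y2 z22"
      for x1 x2 y1 y2 z11 z12 z21 z22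
      by (rule quad_transfer[OF l conjg_refl conjg_image[OF \<kappa>A] conjg_refl conjg_image[OF \<mu>A] I base i r])
  qed
  then show ?thesis by blast
qed

end

section \<open>Imaginaries\<close>

text \<open>What the passage to imaginaries uses in addition, and hands on. \<open>orbits\<close>
  says that up to automorphism all finite tuples lie in one countable set.\<close>

locale interp_fn = interp D cl G Mods N act hm mdl
  for D :: "'a set" and cl G Mods and N :: "('c, 'g, 's) ambient" and act hm mdl +
  assumes fn_closed: "h \<in> funs (alang N) \<Longrightarrow> us \<in> tuples (elems N) (farity (alang N) h) \<Longrightarrow>
      fn (astruct N) h us = Some v \<Longrightarrow> v \<in> elems N"
    and orbits: "\<exists>C. countable C \<and> (\<forall>us. set us \<subseteq> elems N \<longrightarrow> (\<exists>\<pi>\<in>G. set (map (act \<pi>) us) \<subseteq> C))"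
begin

lemma countable_types: "countable {galois_tp N c {} | c. set c \<subseteq> elems N}"
proof -
  obtain C where C: "countable C" "\<forall>us. set us \<subseteq> elems N \<longrightarrow> (\<exists>\<pi>\<in>G. set (map (act \<pi>) us) \<subseteq> C)"
    using orbits by blast
  have "galois_tp N c {} \<in> (\<lambda>t. galois_tp N t {}) ` lists C" if c: "set c \<subseteq> elems N" for c
  proof -
    obtain \<pi> where \<pi>: "\<pi> \<in> G" "set (map (act \<pi>) c) \<subseteq> C" using C(2) c by blast
    have "set (map (act \<pi>) c) \<subseteq> elems N" using act_mem[OF \<pi>(1)] c by auto
    then have "galois_tp N c {} = galois_tp N (map (act \<pi>) c) {}"
      using galois_tp_eq_iff[OF c _ empty_subsetI] \<pi>(1) by auto
    then show ?thesis by (rule image_eqI) (use \<pi>(2) in \<open>simp add: lists_eq_set\<close>)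
  qed
  then have "{galois_tp N c {} | c. set c \<subseteq> elems N} \<subseteq> (\<lambda>t. galois_tp N t {}) ` lists C" by blast
  then show ?thesis by (rule countable_subset) (simp add: C(1))
qed

text \<open>Invariance is all that has to be checked: the Galois types of related pairs form a
  countable set because finite tuples have only countably many types, and by invariance this set
  decides the relation.\<close>

lemma imag_systemI:
  assumes "countable \<E>" "equality_rel N \<in> \<E>"
    and "\<And>E. E \<in> \<E> \<Longrightarrow> \<exists>n\<ge>1. equiv (tuples (elems N) n) E \<and>
      (\<forall>\<pi>\<in>G. \<forall>(a, b)\<in>E. (map (act \<pi>) a, map (act \<pi>) b) \<in> E)"
  shows "imag_system N \<E>"
  unfolding imag_system_def
proof (intro conjI ballI assms(1,2))
  fix E assume "E \<in> \<E>"
  then obtain n where n: "n \<ge> 1" "equiv (tuples (elems N) n) E"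
    and inv: "\<forall>\<pi>\<in>G. \<forall>(a, b)\<in>E. (map (act \<pi>) a, map (act \<pi>) b) \<in> E" using assms(3) by blast
  have sub: "E \<subseteq> tuples (elems N) n \<times> tuples (elems N) n" by (rule equiv_type[OF n(2)])
  let ?G = "{galois_tp N (a @ b) {} | a b. (a, b) \<in> E}"
  have inv': "(map \<theta> a, map \<theta> b) \<in> E" if \<theta>: "\<theta> \<in> Aut N {}" and ab: "(a, b) \<in> E" for \<theta> a b
  proof -
    obtain \<pi> where \<pi>: "\<pi> \<in> G" "\<forall>u\<in>elems N. \<theta> u = act \<pi> u" using Aut_act[OF \<theta>] by blast
    have "set a \<subseteq> elems N" "set b \<subseteq> elems N" using sub ab unfolding tuples_def by auto
    then have eq: "map \<theta> a = map (act \<pi>) a" "map \<theta> b = map (act \<pi>) b" using \<pi>(2) by auto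
    show ?thesis unfolding eq using bspec[OF bspec[OF inv \<pi>(1)] ab] by simp
  qed
  have "?G \<subseteq> {galois_tp N c {} | c. c \<in> tuples (elems N) (2 * n)}"
    using sub unfolding tuples_def by fastforce
  moreover have "?G \<subseteq> {galois_tp N c {} | c. set c \<subseteq> elems N}"
    using sub unfolding tuples_def by fastforce
  then have "countable ?G" by (rule countable_subset[OF _ countable_types])
  moreover have "(a, b) \<in> E \<longleftrightarrow> galois_tp N (a @ b) {} \<in> ?G"
    if ab: "a \<in> tuples (elems N) n" "b \<in> tuples (elems N) n" for a b
  proof
    assume "galois_tp N (a @ b) {} \<in> ?G"
    then obtain a' b' where *: "(a', b') \<in> E" "galois_tp N (a @ b) {} = galois_tp N (a' @ b') {}" by blast
    have t: "a' \<in> tuples (elems N) n" "b' \<in> tuples (elems N) n" using sub *(1) by auto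
    have "set (a @ b) \<subseteq> elems N" "set (a' @ b') \<subseteq> elems N" using ab t unfolding tuples_def by auto
    from galois_tp_eq_iff[OF this(2,1) empty_subsetI] *(2)
    obtain \<rho> where \<rho>: "\<rho> \<in> G" "map (act \<rho>) (a' @ b') = a @ b" by auto
    have "map (act \<rho>) a' = a" "map (act \<rho>) b' = b"
      using \<rho>(2) ab t unfolding tuples_def by auto
    then show "(a, b) \<in> E" using inv \<rho>(1) *(1) by auto
  qed blast
  ultimately show "\<exists>n\<ge>1. equiv (tuples (elems N) n) E \<and> (\<forall>\<pi>\<in>Aut N {}. \<forall>(a, b)\<in>E. (map \<pi> a, map \<pi> b) \<in> E) \<and>
      (\<exists>G. countable G \<and> G \<subseteq> {galois_tp N c {} | c. c \<in> tuples (elems N) (2 * n)} \<and>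
        (\<forall>a\<in>tuples (elems N) n. \<forall>b\<in>tuples (elems N) n. (a, b) \<in> E \<longleftrightarrow> galois_tp N (a @ b) {} \<in> G))"
    using n inv' by (intro exI[of _ n] conjI exI[of _ ?G]) auto
qed

lemma equality_rel_invariant:
  "equiv (tuples (elems N) 1) (equality_rel N)"
  "\<pi> \<in> G \<Longrightarrow> (a, b) \<in> equality_rel N \<Longrightarrow> (map (act \<pi>) a, map (act \<pi>) b) \<in> equality_rel N"
proof -
  have "equality_rel N = Id_on (tuples (elems N) 1)"
    unfolding equality_rel_def tuples_def by (auto simp: length_Suc_conv)
  then show "equiv (tuples (elems N) 1) (equality_rel N)"
    unfolding equiv_def refl_on_def sym_on_def trans_on_def by auto
  show "\<pi> \<in> G \<Longrightarrow> (a, b) \<in> equality_rel N \<Longrightarrow> (map (act \<pi>) a, map (act \<pi>) b) \<in> equality_rel N"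
    unfolding equality_rel_def using act_mem by auto
qed

end

locale eq_interp = interp_fn D cl G Mods N act hm mdl
  for D :: "'a set" and cl G Mods and N :: "('c, 'g, 's) ambient" and act hm mdl +
  fixes \<E> :: "('c list \<times> 'c list) set set"
  assumes sys: "imag_system N \<E>"
begin

definition eq_act :: "('a \<Rightarrow> 'a) \<Rightarrow> 'c imag \<Rightarrow> 'c imag" where
  "eq_act \<pi> u = (fst u, map (act \<pi>) ` snd u)"

lemma eqrel_mem: "equality_rel N \<in> \<E>"
  using sys unfolding imag_system_def by simp

lemma sysD:
  assumes "E \<in> \<E>"
  obtains n where "n \<ge> 1" "equiv (tuples (elems N) n) E" "\<forall>\<pi>\<in>Aut N {}. \<forall>(a, b)\<in>E. (map \<pi> a, map \<pi> b) \<in> E"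
proof -
  have "\<exists>n\<ge>1. equiv (tuples (elems N) n) E \<and> (\<forall>\<pi>\<in>Aut N {}. \<forall>(a, b)\<in>E. (map \<pi> a, map \<pi> b) \<in> E) \<and>
      (\<exists>G. countable G \<and> G \<subseteq> {galois_tp N c {} | c. c \<in> tuples (elems N) (2 * n)} \<and>
        (\<forall>a\<in>tuples (elems N) n. \<forall>b\<in>tuples (elems N) n. (a, b) \<in> E \<longleftrightarrow> galois_tp N (a @ b) {} \<in> G))"
    by (rule bspec[OF conjunct2[OF conjunct2[OF sys[unfolded imag_system_def]]] assms])
  then show ?thesis by (elim exE conjE) (rule that)
qed

lemma E_equiv: "E \<in> \<E> \<Longrightarrow> \<exists>n\<ge>1. equiv (tuples (elems N) n) E \<and> Field E = tuples (elems N) n"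
proof (erule sysD)
  fix n assume n: "n \<ge> 1" "equiv (tuples (elems N) n) E"
  have "a \<in> Field E" if "a \<in> tuples (elems N) n" for a
    using equiv_class_self[OF n(2) that] by (auto intro: FieldI1)
  moreover have "a \<in> tuples (elems N) n" if "a \<in> Field E" for a
    using equiv_type[OF n(2)] that unfolding Field_def by auto
  ultimately have "Field E = tuples (elems N) n" by blast
  with n show "\<exists>n\<ge>1. equiv (tuples (elems N) n) E \<and> Field E = tuples (elems N) n"
    by (intro exI[of _ n] conjI)
qed

lemma E_refl: "E \<in> \<E> \<Longrightarrow> a \<in> Field E \<Longrightarrow> (a, a) \<in> E"
  using E_equiv[of E] equiv_class_self[of _ E a] by auto

lemma E_elems: "E \<in> \<E> \<Longrightarrow> a \<in> Field E \<Longrightarrow> set a \<subseteq> elems N"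
  using E_equiv[of E] unfolding tuples_def by auto

lemma E_length: "E \<in> \<E> \<Longrightarrow> a \<in> Field E \<Longrightarrow> b \<in> Field E \<Longrightarrow> length a = length b"
  using E_equiv[of E] unfolding tuples_def by auto

lemma imag_eq_iff: "E \<in> \<E> \<Longrightarrow> a \<in> Field E \<Longrightarrow> b \<in> Field E \<Longrightarrow> imag E a = imag E b \<longleftrightarrow> (a, b) \<in> E"
  using E_equiv[of E] eq_equiv_class_iff[of _ E a b] unfolding imag_def by auto

lemma E_act: "E \<in> \<E> \<Longrightarrow> \<pi> \<in> G \<Longrightarrow> (a, b) \<in> E \<Longrightarrow> (map (act \<pi>) a, map (act \<pi>) b) \<in> E"
proof (erule sysD)
  assume *: "\<pi> \<in> G" "(a, b) \<in> E" "\<forall>\<pi>\<in>Aut N {}. \<forall>(a, b)\<in>E. (map \<pi> a, map \<pi> b) \<in> E"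
  show "(map (act \<pi>) a, map (act \<pi>) b) \<in> E"
    using bspec[OF bspec[OF *(3) act_Aut[OF *(1)]] *(2)] by simp
qed

lemma Field_act: "E \<in> \<E> \<Longrightarrow> \<pi> \<in> G \<Longrightarrow> a \<in> Field E \<Longrightarrow> map (act \<pi>) a \<in> Field E"
  using E_act[OF _ _ E_refl] by (auto intro: FieldI1)

lemma eq_act_imag:
  assumes "E \<in> \<E>" "\<pi> \<in> G" "a \<in> Field E"
  shows "eq_act \<pi> (imag E a) = imag E (map (act \<pi>) a)"
proof -
  obtain \<tau> where \<tau>: "\<tau> \<in> G" "\<forall>u\<in>elems N. act \<tau> (act \<pi> u) = u \<and> act \<pi> (act \<tau> u) = u"
    using act_inv[OF assms(2)] by blast
  have "map (act \<pi>) ` (E `` {a}) = E `` {map (act \<pi>) a}"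
  proof
    show "map (act \<pi>) ` (E `` {a}) \<subseteq> E `` {map (act \<pi>) a}" using E_act[OF assms(1,2)] by auto
    show "E `` {map (act \<pi>) a} \<subseteq> map (act \<pi>) ` (E `` {a})"
    proof
      fix c assume "c \<in> E `` {map (act \<pi>) a}"
      then have c: "(map (act \<pi>) a, c) \<in> E" by simp
      have "set a \<subseteq> elems N" "set c \<subseteq> elems N"
        using E_elems[OF assms(1)] assms(3) FieldI2[OF c] by simp_all
      then have 1: "map (act \<tau>) (map (act \<pi>) a) = a" "map (act \<pi>) (map (act \<tau>) c) = c"
        using \<tau>(2) by (auto intro!: map_idI)
      from E_act[OF assms(1) \<tau>(1) c] have "(a, map (act \<tau>) c) \<in> E" unfolding 1 .
      then show "c \<in> map (act \<pi>) ` (E `` {a})" using 1(2) by (intro image_eqI[where x = "map (act \<tau>) c"]) simp_all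
    qed
  qed
  then show ?thesis unfolding eq_act_def imag_def by simp
qed

lemma Field_equality: "Field (equality_rel N) = {[u] | u. u \<in> elems N}"
  unfolding Field_def equality_rel_def by auto

lemma home_mem: "u \<in> elems N \<Longrightarrow> home N u \<in> imags_of \<E> (elems N)"
  unfolding home_def imags_of_def using eqrel_mem Field_equality
  by (intro CollectI exI[of _ "equality_rel N"] exI[of _ "[u]"]) simp

lemma home_inj: "inj_on (home N) (elems N)"
  by (rule inj_onI) (auto simp: home_def imag_def equality_rel_def)

lemma unhome_home: "u \<in> elems N \<Longrightarrow> unhome N (home N u) = u"
  unfolding unhome_def by (rule inv_into_f_f[OF home_inj])

lemma eq_act_home: "\<pi> \<in> G \<Longrightarrow> u \<in> elems N \<Longrightarrow> eq_act \<pi> (home N u) = home N (act \<pi> u)"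
  unfolding home_def using eq_act_imag[OF eqrel_mem, of \<pi> "[u]"] Field_equality by auto

lemma imagsE:
  assumes "u \<in> imags_of \<E> X"
  obtains E a where "E \<in> \<E>" "a \<in> Field E" "set a \<subseteq> X" "u = imag E a"
  using assms unfolding imags_of_def by blast

lemma home_mem_imags:
  assumes "u \<in> elems N" "X \<subseteq> elems N"
  shows "home N u \<in> imags_of \<E> X \<longleftrightarrow> u \<in> X"
proof
  assume "home N u \<in> imags_of \<E> X"
  then obtain E a where a: "E \<in> \<E>" "a \<in> Field E" "set a \<subseteq> X" "home N u = imag E a" by (rule imagsE)
  have "E = equality_rel N" using a(4) unfolding home_def imag_def by simp
  then obtain v where v: "a = [v]" "v \<in> elems N" using a(2) Field_equality by auto
  have "home N u = home N v" using a(4) v(1) \<open>E = equality_rel N\<close> unfolding home_def by simp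
  then show "u \<in> X" using inj_onD[OF home_inj _ assms(1) v(2)] a(3) v(1) by simp
next
  assume "u \<in> X"
  then show "home N u \<in> imags_of \<E> X"
    unfolding home_def imags_of_def using eqrel_mem Field_equality assms(1)
    by (intro CollectI exI[of _ "equality_rel N"] exI[of _ "[u]"]) simp
qed

lemma imags_mono: "X \<subseteq> Y \<Longrightarrow> imags_of \<E> X \<subseteq> imags_of \<E> Y"
  unfolding imags_of_def by blast

abbreviation Q where "Q \<equiv> eq_ambient N \<E>"

lemma elems_Q: "elems Q = imags_of \<E> (elems N)" and models_Q: "models Q = imags_of \<E> ` models N"
  unfolding eq_ambient_def eq_struct_def by simp_all

text \<open>Imaginaries carry their relation as a tag, so the home sort is recognised by the tag,
  which \<open>eq_act\<close> leaves alone.\<close>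

lemma home_iff: "u \<in> elems Q \<Longrightarrow> u \<in> home N ` elems N \<longleftrightarrow> fst u = equality_rel N"
proof
  show "u \<in> home N ` elems N \<Longrightarrow> fst u = equality_rel N" unfolding home_def imag_def by auto
  assume "u \<in> elems Q" "fst u = equality_rel N"
  from this(1)[unfolded elems_Q] obtain E a where a: "E \<in> \<E>" "a \<in> Field E" "set a \<subseteq> elems N" "u = imag E a"
    by (rule imagsE)
  then have "E = equality_rel N" using \<open>fst u = equality_rel N\<close> unfolding imag_def by simp
  then show "u \<in> home N ` elems N" using a Field_equality unfolding home_def by auto
qed

lemma home_list:
  assumes "set ys \<subseteq> home N ` elems N"
  obtains us where "set us \<subseteq> elems N" "ys = map (home N) us" "map (unhome N) ys = us"
proof
  have *: "home N (unhome N y) = y \<and> unhome N y \<in> elems N" if y: "y \<in> set ys" for y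
  proof -
    obtain u where "u \<in> elems N" "y = home N u" using y assms by auto
    then show ?thesis using unhome_home by simp
  qed
  show "set (map (unhome N) ys) \<subseteq> elems N" using * by auto
  show "ys = map (home N) (map (unhome N) ys)" using * by (auto intro!: map_idI[symmetric])
qed simp

lemma unhome_list: "set us \<subseteq> elems N \<Longrightarrow> map (unhome N) (map (home N) us) = us"
  using unhome_home by (auto intro!: map_idI)

lemma fn_home:
  assumes "set us \<subseteq> elems N"
  shows "fn (astruct Q) (Inl h) (map (home N) us) = map_option (home N) (fn (astruct N) h us)"
    and "E \<in> \<E> \<Longrightarrow> fn (astruct Q) (Inr E) (map (home N) us) = (if us \<in> Field E then Some (imag E us) else None)"
    and "rl (astruct Q) (Inl r) (map (home N) us) \<longleftrightarrow> rl (astruct N) r us"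
  using assms unhome_list[OF assms] unfolding eq_ambient_def eq_struct_def by (auto simp del: map_map)

lemma fn_nohome:
  assumes "\<not> set ys \<subseteq> home N ` elems N"
  shows "fn (astruct Q) h ys = None" "\<not> rl (astruct Q) (Inl r) ys"
  using assms unfolding eq_ambient_def eq_struct_def by (auto split: sum.split)

lemma rl_Inr: "rl (astruct Q) (Inr E) ys \<longleftrightarrow> (\<exists>a\<in>Field E. ys = [imag E a])"
  unfolding eq_ambient_def eq_struct_def by simp

lemma lang_Q: "funs (alang Q) = funs (alang N) <+> \<E>" "rels (alang Q) = rels (alang N) <+> \<E>"
  "farity (alang Q) (Inl h) = farity (alang N) h" "rarity (alang Q) (Inl r) = rarity (alang N) r"
  "rarity (alang Q) (Inr E) = 1"
  unfolding eq_ambient_def eq_lang_def by simp_all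

lemma farity_Inr: "E \<in> \<E> \<Longrightarrow> a \<in> Field E \<Longrightarrow> farity (alang Q) (Inr E) = length a"
proof -
  assume *: "E \<in> \<E>" "a \<in> Field E"
  have "(THE n. \<forall>b\<in>Field E. length b = n) = length a"
  proof (rule the_equality)
    show "\<forall>b\<in>Field E. length b = length a" by (rule ballI) (rule E_length[OF *(1) _ *(2)])
    show "n = length a" if n: "\<forall>b\<in>Field E. length b = n" for n by (rule sym) (rule bspec[OF n *(2)])
  qed
  then show ?thesis unfolding eq_ambient_def eq_lang_def by simp
qed

lemma eq_act_mem: "\<pi> \<in> G \<Longrightarrow> u \<in> elems Q \<Longrightarrow> eq_act \<pi> u \<in> elems Q"
  unfolding elems_Q
proof (elim imagsE)
  fix E a assume *: "\<pi> \<in> G" "E \<in> \<E>" "a \<in> Field E" "u = imag E a"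
  note F = Field_act[OF *(2,1,3)]
  show "eq_act \<pi> u \<in> imags_of \<E> (elems N)"
    unfolding *(4) eq_act_imag[OF *(2,1,3)] imags_of_def using *(2) F E_elems[OF *(2) F] by blast
qed

lemma eq_act_comp:
  assumes "\<pi> \<in> G" "\<tau> \<in> G" "u \<in> elems Q"
  shows "eq_act (\<lambda>x. \<pi> (\<tau> x)) u = eq_act \<pi> (eq_act \<tau> u)"
proof -
  obtain E a where *: "E \<in> \<E>" "a \<in> Field E" "set a \<subseteq> elems N" "u = imag E a"
    using assms(3) unfolding elems_Q by (rule imagsE)
  have m: "map (act (\<lambda>x. \<pi> (\<tau> x))) a = map (act \<pi>) (map (act \<tau>) a)"
    using act_comp[OF assms(1,2)] *(3) by auto
  show ?thesis
    unfolding *(4) eq_act_imag[OF *(1) G_comp[OF assms(1,2)] *(2)] eq_act_imag[OF *(1) assms(2) *(2)]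
      eq_act_imag[OF *(1) assms(1) Field_act[OF *(1) assms(2) *(2)]] m ..
qed

lemma eq_act_cong: "\<pi> \<in> G \<Longrightarrow> (\<forall>x\<in>D. \<pi> x = x) \<Longrightarrow> u \<in> elems Q \<Longrightarrow> eq_act \<pi> u = u"
  unfolding elems_Q
proof (elim imagsE)
  fix E a assume *: "\<pi> \<in> G" "\<forall>x\<in>D. \<pi> x = x" "E \<in> \<E>" "a \<in> Field E" "set a \<subseteq> elems N" "u = imag E a"
  have "map (act \<pi>) a = a" using act_cong[OF *(1,2)] *(5) by (auto intro!: map_idI)
  then show "eq_act \<pi> u = u" unfolding *(6) eq_act_imag[OF *(3,1,4)] by simp
qed

lemma eq_act_fst: "fst (eq_act \<pi> u) = fst u"
  unfolding eq_act_def by simp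

lemma eq_act_homes:
  assumes "\<pi> \<in> G" "set ys \<subseteq> elems Q"
  shows "set (map (eq_act \<pi>) ys) \<subseteq> home N ` elems N \<longleftrightarrow> set ys \<subseteq> home N ` elems N"
proof -
  have "eq_act \<pi> y \<in> home N ` elems N \<longleftrightarrow> y \<in> home N ` elems N" if "y \<in> set ys" for y
    using home_iff[of y] home_iff[OF eq_act_mem[OF assms(1)], of y] eq_act_fst assms(2) that by auto
  then show ?thesis unfolding set_map image_subset_iff subset_iff[of "set ys"] by blast
qed

lemma eq_act_Aut:
  assumes \<pi>: "\<pi> \<in> G"
  shows "eq_act \<pi> \<in> Aut Q {}"
proof -
  have iso: "struct_iso (alang N) (astruct N) (astruct N) (act \<pi>)" using act_Aut[OF \<pi>] unfolding Aut_def by simp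
  obtain \<tau> where \<tau>: "\<tau> \<in> G" "\<forall>x\<in>D. \<tau> (\<pi> x) = x \<and> \<pi> (\<tau> x) = x"
    using stab_inv[of \<pi> "{}"] \<pi> unfolding stab_empty by auto
  have inv: "eq_act \<tau> (eq_act \<pi> u) = u" "eq_act \<pi> (eq_act \<tau> u) = u" if "u \<in> elems Q" for u
    using eq_act_comp[OF \<tau>(1) \<pi> that] eq_act_comp[OF \<pi> \<tau>(1) that] eq_act_cong[OF G_comp[OF \<tau>(1) \<pi>] _ that]
      eq_act_cong[OF G_comp[OF \<pi> \<tau>(1)] _ that] \<tau>(2) by simp_all
  have bij: "bij_betw (eq_act \<pi>) (elems Q) (elems Q)"
    by (rule bij_betw_byWitness[of _ "eq_act \<tau>"]) (use inv eq_act_mem \<pi> \<tau>(1) in auto)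
  have acth: "map (eq_act \<pi>) (map (home N) us) = map (home N) (map (act \<pi>) us)" if "set us \<subseteq> elems N" for us
    using eq_act_home[OF \<pi>] that by auto
  have actm: "set (map (act \<pi>) us) \<subseteq> elems N" if "set us \<subseteq> elems N" for us
    using act_mem[OF \<pi>] that by auto
  have fns: "fn (astruct Q) h (map (eq_act \<pi>) ys) = map_option (eq_act \<pi>) (fn (astruct Q) h ys)"
    if h: "h \<in> funs (alang Q)" and ys: "ys \<in> tuples (elems Q) (farity (alang Q) h)" for h ys
  proof (cases "set ys \<subseteq> home N ` elems N")
    case False
    then have "\<not> set (map (eq_act \<pi>) ys) \<subseteq> home N ` elems N"
      using eq_act_homes[OF \<pi>, of ys] ys unfolding tuples_def by simp
    with False show ?thesis using fn_nohome(1) by simp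
  next
    case True
    obtain us where us: "set us \<subseteq> elems N" "ys = map (home N) us" using home_list[OF True] by metis
    show ?thesis
    proof (cases h)
      case (Inl h')
      have "h' \<in> funs (alang N)" "us \<in> tuples (elems N) (farity (alang N) h')"
        using h ys us unfolding Inl lang_Q tuples_def by auto
      then have "fn (astruct N) h' (map (act \<pi>) us) = map_option (act \<pi>) (fn (astruct N) h' us)"
        "\<And>v. fn (astruct N) h' us = Some v \<Longrightarrow> v \<in> elems N"
        using iso fn_closed unfolding struct_iso_def by blast+
      then show ?thesis
        unfolding Inl us(2) acth[OF us(1)] fn_home(1)[OF actm[OF us(1)]] fn_home(1)[OF us(1)]
        using eq_act_home[OF \<pi>] by (cases "fn (astruct N) h' us") simp_all
    next
      case (Inr E)
      then have E: "E \<in> \<E>" using h unfolding lang_Q by auto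
      obtain \<rho> where \<rho>: "\<rho> \<in> G" "\<forall>u\<in>elems N. act \<rho> (act \<pi> u) = u \<and> act \<pi> (act \<rho> u) = u"
        using act_inv[OF \<pi>] by blast
      have "map (act \<rho>) (map (act \<pi>) us) = us" using \<rho>(2) us(1) by (auto intro!: map_idI)
      then have "map (act \<pi>) us \<in> Field E \<longleftrightarrow> us \<in> Field E"
        using Field_act[OF E \<pi>, of us] Field_act[OF E \<rho>(1), of "map (act \<pi>) us"] by auto
      then show ?thesis
        unfolding Inr us(2) acth[OF us(1)] fn_home(2)[OF actm[OF us(1)] E] fn_home(2)[OF us(1) E]
        using eq_act_imag[OF E \<pi>] by simp
    qed
  qed
  have rls: "rl (astruct Q) r (map (eq_act \<pi>) ys) = rl (astruct Q) r ys"
    if r: "r \<in> rels (alang Q)" and ys: "ys \<in> tuples (elems Q) (rarity (alang Q) r)" for r ys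
  proof (cases r)
    case (Inl r')
    show ?thesis
    proof (cases "set ys \<subseteq> home N ` elems N")
      case False
      then have "\<not> set (map (eq_act \<pi>) ys) \<subseteq> home N ` elems N"
        using eq_act_homes[OF \<pi>, of ys] ys unfolding tuples_def by simp
      with False show ?thesis unfolding Inl using fn_nohome(2) by simp
    next
      case True
      obtain us where us: "set us \<subseteq> elems N" "ys = map (home N) us" using home_list[OF True] by metis
      have "r' \<in> rels (alang N)" "us \<in> tuples (elems N) (rarity (alang N) r')"
        using r ys us unfolding Inl lang_Q tuples_def by auto
      then have "rl (astruct N) r' (map (act \<pi>) us) = rl (astruct N) r' us"
        using iso unfolding struct_iso_def by blast
      then show ?thesis
        unfolding Inl us(2) acth[OF us(1)] fn_home(3)[OF actm[OF us(1)]] fn_home(3)[OF us(1)] .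
    qed
  next
    case (Inr E)
    then have E: "E \<in> \<E>" using r unfolding lang_Q by auto
    obtain y where y: "ys = [y]" "y \<in> elems Q"
      using ys unfolding Inr lang_Q tuples_def by (auto simp: length_Suc_conv)
    have "(\<exists>a\<in>Field E. eq_act \<pi> y = imag E a) \<longleftrightarrow> (\<exists>a\<in>Field E. y = imag E a)"
    proof
      assume "\<exists>a\<in>Field E. eq_act \<pi> y = imag E a"
      then have "fst y = E" unfolding imag_def eq_act_def by auto
      moreover obtain E' a where "E' \<in> \<E>" "a \<in> Field E'" "y = imag E' a"
        using y(2) unfolding elems_Q by (rule imagsE)
      ultimately show "\<exists>a\<in>Field E. y = imag E a" unfolding imag_def by auto
    next
      assume "\<exists>a\<in>Field E. y = imag E a"
      then show "\<exists>a\<in>Field E. eq_act \<pi> y = imag E a" using eq_act_imag[OF E \<pi>] Field_act[OF E \<pi>] by auto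
    qed
    then show ?thesis unfolding Inr rl_Inr y(1) by simp
  qed
  show ?thesis unfolding Aut_def struct_iso_def using bij fns rls by simp
qed

text \<open>The predicate belonging to equality singles out the home sort, so an automorphism
  restricts to it and is induced there by some element of \<open>G\<close>. The quotient maps
  determine it on the remaining imaginaries.\<close>

lemma Aut_eq_act:
  assumes \<theta>: "\<theta> \<in> Aut Q {}"
  shows "\<exists>\<pi>\<in>G. \<forall>u\<in>elems Q. \<theta> u = eq_act \<pi> u"
proof -
  have bij: "bij_betw \<theta> (elems Q) (elems Q)"
    and fns: "\<And>h ys. h \<in> funs (alang Q) \<Longrightarrow> ys \<in> tuples (elems Q) (farity (alang Q) h) \<Longrightarrow>
      fn (astruct Q) h (map \<theta> ys) = map_option \<theta> (fn (astruct Q) h ys)"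
    and rls: "\<And>r ys. r \<in> rels (alang Q) \<Longrightarrow> ys \<in> tuples (elems Q) (rarity (alang Q) r) \<Longrightarrow>
      rl (astruct Q) r (map \<theta> ys) = rl (astruct Q) r ys"
    using \<theta> unfolding Aut_def struct_iso_def by simp_all
  have \<theta>m: "\<theta> u \<in> elems Q" if "u \<in> elems Q" for u using bij_betwE[OF bij] that by blast
  have home_rl: "rl (astruct Q) (Inr (equality_rel N)) [u] \<longleftrightarrow> u \<in> home N ` elems N" for u
    unfolding rl_Inr Field_equality home_def by auto
  have \<theta>h: "\<theta> u \<in> home N ` elems N \<longleftrightarrow> u \<in> home N ` elems N" if "u \<in> elems Q" for u
    using rls[of "Inr (equality_rel N)" "[u]"] eqrel_mem that home_rl
    unfolding lang_Q tuples_def by auto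
  define \<theta>0 where "\<theta>0 = (\<lambda>u. unhome N (\<theta> (home N u)))"
  have hQ: "home N u \<in> elems Q" if "u \<in> elems N" for u using home_mem[OF that] unfolding elems_Q .
  have \<theta>0: "\<theta>0 u \<in> elems N" "home N (\<theta>0 u) = \<theta> (home N u)" if u: "u \<in> elems N" for u
  proof -
    have "\<theta> (home N u) \<in> home N ` elems N" using \<theta>h[OF hQ[OF u]] u by simp
    then obtain v where "v \<in> elems N" "\<theta> (home N u) = home N v" by blast
    then show "\<theta>0 u \<in> elems N" "home N (\<theta>0 u) = \<theta> (home N u)" unfolding \<theta>0_def using unhome_home by simp_all
  qed
  have \<theta>l: "map \<theta> (map (home N) us) = map (home N) (map \<theta>0 us)" "set (map \<theta>0 us) \<subseteq> elems N"
    "set (map (home N) us) \<subseteq> elems Q" if "set us \<subseteq> elems N" for us using \<theta>0 hQ that by auto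
  have "\<theta>0 \<in> Aut N {}"
    unfolding Aut_def struct_iso_def
  proof (intro CollectI conjI ballI)
    show "bij_betw \<theta>0 (elems N) (elems N)"
    proof (rule bij_betw_imageI)
      show "inj_on \<theta>0 (elems N)"
      proof (rule inj_onI)
        fix u v assume *: "u \<in> elems N" "v \<in> elems N" "\<theta>0 u = \<theta>0 v"
        have "\<theta> (home N u) = \<theta> (home N v)" using \<theta>0(2)[OF *(1)] \<theta>0(2)[OF *(2)] *(3) by simp
        then have "home N u = home N v" using bij_betw_imp_inj_on[OF bij] hQ *(1,2) by (auto dest: inj_onD)
        then show "u = v" using inj_onD[OF home_inj _ *(1,2)] by simp
      qed
      show "\<theta>0 ` elems N = elems N"
      proof
        show "\<theta>0 ` elems N \<subseteq> elems N" using \<theta>0(1) by blast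
        show "elems N \<subseteq> \<theta>0 ` elems N"
        proof
          fix v assume v: "v \<in> elems N"
          have "home N v \<in> \<theta> ` elems Q" using bij_betw_imp_surj_on[OF bij] hQ[OF v] by simp
          then obtain w where w: "w \<in> elems Q" "\<theta> w = home N v" by (metis imageE)
          then have "w \<in> home N ` elems N" using \<theta>h[OF w(1)] v by simp
          then obtain u where u: "u \<in> elems N" "w = home N u" by blast
          have "home N (\<theta>0 u) = home N v" using \<theta>0(2)[OF u(1)] w(2) u(2) by simp
          then have "\<theta>0 u = v" using inj_onD[OF home_inj _ \<theta>0(1)[OF u(1)] v] by simp
          then show "v \<in> \<theta>0 ` elems N" using u(1) by blast
        qed
      qed
    qed
  next
    fix h us assume h: "h \<in> funs (alang N)" and us: "us \<in> tuples (elems N) (farity (alang N) h)"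
    have usN: "set us \<subseteq> elems N" using us unfolding tuples_def by simp
    have "map (home N) us \<in> tuples (elems Q) (farity (alang Q) (Inl h))"
      using \<theta>l(3)[OF usN] us unfolding tuples_def lang_Q by simp
    then have "fn (astruct Q) (Inl h) (map \<theta> (map (home N) us)) = map_option \<theta> (fn (astruct Q) (Inl h) (map (home N) us))"
      using fns[of "Inl h"] h unfolding lang_Q by blast
    then have eq: "map_option (home N) (fn (astruct N) h (map \<theta>0 us)) = map_option \<theta> (map_option (home N) (fn (astruct N) h us))"
      unfolding \<theta>l(1)[OF usN] fn_home(1)[OF \<theta>l(2)[OF usN]] fn_home(1)[OF usN] .
    have us0: "map \<theta>0 us \<in> tuples (elems N) (farity (alang N) h)" using \<theta>l(2)[OF usN] us unfolding tuples_def by simp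
    show "fn (astruct N) h (map \<theta>0 us) = map_option \<theta>0 (fn (astruct N) h us)"
    proof (cases "fn (astruct N) h us")
      case None
      then show ?thesis using eq by simp
    next
      case (Some v)
      then have v: "v \<in> elems N" by (rule fn_closed[OF h us])
      obtain w where w: "fn (astruct N) h (map \<theta>0 us) = Some w" "home N w = \<theta> (home N v)" using eq Some by auto
      have "w \<in> elems N" by (rule fn_closed[OF h us0 w(1)])
      then have "w = \<theta>0 v" using inj_onD[OF home_inj, of w "\<theta>0 v"] w(2) \<theta>0[OF v] by simp
      then show ?thesis using w(1) Some by simp
    qed
  next
    fix r us assume r: "r \<in> rels (alang N)" and us: "us \<in> tuples (elems N) (rarity (alang N) r)"
    have usN: "set us \<subseteq> elems N" using us unfolding tuples_def by simp
    have "map (home N) us \<in> tuples (elems Q) (rarity (alang Q) (Inl r))"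
      using \<theta>l(3)[OF usN] us unfolding tuples_def lang_Q by simp
    then have "rl (astruct Q) (Inl r) (map \<theta> (map (home N) us)) = rl (astruct Q) (Inl r) (map (home N) us)"
      using rls[of "Inl r"] r unfolding lang_Q by blast
    then show "rl (astruct N) r (map \<theta>0 us) = rl (astruct N) r us"
      unfolding \<theta>l(1)[OF usN] fn_home(3)[OF \<theta>l(2)[OF usN]] fn_home(3)[OF usN] .
  qed simp
  then obtain \<pi> where \<pi>: "\<pi> \<in> G" "\<forall>u\<in>elems N. \<theta>0 u = act \<pi> u" using Aut_act by blast
  have "\<theta> u = eq_act \<pi> u" if "u \<in> elems Q" for u
  proof -
    obtain E a where a: "E \<in> \<E>" "a \<in> Field E" "set a \<subseteq> elems N" "u = imag E a"
      using \<open>u \<in> elems Q\<close> unfolding elems_Q by (rule imagsE)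
    have 0: "map \<theta>0 a = map (act \<pi>) a" using \<pi>(2) a(3) by auto
    have F: "map \<theta>0 a \<in> Field E" unfolding 0 by (rule Field_act[OF a(1) \<pi>(1) a(2)])
    have "map (home N) a \<in> tuples (elems Q) (farity (alang Q) (Inr E))"
      using \<theta>l(3)[OF a(3)] farity_Inr[OF a(1,2)] unfolding tuples_def by simp
    then have "fn (astruct Q) (Inr E) (map \<theta> (map (home N) a)) = map_option \<theta> (fn (astruct Q) (Inr E) (map (home N) a))"
      using fns[of "Inr E"] a(1) unfolding lang_Q by blast
    then have "Some (imag E (map \<theta>0 a)) = Some (\<theta> (imag E a))"
      unfolding \<theta>l(1)[OF a(3)] fn_home(2)[OF \<theta>l(2)[OF a(3)] a(1)] fn_home(2)[OF a(3,1)] using F a(2) by simp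
    then show ?thesis unfolding a(4) eq_act_imag[OF a(1) \<pi>(1) a(2)] 0 by simp
  qed
  then show ?thesis using \<pi>(1) by blast
qed

lemma eq_fn_closed:
  assumes "fn (astruct Q) h ys = Some v" "h \<in> funs (alang Q)" "ys \<in> tuples (elems Q) (farity (alang Q) h)"
  shows "v \<in> elems Q"
proof -
  have "set ys \<subseteq> home N ` elems N"
    using assms(1) fn_nohome(1)[of ys h] by (metis option.distinct(1))
  then obtain us where us: "set us \<subseteq> elems N" "ys = map (home N) us" by (rule home_list)
  show ?thesis
  proof (cases h)
    case (Inl h')
    have h': "h' \<in> funs (alang N)" "us \<in> tuples (elems N) (farity (alang N) h')"
      using assms(2,3) us unfolding Inl lang_Q tuples_def by auto
    obtain w where w: "fn (astruct N) h' us = Some w" "v = home N w"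
      using assms(1) unfolding Inl us(2) fn_home(1)[OF us(1)] by auto
    show ?thesis using home_mem[OF fn_closed[OF h' w(1)]] w(2) unfolding elems_Q by simp
  next
    case (Inr E)
    then have E: "E \<in> \<E>" using assms(2) unfolding lang_Q by auto
    have "us \<in> Field E" "v = imag E us"
      using assms(1) unfolding Inr us(2) fn_home(2)[OF us(1) E] by (auto split: if_splits)
    then show ?thesis unfolding elems_Q imags_of_def using E us(1) by blast
  qed
qed

text \<open>Finitely many imaginaries are represented within one finite list, and moving this list
  into a countable set moves the imaginaries along with it.\<close>

lemma eq_orbits: "\<exists>C. countable C \<and> (\<forall>us. set us \<subseteq> elems Q \<longrightarrow> (\<exists>\<pi>\<in>G. set (map (eq_act \<pi>) us) \<subseteq> C))"
proof -
  obtain C where C: "countable C" "\<forall>us. set us \<subseteq> elems N \<longrightarrow> (\<exists>\<pi>\<in>G. set (map (act \<pi>) us) \<subseteq> C)"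
    using orbits by blast
  let ?C = "(\<lambda>(E, s). imag E s) ` (\<E> \<times> lists C)"
  have "countable ?C" using C(1) sys unfolding imag_system_def by simp
  moreover have "\<exists>\<pi>\<in>G. set (map (eq_act \<pi>) us) \<subseteq> ?C" if us: "set us \<subseteq> elems Q" for us
  proof -
    have "\<exists>l. set l \<subseteq> elems N \<and> set us \<subseteq> imags_of \<E> (set l)"
      using us
    proof (induction us)
      case (Cons u us)
      then obtain l where l: "set l \<subseteq> elems N" "set us \<subseteq> imags_of \<E> (set l)" by auto
      have "u \<in> imags_of \<E> (elems N)" using Cons.prems unfolding elems_Q by simp
      then obtain E a where a: "E \<in> \<E>" "a \<in> Field E" "set a \<subseteq> elems N" "u = imag E a" by (rule imagsE)
      have "u \<in> imags_of \<E> (set a)" unfolding imags_of_def using a by blast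
      then have "set (u # us) \<subseteq> imags_of \<E> (set (a @ l))"
        using l(2) imags_mono[of "set a" "set (a @ l)"] imags_mono[of "set l" "set (a @ l)"] by auto
      then show ?case using a(3) l(1) by (intro exI[of _ "a @ l"]) simp
    qed (auto intro: exI[of _ "[]"])
    then obtain l where l: "set l \<subseteq> elems N" "set us \<subseteq> imags_of \<E> (set l)" by blast
    obtain \<pi> where \<pi>: "\<pi> \<in> G" "set (map (act \<pi>) l) \<subseteq> C" using C(2) l(1) by blast
    have "eq_act \<pi> u \<in> ?C" if u: "u \<in> set us" for u
    proof -
      obtain E a where a: "E \<in> \<E>" "a \<in> Field E" "set a \<subseteq> set l" "u = imag E a"
        by (rule imagsE[OF subsetD[OF l(2) u]])
      have "map (act \<pi>) a \<in> lists C" using a(3) \<pi>(2) by (auto simp: lists_eq_set)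
      then show ?thesis unfolding a(4) eq_act_imag[OF a(1) \<pi>(1) a(2)] using a(1) by auto
    qed
    then have "set (map (eq_act \<pi>) us) \<subseteq> ?C" unfolding set_map by (rule image_subsetI)
    then show ?thesis using \<pi>(1) by (rule bexI)
  qed
  ultimately show ?thesis by blast
qed

lemma eq_rep:
  assumes "u \<in> elems Q"
  shows "\<exists>a. set a \<subseteq> D \<and> (\<forall>\<pi>\<in>G. \<forall>A\<in>Mods. \<pi> ` set a \<subseteq> A \<longrightarrow> eq_act \<pi> u \<in> imags_of \<E> (mdl A))"
proof -
  obtain E s where s: "E \<in> \<E>" "s \<in> Field E" "set s \<subseteq> elems N" "u = imag E s"
    using assms unfolding elems_Q by (rule imagsE)
  have "\<exists>a. set a \<subseteq> D \<and> (\<forall>\<pi>\<in>G. \<forall>A\<in>Mods. \<pi> ` set a \<subseteq> A \<longrightarrow> set (map (act \<pi>) s) \<subseteq> mdl A)"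
    using s(3)
  proof (induction s)
    case Nil
    show ?case by (rule exI[of _ "[]"]) simp
  next
    case (Cons v s)
    then obtain a where a: "set a \<subseteq> D" "\<forall>\<pi>\<in>G. \<forall>A\<in>Mods. \<pi> ` set a \<subseteq> A \<longrightarrow> set (map (act \<pi>) s) \<subseteq> mdl A" by auto
    obtain b where b: "set b \<subseteq> D" "\<forall>\<pi>\<in>G. \<forall>A\<in>Mods. \<pi> ` set b \<subseteq> A \<longrightarrow> act \<pi> v \<in> mdl A"
      using rep[of v] Cons.prems by auto
    show ?case
    proof (intro exI[of _ "a @ b"] conjI ballI impI)
      fix \<pi> A assume *: "\<pi> \<in> G" "A \<in> Mods" "\<pi> ` set (a @ b) \<subseteq> A"
      then show "set (map (act \<pi>) (v # s)) \<subseteq> mdl A" using a(2) b(2) by (auto simp: image_Un)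
    qed (use a(1) b(1) in simp)
  qed
  then obtain a where a: "set a \<subseteq> D" "\<forall>\<pi>\<in>G. \<forall>A\<in>Mods. \<pi> ` set a \<subseteq> A \<longrightarrow> set (map (act \<pi>) s) \<subseteq> mdl A" by blast
  have "eq_act \<pi> u \<in> imags_of \<E> (mdl A)" if \<pi>: "\<pi> \<in> G" "A \<in> Mods" "\<pi> ` set a \<subseteq> A" for \<pi> A
    unfolding s(4) eq_act_imag[OF s(1) \<pi>(1) s(2)] imags_of_def
    using s(1) Field_act[OF s(1) \<pi>(1) s(2)] a(2) \<pi> by blast
  then show ?thesis using a(1) by blast
qed

lemma eq_mdl_supp:
  assumes "A \<in> Mods" "u \<in> imags_of \<E> (mdl A)"
  shows "\<exists>b. set b \<subseteq> A \<and> (\<forall>\<pi>\<in>stab (set b). eq_act \<pi> u = u)"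
proof -
  obtain E s where s: "E \<in> \<E>" "s \<in> Field E" "set s \<subseteq> mdl A" "u = imag E s" using assms(2) by (rule imagsE)
  obtain b where b: "set b \<subseteq> A" "supp b s" using mdl_supp_list[OF assms(1) s(3)] by blast
  have "eq_act \<pi> u = u" if "\<pi> \<in> stab (set b)" for \<pi>
    unfolding s(4) eq_act_imag[OF s(1) stab_G[OF that] s(2)] using b(2) that unfolding supp_def by simp
  then show ?thesis using b(1) by blast
qed

text \<open>The expansion meets the same interface, so the second stage of imaginaries is a second
  instance of the same locale.\<close>

lemma eq_interp_fn: "interp_fn D cl G Mods Q eq_act (\<lambda>a. home N (hm a)) (\<lambda>A. imags_of \<E> (mdl A))"
proof unfold_locales
  show "models Q = (\<lambda>A. imags_of \<E> (mdl A)) ` Mods" unfolding models_Q models_mdl by auto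
  show "inj_on (\<lambda>a. home N (hm a)) D"
    using inj_onD[OF home_inj] inj_onD[OF hm_inj] hm_mem by (intro inj_onI) blast
  show "a \<in> D \<Longrightarrow> home N (hm a) \<in> elems Q" for a unfolding elems_Q by (intro home_mem hm_mem)
  show "\<pi> \<in> G \<Longrightarrow> a \<in> D \<Longrightarrow> eq_act \<pi> (home N (hm a)) = home N (hm (\<pi> a))" for \<pi> a
    using eq_act_home hm_mem act_hm by simp
  show "A \<in> Mods \<Longrightarrow> imags_of \<E> (mdl A) \<subseteq> elems Q" for A unfolding elems_Q by (intro imags_mono mdl_elems)
  show "A \<subseteq> A' \<Longrightarrow> imags_of \<E> (mdl A) \<subseteq> imags_of \<E> (mdl A')" for A A' by (intro imags_mono mdl_mono)
  show "A \<in> Mods \<Longrightarrow> a \<in> D \<Longrightarrow> home N (hm a) \<in> imags_of \<E> (mdl A) \<longleftrightarrow> a \<in> A" for A a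
    using home_mem_imags[OF hm_mem mdl_elems] hm_mdl by simp
  show "A \<in> Mods \<Longrightarrow> A \<subseteq> D \<and> cl A = A \<and> inf_dim A" for A by (rule Mods_closed)
  show "countable A \<Longrightarrow> A \<subseteq> D \<Longrightarrow> cl A = A \<Longrightarrow> inf_dim A \<Longrightarrow> A \<in> Mods" for A by (rule Mods_countable)
qed (rule eq_orbits | (rule eq_act_Aut Aut_eq_act eq_act_comp eq_act_cong eq_act_mem eq_mdl_supp eq_rep eq_fn_closed; assumption))+

end

section \<open>The group\<close>

locale net_interp = net D cl G A x0 y0 z0 + N: interp_fn D cl G Mods N "\<lambda>\<pi>. \<pi>" "\<lambda>x. x" "\<lambda>X. X"
  for D :: "'a set" and cl G A x0 y0 z0 Mods and N :: "('a, 'g, 's) ambient" +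
  assumes elems_N: "elems N = D"
begin

definition Al where "Al = (SOME l. set l = A)"

lemma set_Al: "set Al = A"
  unfolding Al_def using finite_list[OF AD(2)] by (rule someI_ex)

abbreviation Tup where "Tup \<equiv> tuples D (length Al + 2 * length y0)"

text \<open>The parameters \<open>A\<close> are a part of the tuples, so that the relation is invariant under all
  automorphisms.\<close>

definition germ_rel :: "('a list \<times> 'a list) set" where
  "germ_rel = {(s, t). s \<in> Tup \<and> t \<in> Tup \<and>
    (s = t \<or> (\<exists>\<pi>\<in>G. \<exists>y y' m m'. geq y y' m m' \<and> s = map \<pi> (Al @ y @ y') \<and> t = map \<pi> (Al @ m @ m')))}"

lemma tuple_mem: "y \<in> Y \<Longrightarrow> y' \<in> Y \<Longrightarrow> Al @ y @ y' \<in> Tup"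
  unfolding tuples_def using Y_set set_Al AD(1) by auto

lemma germ_rel_sub: "(s, t) \<in> germ_rel \<Longrightarrow> s \<in> Tup \<and> t \<in> Tup"
  unfolding germ_rel_def by blast

lemma germ_relE:
  assumes "(s, t) \<in> germ_rel" "s \<noteq> t"
  obtains \<pi> y y' m m' where "\<pi> \<in> G" "geq y y' m m'" "s = map \<pi> (Al @ y @ y')" "t = map \<pi> (Al @ m @ m')"
  using assms unfolding germ_rel_def by blast

lemma germ_relI:
  assumes "\<pi> \<in> G" "geq y y' m m'" "s = map \<pi> (Al @ y @ y')" "t = map \<pi> (Al @ m @ m')"
  shows "(s, t) \<in> germ_rel"
proof -
  have Y: "y \<in> Y" "y' \<in> Y" "m \<in> Y" "m' \<in> Y" using geq_Y[OF assms(2)] by simp_all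
  have "map \<pi> u \<in> tuples D n" if "u \<in> tuples D n" for u n
    using that G_image[OF assms(1)] unfolding tuples_def by auto
  from this[OF tuple_mem[OF Y(1,2)]] this[OF tuple_mem[OF Y(3,4)]]
  have "s \<in> Tup" "t \<in> Tup"
    unfolding assms(3,4) .
  then show ?thesis unfolding germ_rel_def using assms by blast
qed

lemma germ_rel_move:
  assumes "\<pi> \<in> G" "\<tau> \<in> G" "map \<pi> (Al @ y @ y') = map \<tau> (Al @ m @ m')" "y \<in> Y" "y' \<in> Y" "m \<in> Y" "m' \<in> Y"
  obtains \<rho> where "\<rho> \<in> stab A" "map \<rho> m = y" "map \<rho> m' = y'" "\<forall>x\<in>D. \<pi> (\<rho> x) = \<tau> x"
proof -
  obtain \<pi>' where \<pi>': "\<pi>' \<in> G" "\<forall>x\<in>D. \<pi>' (\<pi> x) = x \<and> \<pi> (\<pi>' x) = x"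
    using stab_inv[of \<pi> "{}"] assms(1) unfolding stab_empty by auto
  have len: "length y = length m" "length y' = length m'" using Y_set(3) assms(4-7) by simp_all
  let ?\<rho> = "\<lambda>x. \<pi>' (\<tau> x)"
  have e: "map \<tau> Al = map \<pi> Al" "map \<tau> m = map \<pi> y" "map \<tau> m' = map \<pi> y'" using assms(3) len by auto
  have inv: "map ?\<rho> u = v" if "map \<tau> u = map \<pi> v" "set v \<subseteq> D" for u v
  proof -
    have "map ?\<rho> u = map \<pi>' (map \<tau> u)" by simp
    also have "\<dots> = map \<pi>' (map \<pi> v)" unfolding that(1) ..
    also have "\<dots> = v" using \<pi>'(2) that(2) by (auto intro!: map_idI)
    finally show ?thesis .
  qed
  have "map ?\<rho> Al = Al" by (rule inv[OF e(1)]) (use set_Al AD(1) in simp)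
  then have "\<forall>a\<in>A. ?\<rho> a = a" using map_fix[of ?\<rho> Al] set_Al by simp
  then have "?\<rho> \<in> stab A" using G_comp[OF \<pi>'(1) assms(2)] unfolding stab_def by simp
  moreover have "\<forall>x\<in>D. \<pi> (?\<rho> x) = \<tau> x" using \<pi>'(2) G_mem[OF assms(2)] by simp
  ultimately show ?thesis using that inv[OF e(2)] inv[OF e(3)] Y_set(1) assms(4,5) by blast
qed

text \<open>In transitivity the middle tuple is presented in two ways, which differ by an
  automorphism fixing \<open>A\<close>; \<open>geq\<close> is invariant under it. A tuple that
  presents no germ is related only to itself.\<close>

lemma germ_rel_equiv: "equiv Tup germ_rel"
proof (rule equivI)
  show "germ_rel \<subseteq> Tup \<times> Tup"
    using germ_rel_sub by auto
  show "refl_on Tup germ_rel"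
    unfolding germ_rel_def by (intro refl_onI) auto
  show "sym germ_rel"
  proof (rule symI)
    fix s t assume st: "(s, t) \<in> germ_rel"
    show "(t, s) \<in> germ_rel"
    proof (cases "s = t")
      case False
      from st False show ?thesis by (rule germ_relE) (rule germ_relI[OF _ geq_sym])
    qed (use st in simp)
  qed
  show "trans germ_rel"
  proof (rule transI)
    fix s t u assume st: "(s, t) \<in> germ_rel" and tu: "(t, u) \<in> germ_rel"
    show "(s, u) \<in> germ_rel"
    proof (cases "s = t \<or> t = u")
      case False
      then have ne: "s \<noteq> t" "t \<noteq> u" by simp_all
      obtain \<pi> y y' m m' where 1: "\<pi> \<in> G" "geq y y' m m'" "s = map \<pi> (Al @ y @ y')" "t = map \<pi> (Al @ m @ m')"
        using st ne(1) by (rule germ_relE)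
      obtain \<tau> k k' n n' where 2: "\<tau> \<in> G" "geq k k' n n'" "t = map \<tau> (Al @ k @ k')" "u = map \<tau> (Al @ n @ n')"
        using tu ne(2) by (rule germ_relE)
      have Y: "m \<in> Y" "m' \<in> Y" "k \<in> Y" "k' \<in> Y" "n \<in> Y" "n' \<in> Y" using geq_Y[OF 1(2)] geq_Y[OF 2(2)] by simp_all
      obtain \<rho> where \<rho>: "\<rho> \<in> stab A" "map \<rho> k = m" "map \<rho> k' = m'" "\<forall>x\<in>D. \<pi> (\<rho> x) = \<tau> x"
        by (rule germ_rel_move[OF 1(1) 2(1) 1(4)[unfolded 2(3), symmetric] Y(1-4)])
      have g: "geq m m' (map \<rho> n) (map \<rho> n')" using geq_stab1[OF 2(2) \<rho>(1)] unfolding \<rho>(2,3) .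
      have "map \<rho> Al = Al" using stab_fix[OF \<rho>(1)] set_Al by (intro map_idI) simp
      moreover have "map \<tau> v = map \<pi> (map \<rho> v)" if "set v \<subseteq> D" for v using \<rho>(4) that by auto
      ultimately have "u = map \<pi> (Al @ map \<rho> n @ map \<rho> n')"
        unfolding 2(4) using Y_set(1)[OF Y(5)] Y_set(1)[OF Y(6)] set_Al AD(1) by (metis map_append)
      then show ?thesis by (rule germ_relI[OF 1(1) geq_trans[OF 1(2) g] 1(3)])
    qed (use st tu in auto)
  qed
qed

lemma germ_rel_invariant:
  assumes "\<tau> \<in> G" "(s, t) \<in> germ_rel"
  shows "(map \<tau> s, map \<tau> t) \<in> germ_rel"
proof (cases "s = t")
  case True
  have "map \<tau> s \<in> Tup"
    using germ_rel_sub[OF assms(2)] G_image[OF assms(1)] unfolding tuples_def by auto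
  then show ?thesis unfolding germ_rel_def True by simp
next
  case False
  obtain \<pi> y y' m m' where 1: "\<pi> \<in> G" "geq y y' m m'" "s = map \<pi> (Al @ y @ y')" "t = map \<pi> (Al @ m @ m')"
    using assms(2) False by (rule germ_relE)
  show ?thesis by (rule germ_relI[OF G_comp[OF assms(1) 1(1)] 1(2)]) (simp_all add: 1(3,4))
qed

text \<open>On tuples beginning with \<open>Al\<close> itself, the automorphism occurring in the
  relation fixes \<open>A\<close> and can be absorbed by \<open>geq_stab1\<close>.\<close>

lemma germ_rel_iff:
  assumes "y \<in> Y" "y' \<in> Y" "m \<in> Y" "m' \<in> Y"
  shows "(Al @ y @ y', Al @ m @ m') \<in> germ_rel \<longleftrightarrow> geq y y' m m'"
proof
  assume *: "(Al @ y @ y', Al @ m @ m') \<in> germ_rel"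
  show "geq y y' m m'"
  proof (cases "Al @ y @ y' = Al @ m @ m'")
    case True
    then have "y = m" "y' = m'" using Y_set(3) assms by auto
    then show ?thesis using geq_refl assms by simp
  next
    case False
    obtain \<pi> k k' n n' where 1: "\<pi> \<in> G" "geq k k' n n'" "Al @ y @ y' = map \<pi> (Al @ k @ k')"
      "Al @ m @ m' = map \<pi> (Al @ n @ n')" using * False by (rule germ_relE)
    have Y: "k \<in> Y" "k' \<in> Y" "n \<in> Y" "n' \<in> Y" using geq_Y[OF 1(2)] by simp_all
    have e: "map \<pi> Al = Al" "map \<pi> k = y" "map \<pi> k' = y'" "map \<pi> n = m" "map \<pi> n' = m'"
      using 1(3,4) Y_set(3) Y assms by auto
    have "\<forall>a\<in>A. \<pi> a = a" using map_fix[OF e(1)] set_Al by simp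
    then have "\<pi> \<in> stab A" using 1(1) unfolding stab_def by simp
    from geq_stab1[OF 1(2) this] show ?thesis unfolding e .
  qed
next
  assume "geq y y' m m'"
  then show "(Al @ y @ y', Al @ m @ m') \<in> germ_rel" by (rule germ_relI[OF G_id]) simp_all
qed

section \<open>Germs as elements of the second expansion\<close>

definition E1 where "E1 = {equality_rel N, germ_rel}"

lemma imag_system1: "imag_system N E1"
proof (rule N.imag_systemI)
  show "\<exists>n\<ge>1. equiv (tuples (elems N) n) E \<and> (\<forall>\<pi>\<in>G. \<forall>(a, b)\<in>E. (map \<pi> a, map \<pi> b) \<in> E)" if "E \<in> E1" for E
  proof (cases "E = germ_rel")
    case True
    have "length y0 \<ge> 1" using statl_D(2)[OF lineD(4)[OF line]] by (cases y0) simp_all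
    then show ?thesis unfolding True elems_N using germ_rel_equiv germ_rel_invariant
      by (intro exI[of _ "length Al + 2 * length y0"]) auto
  next
    case False
    then have "E = equality_rel N" using that unfolding E1_def by simp
    then show ?thesis using N.equality_rel_invariant by (intro exI[of _ 1]) auto
  qed
qed (simp_all add: E1_def)

abbreviation N1 where "N1 \<equiv> eq_ambient N E1"

sublocale Q1: eq_interp D cl G Mods N "\<lambda>\<pi>. \<pi>" "\<lambda>x. x" "\<lambda>X. X" E1
  by (unfold_locales) (rule imag_system1)

sublocale F1: interp_fn D cl G Mods N1 Q1.eq_act "\<lambda>a. home N a" "\<lambda>X. imags_of E1 X"
  by (rule Q1.eq_interp_fn)

text \<open>Germs are already imaginaries over the monster, so the second collection consists of
  equality alone and the group lies on the home copy of the first expansion.\<close>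

abbreviation E2 where "E2 \<equiv> {equality_rel N1}"

lemma imag_system2: "imag_system N1 E2"
  by (rule F1.imag_systemI) (use F1.equality_rel_invariant in \<open>auto intro: exI[of _ 1]\<close>)

abbreviation N2 where "N2 \<equiv> eq_ambient N1 E2"

sublocale Q2: eq_interp D cl G Mods N1 Q1.eq_act "\<lambda>a. home N a" "\<lambda>X. imags_of E1 X" E2
  by (unfold_locales) (rule imag_system2)

sublocale F2: interp_fn D cl G Mods N2 Q2.eq_act "\<lambda>a. home N1 (home N a)" "\<lambda>X. imags_of E2 (imags_of E1 X)"
  by (rule Q2.eq_interp_fn)

abbreviation mdl2 where "mdl2 W \<equiv> imags_of E2 (imags_of E1 W)"

definition germ where "germ y y' = home N1 (imag germ_rel (Al @ y @ y'))"

lemma germ_rel_mem: "germ_rel \<in> E1"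
  unfolding E1_def by simp

lemma germ_Field: "y \<in> Y \<Longrightarrow> y' \<in> Y \<Longrightarrow> Al @ y @ y' \<in> Field germ_rel"
  using germ_rel_iff[of y y' y y'] geq_refl by (auto intro: FieldI1)

lemma imag_mem: "y \<in> Y \<Longrightarrow> y' \<in> Y \<Longrightarrow> imag germ_rel (Al @ y @ y') \<in> elems N1"
  unfolding Q1.elems_Q imags_of_def elems_N using germ_rel_mem germ_Field tuple_mem[of y y']
  unfolding tuples_def by blast

lemma germ_mem: "y \<in> Y \<Longrightarrow> y' \<in> Y \<Longrightarrow> germ y y' \<in> elems N2"
  unfolding germ_def Q2.elems_Q by (rule Q2.home_mem[OF imag_mem])

lemma germ_eq_iff:
  assumes "y \<in> Y" "y' \<in> Y" "m \<in> Y" "m' \<in> Y"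
  shows "germ y y' = germ m m' \<longleftrightarrow> geq y y' m m'"
proof -
  have "germ y y' = germ m m' \<longleftrightarrow> imag germ_rel (Al @ y @ y') = imag germ_rel (Al @ m @ m')"
    unfolding germ_def by (rule inj_on_eq_iff[OF Q2.home_inj imag_mem[OF assms(1,2)] imag_mem[OF assms(3,4)]])
  also have "\<dots> \<longleftrightarrow> (Al @ y @ y', Al @ m @ m') \<in> germ_rel"
    by (rule Q1.imag_eq_iff[OF germ_rel_mem germ_Field[OF assms(1,2)] germ_Field[OF assms(3,4)]])
  finally show ?thesis unfolding germ_rel_iff[OF assms] .
qed

lemma germ_act:
  assumes "\<pi> \<in> stab A" "y \<in> Y" "y' \<in> Y"
  shows "Q2.eq_act \<pi> (germ y y') = germ (map \<pi> y) (map \<pi> y')"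
proof -
  have "map \<pi> Al = Al" using stab_fix[OF assms(1)] set_Al by (intro map_idI) simp
  then show ?thesis
    unfolding germ_def Q2.eq_act_home[OF stab_G[OF assms(1)] imag_mem[OF assms(2,3)]]
      Q1.eq_act_imag[OF germ_rel_mem stab_G[OF assms(1)] germ_Field[OF assms(2,3)]] by simp
qed

text \<open>Belonging to a model means having a representative there. The automorphism presenting
  this representative fixes \<open>A\<close>, so the representative yields an equal germ formed from
  conjugates of \<open>y0\<close>.\<close>

lemma germ_mdl:
  assumes "y \<in> Y" "y' \<in> Y" "W \<subseteq> D" "A \<subseteq> W"
  shows "germ y y' \<in> mdl2 W \<longleftrightarrow> (\<exists>m m'. geq y y' m m' \<and> set m \<subseteq> W \<and> set m' \<subseteq> W)"
proof -
  have "imags_of E1 W \<subseteq> elems N1" unfolding Q1.elems_Q elems_N by (rule Q1.imags_mono[OF assms(3)])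
  then have 1: "germ y y' \<in> mdl2 W \<longleftrightarrow> imag germ_rel (Al @ y @ y') \<in> imags_of E1 W"
    unfolding germ_def by (rule Q2.home_mem_imags[OF imag_mem[OF assms(1,2)]])
  show ?thesis unfolding 1
  proof
    assume "imag germ_rel (Al @ y @ y') \<in> imags_of E1 W"
    then obtain E t where t: "E \<in> E1" "t \<in> Field E" "set t \<subseteq> W" "imag germ_rel (Al @ y @ y') = imag E t"
      by (rule Q1.imagsE)
    have E: "E = germ_rel" using t(4) unfolding imag_def by simp
    have st: "(Al @ y @ y', t) \<in> germ_rel"
      by (rule iffD1[OF Q1.imag_eq_iff[OF germ_rel_mem germ_Field[OF assms(1,2)] t(2)[unfolded E]] t(4)[unfolded E]])
    show "\<exists>m m'. geq y y' m m' \<and> set m \<subseteq> W \<and> set m' \<subseteq> W"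
    proof (cases "Al @ y @ y' = t")
      case True
      then show ?thesis using geq_refl[OF assms(1,2)] t(3) by (intro exI[of _ y] exI[of _ y']) auto
    next
      case False
      obtain \<pi> k k' n n' where 2: "\<pi> \<in> G" "geq k k' n n'" "Al @ y @ y' = map \<pi> (Al @ k @ k')"
        "t = map \<pi> (Al @ n @ n')" using st False by (rule germ_relE)
      have Y: "k \<in> Y" "k' \<in> Y" "n \<in> Y" "n' \<in> Y" using geq_Y[OF 2(2)] by simp_all
      have e: "map \<pi> Al = Al" "map \<pi> k = y" "map \<pi> k' = y'" using 2(3) Y_set(3) Y assms(1,2) by auto
      have "\<forall>a\<in>A. \<pi> a = a" using map_fix[OF e(1)] set_Al by simp
      then have "\<pi> \<in> stab A" using 2(1) unfolding stab_def by simp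
      from geq_stab1[OF 2(2) this] have "geq y y' (map \<pi> n) (map \<pi> n')" unfolding e .
      then show ?thesis using t(3) unfolding 2(4) by (intro exI[of _ "map \<pi> n"] exI[of _ "map \<pi> n'"]) simp
    qed
  next
    assume "\<exists>m m'. geq y y' m m' \<and> set m \<subseteq> W \<and> set m' \<subseteq> W"
    then obtain m m' where m: "geq y y' m m'" "set m \<subseteq> W" "set m' \<subseteq> W" by blast
    have Y: "m \<in> Y" "m' \<in> Y" using geq_Y[OF m(1)] by simp_all
    have "imag germ_rel (Al @ y @ y') = imag germ_rel (Al @ m @ m')"
      using Q1.imag_eq_iff[OF germ_rel_mem germ_Field[OF assms(1,2)] germ_Field[OF Y]] germ_rel_iff[OF assms(1,2) Y] m(1)
      by simp
    then show "imag germ_rel (Al @ y @ y') \<in> imags_of E1 W"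
      unfolding imags_of_def using germ_rel_mem germ_Field[OF Y] m(2,3) set_Al assms(4)
      by (intro CollectI exI[of _ germ_rel] exI[of _ "Al @ m @ m'"]) simp
  qed
qed

text \<open>The product is (e, k) followed by (k, f). Its value is unique by
  \<open>geq_comp\<close>, and presentations with a common \<open>k\<close> exist because
  \<open>k\<close> may be any generic element.\<close>

definition Gr :: "('a imag imag) monoid" where
  "Gr = \<lparr>carrier = {germ y y' | y y'. y \<in> Y \<and> y' \<in> Y},
    mult = \<lambda>u v. THE w. \<exists>k e f. k \<in> Y \<and> e \<in> Y \<and> f \<in> Y \<and> u = germ k f \<and> v = germ e k \<and> w = germ e f,
    one = germ y0 y0\<rparr>"

lemma carrier_Gr: "u \<in> carrier Gr \<longleftrightarrow> (\<exists>y y'. y \<in> Y \<and> y' \<in> Y \<and> u = germ y y')"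
  unfolding Gr_def by auto

lemma carrierE:
  assumes "u \<in> carrier Gr"
  obtains y y' where "y \<in> Y" "y' \<in> Y" "u = germ y y'"
  using assms unfolding carrier_Gr by blast

lemma Gr_mult:
  assumes "k \<in> Y" "e \<in> Y" "f \<in> Y"
  shows "germ k f \<otimes>\<^bsub>Gr\<^esub> germ e k = germ e f"
proof -
  have "(THE w. \<exists>k' e' f'. k' \<in> Y \<and> e' \<in> Y \<and> f' \<in> Y \<and> germ k f = germ k' f' \<and> germ e k = germ e' k' \<and> w = germ e' f') = germ e f"
  proof (rule the_equality)
    show "\<exists>k' e' f'. k' \<in> Y \<and> e' \<in> Y \<and> f' \<in> Y \<and> germ k f = germ k' f' \<and> germ e k = germ e' k' \<and> germ e f = germ e' f'"
      using assms by blast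
    show "w = germ e f"
      if w: "\<exists>k' e' f'. k' \<in> Y \<and> e' \<in> Y \<and> f' \<in> Y \<and> germ k f = germ k' f' \<and> germ e k = germ e' k' \<and> w = germ e' f'" for w
    proof -
      obtain k' e' f' where *: "k' \<in> Y" "e' \<in> Y" "f' \<in> Y" "germ k f = germ k' f'" "germ e k = germ e' k'" "w = germ e' f'"
        using w by (elim exE conjE)
      have "geq k f k' f'" "geq e k e' k'"
        using *(4,5) germ_eq_iff[OF assms(1,3) *(1,3)] germ_eq_iff[OF assms(2,1) *(2,1)] by simp_all
      from geq_comp[OF this(2,1)] show ?thesis
        unfolding *(6) germ_eq_iff[OF *(2,3) assms(2,3)] by (rule geq_sym)
    qed
  qed
  then show ?thesis unfolding Gr_def by simp
qed

lemma germ_right: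
  assumes "y \<in> Y" "y' \<in> Y" "k \<in> Y" "hd k \<notin> K {hd y, hd y'}"
  obtains f where "f \<in> Y" "germ y y' = germ k f"
proof -
  obtain f where f: "geq y y' k f" using geq_represent'[OF assms] by blast
  have "f \<in> Y" using geq_Y[OF f] by simp
  then show ?thesis using that f germ_eq_iff[OF assms(1,2,3)] by blast
qed

lemma germ_left:
  assumes "y \<in> Y" "y' \<in> Y" "k \<in> Y" "hd k \<notin> K {hd y, hd y'}"
  obtains e where "e \<in> Y" "germ y y' = germ e k"
proof -
  obtain e where e: "geq y y' e k" using geq_represent[OF assms] by blast
  have "e \<in> Y" using geq_Y[OF e] by simp
  then show ?thesis using that e germ_eq_iff[OF assms(1,2) _ assms(3)] by blast
qed

lemma y0_Y: "y0 \<in> Y"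
  unfolding Y_def using conjg_refl by simp

lemma Gr_group: "group Gr"
proof (rule groupI)
  show "\<one>\<^bsub>Gr\<^esub> \<in> carrier Gr" unfolding Gr_def using y0_Y by auto
next
  fix u v assume u: "u \<in> carrier Gr" and v: "v \<in> carrier Gr"
  obtain y y' where y: "y \<in> Y" "y' \<in> Y" "u = germ y y'" using u by (rule carrierE)
  obtain m m' where m: "m \<in> Y" "m' \<in> Y" "v = germ m m'" using v by (rule carrierE)
  have C: "{hd y, hd y', hd m, hd m'} \<subseteq> D" using XY_D(2) y m by simp
  obtain k where k: "k \<in> Y" "hd k \<notin> K {hd y, hd y', hd m, hd m'}" using ex_Y_generic[OF _ C] by auto
  obtain f where f: "f \<in> Y" "u = germ k f"
    using germ_right[OF y(1,2) k(1) notK_mono[OF k(2) C]] y(3) by auto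
  obtain e where e: "e \<in> Y" "v = germ e k"
    using germ_left[OF m(1,2) k(1) notK_mono[OF k(2) C]] m(3) by auto
  show "u \<otimes>\<^bsub>Gr\<^esub> v \<in> carrier Gr" unfolding f e Gr_mult[OF k(1) e(1) f(1)] carrier_Gr using e(1) f(1) by blast
next
  fix u v w assume u: "u \<in> carrier Gr" and v: "v \<in> carrier Gr" and w: "w \<in> carrier Gr"
  obtain y y' where y: "y \<in> Y" "y' \<in> Y" "u = germ y y'" using u by (rule carrierE)
  obtain m m' where m: "m \<in> Y" "m' \<in> Y" "v = germ m m'" using v by (rule carrierE)
  obtain n n' where n: "n \<in> Y" "n' \<in> Y" "w = germ n n'" using w by (rule carrierE)
  let ?C = "{hd y, hd y', hd m, hd m', hd n, hd n'}"
  have C: "?C \<subseteq> D" using XY_D(2) y m n by simp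
  obtain e where e: "e \<in> Y" "hd e \<notin> K ?C" using ex_Y_generic[OF _ C] by auto
  obtain d where d: "d \<in> Y" "w = germ d e"
    using germ_left[OF n(1,2) e(1) notK_mono[OF e(2) C]] n(3) by auto
  obtain k where k: "k \<in> Y" "germ m m' = germ e k"
    using germ_right[OF m(1,2) e(1) notK_mono[OF e(2) C]] by auto
  \<comment> \<open>\<open>e\<close> is generic over all six heads and is recovered from
    \<open>m\<close>, \<open>m'\<close> and \<open>k\<close>. Hence \<open>k\<close> is generic over
    \<open>y\<close> and \<open>y'\<close>, and the first factor can be written with
    \<open>k\<close> as its first coordinate.\<close>
  have "hd e \<in> K {hd m, hd m', hd k}" using geq_cl k(2) germ_eq_iff[OF m(1,2) e(1) k(1)] by simp
  then have "hd k \<notin> K {hd y, hd y'}"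
  proof (rule contrapos_pn)
    assume "hd k \<in> K {hd y, hd y'}"
    then have "hd k \<in> K ?C" by (rule K_mono[OF _ C, rotated]) simp
    moreover have "hd m \<in> K ?C" "hd m' \<in> K ?C" by (rule K_sub[OF C]; simp)+
    ultimately have "{hd m, hd m', hd k} \<subseteq> K ?C" by simp
    from K_min[OF this C] show "hd e \<notin> K {hd m, hd m', hd k}" using e(2) by blast
  qed
  from germ_right[OF y(1,2) k(1) this] obtain f where f: "f \<in> Y" "u = germ k f" using y(3) by auto
  show "u \<otimes>\<^bsub>Gr\<^esub> v \<otimes>\<^bsub>Gr\<^esub> w = u \<otimes>\<^bsub>Gr\<^esub> (v \<otimes>\<^bsub>Gr\<^esub> w)"
    unfolding f d m(3) k(2) using Gr_mult k(1) e(1) d(1) f(1) by simp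
next
  fix u assume u: "u \<in> carrier Gr"
  obtain y y' where y: "y \<in> Y" "y' \<in> Y" "u = germ y y'" using u by (rule carrierE)
  have one: "\<one>\<^bsub>Gr\<^esub> = germ m m" if "m \<in> Y" for m
    unfolding Gr_def using germ_eq_iff[OF y0_Y y0_Y that that] geq_id[OF y0_Y that] by simp
  show "\<one>\<^bsub>Gr\<^esub> \<otimes>\<^bsub>Gr\<^esub> u = u" unfolding y(3) one[OF y(2)] by (rule Gr_mult[OF y(2,1,2)])
  show "\<exists>v\<in>carrier Gr. v \<otimes>\<^bsub>Gr\<^esub> u = \<one>\<^bsub>Gr\<^esub>"
    unfolding y(3) one[OF y(1)] using Gr_mult[OF y(2,1,1)] y carrier_Gr by (intro bexI[of _ "germ y' y"]) auto
qed

section \<open>Definability and rank of the group\<close>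

abbreviation A2 where "A2 \<equiv> (\<lambda>a. home N1 (home N a)) ` A"

lemma A2_elems: "A2 \<subseteq> elems N2"
  using F2.hm_mem AD(1) by auto

lemma Aut_A2:
  assumes "\<theta> \<in> Aut N2 A2"
  obtains \<pi> where "\<pi> \<in> stab A" "\<And>u. u \<in> elems N2 \<Longrightarrow> \<theta> u = Q2.eq_act \<pi> u"
proof -
  have \<theta>: "\<theta> \<in> Aut N2 {}" "\<forall>a\<in>A2. \<theta> a = a" using assms unfolding Aut_def by auto
  obtain \<pi> where \<pi>: "\<pi> \<in> G" "\<forall>u\<in>elems N2. \<theta> u = Q2.eq_act \<pi> u" using F2.Aut_act[OF \<theta>(1)] by (elim bexE)
  have "\<pi> a = a" if a: "a \<in> A" for a
  proof -
    have aD: "a \<in> D" using a AD(1) by blast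
    have "home N1 (home N (\<pi> a)) = \<theta> (home N1 (home N a))"
      using F2.act_hm[OF \<pi>(1) aD] \<pi>(2) F2.hm_mem[OF aD] by simp
    also have "\<dots> = home N1 (home N a)" using \<theta>(2) a by simp
    finally show ?thesis using inj_onD[OF F2.hm_inj] G_mem[OF \<pi>(1) aD] aD by blast
  qed
  then have "\<pi> \<in> stab A" using \<pi>(1) unfolding stab_def by simp
  then show ?thesis by (rule that) (rule bspec[OF \<pi>(2)])
qed

text \<open>Inclusion under all automorphisms fixing \<open>A\<close> is enough; applied to the
  inverse it gives equality.\<close>

lemma galois_definableI:
  assumes W: "\<And>us. us \<in> W \<Longrightarrow> set us \<subseteq> elems N2"
    and inv: "\<And>\<pi> us. \<pi> \<in> stab A \<Longrightarrow> us \<in> W \<Longrightarrow> map (Q2.eq_act \<pi>) us \<in> W"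
  shows "galois_definable N2 A2 W"
  unfolding galois_definable_def
proof
  fix \<theta> assume "\<theta> \<in> Aut N2 A2"
  then obtain \<pi> where \<pi>: "\<pi> \<in> stab A" "\<And>u. u \<in> elems N2 \<Longrightarrow> \<theta> u = Q2.eq_act \<pi> u"
    by (rule Aut_A2) (rule that; assumption)
  obtain \<tau> where \<tau>: "\<tau> \<in> stab A" "\<forall>x\<in>D. \<tau> (\<pi> x) = x \<and> \<pi> (\<tau> x) = x" using stab_inv[OF \<pi>(1) AD(1)] by blast
  have \<theta>: "map \<theta> us = map (Q2.eq_act \<pi>) us" if "us \<in> W" for us using \<pi>(2) W[OF that] by auto
  show "map \<theta> ` W = W"
  proof
    show "map \<theta> ` W \<subseteq> W"
    proof (rule image_subsetI)
      fix us assume us: "us \<in> W"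
      show "map \<theta> us \<in> W" unfolding \<theta>[OF us] by (rule inv[OF \<pi>(1) us])
    qed
    show "W \<subseteq> map \<theta> ` W"
    proof
      fix us assume us: "us \<in> W"
      have vs: "map (Q2.eq_act \<tau>) us \<in> W" by (rule inv[OF \<tau>(1) us])
      have "Q2.eq_act \<pi> (Q2.eq_act \<tau> u) = u" if "u \<in> elems N2" for u
        using F2.act_comp[OF stab_G[OF \<pi>(1)] stab_G[OF \<tau>(1)] that]
          F2.act_cong[OF G_comp[OF stab_G[OF \<pi>(1)] stab_G[OF \<tau>(1)]] _ that] \<tau>(2) by simp
      then have "map (Q2.eq_act \<pi>) (map (Q2.eq_act \<tau>) us) = us"
        using W[OF us] by (auto intro!: map_idI)
      then have "us = map \<theta> (map (Q2.eq_act \<tau>) us)" unfolding \<theta>[OF vs] by simp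
      then show "us \<in> map \<theta> ` W" using vs by (rule image_eqI)
    qed
  qed
qed

lemma carrier_act: "\<pi> \<in> stab A \<Longrightarrow> u \<in> carrier Gr \<Longrightarrow> Q2.eq_act \<pi> u \<in> carrier Gr"
  by (elim carrierE) (auto simp: germ_act carrier_Gr intro: Y_stab)

lemma mult_act:
  assumes "\<pi> \<in> stab A" "u \<in> carrier Gr" "v \<in> carrier Gr"
  shows "Q2.eq_act \<pi> (u \<otimes>\<^bsub>Gr\<^esub> v) = Q2.eq_act \<pi> u \<otimes>\<^bsub>Gr\<^esub> Q2.eq_act \<pi> v"
proof -
  obtain y y' where y: "y \<in> Y" "y' \<in> Y" "u = germ y y'" using assms(2) by (rule carrierE)
  obtain m m' where m: "m \<in> Y" "m' \<in> Y" "v = germ m m'" using assms(3) by (rule carrierE)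
  have C: "{hd y, hd y', hd m, hd m'} \<subseteq> D" using XY_D(2) y m by simp
  obtain k where k: "k \<in> Y" "hd k \<notin> K {hd y, hd y', hd m, hd m'}" using ex_Y_generic[OF _ C] by auto
  obtain f where f: "f \<in> Y" "u = germ k f"
    using germ_right[OF y(1,2) k(1) notK_mono[OF k(2) C]] y(3) by auto
  obtain e where e: "e \<in> Y" "v = germ e k"
    using germ_left[OF m(1,2) k(1) notK_mono[OF k(2) C]] m(3) by auto
  show ?thesis
    unfolding f(2) e(2) Gr_mult[OF k(1) e(1) f(1)] germ_act[OF assms(1) e(1) f(1)] germ_act[OF assms(1) k(1) f(1)]
      germ_act[OF assms(1) e(1) k(1)]
    by (rule Gr_mult[symmetric]) (use Y_stab assms(1) k(1) e(1) f(1) in simp_all)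
qed

lemma Gr_elems: "carrier Gr \<subseteq> elems N2"
  by (rule subsetI, erule carrierE) (simp add: germ_mem)

lemma Gr_definable: "galois_definable_group N2 A2 Gr"
  unfolding galois_definable_group_def
proof (intro conjI Gr_group Gr_elems galois_definableI)
  interpret Gr: group Gr by (rule Gr_group)
  fix us
  show "us \<in> {[x] | x. x \<in> carrier Gr} \<Longrightarrow> set us \<subseteq> elems N2" using Gr_elems by auto
  show "us \<in> {[x, y, x \<otimes>\<^bsub>Gr\<^esub> y] | x y. x \<in> carrier Gr \<and> y \<in> carrier Gr} \<Longrightarrow> set us \<subseteq> elems N2"
    by (elim CollectE exE conjE) (simp add: subsetD[OF Gr_elems])
  fix \<pi> assume \<pi>: "\<pi> \<in> stab A"
  show "us \<in> {[x] | x. x \<in> carrier Gr} \<Longrightarrow> map (Q2.eq_act \<pi>) us \<in> {[x] | x. x \<in> carrier Gr}"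
    by (elim CollectE exE conjE) (simp add: carrier_act[OF \<pi>] del: split_paired_Ex)
  show "us \<in> {[x, y, x \<otimes>\<^bsub>Gr\<^esub> y] | x y. x \<in> carrier Gr \<and> y \<in> carrier Gr} \<Longrightarrow>
    map (Q2.eq_act \<pi>) us \<in> {[x, y, x \<otimes>\<^bsub>Gr\<^esub> y] | x y. x \<in> carrier Gr \<and> y \<in> carrier Gr}"
    by (elim CollectE exE conjE) (simp add: carrier_act[OF \<pi>] mult_act[OF \<pi>] del: split_paired_Ex)
qed

lemma Gr_rank_le:
  assumes "u \<in> carrier Gr"
  shows "U_fin N2 [u] A2 \<le> 1"
proof -
  obtain y y' where y: "y \<in> Y" "y' \<in> Y" "u = germ y y'" using assms by (rule carrierE)
  have "U_fin N2 [u] A2 \<le> enat 1"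
  proof (rule F2.U_fin_le)
    show "set [u] \<subseteq> elems N2" using germ_mem y by simp
    fix W assume W: "W \<in> Mods" and AX: "A2 \<subseteq> mdl2 W"
    have XD: "W \<subseteq> D" "cl W = W" "inf_dim W" using F2.Mods_closed[OF W] by simp_all
    have A: "A \<subseteq> W"
    proof
      fix a assume a: "a \<in> A"
      then have "home N1 (home N a) \<in> mdl2 W" using AX by blast
      then show "a \<in> W" using F2.hm_mdl[OF W, of a] a AD(1) by blast
    qed
    have C: "{hd y, hd y'} \<subseteq> D" using XY_D(2) y by simp
    \<comment> \<open>The model need not contain \<open>y\<close> or \<open>y'\<close>, so an
      element of it generic over them is found by counting dimensions. Once \<open>k\<close> lies
      over the model, only \<open>hd q\<close> contributes to the rank.\<close>
    obtain d where d: "d \<in> W" "d \<notin> K {hd y, hd y'}" using inf_dim_outside2[OF XD AD(2) A _ C] by auto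
    have dD: "d \<in> D" "d \<notin> cl A" using d XD(1) notK_mono[OF d(2) C, of "{}"] by auto
    obtain k where k: "k \<in> Y" "hd k = d" using ex_Y[OF dD] by blast
    obtain q where q: "q \<in> Y" "u = germ k q" using germ_right[OF y(1,2) k(1)] d(2) k(2) y(3) by auto
    have qD: "hd q \<in> D" by (rule XY_D(2)[OF q(1)])
    have Xq: "W \<union> {hd q} \<subseteq> D" using XD(1) qD by simp
    have "set k \<subseteq> K {d}" "set q \<subseteq> K {hd q}" using Y_cl[OF k(1)] Y_cl[OF q(1)] k(2) by simp_all
    moreover have "K {d} \<subseteq> cl (W \<union> {hd q})" "K {hd q} \<subseteq> cl (W \<union> {hd q})"
      by (rule cl_mono[OF _ Xq]; use A d(1) in auto)+
    moreover have "A \<subseteq> cl (W \<union> {hd q})" using A cl_sub[OF Xq] by auto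
    ultimately have "set (Al @ k @ q) \<subseteq> cl (W \<union> set [hd q])" using set_Al by auto
    moreover have "F2.supp (Al @ k @ q) [u]"
      unfolding F2.supp_def
    proof
      fix \<pi> assume \<pi>: "\<pi> \<in> stab (set (Al @ k @ q))"
      have \<pi>A: "\<pi> \<in> stab A" by (rule stab_mono[OF _ \<pi>]) (simp add: set_Al)
      have "map \<pi> k = k" "map \<pi> q = q" using stab_fix[OF \<pi>] by (auto intro!: map_idI)
      then show "map (Q2.eq_act \<pi>) [u] = [u]" unfolding q(2) using germ_act[OF \<pi>A k(1) q(1)] by simp
    qed
    ultimately show "\<exists>a ds. F2.supp a [u] \<and> set a \<subseteq> cl (W \<union> set ds) \<and> set ds \<subseteq> D \<and> length ds \<le> 1"
      using qD by (intro exI[of _ "Al @ k @ q"] exI[of _ "[hd q]"]) simp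
  qed
  then show ?thesis by (simp add: one_enat_def)
qed

text \<open>Take \<open>y\<close> over a model and \<open>k\<close> with head outside it. If the
  germ (y, k) had a representative (m, m') in the model, \<open>geq_cl\<close> would put
  \<open>hd k\<close> into the closure of \<open>m\<close>, \<open>m'\<close> and \<open>y\<close>,
  hence into the model.\<close>

lemma Gr_rank_ge: "\<exists>u\<in>carrier Gr. 1 \<le> U_fin N2 [u] A2"
proof -
  obtain W where W: "countable W" "W \<in> Mods" "A \<subseteq> W" using F2.ex_countable_model[OF AD(2,1), of "[]"] by auto
  have XD: "W \<subseteq> D" "cl W = W" "inf_dim W" using F2.Mods_closed[OF W(2)] by simp_all
  obtain a where a: "a \<in> W" "a \<notin> cl A" using inf_dim_outside[OF XD AD(2) W(3)] by blast
  obtain b where b: "b \<in> D" "b \<notin> cl W" using outside[OF W(1) XD(1)] by blast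
  have aD: "a \<in> D" using a(1) XD(1) by blast
  have bA: "b \<notin> cl A" using b(2) cl_mono[OF W(3) XD(1)] by blast
  obtain y where y: "y \<in> Y" "hd y = a" using ex_Y[OF aD a(2)] by blast
  obtain k where k: "k \<in> Y" "hd k = b" using ex_Y[OF b(1) bA] by blast
  let ?B = "cl (insert b W)"
  have bX: "insert b W \<subseteq> D" using b(1) XD(1) by simp
  have B: "?B \<in> Mods"
    by (rule F2.Mods_countable[OF countable_cl[OF _ bX] cl_D[OF bX] cl_idem[OF bX] inf_dim_insert[OF XD b(1)]])
      (simp add: W(1))
  have XB: "W \<subseteq> ?B" "b \<in> ?B" using cl_sub[OF bX] by simp_all
  have gN: "set [germ y k] \<subseteq> elems N2" using germ_mem[OF y(1) k(1)] by simp
  have yk: "set y \<subseteq> ?B" "set k \<subseteq> ?B"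
  proof -
    have "K {a} \<subseteq> ?B" "K {b} \<subseteq> ?B" by (rule cl_mono[OF _ bX]; use W(3) a(1) in auto)+
    then show "set y \<subseteq> ?B" "set k \<subseteq> ?B" using Y_cl[OF y(1)] Y_cl[OF k(1)] y(2) k(2) by auto
  qed
  have in_B: "germ y k \<in> mdl2 ?B"
    unfolding germ_mdl[OF y(1) k(1) cl_D[OF bX] order_trans[OF W(3) XB(1)]]
    using geq_refl[OF y(1) k(1)] yk by blast
  have notin: "germ y k \<notin> mdl2 W"
    unfolding germ_mdl[OF y(1) k(1) XD(1) W(3)]
  proof
    assume "\<exists>m m'. geq y k m m' \<and> set m \<subseteq> W \<and> set m' \<subseteq> W"
    then obtain m m' where m: "geq y k m m'" "set m \<subseteq> W" "set m' \<subseteq> W" by blast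
    have Y: "m \<in> Y" "m' \<in> Y" using geq_Y[OF m(1)] by simp_all
    have "hd m \<in> W" "hd m' \<in> W" using m(2,3) Y_set(2)[OF Y(1)] Y_set(2)[OF Y(2)] by (auto intro: subsetD list.set_sel(1))
    moreover have "hd k \<in> K {hd m', hd m, hd y}"
      using geq_cl[OF geq_sym[OF geq_inv[OF m(1)]]] by simp
    moreover have "K {hd m', hd m, hd y} \<subseteq> cl W"
      using calculation(1,2) a(1) y(2) W(3) by (intro cl_mono[OF _ XD(1)]) simp
    ultimately show False using b(2) k(2) by blast
  qed
  have "\<not> ns_indep N2 [germ y k] (mdl2 W) (mdl2 ?B)"
    by (rule F2.not_ns_indepI[OF W(2) B XB(1) gN _ in_B notin]) simp
  moreover have "mdl2 ?B \<in> models N2" unfolding F2.models_mdl using B by (rule imageI)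
  moreover have "mdl2 W \<subseteq> mdl2 ?B" by (rule F2.mdl_mono[OF XB(1)])
  ultimately have "U_ge N2 [germ y k] 1 (mdl2 W)" by auto
  moreover have "A2 \<subseteq> mdl2 W" using F2.hm_mdl[OF W(2)] W(3) AD(1) by blast
  ultimately have "enat 1 \<le> U_fin N2 [germ y k] A2" using F2.U_fin_ge[OF W(2)] by blast
  then show ?thesis using y(1) k(1) carrier_Gr by (intro bexI[of _ "germ y k"]) (auto simp: one_enat_def)
qed

lemma Gr_one_dimensional: "one_dimensional_group N2 A2 Gr"
proof -
  obtain u where u: "u \<in> carrier Gr" "1 \<le> U_fin N2 [u] A2" using Gr_rank_ge by blast
  have "generic_element N2 A2 Gr u"
    unfolding generic_element_def using u Gr_rank_le by (meson order_trans)
  moreover have "U_fin N2 [g] A2 = 1" if "generic_element N2 A2 Gr g" for g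
    using that u Gr_rank_le[of g] unfolding generic_element_def by (meson antisym order_trans)
  ultimately show ?thesis unfolding one_dimensional_group_def by blast
qed

end

section \<open>Indices below the first uncountable cardinal\<close>

abbreviation olt :: "nat set \<Rightarrow> nat set \<Rightarrow> bool" where
  "olt x y \<equiv> (x, y) \<in> omega1 \<and> x \<noteq> y"

lemma omega1_card: "Card_order omega1"
  by (rule cardSuc_Card_order[OF natLeq_Card_order])

lemma omega1_linear: "linear_order_on (Field omega1) omega1"
  using card_order_on_well_order_on[OF omega1_card] unfolding well_order_on_def by simp

lemma olt_trans: "olt x y \<Longrightarrow> olt y z \<Longrightarrow> olt x z"
  using omega1_linear unfolding order_on_defs by (auto dest: transD antisymD)

lemma olt_asym: "olt x y \<Longrightarrow> \<not> olt y x"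
  using omega1_linear unfolding order_on_defs by (auto dest: antisymD)

lemma olt_linear: "x \<in> Field omega1 \<Longrightarrow> y \<in> Field omega1 \<Longrightarrow> olt x y \<or> x = y \<or> olt y x"
  using omega1_linear unfolding order_on_defs total_on_def by blast

lemma uncountable_omega1: "uncountable (Field omega1)"
proof
  assume "countable (Field omega1)"
  then have "|Field omega1| \<le>o natLeq" by (simp add: countable_card_le_natLeq)
  moreover have "|Field omega1| =o omega1" by (rule card_of_Field_ordIso[OF omega1_card])
  ultimately have "omega1 \<le>o natLeq" using ordIso_symmetric ordIso_ordLeq_trans by blast
  moreover have "natLeq <o omega1" by (rule cardSuc_greater[OF natLeq_Card_order])
  ultimately show False using not_ordLess_ordLeq by blast
qed

lemma countable_underS: "x \<in> Field omega1 \<Longrightarrow> countable (underS omega1 x)"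
  using card_of_underS[OF omega1_card, of x]
    cardSuc_ordLeq_ordLess[OF natLeq_Card_order card_of_Card_order, of "underS omega1 x"]
  by (simp add: countable_card_le_natLeq)

text \<open>By linearity the complement is contained in a countable union of initial segments, each
  of which is countable.\<close>

lemma uncountable_above:
  assumes "countable S" "S \<subseteq> Field omega1"
  shows "uncountable {u \<in> Field omega1. \<forall>s\<in>S. olt s u}"
proof
  assume c: "countable {u \<in> Field omega1. \<forall>s\<in>S. olt s u}"
  have "Field omega1 \<subseteq> {u \<in> Field omega1. \<forall>s\<in>S. olt s u} \<union> (\<Union>s\<in>S. insert s (underS omega1 s))"
  proof
    fix u assume u: "u \<in> Field omega1"
    show "u \<in> {u \<in> Field omega1. \<forall>s\<in>S. olt s u} \<union> (\<Union>s\<in>S. insert s (underS omega1 s))"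
    proof (cases "\<forall>s\<in>S. olt s u")
      case False
      then obtain s where s: "s \<in> S" "\<not> olt s u" by blast
      then have "u = s \<or> olt u s" using olt_linear[of s u] u assms(2) by blast
      then show ?thesis using s(1) unfolding underS_def by blast
    qed (use u in simp)
  qed
  then have "countable (Field omega1)"
  proof (rule countable_subset)
    have "countable (insert s (underS omega1 s))" if "s \<in> S" for s
      using countable_underS[of s] assms(2) that by auto
    then have "countable (\<Union>s\<in>S. insert s (underS omega1 s))" by (rule countable_UN[OF assms(1)])
    with c show "countable ({u \<in> Field omega1. \<forall>s\<in>S. olt s u} \<union> (\<Union>s\<in>S. insert s (underS omega1 s)))"
      by (rule countable_Un)
  qed
  with uncountable_omega1 show False by (rule notE)
qed

lemma ex_omega_sequence:
  "\<exists>g :: nat \<Rightarrow> nat set. (\<forall>n. g n \<in> Field omega1) \<and> (\<forall>m n. m < n \<longrightarrow> olt (g m) (g n))"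
proof -
  have next_ex: "\<exists>y. y \<in> Field omega1 \<and> olt x y" if "x \<in> Field omega1" for x
  proof -
    have "uncountable {u \<in> Field omega1. \<forall>s\<in>{x}. olt s u}" by (rule uncountable_above) (use that in simp_all)
    then have "{u \<in> Field omega1. \<forall>s\<in>{x}. olt s u} \<noteq> {}" using countable_empty by metis
    then show ?thesis by auto
  qed
  obtain x0 where x0: "x0 \<in> Field omega1" using uncountable_omega1 by (metis countable_empty ex_in_conv)
  have "\<exists>g. \<forall>n::nat. g n \<in> Field omega1 \<and> olt (g n) (g (Suc n))"
    by (rule dependent_nat_choice) (use x0 next_ex in auto)
  then obtain g where g: "\<And>n::nat. g n \<in> Field omega1" "\<And>n. olt (g n) (g (Suc n))" by blast
  have "olt (g m) (g n)" if "m < n" for m n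
    using that
  proof (induction n)
    case (Suc n)
    then show ?case using g(2)[of n] olt_trans[of "g m" "g n" "g (Suc n)"] by (cases "m = n") auto
  qed simp
  then show ?thesis using g(1) by (intro exI[of _ g]) simp
qed

lemma ex_increasing:
  assumes "finite S" "S \<subseteq> Field omega1"
  shows "\<exists>is. increasing omega1 is \<and> set is = S \<and> length is = card S"
  using assms
proof (induction S)
  case empty
  then show ?case unfolding increasing_def by (intro exI[of _ "[]"]) simp
next
  case (insert x S)
  then obtain l where l: "increasing omega1 l" "set l = S" "length l = card S" by auto
  let ?l = "filter (\<lambda>y. olt y x) l" and ?r = "filter (\<lambda>y. \<not> olt y x) l"
  have sorted: "sorted_wrt olt l" using l(1) unfolding increasing_def by simp
  have r: "olt x y" if "y \<in> set ?r" for y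
    using that l(2) insert.hyps(2) insert.prems olt_linear[of x y] by auto
  have lx: "olt y x" if "y \<in> set ?l" for y using that by simp
  have lr: "olt a b" if "a \<in> set ?l" "b \<in> set (x # ?r)" for a b
  proof (cases "b = x")
    case False
    then show ?thesis using olt_trans[OF lx[OF that(1)] r[of b]] that(2) by simp
  qed (use lx[OF that(1)] in simp)
  have 1: "\<forall>y\<in>set ?r. olt x y" by (rule ballI) (rule r)
  have 2: "\<forall>a\<in>set ?l. \<forall>b\<in>set (x # ?r). olt a b" by (rule ballI, rule ballI) (rule lr)
  have "sorted_wrt olt (?l @ x # ?r)"
    unfolding sorted_wrt_append sorted_wrt.simps(2)
    by (rule conjI[OF sorted_wrt_filter[OF sorted] conjI[OF conjI[OF 1 sorted_wrt_filter[OF sorted]] 2]])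
  moreover have s: "set (?l @ x # ?r) = insert x S" using l(2) by auto
  moreover have "length (?l @ x # ?r) = card (insert x S)"
    using l(3) insert.hyps sum_length_filter_compl[of "\<lambda>y. olt y x" l] by simp
  ultimately show ?case using insert.prems unfolding increasing_def by (intro exI[of _ "?l @ x # ?r"]) simp
qed

lemma increasing_map:
  assumes "increasing omega1 is" "\<phi> ` set is \<subseteq> Field omega1"
    and "\<And>i i'. i \<in> set is \<Longrightarrow> i' \<in> set is \<Longrightarrow> olt i i' \<Longrightarrow> olt (\<phi> i) (\<phi> i')"
  shows "increasing omega1 (map \<phi> is)"
  using assms unfolding increasing_def sorted_wrt_map by (auto elim!: sorted_wrt_mono_rel[rotated])

lemma map_subarray_eqD:
  assumes "map \<pi> (subarray f is js) = subarray f (map \<phi> is) (map \<psi> js)" "i \<in> set is" "j \<in> set js"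
  shows "\<pi> (f i j) = f (\<phi> i) (\<psi> j)"
  using assms(1,2)
proof (induction "is")
  case (Cons k ks)
  have "map \<pi> (map (f k) js) @ map \<pi> (subarray f ks js) =
      map (f (\<phi> k)) (map \<psi> js) @ subarray f (map \<phi> ks) (map \<psi> js)"
    using Cons.prems(1) unfolding subarray_def by simp
  then have *: "map \<pi> (map (f k) js) = map (f (\<phi> k)) (map \<psi> js)"
    "map \<pi> (subarray f ks js) = subarray f (map \<phi> ks) (map \<psi> js)" by (simp_all add: append_eq_append_conv)
  show ?case
  proof (cases "i = k")
    case True
    then show ?thesis using *(1) assms(3) by simp
  next
    case False
    then show ?thesis using Cons.IH[OF *(2)] Cons.prems(2) by simp
  qed
qed simp

lemma set_subarray: "set (subarray f is js) = {f i j | i j. i \<in> set is \<and> j \<in> set js}"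
  unfolding subarray_def by auto

section \<open>Repeated entries\<close>

text \<open>Repeating a component changes neither splitting nor the rank; hence a countable \<open>M\<close> has no
  array as in the theorem.\<close>

lemma galois_tp_dup: "galois_tp N (a # a # b) A = (\<lambda>l. hd l # l) ` galois_tp N (a # b) A"
  unfolding galois_tp_def by (simp add: setcompr_eq_image image_image)

lemma same_tp_dup: "same_tp N A (a # a # b) (a' # a' # b') \<longleftrightarrow> same_tp N A (a # b) (a' # b')"
proof -
  have inj: "inj (\<lambda>l. hd l # l)" by (rule injI) simp
  show ?thesis unfolding same_tp_def galois_tp_dup inj_image_eq_iff[OF inj] ..
qed

lemma ns_indep_dup: "ns_indep N [a, a] A B \<longleftrightarrow> ns_indep N [a] A B"
  unfolding ns_indep_def splits_def by (simp add: same_tp_dup)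

lemma U_ge_dup: "U_ge N [a, a] n A \<longleftrightarrow> U_ge N [a] n A"
  by (induction n arbitrary: A) (simp_all add: ns_indep_dup)

lemma U_fin_dup: "U_fin N [a, a] B = U_fin N [a] B"
  unfolding U_fin_def U_model_def by (simp add: U_ge_dup)

lemma array_uncountable:
  assumes f: "\<And>i j. i \<in> Field omega1 \<Longrightarrow> j \<in> Field omega1 \<Longrightarrow> f i j \<in> C"
    and dim: "array_of_type N omega1 omega1 f B (\<lambda>m n. m + n - 1)"
  shows "uncountable C"
proof
  assume C: "countable C"
  obtain i where i: "i \<in> Field omega1" using uncountable_omega1 by (metis countable_empty ex_in_conv)
  have "\<not> inj_on (f i) (Field omega1)"
  proof
    assume inj: "inj_on (f i) (Field omega1)"
    have "f i ` Field omega1 \<subseteq> C" using f[OF i] by blast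
    then have "countable (f i ` Field omega1)" using C by (rule countable_subset)
    then show False using countable_image_inj_on[OF _ inj] uncountable_omega1 by blast
  qed
  then obtain j j' where j: "j \<in> Field omega1" "j' \<in> Field omega1" "j \<noteq> j'" "f i j = f i j'"
    unfolding inj_on_def by blast
  have "\<exists>a b. a \<in> Field omega1 \<and> b \<in> Field omega1 \<and> olt a b \<and> f i a = f i b"
    using olt_linear[OF j(1,2)] j by metis
  then obtain a b where ab: "a \<in> Field omega1" "b \<in> Field omega1" "olt a b" "f i a = f i b" by blast
  have U: "increasing omega1 is \<Longrightarrow> is \<noteq> [] \<Longrightarrow> increasing omega1 js \<Longrightarrow> js \<noteq> [] \<Longrightarrow>
      U_fin N (subarray f is js) B = enat (length is + length js - 1)" for "is" js
    using dim unfolding array_of_type_def by blast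
  have "increasing omega1 [i]" "increasing omega1 [a]" "increasing omega1 [a, b]"
    unfolding increasing_def using i ab by simp_all
  \<comment> \<open>The prescribed ranks of one entry and of two entries of a row are 1 + 1 - 1 and
    1 + 2 - 1, although here the second list repeats the first entry.\<close>
  then have "U_fin N [f i a] B = enat 1" "U_fin N [f i a, f i b] B = enat 2"
    using U[of "[i]" "[a]"] U[of "[i]" "[a, b]"] by (simp_all add: subarray_def numeral_2_eq_2)
  then show False using U_fin_dup[of N "f i a" B] ab(4) by simp
qed

section \<open>The theorem\<close>

context monster begin

abbreviation \<N> where "\<N> \<equiv> monster_ambient L M0 \<delta> M"

lemma interp_fn_monster: "interp_fn (Dom M) (cl M) Gam (small_models L M0 \<delta> M) \<N> (\<lambda>\<pi>. \<pi>) (\<lambda>x. x) (\<lambda>X. X)"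
proof (intro interp_fn.intro I.interp_axioms interp_fn_axioms.intro)
  have e: "elems \<N> = Dom M" unfolding monster_ambient_def struct.truncate_def by simp
  show "v \<in> elems \<N>"
    if "h \<in> funs (alang \<N>)"
      "us \<in> tuples (elems \<N>) (farity (alang \<N>) h)"
      "fn (astruct \<N>) h us = Some v" for h us v
  proof -
    have "h \<in> funs L" "us \<in> tuples (Dom M) (farity L h)" "fn M h us = Some v"
      using that unfolding monster_ambient_def struct.truncate_def by simp_all
    moreover have "fn M h us \<in> Some ` Dom M" using wfM calculation(1,2) unfolding wf_struct_def by blast
    ultimately show ?thesis unfolding e by auto
  qed
  show "\<exists>C. countable C \<and> (\<forall>us. set us \<subseteq> elems \<N> \<longrightarrow> (\<exists>\<pi>\<in>Gam. set (map \<pi> us) \<subseteq> C))"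
  proof -
    obtain T where T: "countable T" "\<forall>xs. set xs \<subseteq> Dom M \<longrightarrow> (\<exists>\<pi>\<in>H.stab (cl M {}). map \<pi> xs \<in> T)"
      using H.countable_orbits[of "{}"] by auto
    have "countable (\<Union> (set ` T))" using T(1) by (intro countable_UN) (simp_all add: countable_finite)
    moreover have "\<exists>\<pi>\<in>Gam. set (map \<pi> us) \<subseteq> \<Union> (set ` T)" if us: "set us \<subseteq> Dom M" for us
    proof -
      obtain \<pi> where "\<pi> \<in> H.stab (cl M {})" "map \<pi> us \<in> T" using T(2) us by blast
      then show ?thesis using H.stab_G by (intro bexI[of _ \<pi>]) blast+
    qed
    ultimately show ?thesis unfolding e by blast
  qed
qed

text \<open>Translates the hypotheses into the pregeometry. Weak types over the finite
  \<open>B\<close> are orbits, and the rank of a subarray is squeezed between the two bounds that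
  identify it with the length of a basis.\<close>

lemma ex_array:
  assumes B: "finite B" "B \<subseteq> Dom M"
    and f: "\<And>i j. i \<in> Field omega1 \<Longrightarrow> j \<in> Field omega1 \<Longrightarrow> f i j \<in> Dom M"
    and ind: "indiscernible_array \<N> omega1 omega1 f B"
    and dim: "array_of_type \<N> omega1 omega1 f B (\<lambda>m n. m + n - 1)"
  shows "\<exists>g U. array (Dom M) (cl M) Gam B olt (Field omega1) g U f"
proof -
  have e: "elems \<N> = Dom M" unfolding monster_ambient_def struct.truncate_def by simp
  obtain g :: "nat \<Rightarrow> nat set" where g0: "(\<forall>n. g n \<in> Field omega1) \<and> (\<forall>m n. m < n \<longrightarrow> olt (g m) (g n))"
    using ex_omega_sequence by (rule exE)
  have g: "g n \<in> Field omega1" "m < n \<Longrightarrow> olt (g m) (g n)" for m n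
    by (rule conjunct1[OF g0, rule_format], rule conjunct2[OF g0, rule_format])
  define U where "U = {u \<in> Field omega1. \<forall>s\<in>range g. olt s u}"
  have sub: "set (subarray f is js) \<subseteq> Dom M" if "set is \<subseteq> Field omega1" "set js \<subseteq> Field omega1" for "is" js
    unfolding set_subarray using f that by blast
  have "array (Dom M) (cl M) Gam B olt (Field omega1) g U f"
  proof (intro array.intro H.homog_pregeom_axioms array_axioms.intro)
    show "finite B" "B \<subseteq> Dom M" by (rule B)+
    show "uncountable U" unfolding U_def by (rule uncountable_above) (use g(1) in auto)
    show "U \<subseteq> Field omega1" unfolding U_def by blast
    show "olt (g n) u" if "u \<in> U" for u n using that unfolding U_def by blast
    show "i \<in> Field omega1 \<Longrightarrow> j \<in> Field omega1 \<Longrightarrow> f i j \<in> Dom M" for i j by (rule f)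
    show "\<not> olt i i" for i by simp
    show "olt i j \<Longrightarrow> \<not> olt j i" for i j by (rule olt_asym)
    show "g n \<in> Field omega1" "m < n \<Longrightarrow> olt (g m) (g n)" for m n by (rule g(1), rule g(2))
  next
    fix S T :: "nat set set" and \<phi> \<psi> :: "nat set \<Rightarrow> nat set"
    assume S: "finite S" "S \<subseteq> Field omega1" "\<phi> ` S \<subseteq> Field omega1"
      and T: "finite T" "T \<subseteq> Field omega1" "\<psi> ` T \<subseteq> Field omega1"
      and \<phi>: "\<And>i i'. i \<in> S \<Longrightarrow> i' \<in> S \<Longrightarrow> olt i i' \<Longrightarrow> olt (\<phi> i) (\<phi> i')"
      and \<psi>: "\<And>j j'. j \<in> T \<Longrightarrow> j' \<in> T \<Longrightarrow> olt j j' \<Longrightarrow> olt (\<psi> j) (\<psi> j')"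
    show "\<exists>\<pi>\<in>H.stab B. \<forall>i\<in>S. \<forall>j\<in>T. \<pi> (f i j) = f (\<phi> i) (\<psi> j)"
    proof (cases "S = {} \<or> T = {}")
      case True
      then show ?thesis using H.stab_id by auto
    next
      case False
      obtain "is" where "is": "increasing omega1 is" "set is = S" using ex_increasing[OF S(1,2)] by blast
      obtain js where js: "increasing omega1 js" "set js = T" using ex_increasing[OF T(1,2)] by blast
      have is': "increasing omega1 (map \<phi> is)" by (rule increasing_map[OF "is"(1)]) (use S(3) \<phi> "is"(2) in simp_all)
      have js': "increasing omega1 (map \<psi> js)" by (rule increasing_map[OF js(1)]) (use T(3) \<psi> js(2) in simp_all)
      have ne: "is \<noteq> []" "js \<noteq> []" using False "is"(2) js(2) by auto
      have st: "same_tp \<N> B (subarray f is js) (subarray f (map \<phi> is) (map \<psi> js))"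
        using ind "is"(1) is' js(1) js' ne unfolding indiscernible_array_def by simp
      have "\<exists>\<pi>\<in>Gam. (\<forall>a\<in>B. \<pi> a = a) \<and> map \<pi> (subarray f is js) = subarray f (map \<phi> is) (map \<psi> js)"
        by (rule I.same_tpD[OF st B(1)]; unfold e) (use B(2) sub "is"(2) js(2) S T in simp_all)
      then obtain \<pi> where \<pi>: "\<pi> \<in> Gam" "\<forall>a\<in>B. \<pi> a = a" "map \<pi> (subarray f is js) = subarray f (map \<phi> is) (map \<psi> js)"
        by blast
      have "\<pi> \<in> H.stab B" using \<pi>(1,2) unfolding H.stab_def by simp
      moreover have "\<pi> (f i j) = f (\<phi> i) (\<psi> j)" if "i \<in> S" "j \<in> T" for i j
        by (rule map_subarray_eqD[OF \<pi>(3)]) (use that "is"(2) js(2) in simp_all)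
      ultimately show ?thesis by blast
    qed
  next
    fix S T :: "nat set set"
    assume S: "finite S" "S \<subseteq> Field omega1" "S \<noteq> {}" and T: "finite T" "T \<subseteq> Field omega1" "T \<noteq> {}"
    obtain "is" where "is": "increasing omega1 is" "set is = S" "length is = card S" using ex_increasing[OF S(1,2)] by blast
    obtain js where js: "increasing omega1 js" "set js = T" "length js = card T" using ex_increasing[OF T(1,2)] by blast
    let ?us = "subarray f is js"
    have usD: "set ?us \<subseteq> Dom M" by (rule sub) (use "is"(2) js(2) S T in simp_all)
    have ne: "is \<noteq> []" "js \<noteq> []" using "is"(2) js(2) S(3) T(3) by auto
    have U: "U_fin \<N> ?us B = enat (card S + card T - 1)"
      using dim "is" js ne unfolding array_of_type_def by metis
    obtain ds where ds: "M.indep B ds" "set ds \<subseteq> set ?us" "set ?us \<subseteq> cl M (B \<union> set ds)"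
      using M.ex_basis[OF B(2) usD] by blast
    have dsD: "set ds \<subseteq> Dom M" by (rule M.indep_D[OF ds(1)])
    have "U_fin \<N> ?us B \<le> enat (length ds)"
    proof (rule I.U_fin_le)
      show "set ?us \<subseteq> elems \<N>" unfolding e by (rule usD)
      fix X assume X: "X \<in> small_models L M0 \<delta> M" "B \<subseteq> X"
      have "X \<union> set ds \<subseteq> Dom M" using small_modelsD(1)[OF X(1)] dsD by simp
      then have "cl M (B \<union> set ds) \<subseteq> cl M (X \<union> set ds)" by (rule M.cl_mono[rotated]) (use X(2) in auto)
      then have "set ?us \<subseteq> cl M (X \<union> set ds)" using ds(3) by blast
      moreover have "I.supp ?us ?us" unfolding I.supp_def using H.stab_fix by (auto intro!: map_idI)
      ultimately show "\<exists>a ds'. I.supp a ?us \<and> set a \<subseteq> cl M (X \<union> set ds') \<and> set ds' \<subseteq> Dom M \<and> length ds' \<le> length ds"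
        using dsD by (intro exI[of _ ?us] exI[of _ ds]) simp
    qed
    moreover have "enat (length ds) \<le> U_fin \<N> ?us B"
    proof -
      obtain X where X: "countable X" "X \<in> small_models L M0 \<delta> M" "B \<subseteq> X" "M.indep X ds"
        using I.ex_countable_model[OF B ds(1)] by blast
      have "U_ge \<N> ?us (length ds) X"
        by (rule I.U_ge_indep[OF X(1,2,4)]) (use usD ds(2) e in simp_all)
      then show ?thesis by (rule I.U_fin_ge[OF X(2,3)])
    qed
    ultimately have "length ds = card S + card T - 1" unfolding U by simp
    moreover have "\<exists>i\<in>S. \<exists>j\<in>T. d = f i j" if "d \<in> set ds" for d
      using ds(2) that unfolding set_subarray "is"(2) js(2) by blast
    moreover have "f i j \<in> cl M (B \<union> set ds)" if "i \<in> S" "j \<in> T" for i j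
      using ds(3) that unfolding set_subarray "is"(2) js(2) by blast
    ultimately show "\<exists>ds. M.indep B ds \<and> (\<forall>d\<in>set ds. \<exists>i\<in>S. \<exists>j\<in>T. d = f i j) \<and>
        (\<forall>i\<in>S. \<forall>j\<in>T. f i j \<in> cl M (B \<union> set ds)) \<and> length ds = card S + card T - 1"
      using ds(1) by blast
  qed
  then show ?thesis by blast
qed

lemma ex_group:
  assumes "net (Dom M) (cl M) Gam A x0 y0 z0"
  shows "\<exists>\<E>1 \<E>2. imag_system \<N> \<E>1 \<and>
    imag_system (eq_ambient \<N> \<E>1) \<E>2 \<and>
    (\<exists>A G. finite A \<and> A \<subseteq> elems (eq_ambient (eq_ambient \<N> \<E>1) \<E>2) \<and>
       galois_definable_group (eq_ambient (eq_ambient \<N> \<E>1) \<E>2) A G \<and>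
       one_dimensional_group (eq_ambient (eq_ambient \<N> \<E>1) \<E>2) A G)"
proof -
  have e: "elems \<N> = Dom M" unfolding monster_ambient_def struct.truncate_def by simp
  interpret P: net_interp "Dom M" "cl M" Gam A x0 y0 z0 "small_models L M0 \<delta> M" "\<N>"
    by (intro net_interp.intro assms interp_fn_monster net_interp_axioms.intro e)
  show ?thesis
    using P.imag_system1 P.imag_system2 P.AD(2) P.A2_elems P.Gr_definable P.Gr_one_dimensional
    by (intro exI[of _ P.E1] exI[of _ P.E2] exI[of _ P.A2] exI[of _ P.Gr] conjI) simp_all
qed

end

theorem lemma4p17:
  fixes L :: "('f, 'r) lang"
    and M0 :: "('b, 'f, 'r) pstruct"
    and \<delta> :: "'d rel"
    and M :: "('a, 'f, 'r) pstruct"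
    and f :: "nat set \<Rightarrow> nat set \<Rightarrow> 'a"
    and B :: "'a set"
  defines "\<M> \<equiv> monster_ambient L M0 \<delta> M"
  assumes "countable_lang L"
    and "quasiminimal L M0"
    and "monster_model L M0 \<delta> M"
    and "finite B" and "B \<subseteq> Dom M"
    and "\<And>i j. i \<in> Field omega1 \<Longrightarrow> j \<in> Field omega1 \<Longrightarrow> f i j \<in> Dom M"
    and "indiscernible_array \<M> omega1 omega1 f B"
    and "array_of_type \<M> omega1 omega1 f B (\<lambda>m n. m + n - 1)"
  shows "\<exists>\<E>1 \<E>2. imag_system \<M> \<E>1 \<and> imag_system (eq_ambient \<M> \<E>1) \<E>2 \<and>
    (\<exists>A G. finite A \<and> A \<subseteq> elems (eq_ambient (eq_ambient \<M> \<E>1) \<E>2) \<and>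
       galois_definable_group (eq_ambient (eq_ambient \<M> \<E>1) \<E>2) A G \<and>
       one_dimensional_group (eq_ambient (eq_ambient \<M> \<E>1) \<E>2) A G)"
proof -
  \<comment> \<open>The array forces the monster to be uncountable, which has to be known before the
    homogeneous pregeometry can be set up.\<close>
  have u: "uncountable (Dom M)" by (rule array_uncountable[OF assms(7,9)])
  interpret monster L M0 \<delta> M by unfold_locales (rule assms(3,4) u)+
  have "\<exists>g U. array (Dom M) (cl M) Gam B olt (Field omega1) g U f"
    by (rule ex_array[OF assms(5,6) assms(7) assms(8,9)[unfolded \<M>_def]])
  then obtain g U where arr: "array (Dom M) (cl M) Gam B olt (Field omega1) g U f" by (elim exE)
  obtain A x0 y0 z0 where "net (Dom M) (cl M) Gam A x0 y0 z0" using array.ex_net[OF arr] by (elim exE)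
  from ex_group[OF this] show ?thesis unfolding \<M>_def .
qed

end
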